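(* Let $\sigma$ be a smooth function and $h^{(2)}_{ab}$ a smooth symmetric tensor on the unit hyperboloid $\mathcal H$ satisfying the asymptotic vacuum Einstein equations $$(\Box+3)\sigma=0,\qquad h^{(2)a}{}_a=12\sigma^2+\sigma_c\sigma^c,\qquad \mathcal D^bh^{(2)}_{ab}=\mathcal D_a\left(\sigma_c\sigma^c+8\sigma^2\right),$$ $$(\Box-2)h^{(2)}_{ab}=\mathcal D_a\mathcal D_b\left(5\sigma^2+\sigma_c\sigma^c\right)+h^{(0)}_{ab}\left(-18\sigma^2+4\sigma_c\sigma^c\right)+4\sigma\sigma_{ab}.$$ Define $$E^{(1)}_{ab}=-\sigma_{ab}-\sigma h^{(0)}_{ab},\qquad E^{(2)}_{ab}=-h^{(2)}_{ab}+5\sigma^2h^{(0)}_{ab}+\sigma\sigma_{ab}-2\sigma_a\sigma_b+\sigma_c\sigma^ch^{(0)}_{ab},$$ $$\gamma_{ab}=2\sigma\sigma_{ab}+\tfrac52\sigma^2h^{(0)}_{ab}+\sigma_a{}^c\sigma_{cb}-\tfrac12\sigma_{cd}\sigma^{cd}h^{(0)}_{ab},$$ $$\Delta^{(2)}_{ab}=-\tfrac14\Big[9\sigma_c\sigma^ch^{(0)}_{ab}-29\sigma_a\sigma_b+63\sigma\sigma_{ab}+24\sigma_{ap}\sigma_b{}^p-5\sigma_{cd}\sigma^{cd}h^{(0)}_{ab}+45\sigma^2h^{(0)}_{ab}$$ $$\qquad-3\sigma_{mnp}\sigma^{mnp}h^{(0)}_{ab}+9\sigma_{pq(a}\sigma^{pq}{}_{b)}-3\sigma^{pq}\sigma_{pq(ab)}-2\sigma^e\sigma_{e(ab)}\Big].$$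 Then, for every Killing vector $\xi^a_{(0)}$ of $\mathcal H$, the counter-term charge equals the charge built from the electric part of the Weyl tensor: $$\frac1{8\pi G}\int_Sd^2S\,\left(E^{(2)}_{ab}-\sigma E^{(1)}_{ab}-\gamma_{ab}-\Delta^{(2)}_{ab}\right)\xi^a_{(0)}n^b=\frac1{8\pi G}\int_Sd^2S\,\left(E^{(2)}_{ab}-\sigma E^{(1)}_{ab}\right)\xi^a_{(0)}n^b .$$ (No parity condition on $\sigma$ is assumed.)
   Context: $\mathcal H$ is three-dimensional de Sitter space $\mathbb R\times S^2$ with metric $h^{(0)}_{ab}dx^adx^b=-d\tau^2+\cosh^2\tau(d\theta^2+\sin^2\theta\,d\phi^2)$; $\mathcal D_a$ is its Levi-Civita covariant derivative, $\Box=\mathcal D^a\mathcal D_a$, and indices are moved with $h^{(0)}$. Subscripts on $\sigma$ denote covariant derivatives, the leftmost index being differentiated first: $\sigma_a=\mathcal D_a\sigma$, $\sigma_{ab}=\mathcal D_b\mathcal D_a\sigma$, $\sigma_{abc}=\mathcal D_c\mathcal D_b\mathcal D_a\sigma$, $\sigma_{abcd}=\mathcal D_d\mathcal D_c\mathcal D_b\mathcal D_a\sigma$. Round brackets denote symmetrization with weight one: $X_{(ab)}=\frac12(X_{ab}+X_{ba})$. $G>0$ is a constant. $S$ is a Cauchy surface (a two-sphere cut, e.g. $\tau=$ constant) of $\mathcal H$, $n^a$ its unit future-directed normal, and $d^2S$ the induced area element. (The fields arise from asymptotically flat metrics $ds^2=(1+\sigma/\rho)^2d\rho^2+\rho^2\big(h^{(0)}_{ab}-2\sigma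 h^{(0)}_{ab}/\rho+h^{(2)}_{ab}/\rho^2+\dots\big)dx^adx^b$; the left-hand side is the finite part of the Lorentz charge obtained from the Mann–Marolf boundary stress tensor. The claim only uses the definitions given.) *)

theory Defs
  imports "HOL-Analysis.Analysis"
begin

section \<open>Smooth maps on open sets\<close>

fun Ck_on :: "nat \<Rightarrow> 'a::euclidean_space set \<Rightarrow> ('a \<Rightarrow> 'b::real_normed_vector) \<Rightarrow> bool" where
  "Ck_on 0 U f \<longleftrightarrow> continuous_on U f"
| "Ck_on (Suc k) U f \<longleftrightarrow> (\<forall>x\<in>U. f differentiable (at x)) \<and>
     (\<forall>v. Ck_on k U (\<lambda>x. frechet_derivative f (at x) v))"

definition smooth_on :: "'a::euclidean_space set \<Rightarrow> ('a \<Rightarrow> 'b::real_normed_vector) \<Rightarrow> bool" where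
  "smooth_on U f \<longleftrightarrow> (\<forall>k. Ck_on k U f)"


section \<open>Tensor calculus in local coordinates\<close>

text \<open>Components of covariant tensors of arbitrary rank: a coordinate point and the list of
  indices, read from left to right. Scalars are evaluated at the empty list.\<close>

type_synonym tensor = "real^3 \<Rightarrow> 3 list \<Rightarrow> real"
type_synonym metric = "real^3 \<Rightarrow> real^3^3"

definition pd :: "3 \<Rightarrow> (real^3 \<Rightarrow> real) \<Rightarrow> real^3 \<Rightarrow> real" where
  "pd a f x = frechet_derivative f (at x) (axis a 1)"

definition ginv :: "metric \<Rightarrow> real^3 \<Rightarrow> 3 \<Rightarrow> 3 \<Rightarrow> real" where
  "ginv g x a b = matrix_inv (g x) $ a $ b"

definition christoffel :: "metric \<Rightarrow> real^3 \<Rightarrow> 3 \<Rightarrow> 3 \<Rightarrow> 3 \<Rightarrow> real" where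
  "christoffel g x c a b = (1/2) * (\<Sum>d\<in>UNIV. ginv g x c d *
     (pd a (\<lambda>y. g y $ d $ b) x + pd b (\<lambda>y. g y $ d $ a) x - pd d (\<lambda>y. g y $ a $ b) x))"

text \<open>The Levi-Civita derivative appends the new index on the right, so that
  \<open>(cov g ^^ 2) s x [a, b]\<close> is \<open>D\<^sub>b D\<^sub>a s\<close>.\<close>

definition cov :: "metric \<Rightarrow> tensor \<Rightarrow> tensor" where
  "cov g T x is = (let js = butlast is; c = last is in
     pd c (\<lambda>y. T y js) x -
     (\<Sum>k<length js. \<Sum>d\<in>UNIV. christoffel g x d c (js ! k) * T x (js[k := d])))"

definition up :: "metric \<Rightarrow> nat \<Rightarrow> tensor \<Rightarrow> tensor" where
  "up g k T x is = (\<Sum>d\<in>UNIV. ginv g x (is ! k) d * T x (is[k := d]))"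

definition box_op :: "metric \<Rightarrow> tensor \<Rightarrow> tensor" where
  "box_op g T x is = (\<Sum>c\<in>UNIV. \<Sum>d\<in>UNIV. ginv g x c d * (cov g ^^ 2) T x (is @ [c, d]))"

definition symm :: "(3 \<Rightarrow> 3 \<Rightarrow> real) \<Rightarrow> 3 \<Rightarrow> 3 \<Rightarrow> real" where
  "symm X a b = (1/2) * (X a b + X b a)"


section \<open>De Sitter space \<open>\<real> \<times> S\<^sup>2\<close>\<close>

text \<open>The two-sphere is the unit sphere of \<open>\<real>\<^sup>3\<close>; tangent vectors of \<open>\<real> \<times> S\<^sup>2\<close> are
  vectors of the ambient space \<open>\<real> \<times> \<real>\<^sup>3\<close>.\<close>

type_synonym pt = "real \<times> (real^3)"

definition dS :: "pt set" where
  "dS = UNIV \<times> sphere 0 1"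

definition h0 :: "pt \<Rightarrow> pt \<Rightarrow> pt \<Rightarrow> real" where
  "h0 p u v = - fst u * fst v + (cosh (fst p))\<^sup>2 * (snd u \<bullet> snd v)"

definition tangent :: "pt set \<Rightarrow> pt \<Rightarrow> pt \<Rightarrow> bool" where
  "tangent M p v \<longleftrightarrow> (\<exists>c. (\<forall>t. c t \<in> M) \<and> c 0 = p \<and> (c has_vector_derivative v) (at 0))"

text \<open>Charts are given by their inverses, the regular local parametrizations.\<close>

definition chart :: "(real^3) set \<Rightarrow> (real^3 \<Rightarrow> pt) \<Rightarrow> bool" where
  "chart U \<psi> \<longleftrightarrow> open U \<and> smooth_on U \<psi> \<and> \<psi> ` U \<subseteq> dS \<and> inj_on \<psi> U \<and>
     (\<forall>x\<in>U. inj (frechet_derivative \<psi> (at x)))"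

definition frame :: "(real^3 \<Rightarrow> pt) \<Rightarrow> real^3 \<Rightarrow> 3 \<Rightarrow> pt" where
  "frame \<psi> x a = frechet_derivative \<psi> (at x) (axis a 1)"

definition met :: "(real^3 \<Rightarrow> pt) \<Rightarrow> metric" where
  "met \<psi> x = (\<chi> a b. h0 (\<psi> x) (frame \<psi> x a) (frame \<psi> x b))"

definition comp0 :: "(real^3 \<Rightarrow> pt) \<Rightarrow> (pt \<Rightarrow> real) \<Rightarrow> tensor" where
  "comp0 \<psi> f x is = f (\<psi> x)"

definition comp2 :: "(real^3 \<Rightarrow> pt) \<Rightarrow> (pt \<Rightarrow> pt \<Rightarrow> pt \<Rightarrow> real) \<Rightarrow> tensor" where
  "comp2 \<psi> h x is = h (\<psi> x) (frame \<psi> x (is ! 0)) (frame \<psi> x (is ! 1))"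

definition lower_comp :: "(real^3 \<Rightarrow> pt) \<Rightarrow> (pt \<Rightarrow> pt) \<Rightarrow> tensor" where
  "lower_comp \<psi> V x is = h0 (\<psi> x) (V (\<psi> x)) (frame \<psi> x (is ! 0))"

definition vec_comp :: "(real^3 \<Rightarrow> pt) \<Rightarrow> (pt \<Rightarrow> pt) \<Rightarrow> real^3 \<Rightarrow> 3 \<Rightarrow> real" where
  "vec_comp \<psi> V x a = up (met \<psi>) 0 (lower_comp \<psi> V) x [a]"

definition smooth_function :: "(pt \<Rightarrow> real) \<Rightarrow> bool" where
  "smooth_function f \<longleftrightarrow> (\<forall>U \<psi>. chart U \<psi> \<longrightarrow> smooth_on U (\<lambda>x. f (\<psi> x)))"

text \<open>A bilinear form on a tangent space extends to the ambient space (e.g. by orthogonal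
  projection), and only its values on tangent vectors are ever used; asking for bilinearity on
  the ambient space is therefore no restriction.\<close>

definition smooth_symmetric_tensor :: "(pt \<Rightarrow> pt \<Rightarrow> pt \<Rightarrow> real) \<Rightarrow> bool" where
  "smooth_symmetric_tensor h \<longleftrightarrow>
     (\<forall>p\<in>dS. bilinear (h p)) \<and>
     (\<forall>p\<in>dS. \<forall>u v. tangent dS p u \<longrightarrow> tangent dS p v \<longrightarrow> h p u v = h p v u) \<and>
     (\<forall>U \<psi> a b. chart U \<psi> \<longrightarrow> smooth_on U (\<lambda>x. comp2 \<psi> h x [a, b]))"

definition smooth_vector_field :: "(pt \<Rightarrow> pt) \<Rightarrow> bool" where
  "smooth_vector_field V \<longleftrightarrow>
     (\<forall>p\<in>dS. tangent dS p (V p)) \<and>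
     (\<forall>U \<psi> a. chart U \<psi> \<longrightarrow> smooth_on U (\<lambda>x. vec_comp \<psi> V x a))"

definition killing :: "(pt \<Rightarrow> pt) \<Rightarrow> bool" where
  "killing \<xi> \<longleftrightarrow> smooth_vector_field \<xi> \<and>
     (\<forall>U \<psi> x a b. chart U \<psi> \<longrightarrow> x \<in> U \<longrightarrow>
        cov (met \<psi>) (lower_comp \<psi> \<xi>) x [a, b] + cov (met \<psi>) (lower_comp \<psi> \<xi>) x [b, a] = 0)"


section \<open>The tensors built from \<open>\<sigma>\<close> and \<open>h\<^sup>(\<^sup>2\<^sup>)\<close>\<close>

text \<open>\<open>grad_sq\<close> is \<open>\<sigma>\<^sub>c \<sigma>\<^sup>c\<close>, \<open>hess_sq\<close> is \<open>\<sigma>\<^sub>c\<^sub>d \<sigma>\<^sup>c\<^sup>d\<close>, \<open>third_sq\<close> is \<open>\<sigma>\<^sub>m\<^sub>n\<^sub>p \<sigma>\<^sup>m\<^sup>n\<^sup>p\<close>.\<close>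

definition grad_sq :: "metric \<Rightarrow> tensor \<Rightarrow> real^3 \<Rightarrow> real" where
  "grad_sq g s x = (\<Sum>c\<in>UNIV. cov g s x [c] * up g 0 (cov g s) x [c])"

definition hess_sq :: "metric \<Rightarrow> tensor \<Rightarrow> real^3 \<Rightarrow> real" where
  "hess_sq g s x = (let s2 = (cov g ^^ 2) s in
     \<Sum>c\<in>UNIV. \<Sum>d\<in>UNIV. s2 x [c, d] * up g 0 (up g 1 s2) x [c, d])"

definition third_sq :: "metric \<Rightarrow> tensor \<Rightarrow> real^3 \<Rightarrow> real" where
  "third_sq g s x = (let s3 = (cov g ^^ 3) s in
     \<Sum>m\<in>UNIV. \<Sum>n\<in>UNIV. \<Sum>p\<in>UNIV.
       s3 x [m, n, p] * up g 0 (up g 1 (up g 2 s3)) x [m, n, p])"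

definition E1 :: "metric \<Rightarrow> tensor \<Rightarrow> real^3 \<Rightarrow> 3 \<Rightarrow> 3 \<Rightarrow> real" where
  "E1 g s x a b = - (cov g ^^ 2) s x [a, b] - s x [] * g x $ a $ b"

definition E2 :: "metric \<Rightarrow> tensor \<Rightarrow> tensor \<Rightarrow> real^3 \<Rightarrow> 3 \<Rightarrow> 3 \<Rightarrow> real" where
  "E2 g s h x a b =
     - h x [a, b] + 5 * (s x [])\<^sup>2 * g x $ a $ b + s x [] * (cov g ^^ 2) s x [a, b]
     - 2 * cov g s x [a] * cov g s x [b] + grad_sq g s x * g x $ a $ b"

definition gamma :: "metric \<Rightarrow> tensor \<Rightarrow> real^3 \<Rightarrow> 3 \<Rightarrow> 3 \<Rightarrow> real" where
  "gamma g s x a b = (let s2 = (cov g ^^ 2) s in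
     2 * s x [] * s2 x [a, b] + (5/2) * (s x [])\<^sup>2 * g x $ a $ b
     + (\<Sum>c\<in>UNIV. up g 1 s2 x [a, c] * s2 x [c, b])
     - (1/2) * hess_sq g s x * g x $ a $ b)"

definition Delta2 :: "metric \<Rightarrow> tensor \<Rightarrow> real^3 \<Rightarrow> 3 \<Rightarrow> 3 \<Rightarrow> real" where
  "Delta2 g s x a b =
    (let s1 = cov g s; s2 = (cov g ^^ 2) s; s3 = (cov g ^^ 3) s; s4 = (cov g ^^ 4) s in
     - (1/4) *
     (  9 * grad_sq g s x * g x $ a $ b
      - 29 * s1 x [a] * s1 x [b]
      + 63 * s x [] * s2 x [a, b]
      + 24 * (\<Sum>p\<in>UNIV. s2 x [a, p] * up g 1 s2 x [b, p])
      - 5 * hess_sq g s x * g x $ a $ b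
      + 45 * (s x [])\<^sup>2 * g x $ a $ b
      - 3 * third_sq g s x * g x $ a $ b
      + 9 * symm (\<lambda>a b. \<Sum>p\<in>UNIV. \<Sum>q\<in>UNIV. s3 x [p, q, a] * up g 0 (up g 1 s3) x [p, q, b]) a b
      - 3 * (\<Sum>p\<in>UNIV. \<Sum>q\<in>UNIV. up g 0 (up g 1 s2) x [p, q] * symm (\<lambda>a b. s4 x [p, q, a, b]) a b)
      - 2 * (\<Sum>e\<in>UNIV. up g 0 s1 x [e] * symm (\<lambda>a b. s3 x [e, a, b]) a b)))"

definition asymptotic_einstein :: "(pt \<Rightarrow> real) \<Rightarrow> (pt \<Rightarrow> pt \<Rightarrow> pt \<Rightarrow> real) \<Rightarrow> bool" where
  "asymptotic_einstein \<sigma> h2 \<longleftrightarrow>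
     (\<forall>U \<psi> x. chart U \<psi> \<longrightarrow> x \<in> U \<longrightarrow>
       (let g = met \<psi>; s = comp0 \<psi> \<sigma>; h = comp2 \<psi> h2 in
          box_op g s x [] + 3 * s x [] = 0
        \<and> (\<Sum>a\<in>UNIV. up g 0 h x [a, a]) = 12 * (s x [])\<^sup>2 + grad_sq g s x
        \<and> (\<forall>a. (\<Sum>b\<in>UNIV. up g 2 (cov g h) x [a, b, b])
              = cov g (\<lambda>y _. grad_sq g s y + 8 * (s y [])\<^sup>2) x [a])
        \<and> (\<forall>a b. box_op g h x [a, b] - 2 * h x [a, b]
              = (cov g ^^ 2) (\<lambda>y _. 5 * (s y [])\<^sup>2 + grad_sq g s y) x [b, a]
                + g x $ a $ b * (- 18 * (s x [])\<^sup>2 + 4 * grad_sq g s x)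
                + 4 * s x [] * (cov g ^^ 2) s x [a, b])))"


section \<open>Cauchy surfaces and charges\<close>

definition inextendible_timelike :: "(real \<Rightarrow> pt) \<Rightarrow> bool" where
  "inextendible_timelike c \<longleftrightarrow> smooth_on UNIV c \<and> range c \<subseteq> dS \<and>
     (\<forall>t. h0 (c t) (vector_derivative c (at t)) (vector_derivative c (at t)) < 0) \<and>
     \<not> (\<exists>p. (c \<longlongrightarrow> p) at_top) \<and> \<not> (\<exists>p. (c \<longlongrightarrow> p) at_bot)"

definition Cauchy_surface :: "pt set \<Rightarrow> bool" where
  "Cauchy_surface S \<longleftrightarrow> S \<subseteq> dS \<and> (\<forall>c. inextendible_timelike c \<longrightarrow> (\<exists>!t. c t \<in> S))"

lemma Ck_on_const: "Ck_on k U (\<lambda>x. c)"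
  by (induction k arbitrary: c) (auto simp: frechet_derivative_const)

lemma Cauchy_surface_graph:
  assumes "Cauchy_surface S"
  obtains T where "S = {(T \<omega>, \<omega>) | \<omega>. \<omega> \<in> sphere 0 1}"
proof -
  have ex1: "\<exists>!t. (t, \<omega>) \<in> S" if \<omega>: "\<omega> \<in> sphere 0 1" for \<omega> :: "real^3"
  proof -
    let ?c = "\<lambda>t::real. (t, \<omega>)"
    have d: "(?c has_derivative (\<lambda>v. (v, 0))) (at t)" for t
      by (auto intro!: derivative_eq_intros)
    then have fd: "frechet_derivative ?c (at t) v = (v, 0)" for t v
      by (metis frechet_derivative_at)
    have "Ck_on k UNIV ?c" for k
      using d by (cases k) (auto simp: fd Ck_on_const differentiable_def intro!: continuous_intros)
    then have sm: "smooth_on UNIV ?c"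
      by (simp add: smooth_on_def)
    have vd: "vector_derivative ?c (at t) = (1, 0)" for t
      by (rule vector_derivative_at)
        (auto simp: has_vector_derivative_def intro!: derivative_eq_intros)
    have "\<not> (?c \<longlongrightarrow> p) F" if F: "filterlim (\<lambda>t. t) at_infinity F" "F \<noteq> bot" for p F
    proof
      assume "(?c \<longlongrightarrow> p) F"
      from tendsto_fst[OF this] have "((\<lambda>t. t) \<longlongrightarrow> fst p) F" by simp
      then show False
        using F not_tendsto_and_filterlim_at_infinity by blast
    qed
    from this[of at_top] this[of at_bot] have "inextendible_timelike ?c"
      using \<omega> sm filterlim_at_top_imp_at_infinity[OF filterlim_ident]
        filterlim_at_bot_imp_at_infinity[OF filterlim_ident]
      by (auto simp: inextendible_timelike_def dS_def vd h0_def)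
    then show ?thesis
      using assms by (simp add: Cauchy_surface_def)
  qed
  define T where "T \<omega> = (THE t. (t, \<omega>) \<in> S)" for \<omega>
  have "(t, \<omega>) \<in> S \<longleftrightarrow> t = T \<omega>" if "\<omega> \<in> sphere 0 1" for t \<omega>
    using theI'[OF ex1[OF that]] ex1[OF that] unfolding T_def by blast
  moreover have "S \<subseteq> UNIV \<times> sphere 0 1"
    using assms by (simp add: Cauchy_surface_def dS_def)
  ultimately have "S = {(T \<omega>, \<omega>) | \<omega>. \<omega> \<in> sphere 0 1}"
    by force
  then show ?thesis ..
qed

definition spacelike :: "pt set \<Rightarrow> bool" where
  "spacelike S \<longleftrightarrow> (\<forall>p\<in>S. \<forall>v. tangent S p v \<longrightarrow> v \<noteq> 0 \<longrightarrow> h0 p v v > 0)"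

text \<open>A Cauchy surface meets each curve of constant \<open>\<omega> \<in> S\<^sup>2\<close> exactly once, hence is the graph of
  a unique function \<open>T\<close> on \<open>S\<^sup>2\<close> (a two-sphere cut), and a spacelike one is a smooth surface iff
  \<open>T\<close> is smooth. Smoothness of \<open>T\<close> is expressed by its pullback to \<open>\<real> \<times> S\<^sup>2\<close>.\<close>

definition smooth_Cauchy_cut :: "pt set \<Rightarrow> (real^3 \<Rightarrow> real) \<Rightarrow> bool" where
  "smooth_Cauchy_cut S T \<longleftrightarrow> Cauchy_surface S \<and> spacelike S \<and>
     S = {(T \<omega>, \<omega>) | \<omega>. \<omega> \<in> sphere 0 1} \<and> smooth_function (\<lambda>p. T (snd p))"

definition future_unit_normal :: "pt set \<Rightarrow> (pt \<Rightarrow> pt) \<Rightarrow> bool" where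
  "future_unit_normal S n \<longleftrightarrow> (\<forall>p\<in>S. tangent dS p (n p) \<and> h0 p (n p) (n p) = -1 \<and>
     (\<forall>v. tangent S p v \<longrightarrow> h0 p (n p) v = 0) \<and> fst (n p) > 0)"

definition sph :: "real \<Rightarrow> real \<Rightarrow> real^3" where
  "sph \<theta> \<phi> = vector [sin \<theta> * cos \<phi>, sin \<theta> * sin \<phi>, cos \<theta>]"

text \<open>The coordinates \<open>(\<tau>, \<theta>, \<phi>)\<close>.\<close>

definition sph_chart :: "real^3 \<Rightarrow> pt" where
  "sph_chart x = (x $ 1, sph (x $ 2) (x $ 3))"

lemma has_derivative_sph_chart:
  "(sph_chart has_derivative (\<lambda>v. (v $ 1, vector
     [v $ 2 * (cos (x $ 2) * cos (x $ 3)) - v $ 3 * (sin (x $ 2) * sin (x $ 3)),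
      v $ 2 * (cos (x $ 2) * sin (x $ 3)) + v $ 3 * (sin (x $ 2) * cos (x $ 3)),
      - v $ 2 * sin (x $ 2)]))) (at x)"
proof -
  have nth: "((\<lambda>y::real^3. y $ i) has_derivative (\<lambda>v. v $ i)) (at x)" for i
    by (rule bounded_linear_imp_has_derivative[OF bounded_linear_vec_nth])
  show ?thesis
    unfolding sph_chart_def sph_def
    apply (rule has_derivative_Pair[OF nth])
    apply (subst has_derivative_componentwise_within)
    apply (auto simp: Basis_vec_def inner_axis cart_eq_inner_axis[symmetric])
    subgoal for i
      using exhaust_3[of i]
      by (auto intro!: derivative_eq_intros nth simp: algebra_simps)
    done
qed

lemma met_sph_chart:
  "met sph_chart x = vector [vector [-1, 0, 0], vector [0, (cosh (x $ 1))\<^sup>2, 0],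
     vector [0, 0, (cosh (x $ 1))\<^sup>2 * (sin (x $ 2))\<^sup>2]]"
proof -
  have f: "frechet_derivative sph_chart (at x) = (\<lambda>v. (v $ 1, vector
     [v $ 2 * (cos (x $ 2) * cos (x $ 3)) - v $ 3 * (sin (x $ 2) * sin (x $ 3)),
      v $ 2 * (cos (x $ 2) * sin (x $ 3)) + v $ 3 * (sin (x $ 2) * cos (x $ 3)),
      - v $ 2 * sin (x $ 2)]))"
    by (rule frechet_derivative_at[OF has_derivative_sph_chart, symmetric])
  have 1: "(cos a * cos b)^2 + (cos a * sin b)^2 + (sin a)^2 = 1" for a b :: real
  proof -
    have "(cos a * cos b)^2 + (cos a * sin b)^2 = (cos a)^2 * ((cos b)^2 + (sin b)^2)"
      by (simp only: power_mult_distrib distrib_left)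
    then show ?thesis by simp
  qed
  have 2: "(sin a * cos b)^2 + (sin a * sin b)^2 = (sin a)^2" for a b :: real
  proof -
    have "(sin a * cos b)^2 + (sin a * sin b)^2 = (sin a)^2 * ((cos b)^2 + (sin b)^2)"
      by (simp only: power_mult_distrib distrib_left)
    then show ?thesis by simp
  qed
  have fst_c: "fst (sph_chart x) = x $ 1"
    by (simp add: sph_chart_def)
  show ?thesis
    using arg_cong[OF 1[of "x$2" "x$3"], of "\<lambda>z. (cosh (x$1))\<^sup>2 * z"]
      arg_cong[OF 2[of "x$2" "x$3"], of "\<lambda>z. (cosh (x$1))\<^sup>2 * z"]
    by (simp add: vec_eq_iff forall_3 met_def frame_def f fst_c h0_def inner_vec_def sum_3 axis_def
        power2_eq_square algebra_simps)
qed

definition cut_point :: "(real^3 \<Rightarrow> real) \<Rightarrow> real \<Rightarrow> real \<Rightarrow> pt" where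
  "cut_point T \<theta> \<phi> = (T (sph \<theta> \<phi>), sph \<theta> \<phi>)"

definition cut_coords :: "(real^3 \<Rightarrow> real) \<Rightarrow> real \<Rightarrow> real \<Rightarrow> real^3" where
  "cut_coords T \<theta> \<phi> = vector [T (sph \<theta> \<phi>), \<theta>, \<phi>]"

text \<open>Square root of the determinant of the metric induced on the cut.\<close>

definition area_density :: "(real^3 \<Rightarrow> real) \<Rightarrow> real \<Rightarrow> real \<Rightarrow> real" where
  "area_density T \<theta> \<phi> =
    (let p = cut_point T \<theta> \<phi>;
         u = vector_derivative (\<lambda>t. cut_point T t \<phi>) (at \<theta>);
         v = vector_derivative (\<lambda>t. cut_point T \<theta> t) (at \<phi>)
     in sqrt (h0 p u u * h0 p v v - (h0 p u v)\<^sup>2))"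

text \<open>\<open>charge T \<xi> n X\<close> is the integral of \<open>X\<^sub>a\<^sub>b \<xi>\<^sup>a n\<^sup>b\<close> over the cut \<open>\<tau> = T\<close>, where \<open>X\<close> gives the
  components in the coordinates \<open>(\<tau>, \<theta>, \<phi>)\<close>; these cover the cut up to a null set.\<close>

definition charge ::
  "(real^3 \<Rightarrow> real) \<Rightarrow> (pt \<Rightarrow> pt) \<Rightarrow> (pt \<Rightarrow> pt) \<Rightarrow> (real^3 \<Rightarrow> 3 \<Rightarrow> 3 \<Rightarrow> real) \<Rightarrow> real" where
  "charge T \<xi> n X =
    (LINT w : {0<..<pi} \<times> {0<..<2*pi} | lborel.
       (let \<theta> = fst w; \<phi> = snd w; x = cut_coords T \<theta> \<phi> in
        (\<Sum>a\<in>UNIV. \<Sum>b\<in>UNIV. X x a b * vec_comp sph_chart \<xi> x a * vec_comp sph_chart n x b)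
        * area_density T \<theta> \<phi>))"

end

theory Submission
  imports Defs
begin

text \<open>De Sitter space is the unit hyperboloid of Minkowski space. Extend \<open>\<sigma>\<close> to the function \<open>\<Sigma>\<close> that is
  homogeneous of degree 1 on the spacelike cone, and \<open>h\<^sup>(\<^sup>2\<^sup>)\<close> to a tangential tensor \<open>H\<close> of degree
  \<open>-2\<close>. Then \<open>(\<box> + 3) \<sigma> = 0\<close> becomes the flat wave equation for \<open>\<Sigma>\<close>, and covariant derivatives on the
  hyperboloid become projections of partial derivatives, which commute. In these terms
  \<open>4 (\<gamma> + \<Delta>\<^sup>(\<^sup>2\<^sup>))\<close> is the tangential part of twice the linearized Einstein tensor of
  \<open>k\<^sub>A\<^sub>B = H\<^sub>A\<^sub>B + 6 \<Sigma>\<^sub>A\<^sup>P \<Sigma>\<^sub>P\<^sub>B + \<Sigma> \<Sigma>\<^sub>A\<^sub>B / X\<^sup>2 + m \<eta>\<^sub>A\<^sub>B\<close> for a suitable function \<open>m\<close>.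
  Contracted with a Killing field, the linearized Einstein tensor is the divergence of an
  antisymmetric superpotential. Since \<open>k\<close> has degree \<open>-2\<close>, Euler's relation makes the flux of this
  current an exact 2-form on the whole hyperboloid, so its integral over a closed cut vanishes.
  The sources quadratic in \<open>\<sigma>\<close> alone do not have this property: it is the existence of a solution
  \<open>h\<^sup>(\<^sup>2\<^sup>)\<close> of the second-order equations that makes them exact.\<close>

section \<open>Smooth functions\<close>

text \<open>The obstacle is that the charge is written in spherical coordinates, which degenerate at
  the poles and miss a meridian, whereas exactness must hold on the closed cut. The field equations
  and the Killing equation enter on the open cone over that chart. The fields and the potential
  1-form of the flux, however, have Minkowski components that are smooth on the whole cone. Pulled
  back to the angles, the potential is smooth on the whole plane, its \<phi>-component vanishes on
  the two pole edges and its \<theta>-component is periodic in \<phi>, so no boundary term survives.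
  The tensor identity becomes algebra at one point: the derivatives of \<Sigma> up to order four
  enter as symmetric arrays subject to Euler relations and trace conditions. The terms added to H
  form an ansatz, quadratic in \<Sigma> and of degree -2, whose coefficients are fixed by
  comparison. What makes the comparison possible is that the Hessians of \<sigma>_c \<sigma>^c
  coming from the trace, the divergence and the wave equation of H cancel in the linearized Einstein
  tensor.\<close>

lemma Ck_on_cong:
  assumes "open U" "\<And>x. x \<in> U \<Longrightarrow> f x = g x" "Ck_on k U f"
  shows "Ck_on k U g"
  using assms(2,3)
proof (induction k arbitrary: f g)
  case 0
  then show ?case using continuous_on_cong[of U U f g] by simp
next
  case (Suc k)
  have d: "(g has_derivative frechet_derivative f (at x)) (at x)" if "x \<in> U" for x
  proof -
    have "(f has_derivative frechet_derivative f (at x)) (at x)"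
      using Suc.prems that frechet_derivative_works by auto
    then show ?thesis
      using has_derivative_transform_within_open[OF _ \<open>open U\<close> that] Suc.prems(1) by blast
  qed
  have fd: "frechet_derivative g (at x) = frechet_derivative f (at x)" if "x \<in> U" for x
    using frechet_derivative_at[OF d[OF that]] by simp
  have "Ck_on k U (\<lambda>x. frechet_derivative g (at x) v)" for v
    by (rule Suc.IH[of "\<lambda>x. frechet_derivative f (at x) v"]) (use Suc.prems fd in auto)
  moreover have "g differentiable (at x)" if "x \<in> U" for x
    using d[OF that] unfolding differentiable_def by blast
  ultimately show ?case by simp
qed

text \<open>\<open>Ck_on\<close> recurses through \<open>frechet_derivative\<close>; by uniqueness
  of derivatives an explicit one coincides with it on U and may be used in its place.\<close>

lemma Ck_on_SucI:
  assumes "open U" "\<And>x. x \<in> U \<Longrightarrow> (f has_derivative f' x) (at x)"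
    "\<And>v. Ck_on k U (\<lambda>x. f' x v)"
  shows "Ck_on (Suc k) U f"
proof -
  have "Ck_on k U (\<lambda>x. frechet_derivative f (at x) v)" for v
    by (rule Ck_on_cong[OF assms(1) _ assms(3)[of v]])
      (metis assms(2) frechet_derivative_at)
  then show ?thesis using assms(2) by (auto simp: differentiable_def)
qed

lemma Ck_on_SucD:
  assumes "Ck_on (Suc k) U f"
  shows "\<And>x. x \<in> U \<Longrightarrow> (f has_derivative frechet_derivative f (at x)) (at x)"
    "\<And>v. Ck_on k U (\<lambda>x. frechet_derivative f (at x) v)"
  using assms frechet_derivative_works by auto

lemma Ck_on_Suc_imp: "Ck_on (Suc k) U f \<Longrightarrow> Ck_on k U f"
proof (induction k arbitrary: f)
  case 0
  then show ?case
    by (metis Ck_on.simps(1) Ck_on_SucD(1) continuous_at_imp_continuous_on has_derivative_continuous)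
next
  case (Suc k)
  then show ?case by (metis Ck_on.simps(2))
qed

lemma Ck_on_linear:
  assumes U: "open U" and L: "bounded_linear L" and f: "Ck_on k U f"
  shows "Ck_on k U (\<lambda>x. L (f x))"
  using f
proof (induction k arbitrary: f)
  case 0
  then show ?case using bounded_linear.continuous_on[OF L] by simp
next
  case (Suc k)
  show ?case
    by (rule Ck_on_SucI[OF U bounded_linear.has_derivative[OF L Ck_on_SucD(1)[OF Suc.prems]]])
      (use Suc.IH Ck_on_SucD(2)[OF Suc.prems] in auto)
qed

lemma Ck_on_add:
  assumes U: "open U" and "Ck_on k U f" "Ck_on k U g"
  shows "Ck_on k U (\<lambda>x. f x + g x)"
  using assms(2,3)
proof (induction k arbitrary: f g)
  case 0
  then show ?case by (auto intro: continuous_intros)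
next
  case (Suc k)
  show ?case
    by (rule Ck_on_SucI[OF U has_derivative_add[OF Ck_on_SucD(1)[OF Suc.prems(1)] Ck_on_SucD(1)[OF Suc.prems(2)]]])
      (use Suc.IH Ck_on_SucD(2)[OF Suc.prems(1)] Ck_on_SucD(2)[OF Suc.prems(2)] in auto)
qed

lemma Ck_on_mult:
  fixes f g :: "'a::euclidean_space \<Rightarrow> real"
  assumes U: "open U" and "Ck_on k U f" "Ck_on k U g"
  shows "Ck_on k U (\<lambda>x. f x * g x)"
  using assms(2,3)
proof (induction k arbitrary: f g)
  case 0
  then show ?case by (auto intro: continuous_intros)
next
  case (Suc k)
  show ?case
    by (rule Ck_on_SucI[OF U has_derivative_mult[OF Ck_on_SucD(1)[OF Suc.prems(1)] Ck_on_SucD(1)[OF Suc.prems(2)]]])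
      (auto intro!: Ck_on_add[OF U] Suc.IH Ck_on_SucD(2)[OF Suc.prems(1)] Ck_on_SucD(2)[OF Suc.prems(2)]
        Ck_on_Suc_imp[OF Suc.prems(1)] Ck_on_Suc_imp[OF Suc.prems(2)] simp del: Ck_on.simps)
qed

lemma Ck_on_sum:
  assumes "open U" "\<And>i. i \<in> I \<Longrightarrow> Ck_on k U (f i)"
  shows "Ck_on k U (\<lambda>x. \<Sum>i\<in>I. f i x)"
  using assms(2)
  by (induction I rule: infinite_finite_induct) (auto simp: Ck_on_const intro!: Ck_on_add[OF assms(1)] simp del: Ck_on.simps)

text \<open>In the chain rule the derivative of h is taken in a direction that moves with x, while
  \<open>Ck_on\<close> controls fixed directions. Expanding the direction in \<open>Basis\<close>
  leaves sums of products of functions already known to be of class k. The induction generalises h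
  and keeps g.\<close>

lemma Ck_on_compose:
  fixes g :: "'a::euclidean_space \<Rightarrow> 'b::euclidean_space" and h :: "'b \<Rightarrow> real"
  assumes U: "open U" and V: "open V" and "Ck_on k U g" "Ck_on k V h" and im: "g ` U \<subseteq> V"
  shows "Ck_on k U (\<lambda>x. h (g x))"
  using assms(3,4)
proof (induction k arbitrary: h)
  case 0
  then show ?case using continuous_on_compose2 im by auto
next
  case (Suc k)
  note g = Ck_on_SucD[OF Suc.prems(1)] and h = Ck_on_SucD[OF Suc.prems(2)]
  have d: "((\<lambda>x. h (g x)) has_derivative (\<lambda>v. \<Sum>b\<in>Basis.
     (frechet_derivative g (at x) v \<bullet> b) * frechet_derivative h (at (g x)) b)) (at x)" if x: "x \<in> U" for x
  proof -
    have gx: "g x \<in> V" using im x by auto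
    interpret l: bounded_linear "frechet_derivative h (at (g x))"
      using h(1)[OF gx] has_derivative_bounded_linear by blast
    have "frechet_derivative h (at (g x)) w = (\<Sum>b\<in>Basis. (w \<bullet> b) * frechet_derivative h (at (g x)) b)" for w
    proof -
      have "frechet_derivative h (at (g x)) w = frechet_derivative h (at (g x)) (\<Sum>b\<in>Basis. (w \<bullet> b) *\<^sub>R b)"
        by (simp add: euclidean_representation)
      then show ?thesis by (simp only: l.sum l.scaleR real_scaleR_def)
    qed
    then have "(\<lambda>v. frechet_derivative h (at (g x)) (frechet_derivative g (at x) v)) =
      (\<lambda>v. \<Sum>b\<in>Basis. (frechet_derivative g (at x) v \<bullet> b) * frechet_derivative h (at (g x)) b)"
      by blast
    then show ?thesis
      by (rule has_derivative_eq_rhs[OF has_derivative_compose[OF g(1)[OF x] h(1)[OF gx]]])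
  qed
  have g': "Ck_on k U (\<lambda>x. frechet_derivative g (at x) v \<bullet> b)" for v b
    by (rule Ck_on_linear[OF U bounded_linear_inner_left g(2)])
  have h': "Ck_on k U (\<lambda>x. frechet_derivative h (at (g x)) b)" for b
    by (rule Suc.IH[OF Ck_on_Suc_imp[OF Suc.prems(1)] h(2)])
  show ?case
    by (rule Ck_on_SucI[OF U d], assumption) (intro Ck_on_sum[OF U] Ck_on_mult[OF U] g' h')
qed

lemma smooth_on_const [intro]: "smooth_on U (\<lambda>x. c)"
  by (simp add: smooth_on_def Ck_on_const)

lemma smooth_on_linear: "open U \<Longrightarrow> bounded_linear L \<Longrightarrow> smooth_on U f \<Longrightarrow> smooth_on U (\<lambda>x. L (f x))"
  by (simp add: smooth_on_def Ck_on_linear)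

lemma smooth_on_add: "open U \<Longrightarrow> smooth_on U f \<Longrightarrow> smooth_on U g \<Longrightarrow> smooth_on U (\<lambda>x. f x + g x)"
  by (simp add: smooth_on_def Ck_on_add)

lemma smooth_on_mult:
  fixes f g :: "'a::euclidean_space \<Rightarrow> real"
  shows "open U \<Longrightarrow> smooth_on U f \<Longrightarrow> smooth_on U g \<Longrightarrow> smooth_on U (\<lambda>x. f x * g x)"
  by (simp add: smooth_on_def Ck_on_mult)

lemma smooth_on_sum:
  "open U \<Longrightarrow> (\<And>i. i \<in> I \<Longrightarrow> smooth_on U (f i)) \<Longrightarrow> smooth_on U (\<lambda>x. \<Sum>i\<in>I. f i x)"
  by (simp add: smooth_on_def Ck_on_sum)

lemma smooth_on_minus: "open U \<Longrightarrow> smooth_on U f \<Longrightarrow> smooth_on U (\<lambda>x. - f x)"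
  using smooth_on_linear[of U uminus f] bounded_linear_minus[OF bounded_linear_ident] by simp

lemma smooth_on_diff: "open U \<Longrightarrow> smooth_on U f \<Longrightarrow> smooth_on U g \<Longrightarrow> smooth_on U (\<lambda>x. f x - g x)"
  using smooth_on_add[of U f "\<lambda>x. - g x"] smooth_on_minus[of U g] by simp

lemma smooth_on_power:
  fixes f :: "'a::euclidean_space \<Rightarrow> real"
  shows "open U \<Longrightarrow> smooth_on U f \<Longrightarrow> smooth_on U (\<lambda>x. f x ^ n)"
  by (induction n) (auto intro: smooth_on_mult)

lemma smooth_on_compose:
  fixes g :: "'a::euclidean_space \<Rightarrow> 'b::euclidean_space" and h :: "'b \<Rightarrow> real"
  shows "open U \<Longrightarrow> open V \<Longrightarrow> smooth_on V h \<Longrightarrow> smooth_on U g \<Longrightarrow> g ` U \<subseteq> V \<Longrightarrow>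
    smooth_on U (\<lambda>x. h (g x))"
  by (auto simp: smooth_on_def intro: Ck_on_compose)

lemma smooth_on_frechet:
  assumes "smooth_on U f"
  shows "smooth_on U (\<lambda>x. frechet_derivative f (at x) v)"
  unfolding smooth_on_def
proof
  show "Ck_on k U (\<lambda>x. frechet_derivative f (at x) v)" for k
    using assms unfolding smooth_on_def by (metis Ck_on.simps(2))
qed

lemma smooth_on_has_derivative:
  assumes "smooth_on U f" "x \<in> U"
  shows "(f has_derivative frechet_derivative f (at x)) (at x)"
  using assms Ck_on_SucD(1)[of 0 U f x] unfolding smooth_on_def by blast

lemma smooth_on_continuous: "smooth_on U f \<Longrightarrow> continuous_on U f"
  unfolding smooth_on_def by (metis Ck_on.simps(1))

lemma smooth_on_cong: "open U \<Longrightarrow> (\<And>x. x \<in> U \<Longrightarrow> f x = g x) \<Longrightarrow> smooth_on U f \<Longrightarrow> smooth_on U g"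
  unfolding smooth_on_def using Ck_on_cong by blast

lemma smooth_on_subset: "smooth_on V f \<Longrightarrow> U \<subseteq> V \<Longrightarrow> smooth_on U f"
proof -
  have "Ck_on k V f \<Longrightarrow> U \<subseteq> V \<Longrightarrow> Ck_on k U f" for k
    by (induction k arbitrary: f) (auto intro: continuous_on_subset)
  then show "smooth_on V f \<Longrightarrow> U \<subseteq> V \<Longrightarrow> smooth_on U f"
    unfolding smooth_on_def by blast
qed

lemma smooth_on_id: "open U \<Longrightarrow> smooth_on U (\<lambda>x. x)"
  unfolding smooth_on_def
proof
  fix k assume U: "open U"
  show "Ck_on k U (\<lambda>x. x)"
    by (cases k) (auto simp: continuous_on_id intro!: Ck_on_SucI[OF U has_derivative_ident] Ck_on_const simp del: Ck_on.simps(2))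
qed

lemma smooth_on_bounded_linear: "open U \<Longrightarrow> bounded_linear L \<Longrightarrow> smooth_on U L"
  using smooth_on_linear[OF _ _ smooth_on_id] by blast

lemma smooth_on_componentwise:
  fixes f :: "'a::euclidean_space \<Rightarrow> 'b::euclidean_space"
  assumes U: "open U" and c: "\<And>b. b \<in> Basis \<Longrightarrow> smooth_on U (\<lambda>x. f x \<bullet> b)"
  shows "smooth_on U f"
proof -
  have "smooth_on U (\<lambda>x. \<Sum>b\<in>Basis. (f x \<bullet> b) *\<^sub>R b)"
    by (intro smooth_on_sum[OF U] smooth_on_linear[OF U bounded_linear_scaleR_left, of "\<lambda>x. f x \<bullet> b" for b] c)
  then show ?thesis by (simp add: euclidean_representation)
qed

lemma smooth_on_vec:
  fixes f :: "'a::euclidean_space \<Rightarrow> real^'n"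
  assumes U: "open U" and c: "\<And>i. smooth_on U (\<lambda>x. f x $ i)"
  shows "smooth_on U f"
  by (rule smooth_on_componentwise[OF U]) (use c in \<open>auto simp: Basis_vec_def inner_axis\<close>)

lemma smooth_on_Pair:
  fixes f :: "'a::euclidean_space \<Rightarrow> 'b::euclidean_space" and g :: "'a \<Rightarrow> 'c::euclidean_space"
  assumes U: "open U" and "smooth_on U f" "smooth_on U g"
  shows "smooth_on U (\<lambda>x. (f x, g x))"
proof -
  have 1: "bounded_linear (\<lambda>x::'b. (x, 0::'c))" "bounded_linear (\<lambda>x::'c. (0::'b, x))"
    by (auto intro!: bounded_linear_Pair bounded_linear_ident bounded_linear_zero)
  show ?thesis
    using smooth_on_add[OF U smooth_on_linear[OF U 1(1) assms(2)] smooth_on_linear[OF U 1(2) assms(3)]] by simp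
qed

text \<open>Serves functions whose derivative is already known to be smooth, such as
  \<open>ln\<close> with the derivative \<open>inverse\<close>; no separate induction is then
  required.\<close>

lemma smooth_on_SucI:
  assumes U: "open U" and d: "\<And>x. x \<in> U \<Longrightarrow> (f has_derivative f' x) (at x)"
    and s: "\<And>v. smooth_on U (\<lambda>x. f' x v)"
  shows "smooth_on U f"
  unfolding smooth_on_def
proof
  show "Ck_on k U f" for k
    using Ck_on_SucI[OF U d s[unfolded smooth_on_def, rule_format], of k] Ck_on_Suc_imp by blast
qed

lemma smooth_on_exp: "smooth_on UNIV (exp :: real \<Rightarrow> real)"
  unfolding smooth_on_def
proof
  fix k show "Ck_on k UNIV (exp :: real \<Rightarrow> real)"
  proof (induction k)
    case (Suc k)
    show ?case
      by (rule Ck_on_SucI[where f'="\<lambda>x v. v * exp x"])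
        (auto intro!: derivative_eq_intros Ck_on_mult Suc Ck_on_const simp del: Ck_on.simps)
  qed (auto intro: continuous_intros)
qed

lemma smooth_on_sin_cos: "smooth_on UNIV (sin :: real \<Rightarrow> real) \<and> smooth_on UNIV (cos :: real \<Rightarrow> real)"
proof -
  have "Ck_on k UNIV (sin :: real \<Rightarrow> real) \<and> Ck_on k UNIV (cos :: real \<Rightarrow> real)" for k
  proof (induction k)
    case (Suc k)
    have "Ck_on (Suc k) UNIV (sin :: real \<Rightarrow> real)"
      by (rule Ck_on_SucI[where f'="\<lambda>x v. v * cos x"])
        (use Suc in \<open>auto intro!: derivative_eq_intros Ck_on_mult Ck_on_const simp del: Ck_on.simps\<close>)
    moreover have "Ck_on (Suc k) UNIV (cos :: real \<Rightarrow> real)"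
    proof (rule Ck_on_SucI[where f'="\<lambda>x v. (- v) * sin x"])
      show "Ck_on k UNIV (\<lambda>x. - v * sin x)" for v :: real
        by (intro Ck_on_mult Ck_on_const open_UNIV conjunct1[OF Suc])
    qed (auto intro!: derivative_eq_intros)
    ultimately show ?case by blast
  qed (auto intro: continuous_intros)
  then show ?thesis by (simp add: smooth_on_def)
qed

lemma smooth_on_inverse_real: "smooth_on (- {0}) (inverse :: real \<Rightarrow> real)"
  unfolding smooth_on_def
proof
  have o: "open (- {0::real})" by auto
  fix k show "Ck_on k (- {0}) (inverse :: real \<Rightarrow> real)"
  proof (induction k)
    case (Suc k)
    show ?case
    proof (rule Ck_on_SucI[OF o, where f'="\<lambda>x v. (- v) * (inverse x * inverse x)"])
      show "Ck_on k (- {0}) (\<lambda>x. - v * (inverse x * inverse x))" for v :: real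
        by (intro Ck_on_mult[OF o] Ck_on_const Suc)
    qed (auto intro!: derivative_eq_intros)
  qed (auto intro: continuous_intros)
qed

lemma smooth_on_real_sqrt: "smooth_on {0<..} sqrt"
  unfolding smooth_on_def
proof
  have o: "open ({0::real<..})" by auto
  fix k show "Ck_on k {0<..} sqrt"
  proof (induction k)
    case (Suc k)
    have "Ck_on k {0<..} (\<lambda>x. inverse (sqrt x))"
      by (rule Ck_on_compose[OF o _ Suc, of "- {0}"])
        (use smooth_on_inverse_real in \<open>auto simp: smooth_on_def simp del: Ck_on.simps\<close>)
    then have "Ck_on k {0<..} (\<lambda>x. (v/2) * inverse (sqrt x))" for v :: real
      by (intro Ck_on_mult[OF o] Ck_on_const)
    then show ?case
      by (intro Ck_on_SucI[OF o, where f'="\<lambda>x v. (v/2) * inverse (sqrt x)"])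
        (auto intro!: derivative_eq_intros simp: field_simps simp del: Ck_on.simps)
  qed (auto intro: continuous_intros)
qed

lemma smooth_on_ln: "smooth_on {0<..} (ln :: real \<Rightarrow> real)"
proof (rule smooth_on_SucI[where f'="\<lambda>x v. v * inverse x"])
  show "smooth_on {0<..} (\<lambda>x. v * inverse x)" for v :: real
    by (intro smooth_on_mult smooth_on_const smooth_on_subset[OF smooth_on_inverse_real]) auto
qed (auto intro!: derivative_eq_intros simp: field_simps)

lemma
  assumes "open U" "smooth_on U (f :: 'a::euclidean_space \<Rightarrow> real)"
  shows smooth_on_sin_comp: "smooth_on U (\<lambda>x. sin (f x))"
    and smooth_on_cos_comp: "smooth_on U (\<lambda>x. cos (f x))"
    and smooth_on_exp_comp: "smooth_on U (\<lambda>x. exp (f x))"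
    and smooth_on_inverse_comp: "(\<And>x. x \<in> U \<Longrightarrow> f x \<noteq> 0) \<Longrightarrow> smooth_on U (\<lambda>x. inverse (f x))"
    and smooth_on_sqrt_comp: "(\<And>x. x \<in> U \<Longrightarrow> f x > 0) \<Longrightarrow> smooth_on U (\<lambda>x. sqrt (f x))"
    and smooth_on_ln_comp: "(\<And>x. x \<in> U \<Longrightarrow> f x > 0) \<Longrightarrow> smooth_on U (\<lambda>x. ln (f x))"
proof -
  note c = smooth_on_compose[OF assms(1) _ _ assms(2)]
  show "smooth_on U (\<lambda>x. sin (f x))" "smooth_on U (\<lambda>x. cos (f x))" "smooth_on U (\<lambda>x. exp (f x))"
    by (rule c[of UNIV]; simp add: smooth_on_sin_cos smooth_on_exp)+
  show "smooth_on U (\<lambda>x. inverse (f x))" if "\<And>x. x \<in> U \<Longrightarrow> f x \<noteq> 0"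
    by (rule c[OF _ smooth_on_inverse_real]) (use that in auto)
  show "smooth_on U (\<lambda>x. sqrt (f x))" if "\<And>x. x \<in> U \<Longrightarrow> f x > 0"
    by (rule c[OF _ smooth_on_real_sqrt]) (use that in auto)
  show "smooth_on U (\<lambda>x. ln (f x))" if "\<And>x. x \<in> U \<Longrightarrow> f x > 0"
    by (rule c[OF _ smooth_on_ln]) (use that in auto)
qed

lemma smooth_on_divide:
  fixes f g :: "'a::euclidean_space \<Rightarrow> real"
  assumes "open U" "smooth_on U f" "smooth_on U g" "\<And>x. x \<in> U \<Longrightarrow> g x \<noteq> 0"
  shows "smooth_on U (\<lambda>x. f x / g x)"
  using smooth_on_mult[OF assms(1,2) smooth_on_inverse_comp[OF assms(1,3,4)]] by (simp add: divide_inverse)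

lemma
  assumes "open U" "smooth_on U (f :: 'a::euclidean_space \<Rightarrow> real)"
  shows smooth_on_cosh_comp: "smooth_on U (\<lambda>x. cosh (f x))"
    and smooth_on_sinh_comp: "smooth_on U (\<lambda>x. sinh (f x))"
proof -
  have "smooth_on U (\<lambda>x. (1/2) * (exp (f x) + exp (- f x)))" "smooth_on U (\<lambda>x. (1/2) * (exp (f x) - exp (- f x)))"
    by (intro smooth_on_mult smooth_on_add smooth_on_diff smooth_on_exp_comp smooth_on_minus smooth_on_const assms)+
  then show "smooth_on U (\<lambda>x. cosh (f x))" "smooth_on U (\<lambda>x. sinh (f x))"
    by (simp_all add: cosh_def sinh_def)
qed

section \<open>Gradients\<close>

text \<open>Derivatives are carried as explicit families of components, so that the sum, product and
  chain rules compute partial derivatives by unification.\<close>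

definition has_grad :: "(real^'n \<Rightarrow> real) \<Rightarrow> ('n \<Rightarrow> real) \<Rightarrow> real^'n \<Rightarrow> bool" where
  "has_grad f f' x \<longleftrightarrow> (f has_derivative (\<lambda>v. \<Sum>i\<in>UNIV. f' i * v $ i)) (at x)"

lemma has_gradI:
  assumes "(f has_derivative D) (at x)"
  shows "has_grad f (\<lambda>i. D (axis i 1)) x"
proof -
  interpret bounded_linear D using assms by (rule has_derivative_bounded_linear)
  have "D v = (\<Sum>i\<in>UNIV. D (axis i 1) * v $ i)" for v
  proof -
    have "D v = D (\<Sum>i\<in>UNIV. v $ i *\<^sub>R axis i 1)"
      using basis_expansion[of v] by (simp add: scalar_mult_eq_scaleR)
    then show ?thesis by (simp only: sum scaleR real_scaleR_def mult.commute)
  qed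
  then have "D = (\<lambda>v. \<Sum>i\<in>UNIV. D (axis i 1) * v $ i)" by blast
  then show ?thesis unfolding has_grad_def by (rule has_derivative_eq_rhs[OF assms])
qed

lemma has_grad_eq: "has_grad f f' x \<Longrightarrow> (\<And>i. f' i = f'' i) \<Longrightarrow> has_grad f f'' x"
  by (simp add: has_grad_def)

lemma has_grad_const: "has_grad (\<lambda>x. c) (\<lambda>i. 0) x"
  by (simp add: has_grad_def)

lemma has_grad_add: "has_grad f f' x \<Longrightarrow> has_grad g g' x \<Longrightarrow> has_grad (\<lambda>x. f x + g x) (\<lambda>i. f' i + g' i) x"
  unfolding has_grad_def by (drule (1) has_derivative_add) (simp add: sum.distrib algebra_simps)

lemma has_grad_diff: "has_grad f f' x \<Longrightarrow> has_grad g g' x \<Longrightarrow> has_grad (\<lambda>x. f x - g x) (\<lambda>i. f' i - g' i) x"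
  unfolding has_grad_def by (drule (1) has_derivative_diff) (simp add: sum_subtractf algebra_simps)

lemma has_grad_mult:
  "has_grad f f' x \<Longrightarrow> has_grad g g' x \<Longrightarrow> has_grad (\<lambda>x. f x * g x) (\<lambda>i. f' i * g x + f x * g' i) x"
  unfolding has_grad_def
  by (drule (1) has_derivative_mult) (simp add: sum.distrib algebra_simps sum_distrib_left)

lemma has_grad_sum:
  "(\<And>j. j \<in> J \<Longrightarrow> has_grad (f j) (f' j) x) \<Longrightarrow> has_grad (\<lambda>x. \<Sum>j\<in>J. f j x) (\<lambda>i. \<Sum>j\<in>J. f' j i) x"
  by (induction J rule: infinite_finite_induct) (auto simp: has_grad_const intro: has_grad_add)

lemma has_grad_nth: "has_grad (\<lambda>x. x $ j) (\<lambda>i. if i = j then 1 else 0) x"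
  unfolding has_grad_def
proof -
  have "(\<lambda>v::real^'a. v $ j) = (\<lambda>v. \<Sum>i\<in>UNIV. (if i = j then 1 else 0) * v $ i)"
    by (simp add: if_distrib[of "\<lambda>a. a * _"] cong: if_cong)
  then show "((\<lambda>x. x $ j) has_derivative (\<lambda>v. \<Sum>i\<in>UNIV. (if i = j then 1 else 0) * v $ i)) (at x)"
    using bounded_linear_imp_has_derivative[OF bounded_linear_vec_nth, of j "at x"] by simp
qed

lemma has_grad_chain:
  assumes "\<And>j. has_grad (\<lambda>x. g x $ j) (g' j) x" "has_grad f f' (g x)"
  shows "has_grad (\<lambda>x. f (g x)) (\<lambda>i. \<Sum>j\<in>UNIV. f' j * g' j i) x"
proof -
  have "(g has_derivative (\<lambda>v. \<chi> j. \<Sum>i\<in>UNIV. g' j i * v $ i)) (at x)"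
    by (subst has_derivative_componentwise_within)
      (use assms(1) in \<open>auto simp: Basis_vec_def inner_axis has_grad_def\<close>)
  from has_derivative_compose[OF this assms(2)[unfolded has_grad_def]] show ?thesis
    unfolding has_grad_def
    by (simp add: sum_distrib_left sum_distrib_right mult.assoc)
      (subst sum.swap, simp)
qed

lemma has_grad_unique: "has_grad f f' x \<Longrightarrow> has_grad f f'' x \<Longrightarrow> f' i = f'' i"
  unfolding has_grad_def by (drule (1) has_derivative_unique) (drule fun_cong[of _ _ "axis i 1"], simp add: axis_def if_distrib cong: if_cong)

lemma has_grad_transform:
  "has_grad f f' x \<Longrightarrow> open U \<Longrightarrow> x \<in> U \<Longrightarrow> (\<And>y. y \<in> U \<Longrightarrow> f y = g y) \<Longrightarrow> has_grad g f' x"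
  unfolding has_grad_def using has_derivative_transform_within_open by blast

lemma pd_eqI: "has_grad f f' x \<Longrightarrow> pd a f x = f' a"
  unfolding has_grad_def pd_def
  by (drule frechet_derivative_at) (drule fun_cong[of _ _ "axis a 1"], simp add: axis_def if_distrib cong: if_cong)

lemma has_grad_DERIV:
  assumes "has_grad f f' x" "(g has_real_derivative D) (at (f x))"
  shows "has_grad (\<lambda>x. g (f x)) (\<lambda>i. D * f' i) x"
  using has_derivative_compose[OF assms(1)[unfolded has_grad_def] assms(2)[unfolded has_field_derivative_def]]
  unfolding has_grad_def by (simp add: sum_distrib_left mult.assoc)

lemma smooth_on_has_grad:
  "smooth_on U f \<Longrightarrow> x \<in> U \<Longrightarrow> has_grad f (\<lambda>i. frechet_derivative f (at x) (axis i 1)) x"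
  by (intro has_gradI smooth_on_has_derivative)

section \<open>Symmetry of second partial derivatives\<close>

text \<open>The second difference of f over a small square, treated by the mean value theorem in
  either order of the variables, equals the squared side times a value of either mixed derivative at
  an interior point. Continuity at the origin then excludes different values there.\<close>

lemma mixed_partials_2d:
  fixes f fx fy fxy fyx :: "real \<Rightarrow> real \<Rightarrow> real"
  assumes e: "e > 0"
    and fx: "\<And>s t. \<bar>s\<bar> < e \<Longrightarrow> \<bar>t\<bar> < e \<Longrightarrow> ((\<lambda>s. f s t) has_real_derivative fx s t) (at s)"
    and fy: "\<And>s t. \<bar>s\<bar> < e \<Longrightarrow> \<bar>t\<bar> < e \<Longrightarrow> (f s has_real_derivative fy s t) (at t)"
    and fxy: "\<And>s t. \<bar>s\<bar> < e \<Longrightarrow> \<bar>t\<bar> < e \<Longrightarrow> (fx s has_real_derivative fxy s t) (at t)"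
    and fyx: "\<And>s t. \<bar>s\<bar> < e \<Longrightarrow> \<bar>t\<bar> < e \<Longrightarrow> ((\<lambda>s. fy s t) has_real_derivative fyx s t) (at s)"
    and c: "isCont (\<lambda>p. fxy (fst p) (snd p)) (0,0)" "isCont (\<lambda>p. fyx (fst p) (snd p)) (0,0)"
  shows "fxy 0 0 = fyx 0 0"
proof (rule ccontr)
  assume ne: "fxy 0 0 \<noteq> fyx 0 0"
  define \<epsilon> where "\<epsilon> = \<bar>fxy 0 0 - fyx 0 0\<bar> / 2"
  have \<epsilon>: "\<epsilon> > 0" using ne by (simp add: \<epsilon>_def)
  obtain d1 where d1: "d1 > 0" "\<And>p. dist p (0,0) < d1 \<Longrightarrow> dist (fxy (fst p) (snd p)) (fxy 0 0) < \<epsilon>"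
    using c(1) \<epsilon> unfolding continuous_at_eps_delta by (metis fst_conv snd_conv)
  obtain d2 where d2: "d2 > 0" "\<And>p. dist p (0,0) < d2 \<Longrightarrow> dist (fyx (fst p) (snd p)) (fyx 0 0) < \<epsilon>"
    using c(2) \<epsilon> unfolding continuous_at_eps_delta by (metis fst_conv snd_conv)
  \<comment> \<open>A third keeps the square inside the domain, and its points, at distance at most
    2h from the corner, inside both continuity neighbourhoods.\<close>
  define h where "h = min e (min d1 d2) / 3"
  have h: "h > 0" "h < e" "2 * h < d1" "2 * h < d2"
    using e d1(1) d2(1) by (auto simp: h_def min_def)
  have near: "dist (s, t) (0, 0) \<le> 2 * h" if "0 < s" "s < h" "0 < t" "t < h" for s t :: real
  proof -
    have "dist (s, t) (0, 0) \<le> \<bar>s\<bar> + \<bar>t\<bar>"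
      by (simp add: dist_Pair_Pair sqrt_sum_squares_le_sum_abs)
    then show ?thesis using that by simp
  qed
  obtain s1 where s1: "0 < s1" "s1 < h" "(f h h - f h 0) - (f 0 h - f 0 0) = (h - 0) * (fx s1 h - fx s1 0)"
    using MVT2[OF h(1), of "\<lambda>s. f s h - f s 0" "\<lambda>s. fx s h - fx s 0"] h
    by (force intro!: DERIV_diff fx)
  obtain t1 where t1: "0 < t1" "t1 < h" "fx s1 h - fx s1 0 = (h - 0) * fxy s1 t1"
    using MVT2[OF h(1), of "fx s1" "fxy s1"] h s1 by (force intro!: fxy)
  obtain t2 where t2: "0 < t2" "t2 < h" "(f h h - f 0 h) - (f h 0 - f 0 0) = (h - 0) * (fy h t2 - fy 0 t2)"
    using MVT2[OF h(1), of "\<lambda>t. f h t - f 0 t" "\<lambda>t. fy h t - fy 0 t"] h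
    by (force intro!: DERIV_diff fy)
  obtain s2 where s2: "0 < s2" "s2 < h" "fy h t2 - fy 0 t2 = (h - 0) * fyx s2 t2"
    using MVT2[OF h(1), of "\<lambda>s. fy s t2" "\<lambda>s. fyx s t2"] h t2 by (force intro!: fyx)
  have "h * (h * fxy s1 t1) = h * (h * fyx s2 t2)"
  proof -
    have "h * (fx s1 h - fx s1 0) = h * (fy h t2 - fy 0 t2)"
      using s1(3) t2(3) unfolding diff_zero by argo
    then show ?thesis unfolding t1(3) s2(3) by simp
  qed
  then have eq: "fxy s1 t1 = fyx s2 t2" using h(1) by simp
  have "dist (fxy s1 t1) (fxy 0 0) < \<epsilon>" "dist (fyx s2 t2) (fyx 0 0) < \<epsilon>"
    using d1(2)[of "(s1,t1)"] d2(2)[of "(s2,t2)"] near[of s1 t1] near[of s2 t2] s1 t1 s2 t2 h by auto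
  then show False using eq unfolding dist_real_def \<epsilon>_def by (auto simp: abs_if split: if_splits)
qed

text \<open>Restriction to the plane spanned by u and v through x reduces the claim to two real
  variables.\<close>

lemma smooth_on_symmetric:
  fixes f :: "'a::euclidean_space \<Rightarrow> real"
  assumes U: "open U" and f: "smooth_on U f" and x: "x \<in> U"
  shows "frechet_derivative (\<lambda>x. frechet_derivative f (at x) u) (at x) v =
    frechet_derivative (\<lambda>x. frechet_derivative f (at x) v) (at x) u"
proof -
  define D where "D u g x = frechet_derivative g (at x) u" for u and g :: "'a \<Rightarrow> real" and x
  define q where "q s t = x + s *\<^sub>R u + t *\<^sub>R v" for s t
  obtain r where r: "r > 0" "ball x r \<subseteq> U" using U x open_contains_ball by blast
  \<comment> \<open>The summand 1 keeps e positive when u and v both vanish.\<close>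
  define e where "e = r / (norm u + norm v + 1)"
  have e: "e > 0" using r by (simp add: e_def add_nonneg_pos)
  have q: "q s t \<in> U" if "\<bar>s\<bar> < e" "\<bar>t\<bar> < e" for s t
  proof -
    have "norm (s *\<^sub>R u + t *\<^sub>R v) \<le> \<bar>s\<bar> * norm u + \<bar>t\<bar> * norm v"
      using norm_triangle_ineq[of "s *\<^sub>R u" "t *\<^sub>R v"] by simp
    also have "\<dots> \<le> e * norm u + e * norm v"
      using that by (intro add_mono mult_right_mono) auto
    also have "\<dots> < e * (norm u + norm v + 1)" using e by (simp add: algebra_simps)
    also have "\<dots> = r"
      using add_nonneg_pos[of "norm u + norm v" 1] by (simp add: e_def)
    finally have "q s t \<in> ball x r"
      using norm_minus_cancel[of "s *\<^sub>R u + t *\<^sub>R v"] by (simp add: q_def dist_norm)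
    then show ?thesis using r by blast
  qed
  have d1: "((\<lambda>s. g (q s t)) has_real_derivative D u g (q s t)) (at s)"
    and d2: "((\<lambda>t. g (q s t)) has_real_derivative D v g (q s t)) (at t)"
    if g: "smooth_on U g" and st: "\<bar>s\<bar> < e" "\<bar>t\<bar> < e" for g s t
  proof -
    have gd: "(g has_derivative frechet_derivative g (at (q s t))) (at (q s t))"
      by (rule smooth_on_has_derivative[OF g q[OF st]])
    interpret l: bounded_linear "frechet_derivative g (at (q s t))"
      using gd by (rule has_derivative_bounded_linear)
    have 1: "((\<lambda>s. q s t) has_derivative (\<lambda>h. h *\<^sub>R u)) (at s)"
      and 2: "((\<lambda>t. q s t) has_derivative (\<lambda>h. h *\<^sub>R v)) (at t)"
      unfolding q_def by (auto intro!: derivative_eq_intros)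
    show "((\<lambda>s. g (q s t)) has_real_derivative D u g (q s t)) (at s)"
      using has_derivative_compose[OF 1 gd]
      by (simp add: has_field_derivative_def l.scaleR D_def mult.commute[of _ "frechet_derivative g _ _"])
    show "((\<lambda>t. g (q s t)) has_real_derivative D v g (q s t)) (at t)"
      using has_derivative_compose[OF 2 gd]
      by (simp add: has_field_derivative_def l.scaleR D_def mult.commute[of _ "frechet_derivative g _ _"])
  qed
  have sm: "smooth_on U (D w g)" if "smooth_on U g" for w g
    unfolding D_def by (rule smooth_on_frechet[OF that])
  have co: "isCont (\<lambda>p. g (q (fst p) (snd p))) (0,0)" if "smooth_on U g" for g
  proof -
    have "isCont g (q (fst (0::real,0::real)) (snd (0::real,0::real)))"
      using smooth_on_continuous[OF that] continuous_on_eq_continuous_at[OF U, of g] x by (simp add: q_def)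
    moreover have "isCont (\<lambda>p. q (fst p) (snd p)) (0::real,0::real)"
      unfolding q_def by (intro continuous_intros)
    ultimately show ?thesis by (rule isCont_o2[rotated])
  qed
  have "D v (D u f) (q 0 0) = D u (D v f) (q 0 0)"
  proof (rule mixed_partials_2d[OF e, of "\<lambda>s t. f (q s t)" "\<lambda>s t. D u f (q s t)" "\<lambda>s t. D v f (q s t)"
        "\<lambda>s t. D v (D u f) (q s t)" "\<lambda>s t. D u (D v f) (q s t)"])
    show "isCont (\<lambda>p. D v (D u f) (q (fst p) (snd p))) (0, 0)"
      "isCont (\<lambda>p. D u (D v f) (q (fst p) (snd p))) (0, 0)"
      by (rule co[OF sm[OF sm[OF f]]])+
  qed (assumption | rule d1 d2 f sm)+
  moreover have "D w f = (\<lambda>x. frechet_derivative f (at x) w)" for w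
    by (simp add: D_def fun_eq_iff)
  ultimately show ?thesis unfolding D_def[of _ "D _ f"] by (simp add: q_def)
qed

section \<open>The hyperboloid in Minkowski space\<close>

definition eta :: "4 \<Rightarrow> real" where "eta A = (if A = 1 then - 1 else 1)"

text \<open>De Sitter space as the unit hyperboloid, in the coordinates (\<tau>, \<theta>, \<phi>);
  component 1 is the timelike one.\<close>

definition emb :: "real^3 \<Rightarrow> real^4" where
  "emb x = (\<chi> A. if A = 1 then sinh (x $ 1) else if A = 2 then cosh (x $ 1) * (sin (x $ 2) * cos (x $ 3))
    else if A = 3 then cosh (x $ 1) * (sin (x $ 2) * sin (x $ 3)) else cosh (x $ 1) * cos (x $ 2))"

text \<open>The partial derivative of component A of \<open>emb\<close> along coordinate a. Lower
  case indices belong to the hyperboloid, upper case ones to Minkowski space.\<close>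

definition fr :: "real^3 \<Rightarrow> 3 \<Rightarrow> 4 \<Rightarrow> real" where
  "fr x a A =
    (if a = 1 then
       (if A = 1 then cosh (x $ 1) else if A = 2 then sinh (x $ 1) * (sin (x $ 2) * cos (x $ 3))
        else if A = 3 then sinh (x $ 1) * (sin (x $ 2) * sin (x $ 3)) else sinh (x $ 1) * cos (x $ 2))
     else if a = 2 then
       (if A = 1 then 0 else if A = 2 then cosh (x $ 1) * (cos (x $ 2) * cos (x $ 3))
        else if A = 3 then cosh (x $ 1) * (cos (x $ 2) * sin (x $ 3)) else - (cosh (x $ 1) * sin (x $ 2)))
     else
       (if A = 1 then 0 else if A = 2 then - (cosh (x $ 1) * (sin (x $ 2) * sin (x $ 3)))
        else if A = 3 then cosh (x $ 1) * (sin (x $ 2) * cos (x $ 3)) else 0))"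

text \<open>The diagonal of the inverse metric; below, \<open>gd\<close> is the metric itself and
  \<open>gam x c a b\<close> the Christoffel symbol with upper index c.\<close>

definition wt :: "real^3 \<Rightarrow> 3 \<Rightarrow> real" where
  "wt x a = (if a = 1 then -1 else if a = 2 then 1 / (cosh (x $ 1))\<^sup>2
    else 1 / ((cosh (x $ 1))\<^sup>2 * (sin (x $ 2))\<^sup>2))"

definition gd :: "real^3 \<Rightarrow> 3 \<Rightarrow> 3 \<Rightarrow> real" where
  "gd x a b = (if a = b then (if a = 1 then -1 else if a = 2 then (cosh (x $ 1))\<^sup>2
    else (cosh (x $ 1))\<^sup>2 * (sin (x $ 2))\<^sup>2) else 0)"

definition gam :: "real^3 \<Rightarrow> 3 \<Rightarrow> 3 \<Rightarrow> 3 \<Rightarrow> real" where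
  "gam x c a b =
    (if c = 1 then
       (if a = 2 \<and> b = 2 then cosh (x $ 1) * sinh (x $ 1)
        else if a = 3 \<and> b = 3 then cosh (x $ 1) * sinh (x $ 1) * (sin (x $ 2))\<^sup>2 else 0)
     else if c = 2 then
       (if a = 1 \<and> b = 2 \<or> a = 2 \<and> b = 1 then sinh (x $ 1) / cosh (x $ 1)
        else if a = 3 \<and> b = 3 then - (sin (x $ 2) * cos (x $ 2)) else 0)
     else
       (if a = 1 \<and> b = 3 \<or> a = 3 \<and> b = 1 then sinh (x $ 1) / cosh (x $ 1)
        else if a = 2 \<and> b = 3 \<or> a = 3 \<and> b = 2 then cos (x $ 2) / sin (x $ 2) else 0))"

abbreviation "gS \<equiv> met sph_chart"

lemma gS_nth: "gS x $ a $ b = gd x a b"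
  using exhaust_3[of a] exhaust_3[of b] by (auto simp: met_sph_chart gd_def)

lemma gd_sym: "gd x a b = gd x b a"
  by (auto simp: gd_def)

lemma matrix_inv_eqI:
  fixes A :: "real^'n^'n"
  assumes "A ** B = mat 1" "B ** A = mat 1"
  shows "matrix_inv A = B"
proof -
  have "A ** matrix_inv A = mat 1 \<and> matrix_inv A ** A = mat 1"
    unfolding matrix_inv_def by (rule someI[of _ B]) (use assms in blast)
  then have "B ** (A ** matrix_inv A) = B" by simp
  then show ?thesis by (simp add: matrix_mul_assoc assms)
qed

lemma cosh_ne_0: "cosh (x::real) \<noteq> 0"
  using cosh_real_pos[of x] by linarith

lemma ginv_gS:
  assumes "sin (x $ 2) \<noteq> 0"
  shows "ginv gS x a b = (if a = b then wt x a else 0)"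
proof -
  have "matrix_inv (gS x) = (\<chi> a b. if a = b then wt x a else 0)"
    by (rule matrix_inv_eqI)
      (use assms in \<open>auto simp: vec_eq_iff forall_3 matrix_matrix_mult_def sum_3 gS_nth mat_def gd_def wt_def cosh_ne_0\<close>)
  then show ?thesis by (simp add: ginv_def)
qed

lemma up_gS:
  assumes "sin (x $ 2) \<noteq> 0"
  shows "up gS k T x is = wt x (is ! k) * T x is"
  by (simp add: up_def ginv_gS[OF assms] if_distrib[of "\<lambda>a. a * _"] cong: if_cong)

lemma vec_nth_has_derivative: "((\<lambda>y::real^'n. y $ i) has_derivative (\<lambda>v. v $ i)) (at x)"
  by (rule bounded_linear_imp_has_derivative[OF bounded_linear_vec_nth])

lemma nth_cosh_sinh:
  "((\<lambda>y::real^'n. cosh (y $ i)) has_derivative (\<lambda>v. sinh (x $ i) * v $ i)) (at x)"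
  "((\<lambda>y::real^'n. sinh (y $ i)) has_derivative (\<lambda>v. cosh (x $ i) * v $ i)) (at x)"
proof -
  have "(cosh has_real_derivative sinh (x $ i)) (at (x $ i))" "(sinh has_real_derivative cosh (x $ i)) (at (x $ i))"
    by (auto intro!: derivative_eq_intros)
  from this[unfolded has_field_derivative_def]
  show "((\<lambda>y::real^'n. cosh (y $ i)) has_derivative (\<lambda>v. sinh (x $ i) * v $ i)) (at x)"
    "((\<lambda>y::real^'n. sinh (y $ i)) has_derivative (\<lambda>v. cosh (x $ i) * v $ i)) (at x)"
    using has_derivative_compose[OF vec_nth_has_derivative] by blast+
qed

lemma has_grad_3I:
  "(f has_derivative (\<lambda>v. f' 1 * v $ 1 + f' 2 * v $ 2 + f' 3 * v $ 3)) (at (x::real^3)) \<Longrightarrow> has_grad f f' x"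
  by (simp add: has_grad_def sum_3)

lemma has_grad_emb: "has_grad (\<lambda>y. emb y $ A) (\<lambda>a. fr x a A) x"
  using exhaust_4[of A]
  by (intro has_grad_3I) (auto simp: emb_def fr_def intro!: derivative_eq_intros vec_nth_has_derivative nth_cosh_sinh ext, auto simp: algebra_simps)

lemma cosh_sq_real: "(cosh (t::real))\<^sup>2 = 1 + (sinh t)\<^sup>2"
  by (simp add: cosh_square_eq)

lemma
  fixes x :: "real^3"
  shows cosh_sq_x: "cosh (x $ 1) * cosh (x $ 1) = 1 + sinh (x $ 1) * sinh (x $ 1)"
    and cos_sq_x: "cos (x $ i) * cos (x $ i) = 1 - sin (x $ i) * sin (x $ i)"
  using cosh_sq_real[of "x $ 1"] sin_cos_squared_add[of "x $ i"] by (simp_all add: power2_eq_square)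

lemma
  fixes x :: "real^3"
  shows cosh_sq_x': "cosh (x $ 1) * (cosh (x $ 1) * z) = z + sinh (x $ 1) * (sinh (x $ 1) * z)"
    and cos_sq_x': "cos (x $ i) * (cos (x $ i) * z) = z - sin (x $ i) * (sin (x $ i) * z)"
  by (simp_all only: mult.assoc[symmetric] cosh_sq_x cos_sq_x distrib_right left_diff_distrib mult_1_left)

lemmas trig_x = cosh_sq_x cos_sq_x cosh_sq_x' cos_sq_x'

text \<open>This is the Gauss formula. The position vector is the unit normal of the hyperboloid,
  and since it is orthogonal to the frame, the normal part of the second derivatives of the
  embedding is minus the metric.\<close>

lemma has_grad_fr:
  assumes "sin (x $ 2) \<noteq> 0"
  shows "has_grad (\<lambda>y. fr y a A) (\<lambda>c. (\<Sum>d\<in>UNIV. gam x d c a * fr x d A) - gd x c a * emb x $ A) x"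
proof -
  have 1: "cosh (x $ 1) \<noteq> 0" by (rule cosh_ne_0)
  have "\<forall>a A. has_grad (\<lambda>y. fr y a A) (\<lambda>c. (\<Sum>d\<in>UNIV. gam x d c a * fr x d A) - gd x c a * emb x $ A) x"
    unfolding forall_3 forall_4
    apply (intro conjI has_grad_3I)
    apply (simp_all add: fr_def)
    apply (auto intro!: derivative_eq_intros vec_nth_has_derivative nth_cosh_sinh ext simp: fr_def emb_def gam_def gd_def sum_3 assms 1 power2_eq_square)
    apply (simp_all add: assms 1 field_simps)
    apply (simp_all add: algebra_simps trig_x)
    done
  then show ?thesis by blast
qed

lemma christoffel_gS:
  assumes "sin (x $ 2) \<noteq> 0"
  shows "christoffel gS x c a b = gam x c a b"
proof -
  define dg :: "3 \<Rightarrow> 3 \<Rightarrow> 3 \<Rightarrow> real" where "dg a b i =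
     (if a = b then (if a = 2 then (if i = 1 then 2 * cosh (x $ 1) * sinh (x $ 1) else 0)
        else if a = 3 then (if i = 1 then 2 * cosh (x $ 1) * sinh (x $ 1) * (sin (x $ 2))\<^sup>2
          else if i = 2 then (cosh (x $ 1))\<^sup>2 * (2 * sin (x $ 2) * cos (x $ 2)) else 0) else 0) else 0)" for a b i
  have "has_grad (\<lambda>y. gS y $ a $ b) (dg a b) x" for a b
    unfolding gS_nth
    using exhaust_3[of a] exhaust_3[of b]
    by (intro has_grad_3I) (auto simp: gd_def dg_def power2_eq_square fun_eq_iff algebra_simps intro!: derivative_eq_intros vec_nth_has_derivative nth_cosh_sinh)
  then have pd: "pd i (\<lambda>y. gS y $ a $ b) x = dg a b i" for a b i
    using pd_eqI by blast
  have 1: "cosh (x $ 1) \<noteq> 0" by (rule cosh_ne_0)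
  show ?thesis
    unfolding christoffel_def pd ginv_gS[OF assms]
    using exhaust_3[of a] exhaust_3[of b] exhaust_3[of c]
    by (elim disjE; simp add: sum_3 dg_def gam_def wt_def assms 1 power2_eq_square)
qed

lemma fr_orth: "(\<Sum>A\<in>UNIV. eta A * fr x a A * fr x b A) = gd x a b"
proof -
  have "\<forall>a b. (\<Sum>A\<in>UNIV. eta A * fr x a A * fr x b A) = gd x a b"
    unfolding forall_3
    apply (intro conjI; simp add: sum_4 eta_def fr_def gd_def power2_eq_square)
    apply (simp_all add: algebra_simps trig_x)
    done
  then show ?thesis by blast
qed

lemma emb_orth: "(\<Sum>A\<in>UNIV. eta A * emb x $ A * fr x a A) = 0"
proof -
  have "\<forall>a. (\<Sum>A\<in>UNIV. eta A * emb x $ A * fr x a A) = 0"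
    unfolding forall_3
    apply (intro conjI; simp add: sum_4 eta_def fr_def emb_def del: mult_eq_0_iff)
    apply (simp_all add: algebra_simps trig_x)
    done
  then show ?thesis by blast
qed

lemma emb_unit: "(\<Sum>A\<in>UNIV. eta A * emb x $ A * emb x $ A) = 1"
  by (simp add: sum_4 eta_def emb_def) (simp add: algebra_simps trig_x)

text \<open>The frame together with the unit normal spans Minkowski space, so the inverse Minkowski
  metric splits into a tangential and a normal part.\<close>

lemma fr_complete:
  assumes "sin (x $ 2) \<noteq> 0"
  shows "(\<Sum>a\<in>UNIV. wt x a * fr x a A * fr x a B) = (if A = B then eta A else 0) - emb x $ A * emb x $ B"
proof -
  have 3: "cosh (x $ 1) \<noteq> 0" by (rule cosh_ne_0)
  have "\<forall>A B. (\<Sum>a\<in>UNIV. wt x a * fr x a A * fr x a B) = (if A = B then eta A else 0) - emb x $ A * emb x $ B"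
    unfolding forall_4
    apply (intro conjI; simp add: sum_3 eta_def fr_def emb_def wt_def power2_eq_square 3 assms)
    apply (simp_all add: algebra_simps trig_x)
    done
  then show ?thesis by blast
qed

text \<open>Completeness of the frame turns a contraction on the hyperboloid into a Minkowski
  contraction minus the product of the normal components.\<close>

lemma contr:
  assumes "sin (x $ 2) \<noteq> 0"
  shows "(\<Sum>a\<in>UNIV. wt x a * ((\<Sum>A\<in>UNIV. U A * fr x a A) * (\<Sum>B\<in>UNIV. V B * fr x a B))) =
    (\<Sum>A\<in>UNIV. eta A * (U A * V A)) - (\<Sum>A\<in>UNIV. U A * emb x $ A) * (\<Sum>B\<in>UNIV. V B * emb x $ B)"
proof -
  have "(\<Sum>a\<in>UNIV. wt x a * ((\<Sum>A\<in>UNIV. U A * fr x a A) * (\<Sum>B\<in>UNIV. V B * fr x a B))) =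
    (\<Sum>a\<in>UNIV. \<Sum>A\<in>UNIV. \<Sum>B\<in>UNIV. U A * V B * (wt x a * fr x a A * fr x a B))"
    by (subst sum_product) (simp add: sum_distrib_left mult.assoc mult.left_commute)
  also have "\<dots> = (\<Sum>A\<in>UNIV. \<Sum>B\<in>UNIV. U A * V B * (\<Sum>a\<in>UNIV. wt x a * fr x a A * fr x a B))"
    by (subst sum.swap, rule sum.cong[OF refl], subst sum.swap) (simp add: sum_distrib_left)
  also have "\<dots> = (\<Sum>A\<in>UNIV. \<Sum>B\<in>UNIV. (if A = B then U A * V B * eta A else 0) - (U A * emb x $ A) * (V B * emb x $ B))"
    unfolding fr_complete[OF assms] by (intro sum.cong refl) (simp add: algebra_simps)
  also have "\<dots> = (\<Sum>A\<in>UNIV. eta A * (U A * V A)) - (\<Sum>A\<in>UNIV. U A * emb x $ A) * (\<Sum>B\<in>UNIV. V B * emb x $ B)"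
    by (simp add: sum_subtractf sum_product mult_ac)
  finally show ?thesis .
qed

section \<open>Covariant derivatives of pullbacks from Minkowski space\<close>

definition pull0 :: "(real^4 \<Rightarrow> real) \<Rightarrow> tensor" where "pull0 T x is = T (emb x)"
definition pull1 :: "(4 \<Rightarrow> real^4 \<Rightarrow> real) \<Rightarrow> tensor" where
  "pull1 T x is = (\<Sum>A\<in>UNIV. T A (emb x) * fr x (is ! 0) A)"
definition pull2 :: "(4 \<Rightarrow> 4 \<Rightarrow> real^4 \<Rightarrow> real) \<Rightarrow> tensor" where
  "pull2 T x is = (\<Sum>A\<in>UNIV. \<Sum>B\<in>UNIV. T A B (emb x) * fr x (is ! 0) A * fr x (is ! 1) B)"
definition pull3 :: "(4 \<Rightarrow> 4 \<Rightarrow> 4 \<Rightarrow> real^4 \<Rightarrow> real) \<Rightarrow> tensor" where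
  "pull3 T x is = (\<Sum>A\<in>UNIV. \<Sum>B\<in>UNIV. \<Sum>C\<in>UNIV.
     T A B C (emb x) * fr x (is ! 0) A * fr x (is ! 1) B * fr x (is ! 2) C)"
definition pull4 :: "(4 \<Rightarrow> 4 \<Rightarrow> 4 \<Rightarrow> 4 \<Rightarrow> real^4 \<Rightarrow> real) \<Rightarrow> tensor" where
  "pull4 T x is = (\<Sum>A\<in>UNIV. \<Sum>B\<in>UNIV. \<Sum>C\<in>UNIV. \<Sum>D\<in>UNIV.
     T A B C D (emb x) * fr x (is ! 0) A * fr x (is ! 1) B * fr x (is ! 2) C * fr x (is ! 3) D)"

lemma has_grad_emb_comp:
  "has_grad f F (emb x) \<Longrightarrow> has_grad (\<lambda>y. f (emb y)) (\<lambda>c. \<Sum>C\<in>UNIV. F C * fr x c C) x"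
  by (rule has_grad_chain[OF has_grad_emb])

lemma cov_pull0:
  assumes "has_grad f (\<lambda>A. f' A (emb x)) (emb x)"
  shows "cov gS (pull0 f) x [a] = pull1 f' x [a]"
proof -
  have "has_grad (\<lambda>y. pull0 f y []) (\<lambda>c. \<Sum>C\<in>UNIV. f' C (emb x) * fr x c C) x"
    unfolding pull0_def by (rule has_grad_emb_comp[OF assms])
  from pd_eqI[OF this] show ?thesis by (simp add: cov_def pull1_def)
qed

text \<open>The tangential part of the Gauss formula cancels the Christoffel terms. What remains is
  the projected partial derivative and, for each index, the metric times the normal contraction in
  that index. \<open>cov_pull2\<close> and \<open>cov_pull3\<close> repeat this for higher
  rank.\<close>

lemma cov_pull1:
  assumes s: "sin (x $ 2) \<noteq> 0" and T: "\<And>A. has_grad (T A) (\<lambda>C. T' A C (emb x)) (emb x)"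
  shows "cov gS (pull1 T) x [a, b] = pull2 T' x [a, b] - gd x b a * (\<Sum>A\<in>UNIV. T A (emb x) * emb x $ A)"
proof -
  have "has_grad (\<lambda>y. pull1 T y [a]) (\<lambda>c. \<Sum>A\<in>UNIV. (\<Sum>C\<in>UNIV. T' A C (emb x) * fr x c C) * fr x a A
      + T A (emb x) * ((\<Sum>d\<in>UNIV. gam x d c a * fr x d A) - gd x c a * emb x $ A)) x"
    unfolding pull1_def by (simp, intro has_grad_sum has_grad_mult has_grad_emb_comp T has_grad_fr s)
  note p = pd_eqI[OF this]
  show ?thesis
    apply (simp add: cov_def Let_def p christoffel_gS[OF s] sum_3)
    apply (simp add: pull1_def pull2_def sum.distrib sum_subtractf
        sum_distrib_left sum_distrib_right algebra_simps)
    done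
qed

lemma cov_pull2:
  assumes s: "sin (x $ 2) \<noteq> 0" and T: "\<And>A B. has_grad (T A B) (\<lambda>C. T' A B C (emb x)) (emb x)"
  shows "cov gS (pull2 T) x [a, b, c] = pull3 T' x [a, b, c]
    - gd x c a * (\<Sum>A\<in>UNIV. \<Sum>B\<in>UNIV. T A B (emb x) * emb x $ A * fr x b B)
    - gd x c b * (\<Sum>A\<in>UNIV. \<Sum>B\<in>UNIV. T A B (emb x) * fr x a A * emb x $ B)"
proof -
  have "has_grad (\<lambda>y. pull2 T y [a, b]) (\<lambda>c. \<Sum>A\<in>UNIV. \<Sum>B\<in>UNIV.
      ((\<Sum>C\<in>UNIV. T' A B C (emb x) * fr x c C) * fr x a A
        + T A B (emb x) * ((\<Sum>d\<in>UNIV. gam x d c a * fr x d A) - gd x c a * emb x $ A)) * fr x b B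
      + T A B (emb x) * fr x a A * ((\<Sum>d\<in>UNIV. gam x d c b * fr x d B) - gd x c b * emb x $ B)) x"
    unfolding pull2_def by (simp, intro has_grad_sum has_grad_mult has_grad_emb_comp T has_grad_fr s)
  note p = pd_eqI[OF this]
  show ?thesis
    apply (simp add: cov_def Let_def p christoffel_gS[OF s] sum_3 lessThan_Suc numeral_2_eq_2)
    apply (simp add: pull2_def pull3_def sum.distrib sum_subtractf
        sum_distrib_left sum_distrib_right algebra_simps)
    done
qed

lemma cov_pull3:
  assumes s: "sin (x $ 2) \<noteq> 0" and T: "\<And>A B C. has_grad (T A B C) (\<lambda>D. T' A B C D (emb x)) (emb x)"
  shows "cov gS (pull3 T) x [a, b, c, d] = pull4 T' x [a, b, c, d]
    - gd x d a * (\<Sum>A\<in>UNIV. \<Sum>B\<in>UNIV. \<Sum>C\<in>UNIV. T A B C (emb x) * emb x $ A * fr x b B * fr x c C)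
    - gd x d b * (\<Sum>A\<in>UNIV. \<Sum>B\<in>UNIV. \<Sum>C\<in>UNIV. T A B C (emb x) * fr x a A * emb x $ B * fr x c C)
    - gd x d c * (\<Sum>A\<in>UNIV. \<Sum>B\<in>UNIV. \<Sum>C\<in>UNIV. T A B C (emb x) * fr x a A * fr x b B * emb x $ C)"
proof -
  have "has_grad (\<lambda>y. pull3 T y [a, b, c]) (\<lambda>i. \<Sum>A\<in>UNIV. \<Sum>B\<in>UNIV. \<Sum>C\<in>UNIV.
      (((\<Sum>D\<in>UNIV. T' A B C D (emb x) * fr x i D) * fr x a A
        + T A B C (emb x) * ((\<Sum>d\<in>UNIV. gam x d i a * fr x d A) - gd x i a * emb x $ A)) * fr x b B
      + T A B C (emb x) * fr x a A * ((\<Sum>d\<in>UNIV. gam x d i b * fr x d B) - gd x i b * emb x $ B)) * fr x c C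
      + T A B C (emb x) * fr x a A * fr x b B * ((\<Sum>d\<in>UNIV. gam x d i c * fr x d C) - gd x i c * emb x $ C)) x"
    unfolding pull3_def by (simp, intro has_grad_sum has_grad_mult has_grad_emb_comp T has_grad_fr s)
  note p = pd_eqI[OF this]
  show ?thesis
    apply (simp add: cov_def Let_def p christoffel_gS[OF s] sum_3 lessThan_Suc numeral_3_eq_3 numeral_2_eq_2)
    apply (simp add: pull3_def pull4_def sum.distrib sum_subtractf
        sum_distrib_left sum_distrib_right algebra_simps)
    done
qed

text \<open>The derivative sees a neighbourhood, so agreement is required on an open set. It is
  required for one index length only, because a \<open>tensor\<close> is defined on lists of every
  length and identities hold for a single rank.\<close>

lemma cov_cong:
  assumes "open U" "x \<in> U" "length js = k" and eq: "\<And>y js. y \<in> U \<Longrightarrow> length js = k \<Longrightarrow> T y js = T' y js"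
  shows "cov g T x (js @ [c]) = cov g T' x (js @ [c])"
proof -
  have "pd c (\<lambda>y. T y js) x = pd c (\<lambda>y. T' y js) x"
  proof -
    have "((\<lambda>y. T y js) has_derivative D) (at x) \<longleftrightarrow> ((\<lambda>y. T' y js) has_derivative D) (at x)" for D
      using has_derivative_transform_within_open[OF _ assms(1,2)] eq assms(3) by metis
    then show ?thesis unfolding pd_def frechet_derivative_def by presburger
  qed
  then show ?thesis
    using eq[OF \<open>x \<in> U\<close>] assms(3) by (simp add: cov_def)
qed

section \<open>Algebra of the superpotential\<close>

lemma antisym_sum_zero:
  fixes f :: "'n::finite \<Rightarrow> 'n \<Rightarrow> real"
  assumes "\<And>B C. f B C = - f C B"
  shows "(\<Sum>B\<in>UNIV. \<Sum>C\<in>UNIV. f B C) = 0"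
proof -
  have "(\<Sum>B\<in>UNIV. \<Sum>C\<in>UNIV. f B C) = (\<Sum>C\<in>UNIV. \<Sum>B\<in>UNIV. f B C)" by (rule sum.swap)
  also have "\<dots> = - (\<Sum>C\<in>UNIV. \<Sum>B\<in>UNIV. f C B)"
    unfolding sum_negf[symmetric] by (intro sum.cong refl assms)
  finally show ?thesis by simp
qed

text \<open>The arguments \<open>k1 A B C\<close> and \<open>k2 A B C D\<close> stand for \<open>\<partial>\<^sub>C k\<^sub>A\<^sub>B\<close> and \<open>\<partial>\<^sub>D \<partial>\<^sub>C k\<^sub>A\<^sub>B\<close>, and
  \<open>Om A B\<close> for \<open>\<partial>\<^sub>A \<xi>\<^sub>B\<close>; all indices are down. \<open>lin_ein\<close> is \<open>-2\<close> times the linearized Einstein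
  tensor, \<open>spot\<close> its superpotential, and \<open>spot1\<close> the derivative of \<open>spot\<close> (with \<open>\<partial> Om = 0\<close>).\<close>

definition dv :: "(4 \<Rightarrow> 4 \<Rightarrow> 4 \<Rightarrow> real) \<Rightarrow> 4 \<Rightarrow> real" where
  "dv k1 A = (\<Sum>C\<in>UNIV. eta C * k1 A C C)"
definition dv1 :: "(4 \<Rightarrow> 4 \<Rightarrow> 4 \<Rightarrow> 4 \<Rightarrow> real) \<Rightarrow> 4 \<Rightarrow> 4 \<Rightarrow> real" where
  "dv1 k2 A E = (\<Sum>C\<in>UNIV. eta C * k2 A C C E)"
definition tr0 :: "(4 \<Rightarrow> 4 \<Rightarrow> real) \<Rightarrow> real" where
  "tr0 k = (\<Sum>C\<in>UNIV. eta C * k C C)"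
definition tr1 :: "(4 \<Rightarrow> 4 \<Rightarrow> 4 \<Rightarrow> real) \<Rightarrow> 4 \<Rightarrow> real" where
  "tr1 k1 A = (\<Sum>C\<in>UNIV. eta C * k1 C C A)"
definition tr2 :: "(4 \<Rightarrow> 4 \<Rightarrow> 4 \<Rightarrow> 4 \<Rightarrow> real) \<Rightarrow> 4 \<Rightarrow> 4 \<Rightarrow> real" where
  "tr2 k2 A E = (\<Sum>C\<in>UNIV. eta C * k2 C C A E)"

definition lin_ein :: "(4 \<Rightarrow> 4 \<Rightarrow> 4 \<Rightarrow> 4 \<Rightarrow> real) \<Rightarrow> 4 \<Rightarrow> 4 \<Rightarrow> real" where
  "lin_ein k2 A C = (\<Sum>B\<in>UNIV. eta B * k2 A C B B) - dv1 k2 A C - dv1 k2 C A + tr2 k2 A C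
    + (if A = C then eta A * ((\<Sum>B\<in>UNIV. eta B * dv1 k2 B B) - (\<Sum>B\<in>UNIV. eta B * tr2 k2 B B)) else 0)"

definition spot :: "(4 \<Rightarrow> 4 \<Rightarrow> real) \<Rightarrow> (4 \<Rightarrow> 4 \<Rightarrow> 4 \<Rightarrow> real) \<Rightarrow> (4 \<Rightarrow> real) \<Rightarrow> (4 \<Rightarrow> 4 \<Rightarrow> real) \<Rightarrow> 4 \<Rightarrow> 4 \<Rightarrow> real"
  where "spot k k1 Xi Om A B =
    (\<Sum>C\<in>UNIV. eta C * (Xi C * (k1 A C B - k1 B C A))) + (Xi A * dv k1 B - Xi B * dv k1 A)
    + (Xi B * tr1 k1 A - Xi A * tr1 k1 B)
    + (\<Sum>C\<in>UNIV. eta C * (k A C * Om C B - k B C * Om C A)) - tr0 k * Om A B"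

definition spot1 :: "(4 \<Rightarrow> 4 \<Rightarrow> real) \<Rightarrow> (4 \<Rightarrow> 4 \<Rightarrow> 4 \<Rightarrow> real) \<Rightarrow> (4 \<Rightarrow> 4 \<Rightarrow> 4 \<Rightarrow> 4 \<Rightarrow> real)
    \<Rightarrow> (4 \<Rightarrow> real) \<Rightarrow> (4 \<Rightarrow> 4 \<Rightarrow> real) \<Rightarrow> 4 \<Rightarrow> 4 \<Rightarrow> 4 \<Rightarrow> real"
  where "spot1 k k1 k2 Xi Om A B E =
    (\<Sum>C\<in>UNIV. eta C * (Om E C * (k1 A C B - k1 B C A) + Xi C * (k2 A C B E - k2 B C A E)))
    + ((Om E A * dv k1 B + Xi A * dv1 k2 B E) - (Om E B * dv k1 A + Xi B * dv1 k2 A E))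
    + ((Om E B * tr1 k1 A + Xi B * tr2 k2 A E) - (Om E A * tr1 k1 B + Xi A * tr2 k2 B E))
    + (\<Sum>C\<in>UNIV. eta C * (k1 A C E * Om C B - k1 B C E * Om C A)) - tr1 k1 E * Om A B"

lemma spot_antisym: "(\<And>A B. Om A B = - Om B A) \<Longrightarrow> spot k k1 Xi Om A B = - spot k k1 Xi Om B A"
proof -
  assume Om: "\<And>A B. Om A B = - Om B A"
  have 1: "(\<Sum>C\<in>UNIV. eta C * (f C - g C)) = - (\<Sum>C\<in>UNIV. eta C * (g C - f C))" for f g :: "4 \<Rightarrow> real"
    by (simp add: right_diff_distrib sum_subtractf)
  have 2: "(\<Sum>C\<in>UNIV. eta C * (Xi C * (f C - g C))) = - (\<Sum>C\<in>UNIV. eta C * (Xi C * (g C - f C)))" for f g :: "4 \<Rightarrow> real"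
    by (simp add: right_diff_distrib sum_subtractf)
  show ?thesis
    unfolding spot_def 1[of "\<lambda>C. k A C * Om C B"] 2[of "\<lambda>C. k1 A C B"] Om[of A B]
    by (simp add: algebra_simps)
qed

text \<open>The terms with second derivatives of k assemble into \<open>lin_ein\<close>. The terms
  with \<open>Om\<close> drop out: \<open>s2\<close> pairs a symmetric with an antisymmetric array,
  and \<open>s12\<close>, \<open>s13\<close>, \<open>s14\<close> cancel \<open>s1\<close>,
  \<open>s5\<close>, \<open>s10\<close> by antisymmetry of \<open>Om\<close> and symmetry of
  k.\<close>

lemma spot_divergence:
  assumes Om: "\<And>A B. Om A B = - Om B A"
    and k1: "\<And>A B C. k1 A B C = k1 B A C" and k2: "\<And>A B C D. k2 A B C D = k2 B A C D"
    and k2': "\<And>A B C D. k2 A B C D = k2 A B D C"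
  shows "(\<Sum>B\<in>UNIV. eta B * spot1 k k1 k2 Xi Om A B B) = (\<Sum>C\<in>UNIV. eta C * (Xi C * lin_ein k2 A C))"
proof -
  have OmD: "Om B B = 0" for B using Om[of B B] by simp
  define s1 where "s1 = (\<Sum>B\<in>UNIV. \<Sum>C\<in>UNIV. eta B * (eta C * (Om B C * k1 A C B)))"
  define s2 where "s2 = (\<Sum>B\<in>UNIV. \<Sum>C\<in>UNIV. eta B * (eta C * (Om B C * k1 B C A)))"
  define s3 where "s3 = (\<Sum>B\<in>UNIV. \<Sum>C\<in>UNIV. eta B * (eta C * (Xi C * k2 A C B B)))"
  define s4 where "s4 = (\<Sum>B\<in>UNIV. \<Sum>C\<in>UNIV. eta B * (eta C * (Xi C * k2 B C A B)))"
  define s5 where "s5 = (\<Sum>B\<in>UNIV. eta B * (Om B A * dv k1 B))"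
  define s6 where "s6 = (\<Sum>B\<in>UNIV. eta B * dv1 k2 B B)"
  define s8 where "s8 = (\<Sum>B\<in>UNIV. eta B * (Xi B * dv1 k2 A B))"
  define s9 where "s9 = (\<Sum>B\<in>UNIV. eta B * (Xi B * tr2 k2 A B))"
  define s10 where "s10 = (\<Sum>B\<in>UNIV. eta B * (Om B A * tr1 k1 B))"
  define s11 where "s11 = (\<Sum>B\<in>UNIV. eta B * tr2 k2 B B)"
  define s12 where "s12 = (\<Sum>B\<in>UNIV. \<Sum>C\<in>UNIV. eta B * (eta C * (k1 A C B * Om C B)))"
  define s13 where "s13 = (\<Sum>B\<in>UNIV. \<Sum>C\<in>UNIV. eta B * (eta C * (k1 B C B * Om C A)))"
  define s14 where "s14 = (\<Sum>B\<in>UNIV. eta B * (tr1 k1 B * Om A B))"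
  have lhs: "(\<Sum>B\<in>UNIV. eta B * spot1 k k1 k2 Xi Om A B B) =
    (s1 - s2 + (s3 - s4)) + (s5 + Xi A * s6 - s8) + (s9 - (s10 + Xi A * s11)) + (s12 - s13) - s14"
    unfolding spot1_def s1_def s2_def s3_def s4_def s5_def s6_def s8_def s9_def s10_def s11_def s12_def s13_def s14_def
    by (simp add: OmD sum.distrib sum_subtractf sum_distrib_left algebra_simps)
  have e2: "s2 = 0"
    unfolding s2_def
  proof (rule antisym_sum_zero)
    fix B C
    show "eta B * (eta C * (Om B C * k1 B C A)) = - (eta C * (eta B * (Om C B * k1 C B A)))"
      using Om[of B C] k1[of B C A] by simp
  qed
  have e4: "s4 = (\<Sum>C\<in>UNIV. eta C * (Xi C * dv1 k2 C A))"
  proof -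
    have "k2 B C A B = k2 C B B A" for B C using k2 k2' by metis
    then show ?thesis
      unfolding s4_def dv1_def by (subst sum.swap) (simp add: sum_distrib_left mult_ac)
  qed
  have e12: "s12 = - s1"
  proof -
    have "eta B * (eta C * (k1 A C B * Om C B)) = - (eta B * (eta C * (Om B C * k1 A C B)))" for B C
      using Om[of B C] by simp
    then show ?thesis unfolding s1_def s12_def by (simp add: sum_negf)
  qed
  have e13: "s13 = s5"
  proof -
    have "s13 = (\<Sum>C\<in>UNIV. \<Sum>B\<in>UNIV. eta B * (eta C * (k1 C B B * Om C A)))"
      unfolding s13_def by (subst sum.swap) (simp add: k1[of _ _])
    then show ?thesis unfolding s5_def dv_def by (simp add: sum_distrib_left sum_distrib_right mult_ac)
  qed
  have e14: "s14 = - s10"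
  proof -
    have "eta B * (tr1 k1 B * Om A B) = - (eta B * (Om B A * tr1 k1 B))" for B
      using Om[of A B] by simp
    then show ?thesis unfolding s14_def s10_def by (simp add: sum_negf)
  qed
  have rhs: "(\<Sum>C\<in>UNIV. eta C * (Xi C * lin_ein k2 A C)) =
    s3 - s8 - s4 + s9 + Xi A * (s6 - s11)"
  proof -
    have "eta C * (Xi C * (if A = C then eta A * z else 0)) = (if C = A then Xi A * z else 0)" for C z
      by (simp add: eta_def)
    then have "(\<Sum>C\<in>UNIV. eta C * (Xi C * (if A = C then eta A * z else 0))) = Xi A * z" for z
      by simp
    then have "(\<Sum>C\<in>UNIV. eta C * (Xi C * lin_ein k2 A C)) =
      (\<Sum>C\<in>UNIV. \<Sum>B\<in>UNIV. eta C * (Xi C * (eta B * k2 A C B B))) - s8 - s4 + s9 + Xi A * (s6 - s11)"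
      unfolding lin_ein_def e4 s8_def s9_def s6_def s11_def
      by (simp add: distrib_left right_diff_distrib sum.distrib sum_subtractf sum_distrib_left)
    also have "(\<Sum>C\<in>UNIV. \<Sum>B\<in>UNIV. eta C * (Xi C * (eta B * k2 A C B B))) = s3"
      unfolding s3_def by (subst sum.swap) (simp add: mult_ac)
    finally show ?thesis .
  qed
  show ?thesis unfolding lhs rhs e2 e12 e13 e14 by (simp add: algebra_simps)
qed

text \<open>\<open>dual1 X f\<close> is the contraction of the Hodge dual of the 2-form \<open>f\<close> with the position vector.\<close>

definition dual1 :: "real^4 \<Rightarrow> (4 \<Rightarrow> 4 \<Rightarrow> real) \<Rightarrow> 4 \<Rightarrow> real" where
  "dual1 X f D = (if D = 1 then X$2 * f 3 4 - X$3 * f 2 4 + X$4 * f 2 3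
     else if D = 2 then - X$1 * f 3 4 - X$3 * f 1 4 + X$4 * f 1 3
     else if D = 3 then X$1 * f 2 4 + X$2 * f 1 4 - X$4 * f 1 2
     else - X$1 * f 2 3 - X$2 * f 1 3 + X$3 * f 1 2)"

definition wdg :: "(4 \<Rightarrow> real) \<Rightarrow> (4 \<Rightarrow> real) \<Rightarrow> 4 \<Rightarrow> 4 \<Rightarrow> real" where
  "wdg u v A B = u A * v B - u B * v A"

text \<open>The determinant of the four vectors, in Laplace expansion along the pairs (u, v) and (X,
  J).\<close>

definition vol4 :: "(4 \<Rightarrow> real) \<Rightarrow> (4 \<Rightarrow> real) \<Rightarrow> (4 \<Rightarrow> real) \<Rightarrow> (4 \<Rightarrow> real) \<Rightarrow> real" where
  "vol4 u v X J = wdg u v 1 2 * wdg X J 3 4 - wdg u v 1 3 * wdg X J 2 4 + wdg u v 1 4 * wdg X J 2 3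
    + wdg u v 2 3 * wdg X J 1 4 - wdg u v 2 4 * wdg X J 1 3 + wdg u v 3 4 * wdg X J 1 2"

text \<open>Cartan's formula. The Hodge dual of f is a 2-form with components of degree -2, hence
  has zero Lie derivative along the position vector field X. So the exterior derivative of its
  contraction with X is minus the contraction of its exterior derivative with X, and the latter is
  dual to the divergence of f. The left side is that exterior derivative evaluated on u and
  v.\<close>

lemma dual_closed:
  fixes f :: "4 \<Rightarrow> 4 \<Rightarrow> real" and f1 :: "4 \<Rightarrow> 4 \<Rightarrow> 4 \<Rightarrow> real"
  assumes f: "\<And>A B. f A B = - f B A" and f1: "\<And>A B E. f1 A B E = - f1 B A E"
    and eul: "\<And>A B. (\<Sum>E\<in>UNIV. X $ E * f1 A B E) = - 2 * f A B"
  shows "(\<Sum>D\<in>UNIV. \<Sum>E\<in>UNIV. (dual1 (axis E 1) f D + dual1 X (\<lambda>A B. f1 A B E) D) * (u E * v D - v E * u D))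
    = - vol4 u v (\<lambda>A. X $ A) (\<lambda>B. eta B * (\<Sum>C\<in>UNIV. eta C * f1 B C C))"
proof -
  define al where "al D E = dual1 (axis E 1) f D + dual1 X (\<lambda>A B. f1 A B E) D" for D E
  define J where "J B = eta B * (\<Sum>C\<in>UNIV. eta C * f1 B C C)" for B
  \<comment> \<open>Euler's relation for the pair A, B is used exactly once: in the component of the
    exterior derivative whose two indices are complementary to A, B.\<close>
  have e: "X$1 * f1 A B 1 = - 2 * f A B - X$2 * f1 A B 2 - X$3 * f1 A B 3 - X$4 * f1 A B 4" for A B
    using eul[of A B] by (simp add: sum_4)
  have d: "f1 A A E = 0" for A E using f1[of A A E] by simp
  have s: "f1 2 1 E = - f1 1 2 E" "f1 3 1 E = - f1 1 3 E" "f1 4 1 E = - f1 1 4 E"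
    "f1 3 2 E = - f1 2 3 E" "f1 4 2 E = - f1 2 4 E" "f1 4 3 E = - f1 3 4 E" for E
    using f1 by blast+
  note J = J_def sum_4 eta_def d s
  have d1: "al 2 1 - al 1 2 = - wdg (\<lambda>A. X $ A) J 3 4"
    using e[of 3 4] by (simp add: al_def dual1_def wdg_def J axis_def algebra_simps)
  have d2: "al 3 1 - al 1 3 = wdg (\<lambda>A. X $ A) J 2 4"
    using e[of 2 4] by (simp add: al_def dual1_def wdg_def J axis_def algebra_simps)
  have d3: "al 4 1 - al 1 4 = - wdg (\<lambda>A. X $ A) J 2 3"
    using e[of 2 3] by (simp add: al_def dual1_def wdg_def J axis_def algebra_simps)
  have d4: "al 3 2 - al 2 3 = - wdg (\<lambda>A. X $ A) J 1 4"
    using e[of 1 4] by (simp add: al_def dual1_def wdg_def J axis_def algebra_simps)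
  have d5: "al 4 2 - al 2 4 = wdg (\<lambda>A. X $ A) J 1 3"
    using e[of 1 3] by (simp add: al_def dual1_def wdg_def J axis_def algebra_simps)
  have d6: "al 4 3 - al 3 4 = - wdg (\<lambda>A. X $ A) J 1 2"
    using e[of 1 2] by (simp add: al_def dual1_def wdg_def J axis_def algebra_simps)
  have e0: "(\<Sum>D\<in>UNIV. \<Sum>E\<in>UNIV. al D E * (u E * v D - v E * u D)) =
    (al 2 1 - al 1 2) * wdg u v 1 2 + (al 3 1 - al 1 3) * wdg u v 1 3 + (al 4 1 - al 1 4) * wdg u v 1 4
    + (al 3 2 - al 2 3) * wdg u v 2 3 + (al 4 2 - al 2 4) * wdg u v 2 4 + (al 4 3 - al 3 4) * wdg u v 3 4"
    by (simp add: sum_4 wdg_def algebra_simps)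
  show ?thesis
    unfolding al_def[symmetric] J_def[symmetric] e0 d1 d2 d3 d4 d5 d6 vol4_def by (simp add: algebra_simps)
qed

text \<open>The first two vectors are the coordinate tangents of a graph \<tau> = T(\<theta>,
  \<phi>) with slopes a and b. The determinant is therefore the flux density of J, and the bracket
  is J evaluated on the normal with components (1, \<open>wt x 2 * a\<close>,
  \<open>wt x 3 * b\<close>).\<close>

lemma flux_form:
  fixes x :: "real^3" and J :: "4 \<Rightarrow> real"
  assumes s: "sin (x $ 2) \<noteq> 0"
  shows "vol4 (\<lambda>A. fr x 2 A + a * fr x 1 A) (\<lambda>A. fr x 3 A + b * fr x 1 A) (\<lambda>A. emb x $ A) (\<lambda>B. eta B * J B)
   = (cosh (x$1))\<^sup>2 * sin (x$2) * ((\<Sum>B\<in>UNIV. J B * fr x 1 B) + wt x 2 * a * (\<Sum>B\<in>UNIV. J B * fr x 2 B)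
      + wt x 3 * b * (\<Sum>B\<in>UNIV. J B * fr x 3 B))"
proof -
  have c: "cosh (x$1) \<noteq> 0" by (rule cosh_ne_0)
  have "(cosh (x$1))\<^sup>2 * sin (x$2) * ((\<Sum>B\<in>UNIV. J B * fr x 1 B) + wt x 2 * a * (\<Sum>B\<in>UNIV. J B * fr x 2 B)
      + wt x 3 * b * (\<Sum>B\<in>UNIV. J B * fr x 3 B)) =
    cosh (x$1) * cosh (x$1) * sin (x$2) * (\<Sum>B\<in>UNIV. J B * fr x 1 B) + sin (x$2) * a * (\<Sum>B\<in>UNIV. J B * fr x 2 B)
    + b * (cosh (x$1) * (J 3 * cos (x$3) - J 2 * sin (x$3)))"
    using c s by (simp add: wt_def power2_eq_square algebra_simps fr_def sum_4)
  also have "\<dots> = vol4 (\<lambda>A. fr x 2 A + a * fr x 1 A) (\<lambda>A. fr x 3 A + b * fr x 1 A) (\<lambda>A. emb x $ A) (\<lambda>B. eta B * J B)"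
    unfolding vol4_def wdg_def
    by (simp add: sum_4 eta_def fr_def emb_def algebra_simps trig_x)
  finally show ?thesis by simp
qed

section \<open>Pointwise tensor algebra on the hyperboloid\<close>

text \<open>In spherical coordinates the metric is diagonal, so at a fixed point raising an index is
  multiplication by the weight w and every contraction is a weighted sum.\<close>

locale diag_metric =
  fixes w g :: "3 \<Rightarrow> real"
  assumes wg: "w a * g a = 1"
begin

definition gm :: "3 \<Rightarrow> 3 \<Rightarrow> real" where "gm a b = (if a = b then g a else 0)"

lemma contract_gm: "(\<Sum>n\<in>UNIV. w n * (gm m n * f n)) = f m" "(\<Sum>n\<in>UNIV. w n * (gm n m * f n)) = f m"
proof -
  have "w n * (gm m n * f n) = (if n = m then f m else 0)" "w n * (gm n m * f n) = (if n = m then f m else 0)" for n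
    using wg[of m] by (auto simp: gm_def mult.assoc[symmetric])
  then show "(\<Sum>n\<in>UNIV. w n * (gm m n * f n)) = f m" "(\<Sum>n\<in>UNIV. w n * (gm n m * f n)) = f m"
    by simp_all
qed

lemma gm_sym: "gm a b = gm b a" by (simp add: gm_def)

lemma gm_trace: "(\<Sum>n\<in>UNIV. w n * gm n n) = 3"
  using wg by (simp add: gm_def)

end

text \<open>\<open>S\<close>, \<open>S3\<close>, \<open>S4\<close> are the projected partial derivatives of the homogeneous extension of \<open>\<sigma>\<close>, and
  \<open>s2\<close>, \<open>s3\<close>, \<open>s4\<close> the covariant derivatives \<open>\<sigma>\<^sub>a\<^sub>b\<close>, \<open>\<sigma>\<^sub>a\<^sub>b\<^sub>c\<close>, \<open>\<sigma>\<^sub>a\<^sub>b\<^sub>c\<^sub>d\<close>; thus \<open>S = - E\<^sup>(\<^sup>1\<^sup>)\<close>.\<close>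

locale mass_aspect_jet = diag_metric +
  fixes s :: real and s1 :: "3 \<Rightarrow> real" and S :: "3 \<Rightarrow> 3 \<Rightarrow> real" and S3 :: "3 \<Rightarrow> 3 \<Rightarrow> 3 \<Rightarrow> real"
    and S4 :: "3 \<Rightarrow> 3 \<Rightarrow> 3 \<Rightarrow> 3 \<Rightarrow> real"
  assumes S_sym: "S a b = S b a" and S3_sym: "S3 a b c = S3 b a c" "S3 a b c = S3 a c b"
    and S4_sym: "S4 a b c d = S4 a b d c"
    and S_tr: "(\<Sum>a\<in>UNIV. w a * S a a) = 0" and S3_tr: "(\<Sum>a\<in>UNIV. w a * S3 a a b) = 0"
    and S4_tr: "(\<Sum>a\<in>UNIV. w a * S4 a a b c) = - 2 * S b c"
begin

definition "s2 a b = S a b - s * gm a b"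
definition "s3 a b c = S3 a b c - s1 c * gm a b"
definition "s4 a b c d = S4 a b c d - S c d * gm a b + gm d a * S b c + gm d b * S a c + gm d c * (S a b + s * gm a b)"

text \<open>The following contractions of projected partial derivatives are the basis in which
  \<gamma> + \<Delta> and the linearized Einstein tensor are compared.\<close>

definition "PP = (\<Sum>c\<in>UNIV. w c * (s1 c * s1 c))"
definition "SS = (\<Sum>c\<in>UNIV. \<Sum>d\<in>UNIV. w c * (w d * (S c d * S c d)))"
definition "TT = (\<Sum>m\<in>UNIV. \<Sum>n\<in>UNIV. \<Sum>p\<in>UNIV. w m * (w n * (w p * (S3 m n p * S3 m n p))))"
definition "SQ a b = (\<Sum>p\<in>UNIV. w p * (S a p * S b p))"
definition "QQ a b = (\<Sum>p\<in>UNIV. \<Sum>q\<in>UNIV. w p * (w q * (S3 p q a * S3 p q b)))"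
definition "SF a b = (\<Sum>p\<in>UNIV. \<Sum>q\<in>UNIV. w p * (w q * (S p q * S4 p q a b)))"
definition "YY a b = (\<Sum>e\<in>UNIV. w e * (s1 e * S3 e a b))"

text \<open>Since \<open>S\<close> is trace-free, its cross term with the metric vanishes, and the
  metric squared gives the dimension 3. The same mechanism, with \<open>S3_tr\<close>, gives
  \<open>third_contr\<close> and \<open>QQ_contr\<close>.\<close>

lemma hess_contr: "(\<Sum>c\<in>UNIV. \<Sum>d\<in>UNIV. w c * (w d * (s2 c d * s2 c d))) = SS + 3 * s\<^sup>2"
proof -
  have 1: "(\<Sum>d\<in>UNIV. w d * (s2 c d * s2 c d)) = (\<Sum>d\<in>UNIV. w d * (S c d * S c d)) - 2 * s * S c c + s\<^sup>2 * gm c c" for c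
  proof -
    have "(\<Sum>d\<in>UNIV. w d * (s2 c d * s2 c d)) = (\<Sum>d\<in>UNIV. w d * (S c d * S c d))
      - 2 * s * (\<Sum>d\<in>UNIV. w d * (gm c d * S c d)) + s\<^sup>2 * (\<Sum>d\<in>UNIV. w d * (gm c d * gm c d))"
      by (simp add: s2_def algebra_simps power2_eq_square sum.distrib sum_subtractf sum_distrib_left)
    then show ?thesis by (simp add: contract_gm)
  qed
  have "(\<Sum>c\<in>UNIV. w c * (\<Sum>d\<in>UNIV. w d * (s2 c d * s2 c d))) =
    (\<Sum>c\<in>UNIV. w c * (\<Sum>d\<in>UNIV. w d * (S c d * S c d))) - 2 * s * (\<Sum>c\<in>UNIV. w c * S c c) + s\<^sup>2 * (\<Sum>c\<in>UNIV. w c * gm c c)"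
    unfolding 1 by (simp add: algebra_simps sum.distrib sum_subtractf sum_distrib_left)
  then show ?thesis by (simp add: S_tr gm_trace SS_def sum_distrib_left)
qed

lemma third_contr: "(\<Sum>m\<in>UNIV. \<Sum>n\<in>UNIV. \<Sum>p\<in>UNIV. w m * (w n * (w p * (s3 m n p * s3 m n p)))) = TT + 3 * PP"
proof -
  have 1: "(\<Sum>n\<in>UNIV. w n * (s3 m n p * s3 m n p)) = (\<Sum>n\<in>UNIV. w n * (S3 m n p * S3 m n p))
      - 2 * s1 p * S3 m m p + s1 p * s1 p * gm m m" for m p
  proof -
    have "(\<Sum>n\<in>UNIV. w n * (s3 m n p * s3 m n p)) = (\<Sum>n\<in>UNIV. w n * (S3 m n p * S3 m n p))
      - 2 * s1 p * (\<Sum>n\<in>UNIV. w n * (gm m n * S3 m n p)) + s1 p * s1 p * (\<Sum>n\<in>UNIV. w n * (gm m n * gm m n))"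
      by (simp add: s3_def algebra_simps sum.distrib sum_subtractf sum_distrib_left)
    then show ?thesis by (simp add: contract_gm)
  qed
  have 2: "(\<Sum>m\<in>UNIV. w m * (\<Sum>n\<in>UNIV. w n * (s3 m n p * s3 m n p))) =
      (\<Sum>m\<in>UNIV. w m * (\<Sum>n\<in>UNIV. w n * (S3 m n p * S3 m n p))) + 3 * (s1 p * s1 p)" for p
  proof -
    have "(\<Sum>m\<in>UNIV. w m * (\<Sum>n\<in>UNIV. w n * (s3 m n p * s3 m n p))) =
      (\<Sum>m\<in>UNIV. w m * (\<Sum>n\<in>UNIV. w n * (S3 m n p * S3 m n p)))
      - 2 * s1 p * (\<Sum>m\<in>UNIV. w m * S3 m m p) + s1 p * s1 p * (\<Sum>m\<in>UNIV. w m * gm m m)"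
      unfolding 1 by (simp add: algebra_simps sum.distrib sum_subtractf sum_distrib_left)
    then show ?thesis by (simp add: S3_tr gm_trace)
  qed
  have sw: "(\<Sum>m\<in>UNIV. \<Sum>n\<in>UNIV. \<Sum>p\<in>UNIV. w m * (w n * (w p * f m n p))) =
    (\<Sum>p\<in>UNIV. w p * (\<Sum>m\<in>UNIV. w m * (\<Sum>n\<in>UNIV. w n * f m n p)))" for f :: "3 \<Rightarrow> 3 \<Rightarrow> 3 \<Rightarrow> real"
    by (simp add: sum_3 algebra_simps)
  show ?thesis
    unfolding TT_def PP_def sw 2 by (simp add: sum.distrib sum_distrib_left algebra_simps)
qed

lemma SQ_contr: "(\<Sum>p\<in>UNIV. w p * (s2 a p * s2 b p)) = SQ a b - 2 * s * S a b + s\<^sup>2 * gm a b"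
proof -
  have "(\<Sum>p\<in>UNIV. w p * (s2 a p * s2 b p)) = SQ a b - s * (\<Sum>p\<in>UNIV. w p * (gm a p * S b p))
    - s * (\<Sum>p\<in>UNIV. w p * (gm b p * S a p)) + s\<^sup>2 * (\<Sum>p\<in>UNIV. w p * (gm a p * gm b p))"
    by (simp add: s2_def SQ_def algebra_simps power2_eq_square sum.distrib sum_subtractf sum_distrib_left)
  then show ?thesis by (simp add: contract_gm S_sym[of b a] gm_sym[of b a])
qed

lemma QQ_contr: "(\<Sum>p\<in>UNIV. \<Sum>q\<in>UNIV. w p * (w q * (s3 p q a * s3 p q b))) = QQ a b + 3 * (s1 a * s1 b)"
proof -
  have 1: "(\<Sum>q\<in>UNIV. w q * (s3 p q a * s3 p q b)) = (\<Sum>q\<in>UNIV. w q * (S3 p q a * S3 p q b))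
    - s1 b * S3 p p a - s1 a * S3 p p b + s1 a * s1 b * gm p p" for p
  proof -
    have "(\<Sum>q\<in>UNIV. w q * (s3 p q a * s3 p q b)) = (\<Sum>q\<in>UNIV. w q * (S3 p q a * S3 p q b))
      - s1 b * (\<Sum>q\<in>UNIV. w q * (gm p q * S3 p q a)) - s1 a * (\<Sum>q\<in>UNIV. w q * (gm p q * S3 p q b))
      + s1 a * s1 b * (\<Sum>q\<in>UNIV. w q * (gm p q * gm p q))"
      by (simp add: s3_def algebra_simps sum.distrib sum_subtractf sum_distrib_left)
    then show ?thesis by (simp add: contract_gm)
  qed
  have "(\<Sum>p\<in>UNIV. w p * (\<Sum>q\<in>UNIV. w q * (s3 p q a * s3 p q b))) =
    (\<Sum>p\<in>UNIV. w p * (\<Sum>q\<in>UNIV. w q * (S3 p q a * S3 p q b)))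
    - s1 b * (\<Sum>p\<in>UNIV. w p * S3 p p a) - s1 a * (\<Sum>p\<in>UNIV. w p * S3 p p b) + s1 a * s1 b * (\<Sum>p\<in>UNIV. w p * gm p p)"
    unfolding 1 by (simp add: algebra_simps sum.distrib sum_subtractf sum_distrib_left)
  then show ?thesis by (simp add: S3_tr gm_trace QQ_def sum_distrib_left)
qed

text \<open>The difference between \<open>s4\<close> and \<open>S4\<close> consists of metric terms.
  Contracted with \<open>S\<close> these produce \<open>SQ\<close> twice and \<open>SS\<close>;
  contracted with the metric part of \<open>s2\<close> only the trace of \<open>s4\<close> is
  left.\<close>

lemma SF_contr: "(\<Sum>p\<in>UNIV. \<Sum>q\<in>UNIV. w p * (w q * (s2 p q * s4 p q a b))) =
  SF a b + 2 * SQ a b + SS * gm a b + 3 * s * S a b - 3 * s\<^sup>2 * gm a b"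
proof -
  have 1: "(\<Sum>q\<in>UNIV. w q * (S p q * s4 p q a b)) = (\<Sum>q\<in>UNIV. w q * (S p q * S4 p q a b)) - S a b * S p p
     + gm b p * (\<Sum>q\<in>UNIV. w q * (S p q * S q a)) + S p b * S p a + gm b a * ((\<Sum>q\<in>UNIV. w q * (S p q * S p q)) + s * S p p)" for p
  proof -
    have "(\<Sum>q\<in>UNIV. w q * (S p q * s4 p q a b)) = (\<Sum>q\<in>UNIV. w q * (S p q * S4 p q a b))
      - S a b * (\<Sum>q\<in>UNIV. w q * (gm p q * S p q))
      + gm b p * (\<Sum>q\<in>UNIV. w q * (S p q * S q a)) + S p a * (\<Sum>q\<in>UNIV. w q * (gm b q * S p q))
      + gm b a * ((\<Sum>q\<in>UNIV. w q * (S p q * S p q)) + s * (\<Sum>q\<in>UNIV. w q * (gm p q * S p q)))"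
      by (simp add: s4_def algebra_simps sum.distrib sum_subtractf sum_distrib_left)
    then show ?thesis by (simp add: contract_gm)
  qed
  have SQ': "(\<Sum>p\<in>UNIV. w p * (S p b * S p a)) = SQ a b" "(\<Sum>q\<in>UNIV. w q * (S b q * S q a)) = SQ a b"
    unfolding SQ_def by (rule sum.cong[OF refl], metis S_sym mult.commute)+
  have 2: "(\<Sum>p\<in>UNIV. w p * (\<Sum>q\<in>UNIV. w q * (S p q * s4 p q a b))) = SF a b + 2 * SQ a b + SS * gm a b"
  proof -
    have "(\<Sum>p\<in>UNIV. w p * (\<Sum>q\<in>UNIV. w q * (S p q * s4 p q a b))) =
      (\<Sum>p\<in>UNIV. w p * (\<Sum>q\<in>UNIV. w q * (S p q * S4 p q a b))) - S a b * (\<Sum>p\<in>UNIV. w p * S p p)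
      + (\<Sum>p\<in>UNIV. w p * (gm b p * (\<Sum>q\<in>UNIV. w q * (S p q * S q a)))) + (\<Sum>p\<in>UNIV. w p * (S p b * S p a))
      + gm b a * ((\<Sum>p\<in>UNIV. w p * (\<Sum>q\<in>UNIV. w q * (S p q * S p q))) + s * (\<Sum>p\<in>UNIV. w p * S p p))"
      unfolding 1 by (simp only: distrib_left right_diff_distrib sum.distrib sum_subtractf sum_distrib_left mult.left_commute)
    then show ?thesis
      unfolding contract_gm SQ' S_tr gm_sym[of b a] SF_def SS_def
      by (simp add: sum_distrib_left sum_distrib_right mult_ac)
  qed
  have 3: "(\<Sum>q\<in>UNIV. w q * (gm p q * s4 p q a b)) = s4 p p a b" for p
    by (rule contract_gm)
  \<comment> \<open>The trace of \<open>s4\<close> in its first pair is the Hessian of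
    \<box>\<sigma> = -3 \<sigma>, that is -3 times \<open>s2\<close>.\<close>
  have 4: "(\<Sum>p\<in>UNIV. w p * s4 p p a b) = - 3 * S a b + 3 * s * gm a b"
  proof -
    have "(\<Sum>p\<in>UNIV. w p * s4 p p a b) = (\<Sum>p\<in>UNIV. w p * S4 p p a b) - S a b * (\<Sum>p\<in>UNIV. w p * gm p p)
       + (\<Sum>p\<in>UNIV. w p * (gm b p * S p a)) + (\<Sum>p\<in>UNIV. w p * (gm b p * S p a))
       + gm b a * ((\<Sum>p\<in>UNIV. w p * S p p) + s * (\<Sum>p\<in>UNIV. w p * gm p p))"
      by (simp add: s4_def algebra_simps sum.distrib sum_subtractf sum_distrib_left)
    then show ?thesis
      by (simp add: contract_gm S4_tr gm_trace S_tr S_sym[of b a] gm_sym[of b a])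
  qed
  have "(\<Sum>p\<in>UNIV. w p * (\<Sum>q\<in>UNIV. w q * (s2 p q * s4 p q a b))) =
    (\<Sum>p\<in>UNIV. w p * (\<Sum>q\<in>UNIV. w q * (S p q * s4 p q a b))) - s * (\<Sum>p\<in>UNIV. w p * (\<Sum>q\<in>UNIV. w q * (gm p q * s4 p q a b)))"
    by (simp add: s2_def algebra_simps sum_subtractf sum_distrib_left)
  then show ?thesis
    unfolding 2 3 4 by (simp add: sum_distrib_left algebra_simps power2_eq_square)
qed

lemma YY_contr: "(\<Sum>e\<in>UNIV. w e * (s1 e * s3 e a b)) = YY a b - s1 a * s1 b"
proof -
  have "(\<Sum>e\<in>UNIV. w e * (s1 e * s3 e a b)) = YY a b - s1 b * (\<Sum>e\<in>UNIV. w e * (gm e a * s1 e))"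
    by (simp add: s3_def YY_def algebra_simps sum_subtractf sum_distrib_left)
  then show ?thesis by (simp add: contract_gm)
qed

end

section \<open>Contractions with the frame\<close>

text \<open>Tangential components of a covector in the coordinate frame; \<open>px\<close> is its
  normal component, the contraction with the position vector. Euler's relation makes
  \<open>px\<close> of a gradient a multiple of the function.\<close>

definition pr :: "real^3 \<Rightarrow> (4 \<Rightarrow> real) \<Rightarrow> 3 \<Rightarrow> real" where "pr x U a = (\<Sum>A\<in>UNIV. U A * fr x a A)"
definition px :: "real^3 \<Rightarrow> (4 \<Rightarrow> real) \<Rightarrow> real" where "px x U = (\<Sum>A\<in>UNIV. U A * emb x $ A)"
definition pr2 :: "real^3 \<Rightarrow> (4 \<Rightarrow> 4 \<Rightarrow> real) \<Rightarrow> 3 \<Rightarrow> 3 \<Rightarrow> real" where "pr2 x M a b = pr x (\<lambda>A. pr x (M A) b) a"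

lemma pr_add: "pr x (\<lambda>A. U A + V A) a = pr x U a + pr x V a"
  by (simp add: pr_def algebra_simps sum.distrib)
lemma pr_diff: "pr x (\<lambda>A. U A - V A) a = pr x U a - pr x V a"
  by (simp add: pr_def algebra_simps sum_subtractf)
lemma pr_cmult: "pr x (\<lambda>A. c * U A) a = c * pr x U a"
  unfolding pr_def by (subst sum_distrib_left) (simp only: mult.assoc)
lemma pr_multc: "pr x (\<lambda>A. U A * c) a = pr x U a * c"
  using pr_cmult[of x c U a] by (simp add: mult.commute)
lemma pr_sum: "pr x (\<lambda>A. \<Sum>i\<in>I. U i A) a = (\<Sum>i\<in>I. pr x (U i) a)"
  unfolding pr_def by (subst sum.swap) (simp add: sum_distrib_right)
lemma pr_minus: "pr x (\<lambda>A. - U A) a = - pr x U a"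
  by (simp add: pr_def sum_negf)
lemma px_add: "px x (\<lambda>A. U A + V A) = px x U + px x V"
  by (simp add: px_def algebra_simps sum.distrib)
lemma px_cmult: "px x (\<lambda>A. c * U A) = c * px x U"
  unfolding px_def by (subst sum_distrib_left) (simp only: mult.assoc)
lemma px_multc: "px x (\<lambda>A. U A * c) = px x U * c"
  using px_cmult[of x c U] by (simp add: mult.commute)
lemma px_sum: "px x (\<lambda>A. \<Sum>i\<in>I. U i A) = (\<Sum>i\<in>I. px x (U i))"
  unfolding px_def by (subst sum.swap) (simp add: sum_distrib_right)
lemma px_minus: "px x (\<lambda>A. - U A) = - px x U"
  by (simp add: px_def sum_negf)

lemma pr_zero: "pr x (\<lambda>A. 0) a = 0" and px_zero: "px x (\<lambda>A. 0) = 0"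
  by (simp_all add: pr_def px_def)

lemma pr_swap: "pr x (\<lambda>A. pr x (\<lambda>B. M A B) b) a = pr x (\<lambda>B. pr x (\<lambda>A. M A B) a) b"
  unfolding pr_def by (simp add: sum_distrib_right) (subst sum.swap, simp add: mult_ac)
lemma pr_px_swap: "pr x (\<lambda>A. px x (\<lambda>B. M A B)) a = px x (\<lambda>B. pr x (\<lambda>A. M A B) a)"
  unfolding pr_def px_def by (simp add: sum_distrib_right) (subst sum.swap, simp add: mult_ac)

lemmas pr_simps = pr_add pr_diff pr_cmult pr_multc pr_minus

lemma contr_pr:
  assumes "sin (x $ 2) \<noteq> 0"
  shows "(\<Sum>A\<in>UNIV. eta A * (U A * V A)) = (\<Sum>a\<in>UNIV. wt x a * (pr x U a * pr x V a)) + px x U * px x V"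
  using contr[OF assms, of U V] by (simp add: pr_def px_def)

text \<open>Each of the two contracted indices is either tangential or normal, whence four
  terms.\<close>

lemma contr_pr2:
  assumes "sin (x $ 2) \<noteq> 0"
  shows "(\<Sum>P\<in>UNIV. \<Sum>B\<in>UNIV. eta P * (eta B * (U P B * V P B))) =
    (\<Sum>p\<in>UNIV. \<Sum>q\<in>UNIV. wt x p * (wt x q * (pr2 x U p q * pr2 x V p q)))
    + (\<Sum>q\<in>UNIV. wt x q * (px x (\<lambda>P. pr x (U P) q) * px x (\<lambda>P. pr x (V P) q)))
    + (\<Sum>p\<in>UNIV. wt x p * (pr x (\<lambda>P. px x (U P)) p * pr x (\<lambda>P. px x (V P)) p))
    + px x (\<lambda>P. px x (U P)) * px x (\<lambda>P. px x (V P))"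
proof -
  have "(\<Sum>P\<in>UNIV. \<Sum>B\<in>UNIV. eta P * (eta B * (U P B * V P B))) =
    (\<Sum>P\<in>UNIV. eta P * ((\<Sum>q\<in>UNIV. wt x q * (pr x (U P) q * pr x (V P) q)) + px x (U P) * px x (V P)))"
    using contr_pr[OF assms] by (simp add: sum_distrib_left[symmetric])
  also have "\<dots> = (\<Sum>q\<in>UNIV. wt x q * (\<Sum>P\<in>UNIV. eta P * (pr x (U P) q * pr x (V P) q)))
     + (\<Sum>P\<in>UNIV. eta P * (px x (U P) * px x (V P)))"
  proof -
    have "(\<Sum>P\<in>UNIV. \<Sum>q\<in>UNIV. eta P * (wt x q * (pr x (U P) q * pr x (V P) q))) =
      (\<Sum>q\<in>UNIV. \<Sum>P\<in>UNIV. wt x q * (eta P * (pr x (U P) q * pr x (V P) q)))"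
      by (subst sum.swap) (simp add: mult.left_commute)
    then show ?thesis
      by (simp only: distrib_left sum.distrib sum_distrib_left)
  qed
  also have "\<dots> = (\<Sum>q\<in>UNIV. wt x q * ((\<Sum>p\<in>UNIV. wt x p * (pr2 x U p q * pr2 x V p q))
      + px x (\<lambda>P. pr x (U P) q) * px x (\<lambda>P. pr x (V P) q)))
     + ((\<Sum>p\<in>UNIV. wt x p * (pr x (\<lambda>P. px x (U P)) p * pr x (\<lambda>P. px x (V P)) p))
    + px x (\<lambda>P. px x (U P)) * px x (\<lambda>P. px x (V P)))"
    unfolding contr_pr[OF assms, of "\<lambda>P. pr x (U P) q" for q] contr_pr[OF assms, of "\<lambda>P. px x (U P)"] pr2_def ..
  also have "(\<Sum>q\<in>UNIV. wt x q * ((\<Sum>p\<in>UNIV. wt x p * (pr2 x U p q * pr2 x V p q))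
      + px x (\<lambda>P. pr x (U P) q) * px x (\<lambda>P. pr x (V P) q))) =
    (\<Sum>q\<in>UNIV. \<Sum>p\<in>UNIV. wt x p * (wt x q * (pr2 x U p q * pr2 x V p q)))
    + (\<Sum>q\<in>UNIV. wt x q * (px x (\<lambda>P. pr x (U P) q) * px x (\<lambda>P. pr x (V P) q)))"
    by (simp add: distrib_left sum.distrib sum_distrib_left mult.left_commute)
  also have "(\<Sum>q\<in>UNIV. \<Sum>p\<in>UNIV. wt x p * (wt x q * (pr2 x U p q * pr2 x V p q))) =
    (\<Sum>p\<in>UNIV. \<Sum>q\<in>UNIV. wt x p * (wt x q * (pr2 x U p q * pr2 x V p q)))"
    by (rule sum.swap)
  finally show ?thesis by simp
qed

lemma contr_bil:
  assumes "sin (x $ 2) \<noteq> 0"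
  shows "(\<Sum>A\<in>UNIV. eta A * M A A) = (\<Sum>a\<in>UNIV. wt x a * pr2 x M a a) + px x (\<lambda>A. px x (M A))"
proof -
  have "(\<Sum>a\<in>UNIV. wt x a * pr2 x M a a) = (\<Sum>a\<in>UNIV. \<Sum>A\<in>UNIV. \<Sum>B\<in>UNIV. M A B * (wt x a * fr x a A * fr x a B))"
    unfolding pr2_def pr_def by (simp add: sum_distrib_left sum_distrib_right mult_ac)
  also have "\<dots> = (\<Sum>A\<in>UNIV. \<Sum>B\<in>UNIV. M A B * (\<Sum>a\<in>UNIV. wt x a * fr x a A * fr x a B))"
    by (subst sum.swap, rule sum.cong[OF refl], subst sum.swap) (simp add: sum_distrib_left)
  also have "\<dots> = (\<Sum>A\<in>UNIV. \<Sum>B\<in>UNIV. (if A = B then M A A * eta A else 0) - M A B * emb x $ B * emb x $ A)"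
    unfolding fr_complete[OF assms] by (intro sum.cong refl) (simp add: algebra_simps)
  also have "\<dots> = (\<Sum>A\<in>UNIV. eta A * M A A) - px x (\<lambda>A. px x (M A))"
    unfolding px_def by (simp add: sum_subtractf sum_distrib_left sum_distrib_right mult_ac)
  finally show ?thesis by simp
qed

lemma pr2_metric: "pr2 x (\<lambda>A B. if A = B then eta A * z else 0) a b = z * gd x a b"
proof -
  have "pr x (\<lambda>B. if A = B then eta A * z else 0) b = z * (eta A * fr x b A)" for A
    by (simp add: pr_def if_distrib[of "\<lambda>c. c * _"] cong: if_cong)
  then show ?thesis
    unfolding pr2_def pr_cmult fr_orth[symmetric]
    by (simp add: pr_def pr_cmult sum_distrib_left mult_ac)
qed

lemma pr_low: "pr x (\<lambda>A. eta A * emb x $ A) a = 0"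
  using emb_orth[of x a] by (simp add: pr_def)
lemma px_low: "px x (\<lambda>A. eta A * emb x $ A) = 1"
  using emb_unit[of x] by (simp add: px_def)

section \<open>The jet of the mass aspect at a point\<close>

text \<open>The values at one point of a homogeneous function of degree 1 and its derivatives up to
  order four. The k-th derivatives have degree 1 - k, which gives the constants in
  \<open>eul1\<close> to \<open>eul4\<close>; \<open>tr2\<close> to \<open>tr4\<close> are the flat
  wave equation and its derivatives.\<close>

locale jet4 =
  fixes x :: "real^3" and c0 :: real and c1 :: "4 \<Rightarrow> real" and c2 :: "4 \<Rightarrow> 4 \<Rightarrow> real"
    and c3 :: "4 \<Rightarrow> 4 \<Rightarrow> 4 \<Rightarrow> real" and c4 :: "4 \<Rightarrow> 4 \<Rightarrow> 4 \<Rightarrow> 4 \<Rightarrow> real"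
  assumes sin: "sin (x $ 2) \<noteq> 0"
    and sym2: "c2 A B = c2 B A"
    and sym3: "c3 A B C = c3 B A C" "c3 A B C = c3 A C B"
    and sym4: "c4 A B C D = c4 B A C D" "c4 A B C D = c4 A C B D" "c4 A B C D = c4 A B D C"
    and eul1: "px x c1 = c0" and eul2: "px x (c2 A) = 0" and eul3: "px x (c3 A B) = - c2 A B"
    and eul4: "px x (c4 A B C) = - 2 * c3 A B C"
    and tr2: "(\<Sum>A\<in>UNIV. eta A * c2 A A) = 0"
    and tr3: "(\<Sum>A\<in>UNIV. eta A * c3 A A B) = 0"
    and tr4: "(\<Sum>A\<in>UNIV. eta A * c4 A A B C) = 0"
begin

lemma eul2': "px x (\<lambda>B. c2 B A) = 0"
  using eul2[of A] by (simp add: sym2[of _ A])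

lemma eul3': "px x (\<lambda>B. c3 A B C) = - c2 A C" "px x (\<lambda>B. c3 B A C) = - c2 A C"
proof -
  have "c3 A B C = c3 A C B" "c3 B A C = c3 A C B" for B
    by (rule sym3(2), rule trans[OF sym3(1) sym3(2)])
  then show "px x (\<lambda>B. c3 A B C) = - c2 A C" "px x (\<lambda>B. c3 B A C) = - c2 A C"
    using eul3[of A C] by simp_all
qed

lemma eul4': "px x (\<lambda>D. c4 D A B C) = - 2 * c3 A B C"
proof -
  have "c4 D A B C = c4 A B C D" for D
    by (rule trans[OF sym4(1) trans[OF sym4(2) sym4(3)]])
  then show ?thesis using eul4 by simp
qed

lemma tr3': "(\<Sum>A\<in>UNIV. eta A * c3 A B A) = 0" "(\<Sum>A\<in>UNIV. eta A * c3 B A A) = 0"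
proof -
  have "c3 A B A = c3 A A B" "c3 B A A = c3 A A B" for A
    by (rule sym3(2), rule trans[OF sym3(1) sym3(2)])
  then show "(\<Sum>A\<in>UNIV. eta A * c3 A B A) = 0" "(\<Sum>A\<in>UNIV. eta A * c3 B A A) = 0"
    using tr3[of B] by simp_all
qed

lemma tr4': "(\<Sum>A\<in>UNIV. eta A * c4 A B A C) = 0" "(\<Sum>A\<in>UNIV. eta A * c4 B A A C) = 0"
  "(\<Sum>A\<in>UNIV. eta A * c4 B C A A) = 0"
proof -
  have 1: "c4 A B A C = c4 A A B C" for A by (rule sym4(2))
  moreover have 2: "c4 B A A C = c4 A A B C" for A by (rule trans[OF sym4(1) 1])
  moreover have "c4 B C A A = c4 A A B C" for A by (rule trans[OF sym4(2) trans[OF sym4(3) 2]])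
  ultimately show "(\<Sum>A\<in>UNIV. eta A * c4 A B A C) = 0" "(\<Sum>A\<in>UNIV. eta A * c4 B A A C) = 0"
    "(\<Sum>A\<in>UNIV. eta A * c4 B C A A) = 0"
    using tr4[of B C] by simp_all
qed

definition "S a b = pr2 x c2 a b"
definition "S3 a b c = pr x (\<lambda>A. pr2 x (c3 A) b c) a"
definition "S4 a b c d = pr x (\<lambda>A. pr x (\<lambda>B. pr2 x (c4 A B) c d) b) a"

lemma wt_gd: "wt x a * gd x a a = 1"
  using sin cosh_ne_0[of "x $ 1"] by (simp add: wt_def gd_def)

sublocale mass_aspect_jet "wt x" "\<lambda>a. gd x a a" c0 "pr x c1" S S3 S4
proof
  show "wt x a * gd x a a = 1" for a by (rule wt_gd)
  show "S a b = S b a" for a b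
    unfolding S_def pr2_def by (subst pr_swap) (simp add: sym2)
  show "S3 a b c = S3 b a c" for a b c
  proof -
    have "c3 A B = c3 B A" for A B using sym3(1) by blast
    then show ?thesis
      unfolding S3_def pr2_def by (subst pr_swap[of x "\<lambda>A B. pr x (c3 A B) c"]) simp
  qed
  show "S3 a b c = S3 a c b" for a b c
  proof -
    have "pr2 x (c3 A) b c = pr2 x (c3 A) c b" for A
      unfolding pr2_def by (subst pr_swap) (simp add: sym3(2)[symmetric])
    then show ?thesis by (simp add: S3_def)
  qed
  show "S4 a b c d = S4 a b d c" for a b c d
  proof -
    have "pr2 x (c4 A B) c d = pr2 x (c4 A B) d c" for A B
      unfolding pr2_def by (subst pr_swap) (simp add: sym4(3)[symmetric])
    then show ?thesis by (simp add: S4_def)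
  qed
  show "(\<Sum>a\<in>UNIV. wt x a * S a a) = 0"
    using contr_bil[OF sin, of c2] by (simp add: S_def tr2 eul2 px_zero)
  show "(\<Sum>a\<in>UNIV. wt x a * S3 a a b) = 0" for b
  proof -
    have "S3 a a b = pr2 x (\<lambda>A B. pr x (c3 A B) b) a a" for a
      unfolding S3_def pr2_def ..
    moreover have "(\<Sum>A\<in>UNIV. eta A * pr x (c3 A A) b) = 0"
      unfolding pr_cmult[symmetric] pr_sum[symmetric] tr3 by (simp add: pr_zero)
    moreover have "px x (\<lambda>A. px x (\<lambda>B. pr x (c3 A B) b)) = 0"
      unfolding pr_px_swap[symmetric] eul3' pr_minus px_minus by (simp add: eul2' pr_zero)
    ultimately show ?thesis
      using contr_bil[OF sin, of "\<lambda>A B. pr x (c3 A B) b"] by simp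
  qed
  \<comment> \<open>The Minkowski trace vanishes, so the tangential trace is minus the double normal
    contraction, for which Euler's relation yields the factor (-2)(-1) = 2.\<close>
  show "(\<Sum>a\<in>UNIV. wt x a * S4 a a b c) = - 2 * S b c" for b c
  proof -
    have "S4 a a b c = pr2 x (\<lambda>A B. pr2 x (c4 A B) b c) a a" for a
      unfolding S4_def pr2_def ..
    moreover have "(\<Sum>A\<in>UNIV. eta A * pr2 x (c4 A A) b c) = 0"
      unfolding pr2_def pr_cmult[symmetric] pr_sum[symmetric] tr4 by (simp add: pr_zero)
    moreover have "px x (\<lambda>A. px x (\<lambda>B. pr2 x (c4 A B) b c)) = 2 * S b c"
    proof -
      have "px x (\<lambda>B. pr2 x (c4 A B) b c) = - 2 * pr2 x (c3 A) b c" for A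
      proof -
        have "px x (\<lambda>B. c4 A B C D) = - 2 * c3 A C D" for C D
          using eul4'[of A C D] sym4(1)[of A] by simp
        then show ?thesis
          unfolding pr2_def pr_px_swap[symmetric] by (simp add: pr_cmult pr_minus)
      qed
      then have "px x (\<lambda>A. px x (\<lambda>B. pr2 x (c4 A B) b c)) = - 2 * px x (\<lambda>A. pr2 x (c3 A) b c)"
        by (simp add: px_cmult px_minus)
      also have "px x (\<lambda>A. pr2 x (c3 A) b c) = - S b c"
        unfolding pr2_def pr_px_swap[symmetric] eul3' S_def by (simp add: pr_minus)
      finally show ?thesis by simp
    qed
    ultimately show ?thesis
      using contr_bil[OF sin, of "\<lambda>A B. pr2 x (c4 A B) b c"] by simp
  qed
qed

lemma gm_gd: "gm a b = gd x a b"
  unfolding gm_def by (auto simp: gd_def)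

lemma S_swap: "pr x (\<lambda>P. pr x (\<lambda>A. c2 A P) a) q = S a q"
  unfolding S_def pr2_def by (rule pr_swap)

text \<open>From here on, the trailing h marks a contraction over all Minkowski indices. The lemmas
  \<open>Nh\<close> to \<open>Th\<close> express their projections through contractions on the
  hyperboloid; the corrections come from normal indices.\<close>

definition "Qh A C = (\<Sum>P\<in>UNIV. \<Sum>B\<in>UNIV. eta P * (eta B * (c3 A P B * c3 C P B)))"
definition "SFh A C = (\<Sum>P\<in>UNIV. \<Sum>B\<in>UNIV. eta P * (eta B * (c2 P B * c4 P B A C)))"
definition "SQh A C = (\<Sum>P\<in>UNIV. eta P * (c2 A P * c2 C P))"
definition "Yh A C = (\<Sum>P\<in>UNIV. eta P * (c1 P * c3 P A C))"
definition "Nh = (\<Sum>P\<in>UNIV. eta P * (c1 P * c1 P))"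
definition "SSh = (\<Sum>P\<in>UNIV. \<Sum>B\<in>UNIV. eta P * (eta B * (c2 P B * c2 P B)))"
definition "Th = (\<Sum>A\<in>UNIV. eta A * Qh A A)"

lemma Nh: "Nh = PP + c0\<^sup>2"
  unfolding Nh_def PP_def using contr_pr[OF sin, of c1 c1] by (simp add: eul1 power2_eq_square)

lemma SSh: "SSh = SS"
  unfolding SSh_def SS_def contr_pr2[OF sin]
  by (simp add: eul2 eul2' pr_px_swap[symmetric] S_def px_zero pr_zero)

lemma SQh: "pr2 x SQh a b = SQ a b"
proof -
  have 1: "pr x (\<lambda>C. SQh A C) b = (\<Sum>P\<in>UNIV. eta P * (c2 A P * pr x (\<lambda>C. c2 C P) b))" for A
    unfolding SQh_def by (simp add: pr_sum pr_cmult)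
  have "pr2 x SQh a b = (\<Sum>P\<in>UNIV. eta P * (pr x (\<lambda>A. c2 A P) a * pr x (\<lambda>C. c2 C P) b))"
    unfolding pr2_def 1 by (simp add: pr_sum pr_cmult pr_multc)
  also have "\<dots> = SQ a b"
    unfolding contr_pr[OF sin] SQ_def pr_px_swap[symmetric] eul2
    by (simp add: S_swap pr_zero)
  finally show ?thesis .
qed

lemma Yh: "pr2 x Yh a b = YY a b - c0 * S a b"
proof -
  have "pr2 x Yh a b = (\<Sum>P\<in>UNIV. eta P * (c1 P * pr2 x (c3 P) a b))"
    unfolding Yh_def pr2_def by (simp add: pr_sum pr_cmult)
  also have "\<dots> = YY a b - c0 * S a b"
  proof -
    have "px x (\<lambda>P. pr2 x (c3 P) a b) = - S a b"
      unfolding pr2_def pr_px_swap[symmetric] eul3' S_def by (simp add: pr_minus)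
    then show ?thesis
      unfolding contr_pr[OF sin] YY_def S3_def eul1 by simp
  qed
  finally show ?thesis .
qed

text \<open>If one contracted index is normal, each third derivative becomes minus a second
  derivative, giving \<open>SQ\<close> for each of the two choices; with both indices normal
  everything vanishes because \<open>c2\<close> has no normal component.\<close>

lemma Qh: "pr2 x Qh a b = QQ a b + 2 * SQ a b"
proof -
  define U where "U a P B = pr x (\<lambda>A. c3 A P B) a" for a P B
  have "pr2 x Qh a b = (\<Sum>P\<in>UNIV. \<Sum>B\<in>UNIV. eta P * (eta B * (U a P B * U b P B)))"
    unfolding Qh_def pr2_def U_def by (simp add: pr_sum pr_cmult pr_multc)
  moreover have "pr2 x (U a) p q = S3 p q a" for a p q
  proof -
    have "pr2 x (U a) p q = S3 a p q"
      unfolding U_def pr2_def S3_def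
      by (subst pr_swap, subst (2) pr_swap) simp
    then show ?thesis using S3_sym(1)[of a p q] S3_sym(2)[of p a q] by simp
  qed
  moreover have "px x (U a P) = - pr x (\<lambda>A. c2 A P) a" for a P
    unfolding U_def pr_px_swap[symmetric] eul3 by (simp add: pr_minus)
  moreover note S_swap
  moreover have "px x (\<lambda>P. pr x (U a P) q) = - S a q" for a q
  proof -
    have "px x (\<lambda>P. c3 A P B) = - c2 A B" for A B by (rule eul3')
    then show ?thesis
      unfolding U_def pr_px_swap[symmetric] S_def pr2_def
      by (simp add: pr_minus pr_swap[of x "\<lambda>B A. c2 A B" a q])
  qed
  moreover have "px x (\<lambda>P. pr x (\<lambda>A. c2 A P) a) = 0" for a
    unfolding pr_px_swap[symmetric] eul2 by (simp add: pr_zero)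
  ultimately show ?thesis
    unfolding contr_pr2[OF sin] QQ_def SQ_def by (simp add: pr_minus px_minus)
qed

lemma SFh: "pr2 x SFh a b = SF a b"
proof -
  have "pr2 x SFh a b = (\<Sum>P\<in>UNIV. \<Sum>B\<in>UNIV. eta P * (eta B * (c2 P B * pr2 x (c4 P B) a b)))"
    unfolding SFh_def pr2_def by (simp add: pr_sum pr_cmult)
  also have "\<dots> = SF a b"
    unfolding contr_pr2[OF sin] SF_def
    by (simp add: eul2 eul2' pr_px_swap[symmetric] S_def S4_def[unfolded pr2_def] pr2_def px_zero pr_zero)
  finally show ?thesis .
qed

text \<open>Any one of the three contracted indices may be normal, and each choice contributes
  \<open>SS\<close>; two normal indices give zero.\<close>

lemma Th: "Th = TT + 3 * SS"
proof -
  have "px x (\<lambda>A. px x (Qh A)) = SSh"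
    unfolding Qh_def SSh_def
    by (simp add: px_sum px_cmult px_multc px_minus eul3')
  moreover have "(\<Sum>a\<in>UNIV. wt x a * QQ a a) = TT"
    unfolding QQ_def TT_def by (simp add: sum_3 algebra_simps)
  moreover have "(\<Sum>a\<in>UNIV. wt x a * SQ a a) = SS"
    unfolding SQ_def SS_def by (simp add: sum_distrib_left)
  ultimately show ?thesis
    unfolding Th_def contr_bil[OF sin] Qh SSh by (simp add: distrib_left sum.distrib sum_distrib_left[symmetric] mult.left_commute)
qed

end

section \<open>The linearized Einstein operator on the quadratic ansatz\<close>

lemma eta_sq: "eta A * eta A = 1" "eta A * (eta A * z) = z"
  by (simp_all add: eta_def)

lemma sum_eta_swap:
  "(\<Sum>B\<in>UNIV. eta B * (\<Sum>P\<in>UNIV. eta P * F P B)) = (\<Sum>P\<in>UNIV. eta P * (\<Sum>B\<in>UNIV. eta B * F P B))"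
  unfolding sum_distrib_left by (subst sum.swap) (simp only: mult.left_commute)

lemma lin_ein_add: "lin_ein (\<lambda>A B C D. U A B C D + V A B C D) A C = lin_ein U A C + lin_ein V A C"
  by (simp add: lin_ein_def dv1_def tr2_def distrib_left sum.distrib) (simp add: algebra_simps)

lemma lin_ein_cmult: "lin_ein (\<lambda>A B C D. c * U A B C D) A C = c * lin_ein U A C"
proof -
  have 1: "(\<Sum>B\<in>UNIV. eta B * (c * f B)) = c * (\<Sum>B\<in>UNIV. eta B * f B)" for f
    unfolding sum_distrib_left by (simp only: mult.left_commute)
  show ?thesis
    unfolding lin_ein_def dv1_def tr2_def 1 by (simp add: algebra_simps)
qed

lemma pr2_add: "pr2 x (\<lambda>A B. U A B + V A B) a b = pr2 x U a b + pr2 x V a b"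
  and pr2_diff: "pr2 x (\<lambda>A B. U A B - V A B) a b = pr2 x U a b - pr2 x V a b"
  and pr2_cmult: "pr2 x (\<lambda>A B. c * U A B) a b = c * pr2 x U a b"
  and pr2_multc: "pr2 x (\<lambda>A B. U A B * c) a b = pr2 x U a b * c"
  and pr2_minus: "pr2 x (\<lambda>A B. - U A B) a b = - pr2 x U a b"
  and pr2_prod: "pr2 x (\<lambda>A B. f A * h B) a b = pr x f a * pr x h b"
  and pr2_prod': "pr2 x (\<lambda>A B. h B * f A) a b = pr x h b * pr x f a"
  by (simp_all add: pr2_def pr_simps)

context jet4 begin

lemma c3_rev: "c3 A B C = c3 C B A"
  by (rule trans[OF sym3(2) trans[OF sym3(1) sym3(2)]])

lemma c4_rot: "c4 A P C E = c4 P C A E"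
  by (rule trans[OF sym4(1) sym4(2)])

text \<open>By Leibniz, the second derivatives of \<Sigma>_A^P \<Sigma>_PB, first along C and then
  along D.\<close>

definition "kb2 A B C D = (\<Sum>P\<in>UNIV. eta P * ((c4 A P C D * c2 B P + c3 A P C * c3 B P D)
   + (c3 A P D * c3 B P C + c2 A P * c4 B P C D)))"

lemma SFh_trace: "(\<Sum>A\<in>UNIV. eta A * SFh A A) = 0"
proof -
  have "(\<Sum>A\<in>UNIV. eta A * SFh A A) = (\<Sum>P\<in>UNIV. \<Sum>B\<in>UNIV. \<Sum>A\<in>UNIV. eta P * (eta B * (c2 P B * (eta A * c4 P B A A))))"
    unfolding SFh_def sum_distrib_left
    by (subst sum.swap, rule sum.cong[OF refl], subst sum.swap) (simp only: mult_ac)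
  then show ?thesis by (simp add: sum_distrib_left[symmetric] tr4')
qed

lemma Yh_trace: "(\<Sum>A\<in>UNIV. eta A * Yh A A) = 0"
proof -
  have "(\<Sum>A\<in>UNIV. eta A * Yh A A) = (\<Sum>P\<in>UNIV. eta P * (c1 P * (\<Sum>A\<in>UNIV. eta A * c3 P A A)))"
    unfolding Yh_def sum_distrib_left by (subst sum.swap) (simp only: mult_ac)
  then show ?thesis by (simp add: tr3')
qed

lemma SQh_trace: "(\<Sum>A\<in>UNIV. eta A * SQh A A) = SSh"
  unfolding SQh_def SSh_def by (simp add: sum_distrib_left)

text \<open>By the wave equation the box leaves only 2 \<open>Qh\<close>. Each divergence is
  \<open>SFh + Qh\<close> and the Hessian of the trace is twice that, so these cancel and the fourth
  derivatives disappear. The scalar part is \<open>Th\<close> minus twice \<open>Th\<close>.\<close>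

lemma lin_ein_kb2: "lin_ein kb2 A C = 2 * Qh A C - (if A = C then eta A * Th else 0)"
proof -
  have Q': "Qh A C = (\<Sum>P\<in>UNIV. eta P * (\<Sum>B\<in>UNIV. eta B * (c3 A P B * c3 C P B)))" for A C
    unfolding Qh_def by (simp only: sum_distrib_left)
  have SF': "SFh A C = (\<Sum>P\<in>UNIV. eta P * (\<Sum>B\<in>UNIV. eta B * (c2 P B * c4 P B A C)))" for A C
    unfolding SFh_def by (simp only: sum_distrib_left)
  have box: "(\<Sum>B\<in>UNIV. eta B * kb2 A C B B) = 2 * Qh A C" for A C
  proof -
    have i: "(\<Sum>B\<in>UNIV. eta B * ((c4 A P B B * c2 C P + c3 A P B * c3 C P B) + (c3 A P B * c3 C P B + c2 A P * c4 C P B B))) =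
      (\<Sum>B\<in>UNIV. eta B * c4 A P B B) * c2 C P + 2 * (\<Sum>B\<in>UNIV. eta B * (c3 A P B * c3 C P B))
      + c2 A P * (\<Sum>B\<in>UNIV. eta B * c4 C P B B)" for P
      by (simp add: distrib_left sum.distrib sum_distrib_left sum_distrib_right mult_ac)
    show ?thesis
      unfolding kb2_def by (subst sum_eta_swap, unfold i tr4' Q') (simp add: sum_distrib_left mult.left_commute)
  qed
  have dv: "dv1 kb2 A E = SFh A E + Qh A E" for A E
  proof -
    have i: "(\<Sum>C\<in>UNIV. eta C * ((c4 A P C E * c2 C P + c3 A P C * c3 C P E) + (c3 A P E * c3 C P C + c2 A P * c4 C P C E))) =
      (\<Sum>C\<in>UNIV. eta C * (c2 P C * c4 P C A E)) + (\<Sum>C\<in>UNIV. eta C * (c3 A P C * c3 E P C))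
      + c3 A P E * (\<Sum>C\<in>UNIV. eta C * c3 C P C) + c2 A P * (\<Sum>C\<in>UNIV. eta C * c4 C P C E)" for P
      using c4_rot[of A P _ E] sym2[of _ P] c3_rev[of _ P E]
      by (simp add: distrib_left sum.distrib sum_distrib_left mult_ac)
    show ?thesis
      unfolding dv1_def kb2_def by (subst sum_eta_swap, unfold i Q' SF') (simp add: tr3' tr4' distrib_left sum.distrib)
  qed
  have tr: "tr2 kb2 A E = 2 * SFh A E + 2 * Qh A E" for A E
  proof -
    have i: "(\<Sum>C\<in>UNIV. eta C * ((c4 C P A E * c2 C P + c3 C P A * c3 C P E) + (c3 C P E * c3 C P A + c2 C P * c4 C P A E))) =
      2 * (\<Sum>C\<in>UNIV. eta C * (c2 P C * c4 P C A E)) + 2 * (\<Sum>C\<in>UNIV. eta C * (c3 A P C * c3 E P C))" for P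
      using sym4(1)[of _ P A E] sym2[of _ P] c3_rev[of _ P E] c3_rev[of _ P A]
      by (simp add: distrib_left sum.distrib sum_distrib_left mult_ac)
    show ?thesis
      unfolding tr2_def kb2_def
      by (subst sum_eta_swap, unfold i Q' SF') (simp add: distrib_left sum.distrib sum_distrib_left mult.left_commute)
  qed
  have Qs: "Qh A C = Qh C A" "SFh A C = SFh C A" for A C
    unfolding Qh_def SFh_def by (simp_all only: mult.commute sym4(3)[of _ _ A C])
  have t1: "(\<Sum>B\<in>UNIV. eta B * (SFh B B + Qh B B)) = Th"
    by (simp add: SFh_trace Th_def distrib_left sum.distrib)
  have t2: "(\<Sum>B\<in>UNIV. eta B * (2 * SFh B B + 2 * Qh B B)) = 2 * Th"
    unfolding t1[symmetric] sum_distrib_left by (rule sum.cong[OF refl]) (simp add: algebra_simps)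
  show ?thesis
    unfolding lin_ein_def box dv tr Qs[of C A] t1 t2 by simp
qed

text \<open>The array belongs to the Hessian of \<Sigma> times a function with derivatives
  \<open>f1\<close>, \<open>f2\<close>. Its trace vanishes, and the mixed terms z occur twice in the
  box and once in each divergence, hence cancel; only the Hessian of the factor is left.\<close>

lemma lin_ein_kc2:
  fixes f :: real and f1 :: "4 \<Rightarrow> real" and f2 :: "4 \<Rightarrow> 4 \<Rightarrow> real"
  shows "lin_ein (\<lambda>A B C D. (f2 C D * c2 A B + f1 C * c3 A B D) + (f1 D * c3 A B C + f * c4 A B C D)) A C =
    (\<Sum>B\<in>UNIV. eta B * f2 B B) * c2 A C - (\<Sum>P\<in>UNIV. eta P * (c2 A P * f2 P C)) - (\<Sum>P\<in>UNIV. eta P * (c2 C P * f2 P A))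
    + (if A = C then eta A * (\<Sum>P\<in>UNIV. \<Sum>B\<in>UNIV. eta P * (eta B * (c2 P B * f2 B P))) else 0)"
proof -
  define kk where "kk A B C D = (f2 C D * c2 A B + f1 C * c3 A B D) + (f1 D * c3 A B C + f * c4 A B C D)" for A B C D
  define z where "z A C = (\<Sum>P\<in>UNIV. eta P * (f1 P * c3 A C P))" for A C
  have box: "(\<Sum>B\<in>UNIV. eta B * kk A C B B) = (\<Sum>B\<in>UNIV. eta B * f2 B B) * c2 A C + 2 * z A C" for A C
  proof -
    have "(\<Sum>B\<in>UNIV. eta B * kk A C B B) = (\<Sum>B\<in>UNIV. eta B * f2 B B) * c2 A C + 2 * z A C
      + f * (\<Sum>B\<in>UNIV. eta B * c4 A C B B)"
      unfolding kk_def z_def by (simp add: distrib_left sum.distrib sum_distrib_left sum_distrib_right mult_ac)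
    then show ?thesis by (simp add: tr4')
  qed
  have dv: "dv1 kk A E = (\<Sum>P\<in>UNIV. eta P * (c2 A P * f2 P E)) + z A E" for A E
  proof -
    have "dv1 kk A E = (\<Sum>P\<in>UNIV. eta P * (c2 A P * f2 P E)) + (\<Sum>P\<in>UNIV. eta P * (f1 P * c3 A P E))
      + f1 E * (\<Sum>P\<in>UNIV. eta P * c3 A P P) + f * (\<Sum>P\<in>UNIV. eta P * c4 A P P E)"
      unfolding dv1_def kk_def by (simp add: distrib_left sum.distrib sum_distrib_left mult_ac)
    then show ?thesis unfolding z_def using sym3(2)[of A _ E] by (simp add: tr3' tr4')
  qed
  have tr: "tr2 kk A E = 0" for A E
  proof -
    have "tr2 kk A E = f2 A E * (\<Sum>P\<in>UNIV. eta P * c2 P P) + f1 A * (\<Sum>P\<in>UNIV. eta P * c3 P P E)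
      + f1 E * (\<Sum>P\<in>UNIV. eta P * c3 P P A) + f * (\<Sum>P\<in>UNIV. eta P * c4 P P A E)"
      unfolding tr2_def kk_def by (simp add: distrib_left sum.distrib sum_distrib_left mult_ac)
    then show ?thesis by (simp add: tr2 tr3 tr4)
  qed
  have zs: "z A C = z C A" for A C
    unfolding z_def using sym3(1)[of A C] by simp
  have zt: "(\<Sum>B\<in>UNIV. eta B * z B B) = 0"
  proof -
    have "(\<Sum>B\<in>UNIV. eta B * z B B) = (\<Sum>P\<in>UNIV. eta P * (f1 P * (\<Sum>B\<in>UNIV. eta B * c3 B B P)))"
      unfolding z_def by (subst sum_eta_swap) (simp only: sum_distrib_left mult.left_commute)
    then show ?thesis by (simp add: tr3)
  qed
  have "(\<Sum>B\<in>UNIV. eta B * ((\<Sum>P\<in>UNIV. eta P * (c2 B P * f2 P B)) + z B B)) =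
    (\<Sum>P\<in>UNIV. \<Sum>B\<in>UNIV. eta P * (eta B * (c2 P B * f2 B P)))"
    unfolding distrib_left sum.distrib zt by (simp add: sum_distrib_left)
  then show ?thesis
    unfolding kk_def[symmetric] lin_ein_def box dv tr zs[of C A] by simp
qed

text \<open>In four dimensions the trace of m times the metric is 4m: the Hessians add up to -1 - 1
  + 4 = 2 and the wave operators to 1 + 1 - 4 = -2.\<close>

lemma lin_ein_conformal:
  fixes m2 :: "4 \<Rightarrow> 4 \<Rightarrow> real"
  assumes m2: "\<And>A B. m2 A B = m2 B A"
  shows "lin_ein (\<lambda>A B C D. if A = B then eta A * m2 C D else 0) A C =
    2 * (m2 A C - (if A = C then eta A * (\<Sum>B\<in>UNIV. eta B * m2 B B) else 0))"
proof -
  define kk where "kk A B C D = (if A = B then eta A * m2 C D else 0)" for A B C D :: 4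
  define z where "z = (\<Sum>B\<in>UNIV. eta B * m2 B B)"
  have box: "(\<Sum>B\<in>UNIV. eta B * kk A C B B) = (if A = C then eta A * z else 0)" for A C
    by (simp add: kk_def z_def sum_distrib_left mult.left_commute)
  have dv: "dv1 kk A E = m2 A E" for A E
    by (simp add: dv1_def kk_def if_distrib[of "\<lambda>c. _ * c"] eta_sq cong: if_cong)
  have tr: "tr2 kk A E = 4 * m2 A E" for A E
    by (simp add: tr2_def kk_def eta_sq sum_4)
  have "(\<Sum>B\<in>UNIV. eta B * (4 * m2 B B)) = 4 * z"
    by (simp add: z_def sum_distrib_left mult.left_commute)
  then show ?thesis
    unfolding kk_def[symmetric] lin_ein_def box dv tr z_def[symmetric] m2[of C A]
    by (simp add: algebra_simps)
qed

text \<open>Here \<open>rr1\<close>, \<open>rr2\<close> are the first and second derivatives of the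
  inverse of X^2 at X^2 = 1, \<open>f1\<close>, \<open>f2\<close> those of this inverse times
  \<Sigma>, and \<open>N1\<close> is half the gradient of the Minkowski square of the gradient of
  \<Sigma>. \<open>m2\<close> is the Hessian of the factor m.\<close>

definition "rr1 A = - 2 * (eta A * emb x $ A)"
definition "rr2 A B = 8 * ((eta A * emb x $ A) * (eta B * emb x $ B)) + (if A = B then eta A * (- 2) else 0)"
definition "N1 A = (\<Sum>P\<in>UNIV. eta P * (c1 P * c2 P A))"
definition "f1 A = rr1 A * c0 + c1 A"
definition "f2 A B = rr2 A B * c0 + rr1 A * c1 B + (rr1 B * c1 A + c2 A B)"
definition "m2 A B = - (f1 A * f1 B + c0 * f2 A B) - 1/2 * (rr2 A B * Nh + 2 * rr1 A * N1 B + 2 * (rr1 B * N1 A) + 2 * (SQh A B + Yh A B))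
  - 3/2 * (SFh A B + Qh A B)"

lemma pr_rr1: "pr x rr1 a = 0" and px_rr1: "px x rr1 = - 2"
  unfolding rr1_def pr_cmult px_cmult pr_low px_low by simp_all

lemma pr2_rr2: "pr2 x rr2 a b = - 2 * gd x a b"
  unfolding rr2_def pr2_add pr2_cmult pr2_prod pr2_metric pr_low by simp

lemma px_rr2: "px x (rr2 A) = 6 * (eta A * emb x $ A)"
proof -
  have "px x (\<lambda>B. if A = B then eta A * (- 2) else 0) = - 2 * (eta A * emb x $ A)"
    by (simp add: px_def if_distrib[of "\<lambda>c. c * _"] cong: if_cong)
  then show ?thesis unfolding rr2_def px_add px_cmult px_low by simp
qed

lemma px_N1: "px x N1 = 0"
  unfolding N1_def px_sum px_cmult eul2 by simp

lemma pr_f1: "pr x f1 a = pr x c1 a" and px_f1: "px x f1 = - c0"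
  unfolding f1_def pr_add px_add pr_multc px_multc pr_rr1 px_rr1 eul1 by simp_all

lemma pr2_f2: "pr2 x f2 a b = - 2 * c0 * gd x a b + S a b"
  unfolding f2_def pr2_add pr2_multc pr2_prod pr2_prod' pr2_rr2 pr_rr1 S_def by simp

text \<open>The wave operator on \<Sigma> / X^2 reduces to twice the product of the gradients, since
  both factors are harmonic; Euler's relation evaluates it to -4 \<Sigma> on the
  hyperboloid.\<close>

lemma f2_trace: "(\<Sum>A\<in>UNIV. eta A * f2 A A) = - 4 * c0"
proof -
  have "px x (f2 A) = 4 * c0 * (eta A * emb x $ A) - 2 * c1 A" for A
    unfolding f2_def px_add px_multc px_cmult px_rr1 px_rr2 eul1 eul2 by (simp add: rr1_def)
  then have "px x (\<lambda>A. px x (f2 A)) = px x (\<lambda>A. 4 * c0 * (eta A * emb x $ A)) + px x (\<lambda>A. - (2 * c1 A))"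
    unfolding px_add[symmetric] by simp
  then have "px x (\<lambda>A. px x (f2 A)) = 2 * c0"
    unfolding px_minus px_cmult px_low eul1 by simp
  moreover have "(\<Sum>a\<in>UNIV. wt x a * pr2 x f2 a a) = - 2 * c0 * (\<Sum>a\<in>UNIV. wt x a * gm a a) + (\<Sum>a\<in>UNIV. wt x a * S a a)"
    unfolding pr2_f2 gm_gd by (simp add: algebra_simps sum.distrib sum_subtractf sum_negf sum_distrib_left)
  ultimately show ?thesis
    unfolding contr_bil[OF sin] by (simp add: gm_trace S_tr)
qed

text \<open>The inverse of X^2 solves the wave equation in four dimensions.\<close>

lemma rr2_trace: "(\<Sum>A\<in>UNIV. eta A * rr2 A A) = 0"
proof -
  have "(\<Sum>a\<in>UNIV. wt x a * pr2 x rr2 a a) = - 2 * (\<Sum>a\<in>UNIV. wt x a * gm a a)"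
    unfolding pr2_rr2 gm_gd by (simp add: sum_distrib_left mult.left_commute)
  then show ?thesis
    unfolding contr_bil[OF sin] px_rr2 px_cmult px_low by (simp add: gm_trace)
qed

lemma f2_sym: "f2 A B = f2 B A"
  by (simp add: f2_def rr2_def sym2[of A B] algebra_simps)

lemma m2_sym: "m2 A B = m2 B A"
proof -
  have "Qh A B = Qh B A" "SQh A B = SQh B A"
    unfolding Qh_def SQh_def by (simp_all only: mult.commute)
  moreover have "SFh A B = SFh B A"
    unfolding SFh_def by (simp only: sym4(3)[of _ _ A B])
  moreover have "Yh A B = Yh B A"
    unfolding Yh_def by (simp only: sym3(2)[of _ A B])
  moreover have "rr2 A B = rr2 B A"
    by (simp add: rr2_def)
  ultimately show ?thesis
    by (simp add: m2_def f2_sym[of A B] algebra_simps)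
qed

lemma m2_trace: "(\<Sum>A\<in>UNIV. eta A * m2 A A) = - (Nh - 4 * c0\<^sup>2) - SS - 3/2 * Th"
proof -
  have "(\<Sum>A\<in>UNIV. eta A * (f1 A * f1 A)) = Nh"
    unfolding contr_pr[OF sin] pr_f1 px_f1 Nh PP_def by (simp add: power2_eq_square)
  moreover have "(\<Sum>A\<in>UNIV. eta A * (rr1 A * N1 A)) = 0"
    unfolding contr_pr[OF sin] pr_rr1 px_N1 by simp
  moreover have "(\<Sum>A\<in>UNIV. eta A * m2 A A) =
    - ((\<Sum>A\<in>UNIV. eta A * (f1 A * f1 A)) + c0 * (\<Sum>A\<in>UNIV. eta A * f2 A A))
    - 1/2 * ((\<Sum>A\<in>UNIV. eta A * rr2 A A) * Nh + 4 * (\<Sum>A\<in>UNIV. eta A * (rr1 A * N1 A))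
       + 2 * ((\<Sum>A\<in>UNIV. eta A * SQh A A) + (\<Sum>A\<in>UNIV. eta A * Yh A A)))
    - 3/2 * ((\<Sum>A\<in>UNIV. eta A * SFh A A) + Th)"
    unfolding m2_def Th_def
    by (simp add: distrib_left right_diff_distrib sum.distrib sum_subtractf sum_negf sum_distrib_left sum_distrib_right mult_ac)
  ultimately show ?thesis
    by (simp add: f2_trace rr2_trace SQh_trace SSh Yh_trace SFh_trace power2_eq_square)
qed

lemma pr2_m2: "pr2 x m2 a b = - (pr x c1 a * pr x c1 b + c0 * (- 2 * c0 * gd x a b + S a b))
   + gd x a b * Nh - (SQ a b + YY a b - c0 * S a b) - 3/2 * (SF a b + QQ a b + 2 * SQ a b)"
proof -
  have "pr2 x (\<lambda>A B. 2 * rr1 A * N1 B) a b = 0"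
    unfolding pr2_prod pr_cmult pr_rr1 by simp
  moreover have "pr2 x (\<lambda>A B. rr1 B * N1 A) a b = 0"
    unfolding pr2_prod' pr_rr1 by simp
  ultimately show ?thesis
    unfolding m2_def pr2_add pr2_diff pr2_minus pr2_cmult pr2_multc pr2_prod pr2_rr2 pr2_f2 pr_f1 SQh Yh SFh Qh
    by (simp add: algebra_simps)
qed

text \<open>The jets of the last two terms of the ansatz: \<open>kc2\<close> of \<Sigma> \<Sigma>_AB
  / X^2, \<open>km2\<close> of the conformal term.\<close>

definition "kc2 A B C D = (f2 C D * c2 A B + f1 C * c3 A B D) + (f1 D * c3 A B C + c0 * c4 A B C D)"

definition "km2 A B C D = (if A = B then eta A * m2 C D else 0)"

lemma pr2_kc2: "pr2 x (lin_ein kc2) a b = - 2 * SQ a b + gd x a b * SS"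
proof -
  have 0: "kc2 = (\<lambda>A B C D. (f2 C D * c2 A B + f1 C * c3 A B D) + (f1 D * c3 A B C + c0 * c4 A B C D))"
    by (intro ext) (simp add: kc2_def)
  have 1: "(\<Sum>p\<in>UNIV. wt x p * (S a p * pr2 x f2 p b)) = - 2 * c0 * S a b + SQ a b" for a b
  proof -
    have "(\<Sum>p\<in>UNIV. wt x p * (S a p * pr2 x f2 p b)) =
      - 2 * c0 * (\<Sum>p\<in>UNIV. wt x p * (gm p b * S a p)) + (\<Sum>p\<in>UNIV. wt x p * (S a p * S b p))"
      unfolding pr2_f2 gm_gd S_sym[of _ b] by (simp add: algebra_simps sum.distrib sum_subtractf sum_negf sum_distrib_left)
    then show ?thesis by (simp add: contract_gm SQ_def)
  qed
  have 2: "pr2 x (\<lambda>A C. \<Sum>P\<in>UNIV. eta P * (c2 A P * f2 P C)) a b = - 2 * c0 * S a b + SQ a b" for a b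
  proof -
    have "pr2 x (\<lambda>A C. \<Sum>P\<in>UNIV. eta P * (c2 A P * f2 P C)) a b =
      (\<Sum>P\<in>UNIV. eta P * (pr x (\<lambda>A. c2 A P) a * pr x (f2 P) b))"
      unfolding pr2_def by (simp add: pr_sum pr_cmult pr_multc)
    also have "\<dots> = - 2 * c0 * S a b + SQ a b"
      unfolding contr_pr[OF sin] 1[symmetric] pr_px_swap[symmetric] eul2 by (simp add: S_swap pr_zero pr2_def)
    finally show ?thesis .
  qed
  have 3: "pr2 x (\<lambda>A C. \<Sum>P\<in>UNIV. eta P * (c2 C P * f2 P A)) a b = - 2 * c0 * S a b + SQ a b"
  proof -
    have "pr2 x (\<lambda>A C. \<Sum>P\<in>UNIV. eta P * (c2 C P * f2 P A)) a b = pr2 x (\<lambda>A C. \<Sum>P\<in>UNIV. eta P * (c2 A P * f2 P C)) b a"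
      unfolding pr2_def by (rule pr_swap)
    then show ?thesis unfolding 2 using S_sym[of a b] by (simp add: SQ_def mult.commute)
  qed
  have 4: "(\<Sum>P\<in>UNIV. \<Sum>B\<in>UNIV. eta P * (eta B * (c2 P B * f2 B P))) = SS"
  proof -
    have "(\<Sum>P\<in>UNIV. \<Sum>B\<in>UNIV. eta P * (eta B * (c2 P B * f2 B P))) = (\<Sum>P\<in>UNIV. \<Sum>B\<in>UNIV. eta P * (eta B * (c2 P B * f2 P B)))"
      by (simp only: f2_sym)
    also have "\<dots> = (\<Sum>p\<in>UNIV. \<Sum>q\<in>UNIV. wt x p * (wt x q * (S p q * pr2 x f2 q p)))"
      unfolding contr_pr2[OF sin] pr_px_swap[symmetric] eul2 eul2'
      by (simp add: pr_zero px_zero S_def[symmetric] pr2_f2 S_sym gd_sym)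
    also have "\<dots> = (\<Sum>p\<in>UNIV. wt x p * (- 2 * c0 * S p p + SQ p p))"
      unfolding 1[symmetric] by (simp add: sum_distrib_left)
    also have "\<dots> = - 2 * c0 * (\<Sum>p\<in>UNIV. wt x p * S p p) + (\<Sum>p\<in>UNIV. wt x p * SQ p p)"
      by (simp add: algebra_simps sum.distrib sum_subtractf sum_negf sum_distrib_left)
    also have "\<dots> = SS"
      unfolding S_tr SQ_def SS_def by (simp add: sum_distrib_left)
    finally show ?thesis .
  qed
  show ?thesis
    unfolding 0 lin_ein_kc2 pr2_add pr2_diff pr2_cmult 2 3 4 f2_trace pr2_metric
    by (simp add: S_def[symmetric])
qed

text \<open>This comparison fixes the ansatz. \<open>SF\<close> survives only in the Hessian of m,
  where it determines the 3/2. Then \<open>QQ\<close> reads 12 - 3 = 9, which is the reason for the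
  factor 6, and \<open>SQ\<close> reads 24 - 2 - 8 = 14 with factor 1 in front of
  \<open>kc2\<close>. \<open>YY\<close> fixes the gradient term of m, and the square of \<Sigma> /
  X^2 in m cancels \<sigma>_a \<sigma>_b from \<open>H2\<close>. All metric terms then agree: for
  instance \<open>SS\<close> adds up to -18 + 1 + 2 + 9 = -6.\<close>

lemma source_identity:
  assumes H2: "\<And>a b. pr2 x (lin_ein H2) a b = 2 * (pr x c1 a * pr x c1 b) + 6 * c0 * S a b - 4 * PP * gm a b"
  shows "pr2 x (lin_ein (\<lambda>A B C D. H2 A B C D + (6 * kb2 A B C D + (kc2 A B C D + km2 A B C D)))) a b =
    - (- 6 * c0 * S a b - 14 * SQ a b + 6 * SS * gm a b + 3 * TT * gm a b - 9 * QQ a b + 3 * SF a b + 2 * YY a b)"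
proof -
  have 0: "km2 = (\<lambda>A B C D. if A = B then eta A * m2 C D else 0)"
    by (intro ext) (simp add: km2_def)
  have 1: "lin_ein (\<lambda>A B C D. H2 A B C D + (6 * kb2 A B C D + (kc2 A B C D + km2 A B C D))) A C =
    lin_ein H2 A C + (6 * lin_ein kb2 A C + (lin_ein kc2 A C + lin_ein km2 A C))" for A C
    unfolding lin_ein_add lin_ein_cmult ..
  have "pr2 x (lin_ein (\<lambda>A B C D. H2 A B C D + (6 * kb2 A B C D + (kc2 A B C D + km2 A B C D)))) a b =
    pr2 x (lin_ein H2) a b + (6 * pr2 x (lin_ein kb2) a b + (pr2 x (lin_ein kc2) a b + pr2 x (lin_ein km2) a b))"
    unfolding pr2_add[symmetric] pr2_cmult[symmetric] 1[symmetric] ..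
  moreover have "pr2 x (lin_ein kb2) a b = 2 * (QQ a b + 2 * SQ a b) - Th * gd x a b"
    unfolding lin_ein_kb2 pr2_diff pr2_cmult Qh pr2_metric ..
  moreover have "pr2 x (lin_ein km2) a b = 2 * (pr2 x m2 a b - (- (Nh - 4 * c0\<^sup>2) - SS - 3/2 * Th) * gd x a b)"
    unfolding 0 lin_ein_conformal[OF m2_sym] pr2_cmult pr2_diff pr2_metric m2_trace ..
  ultimately show ?thesis
    unfolding H2 pr2_kc2 pr2_m2 gm_gd Th Nh by (simp add: algebra_simps power2_eq_square)
qed

end

section \<open>Fields on the cone over the hyperboloid\<close>

definition mink :: "real^4 \<Rightarrow> real" where "mink X = (\<Sum>A\<in>UNIV. eta A * (X $ A * X $ A))"
text \<open>An open set of Minkowski space containing the hyperboloid and stable under positive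
  dilations, so that ordinary partial derivatives and Euler's relation are both available.\<close>

definition cone :: "(real^4) set" where "cone = {X. mink X > 0}"
definition D4 :: "4 \<Rightarrow> (real^4 \<Rightarrow> real) \<Rightarrow> real^4 \<Rightarrow> real" where
  "D4 A f X = frechet_derivative f (at X) (axis A 1)"
abbreviation smc :: "(real^4 \<Rightarrow> real) \<Rightarrow> bool" where "smc \<equiv> smooth_on cone"

lemma open_cone: "open cone"
  unfolding cone_def mink_def by (intro open_Collect_less continuous_intros)

lemma emb_cone: "emb x \<in> cone"
  using emb_unit[of x] by (simp add: cone_def mink_def mult.assoc)

lemma D4_eq: "D4 A f = (\<lambda>X. frechet_derivative f (at X) (axis A 1))"
  by (simp add: D4_def fun_eq_iff)

lemma smc_D4: "smc f \<Longrightarrow> smc (D4 A f)"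
  unfolding D4_eq by (rule smooth_on_frechet)

lemma has_grad_D4: "smc f \<Longrightarrow> X \<in> cone \<Longrightarrow> has_grad f (\<lambda>A. D4 A f X) X"
  unfolding D4_def by (rule smooth_on_has_grad)

lemma D4_eqI: "smc f \<Longrightarrow> X \<in> cone \<Longrightarrow> has_grad f f' X \<Longrightarrow> D4 A f X = f' A"
  using has_grad_unique[OF has_grad_D4] by blast

lemma D4_commute: "smc f \<Longrightarrow> X \<in> cone \<Longrightarrow> D4 A (D4 B f) X = D4 B (D4 A f) X"
  unfolding D4_eq by (rule smooth_on_symmetric[OF open_cone])

lemma D4_cong:
  assumes "open V" "X \<in> V" "\<And>Y. Y \<in> V \<Longrightarrow> f Y = g Y"
  shows "D4 A f X = D4 A g X"
proof -
  have "(f has_derivative D) (at X) \<longleftrightarrow> (g has_derivative D) (at X)" for D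
    using has_derivative_transform_within_open[OF _ assms(1,2)] assms(3) by metis
  then show ?thesis unfolding D4_def frechet_derivative_def by presburger
qed

lemmas D4_cong_cone = D4_cong[OF open_cone]

lemma smc_mult: "smc f \<Longrightarrow> smc g \<Longrightarrow> smc (\<lambda>X. f X * g X)"
  and smc_add: "smc f \<Longrightarrow> smc g \<Longrightarrow> smc (\<lambda>X. f X + g X)"
  and smc_diff: "smc f \<Longrightarrow> smc g \<Longrightarrow> smc (\<lambda>X. f X - g X)"
  and smc_minus: "smc f \<Longrightarrow> smc (\<lambda>X. - f X)"
  and smc_sum: "(\<And>i. i \<in> I \<Longrightarrow> smc (F i)) \<Longrightarrow> smc (\<lambda>X. \<Sum>i\<in>I. F i X)"
  and smc_const: "smc (\<lambda>X. c)"
  and smc_nth: "smc (\<lambda>X. X $ A)"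
  by (rule smooth_on_mult smooth_on_add smooth_on_diff smooth_on_minus smooth_on_sum smooth_on_const
      smooth_on_bounded_linear open_cone bounded_linear_vec_nth; assumption?)+

lemmas smc_intros = smc_mult smc_add smc_diff smc_minus smc_sum smc_const smc_nth smc_D4

lemma D4_mult: "smc f \<Longrightarrow> smc g \<Longrightarrow> X \<in> cone \<Longrightarrow> D4 A (\<lambda>X. f X * g X) X = D4 A f X * g X + f X * D4 A g X"
  by (rule D4_eqI[OF smc_mult _ has_grad_mult]) (auto intro: has_grad_D4)

lemma D4_add: "smc f \<Longrightarrow> smc g \<Longrightarrow> X \<in> cone \<Longrightarrow> D4 A (\<lambda>X. f X + g X) X = D4 A f X + D4 A g X"
  by (rule D4_eqI[OF smc_add _ has_grad_add]) (auto intro: has_grad_D4)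

lemma D4_sum: "(\<And>i. i \<in> I \<Longrightarrow> smc (F i)) \<Longrightarrow> X \<in> cone \<Longrightarrow> D4 A (\<lambda>X. \<Sum>i\<in>I. F i X) X = (\<Sum>i\<in>I. D4 A (F i) X)"
  by (rule D4_eqI[OF smc_sum _ has_grad_sum]) (auto intro: has_grad_D4)

lemma D4_const: "D4 A (\<lambda>X. c) X = 0"
  by (simp add: D4_def frechet_derivative_const)

lemma D4_cmult: "smc f \<Longrightarrow> X \<in> cone \<Longrightarrow> D4 A (\<lambda>X. c * f X) X = c * D4 A f X"
  using D4_mult[OF smc_const, of f X A c] by (simp add: D4_const)

lemma D4_nth: "X \<in> cone \<Longrightarrow> D4 A (\<lambda>X. X $ B) X = (if A = B then 1 else 0)"
  by (rule D4_eqI[OF smc_nth _ has_grad_nth])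

lemma D42_mult:
  assumes "smc f" "smc g" "X \<in> cone"
  shows "D4 D (D4 C (\<lambda>X. f X * g X)) X = (D4 D (D4 C f) X * g X + D4 C f X * D4 D g X)
    + (D4 D f X * D4 C g X + f X * D4 D (D4 C g) X)"
proof -
  have "D4 D (D4 C (\<lambda>X. f X * g X)) X = D4 D (\<lambda>X. D4 C f X * g X + f X * D4 C g X) X"
    by (rule D4_cong_cone[OF assms(3)]) (rule D4_mult[OF assms(1,2)])
  also have "\<dots> = D4 D (\<lambda>X. D4 C f X * g X) X + D4 D (\<lambda>X. f X * D4 C g X) X"
    by (intro D4_add smc_intros assms)
  finally show ?thesis
    using D4_mult[OF smc_D4[OF assms(1)] assms(2,3)] D4_mult[OF assms(1) smc_D4[OF assms(2)] assms(3)] by simp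
qed

lemma D42_add:
  assumes "smc f" "smc g" "X \<in> cone"
  shows "D4 D (D4 C (\<lambda>X. f X + g X)) X = D4 D (D4 C f) X + D4 D (D4 C g) X"
proof -
  have "D4 D (D4 C (\<lambda>X. f X + g X)) X = D4 D (\<lambda>X. D4 C f X + D4 C g X) X"
    by (rule D4_cong_cone[OF assms(3)]) (rule D4_add[OF assms(1,2)])
  also have "\<dots> = D4 D (D4 C f) X + D4 D (D4 C g) X"
    by (intro D4_add smc_intros assms)
  finally show ?thesis .
qed

lemma D42_cmult:
  assumes "smc f" "X \<in> cone"
  shows "D4 D (D4 C (\<lambda>X. c * f X)) X = c * D4 D (D4 C f) X"
proof -
  have "D4 D (D4 C (\<lambda>X. c * f X)) X = D4 D (\<lambda>X. c * D4 C f X) X"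
    by (rule D4_cong_cone[OF assms(2)]) (rule D4_cmult[OF assms(1)])
  then show ?thesis using D4_cmult[OF smc_D4[OF assms(1)] assms(2)] by simp
qed

lemma D42_sum:
  assumes "\<And>i. i \<in> I \<Longrightarrow> smc (F i)" "X \<in> cone"
  shows "D4 D (D4 C (\<lambda>X. \<Sum>i\<in>I. F i X)) X = (\<Sum>i\<in>I. D4 D (D4 C (F i)) X)"
proof -
  have "D4 D (D4 C (\<lambda>X. \<Sum>i\<in>I. F i X)) X = D4 D (\<lambda>X. \<Sum>i\<in>I. D4 C (F i) X) X"
    by (rule D4_cong_cone[OF assms(2)]) (rule D4_sum[OF assms(1)])
  also have "\<dots> = (\<Sum>i\<in>I. D4 D (D4 C (F i)) X)"
    by (intro D4_sum smc_intros assms)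
  finally show ?thesis .
qed

text \<open>Homogeneity of degree w in its infinitesimal form, which is the only form the jets
  need.\<close>

definition euler :: "real \<Rightarrow> (real^4 \<Rightarrow> real) \<Rightarrow> bool" where
  "euler w f \<longleftrightarrow> (\<forall>X\<in>cone. (\<Sum>A\<in>UNIV. D4 A f X * X $ A) = w * f X)"

text \<open>Differentiate the relation and commute the derivatives; the derivative of the position
  vector accounts for the loss of one degree.\<close>

lemma euler_D4:
  assumes f: "smc f" and e: "euler w f"
  shows "euler (w - 1) (D4 B f)"
  unfolding euler_def
proof
  fix X assume X: "X \<in> cone"
  have "D4 B (\<lambda>X. \<Sum>A\<in>UNIV. D4 A f X * X $ A) X = D4 B (\<lambda>X. w * f X) X"
    by (rule D4_cong_cone[OF X]) (use e in \<open>simp add: euler_def\<close>)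
  moreover have "D4 B (\<lambda>X. \<Sum>A\<in>UNIV. D4 A f X * X $ A) X =
    (\<Sum>A\<in>UNIV. D4 B (D4 A f) X * X $ A) + D4 B f X"
  proof -
    have "D4 B (\<lambda>X. \<Sum>A\<in>UNIV. D4 A f X * X $ A) X = (\<Sum>A\<in>UNIV. D4 B (\<lambda>X. D4 A f X * X $ A) X)"
      by (intro D4_sum smc_intros f X)
    also have "\<dots> = (\<Sum>A\<in>UNIV. D4 B (D4 A f) X * X $ A + D4 A f X * (if B = A then 1 else 0))"
      by (simp only: D4_mult[OF smc_D4[OF f] smc_nth X] D4_nth[OF X])
    finally show ?thesis by (simp add: sum.distrib if_distrib[of "\<lambda>c. _ * c"] cong: if_cong)
  qed
  moreover have "D4 B (\<lambda>X. w * f X) X = w * D4 B f X"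
    by (rule D4_cmult[OF f X])
  ultimately show "(\<Sum>A\<in>UNIV. D4 A (D4 B f) X * X $ A) = (w - 1) * D4 B f X"
    using D4_commute[OF f X, of _ B] by (simp add: left_diff_distrib)
qed

lemma euler_mult: "smc f \<Longrightarrow> smc g \<Longrightarrow> euler v f \<Longrightarrow> euler w g \<Longrightarrow> euler (v + w) (\<lambda>X. f X * g X)"
  unfolding euler_def by (simp add: D4_mult algebra_simps sum.distrib sum_distrib_left[symmetric])

lemma euler_add: "smc f \<Longrightarrow> smc g \<Longrightarrow> euler w f \<Longrightarrow> euler w g \<Longrightarrow> euler w (\<lambda>X. f X + g X)"
  unfolding euler_def by (simp add: D4_add algebra_simps sum.distrib)

lemma euler_cmult: "smc f \<Longrightarrow> euler w f \<Longrightarrow> euler w (\<lambda>X. c * f X)"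
  unfolding euler_def by (simp add: D4_cmult algebra_simps sum_distrib_left[symmetric])

lemma euler_sum:
  assumes "\<And>i. i \<in> I \<Longrightarrow> smc (F i)" "\<And>i. i \<in> I \<Longrightarrow> euler w (F i)"
  shows "euler w (\<lambda>X. \<Sum>i\<in>I. F i X)"
  unfolding euler_def
proof
  fix X assume X: "X \<in> cone"
  have "(\<Sum>A\<in>UNIV. D4 A (\<lambda>X. \<Sum>i\<in>I. F i X) X * X $ A) = (\<Sum>i\<in>I. \<Sum>A\<in>UNIV. D4 A (F i) X * X $ A)"
  proof -
    have "D4 A (\<lambda>X. \<Sum>i\<in>I. F i X) X = (\<Sum>i\<in>I. D4 A (F i) X)" for A
      by (rule D4_sum[OF assms(1) X])
    then show ?thesis by (simp add: sum_distrib_right) (rule sum.swap)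
  qed
  then show "(\<Sum>A\<in>UNIV. D4 A (\<lambda>X. \<Sum>i\<in>I. F i X) X * X $ A) = w * (\<Sum>i\<in>I. F i X)"
    using assms(2) X by (simp add: euler_def sum_distrib_left)
qed

lemma euler_diff: "smc f \<Longrightarrow> smc g \<Longrightarrow> euler w f \<Longrightarrow> euler w g \<Longrightarrow> euler w (\<lambda>X. f X - g X)"
  using euler_add[of f "\<lambda>X. - 1 * g X" w] euler_cmult[of g w "- 1"] smc_intros(1)[OF smc_intros(6), of g "- 1"] by simp

text \<open>A factor equal to 1 on the hyperboloid, used to adjust the degree of a product by
  -2.\<close>

definition rho :: "real^4 \<Rightarrow> real" where "rho X = inverse (mink X)"

lemma smc_mink: "smc mink"
  unfolding mink_def[abs_def] by (intro smc_intros)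

lemma smc_rho: "smc rho"
  unfolding rho_def[abs_def] by (rule smooth_on_inverse_comp[OF open_cone smc_mink]) (simp add: cone_def)

lemma D4_mink: "X \<in> cone \<Longrightarrow> D4 A mink X = 2 * (eta A * X $ A)"
  unfolding mink_def[abs_def]
  by (subst D4_sum, auto intro!: smc_intros, subst D4_cmult, auto intro!: smc_intros)
    (simp add: D4_mult[OF smc_nth smc_nth] D4_nth distrib_left sum.distrib if_distrib cong: if_cong)

lemma D4_rho: "X \<in> cone \<Longrightarrow> D4 A rho X = - 2 * (rho X * rho X) * (eta A * X $ A)"
proof -
  assume X: "X \<in> cone"
  have "(inverse has_real_derivative - (inverse (mink X) * 1 * inverse (mink X))) (at (mink X))"
    using X by (auto simp: cone_def intro!: derivative_eq_intros)
  from has_grad_DERIV[OF has_grad_D4[OF smc_mink X] this] show ?thesis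
    using D4_eqI[OF smc_rho X] by (simp add: rho_def[abs_def] D4_mink[OF X])
qed

lemma euler_rho: "euler (- 2) rho"
  unfolding euler_def
proof
  fix X assume X: "X \<in> cone"
  have "(\<Sum>A\<in>UNIV. D4 A rho X * X $ A) = - 2 * (rho X * rho X) * mink X"
    by (simp add: D4_rho[OF X] mink_def sum_distrib_left mult_ac)
  also have "\<dots> = - 2 * rho X" using X by (simp add: rho_def cone_def field_simps)
  finally show "(\<Sum>A\<in>UNIV. D4 A rho X * X $ A) = - 2 * rho X" .
qed

lemma rho_emb: "rho (emb x) = 1"
  using emb_unit[of x] by (simp add: rho_def mink_def mult.assoc)

lemma D42_rho: "X \<in> cone \<Longrightarrow> D4 B (D4 A rho) X =
   8 * (rho X * rho X * rho X) * ((eta A * X $ A) * (eta B * X $ B)) - 2 * (rho X * rho X) * (if A = B then eta A else 0)"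
proof -
  assume X: "X \<in> cone"
  have "D4 B (D4 A rho) X = D4 B (\<lambda>X. - 2 * ((rho X * rho X) * (eta A * X $ A))) X"
    by (rule D4_cong_cone[OF X]) (simp add: D4_rho)
  also have "\<dots> = - 2 * ((D4 B rho X * rho X + rho X * D4 B rho X) * (eta A * X $ A)
      + (rho X * rho X) * (eta A * (if B = A then 1 else 0)))"
    by (subst D4_cmult; (intro smc_intros smc_rho X)?; subst D4_mult; (intro smc_intros smc_rho X)?;
        subst D4_mult; (intro smc_intros smc_rho X)?; subst D4_cmult; (intro smc_intros smc_rho X)?; simp add: D4_nth[OF X])
  also have "\<dots> = 8 * (rho X * rho X * rho X) * ((eta A * X $ A) * (eta B * X $ B)) - 2 * (rho X * rho X) * (if A = B then eta A else 0)"
    by (simp add: D4_rho[OF X] algebra_simps)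
  finally show ?thesis .
qed

text \<open>The spherical coordinate patch: the poles and the half meridian \<phi> = 0 are left out,
  \<tau> is free.\<close>

definition sbox :: "(real^3) set" where "sbox = {x. 0 < x $ 2 \<and> x $ 2 < pi \<and> 0 < x $ 3 \<and> x $ 3 < 2 * pi}"

lemma open_sbox: "open sbox"
  unfolding sbox_def by (intro open_Collect_conj open_Collect_less continuous_intros)

lemma sbox_sin: "x \<in> sbox \<Longrightarrow> sin (x $ 2) > 0"
  by (simp add: sbox_def sin_gt_zero)

section \<open>The homogeneous extension of the mass aspect\<close>

text \<open>Smoothness and degree hold on the whole cone, the wave equation on a subset V containing
  the image of the patch. V is open so that the equation can be differentiated.\<close>

locale scalar_field =
  fixes Sg :: "real^4 \<Rightarrow> real" and V :: "(real^4) set"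
  assumes smc_Sg: "smc Sg" and euler_Sg: "euler 1 Sg"
    and open_V: "open V" and V_cone: "V \<subseteq> cone" and emb_V: "x \<in> sbox \<Longrightarrow> emb x \<in> V"
    and trace_Sg: "X \<in> V \<Longrightarrow> (\<Sum>A\<in>UNIV. eta A * D4 A (D4 A Sg) X) = 0"
begin

definition "Sg1 A = D4 A Sg"
definition "Sg2 A B = D4 B (Sg1 A)"
definition "Sg3 A B C = D4 C (Sg2 A B)"
definition "Sg4 A B C D = D4 D (Sg3 A B C)"

lemma smc_Sgs: "smc (Sg1 A)" "smc (Sg2 A B)" "smc (Sg3 A B C)" "smc (Sg4 A B C D)"
  unfolding Sg4_def Sg3_def Sg2_def Sg1_def by (intro smc_intros smc_Sg)+

lemma Sg2_sym: "X \<in> cone \<Longrightarrow> Sg2 A B X = Sg2 B A X"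
  unfolding Sg2_def Sg1_def by (rule D4_commute[OF smc_Sg])

lemma Sg3_sym: assumes X: "X \<in> cone" shows "Sg3 A B C X = Sg3 B A C X" "Sg3 A B C X = Sg3 A C B X"
proof -
  show "Sg3 A B C X = Sg3 B A C X"
    unfolding Sg3_def by (rule D4_cong_cone[OF X]) (rule Sg2_sym)
  show "Sg3 A B C X = Sg3 A C B X"
    unfolding Sg3_def Sg2_def by (rule D4_commute[OF smc_Sgs(1) X])
qed

lemma Sg4_sym:
  assumes X: "X \<in> cone"
  shows "Sg4 A B C D X = Sg4 B A C D X" "Sg4 A B C D X = Sg4 A C B D X" "Sg4 A B C D X = Sg4 A B D C X"
proof -
  show "Sg4 A B C D X = Sg4 B A C D X" "Sg4 A B C D X = Sg4 A C B D X"
    unfolding Sg4_def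
    by (rule D4_cong_cone[OF X], rule Sg3_sym(1), assumption) (rule D4_cong_cone[OF X], rule Sg3_sym(2), assumption)
  show "Sg4 A B C D X = Sg4 A B D C X"
    unfolding Sg4_def Sg3_def by (rule D4_commute[OF smc_Sgs(2) X])
qed

lemma euler_Sg1: "euler 0 (Sg1 A)" and euler_Sg2: "euler (- 1) (Sg2 A B)" and euler_Sg3: "euler (- 2) (Sg3 A B C)"
proof -
  show 1: "euler 0 (Sg1 A)" for A
    unfolding Sg1_def using euler_D4[OF smc_Sg euler_Sg] by simp
  show 2: "euler (- 1) (Sg2 A B)" for A B
    unfolding Sg2_def using euler_D4[OF smc_Sgs(1) 1] by simp
  show "euler (- 2) (Sg3 A B C)"
    unfolding Sg3_def using euler_D4[OF smc_Sgs(2) 2, of C A B] by simp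
qed

lemma sum_D4_zero:
  assumes F: "\<And>A. smc (F A)" and z: "\<And>X. X \<in> V \<Longrightarrow> (\<Sum>A\<in>UNIV. eta A * F A X) = 0" and X: "X \<in> V"
  shows "(\<Sum>A\<in>UNIV. eta A * D4 B (F A) X) = 0"
proof -
  have Xc: "X \<in> cone" using X V_cone by blast
  have "D4 B (\<lambda>X. \<Sum>A\<in>UNIV. eta A * F A X) X = D4 B (\<lambda>X. 0) X"
    by (rule D4_cong[OF open_V X]) (rule z)
  moreover have "D4 B (\<lambda>X. \<Sum>A\<in>UNIV. eta A * F A X) X = (\<Sum>A\<in>UNIV. D4 B (\<lambda>X. eta A * F A X) X)"
    by (intro D4_sum smc_intros F Xc)
  ultimately show ?thesis by (simp add: D4_const D4_cmult[OF F Xc])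
qed

lemma trace_Sgs:
  assumes X: "X \<in> V"
  shows "(\<Sum>A\<in>UNIV. eta A * Sg2 A A X) = 0" "(\<Sum>A\<in>UNIV. eta A * Sg3 A A B X) = 0" "(\<Sum>A\<in>UNIV. eta A * Sg4 A A B C X) = 0"
proof -
  have 2: "(\<Sum>A\<in>UNIV. eta A * Sg2 A A X) = 0" if "X \<in> V" for X
    using trace_Sg[OF that] by (simp add: Sg2_def Sg1_def)
  have 3: "(\<Sum>A\<in>UNIV. eta A * Sg3 A A B X) = 0" if "X \<in> V" for X B
    unfolding Sg3_def by (rule sum_D4_zero[OF smc_Sgs(2) 2 that])
  show "(\<Sum>A\<in>UNIV. eta A * Sg2 A A X) = 0" "(\<Sum>A\<in>UNIV. eta A * Sg3 A A B X) = 0"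
    by (rule 2[OF X], rule 3[OF X])
  show "(\<Sum>A\<in>UNIV. eta A * Sg4 A A B C X) = 0"
    unfolding Sg4_def by (rule sum_D4_zero[OF smc_Sgs(3) 3 X])
qed

lemma jet:
  assumes x: "x \<in> sbox"
  shows "jet4 x (Sg (emb x)) (\<lambda>A. Sg1 A (emb x)) (\<lambda>A B. Sg2 A B (emb x)) (\<lambda>A B C. Sg3 A B C (emb x))
    (\<lambda>A B C D. Sg4 A B C D (emb x))"
proof -
  note X = emb_cone[of x] and V = emb_V[OF x]
  show ?thesis
  proof
    show "sin (x $ 2) \<noteq> 0" using sbox_sin[OF x] by simp
    show "px x (\<lambda>A. Sg1 A (emb x)) = Sg (emb x)"
      using euler_Sg X by (simp add: euler_def px_def Sg1_def)
    show "px x (\<lambda>B. Sg2 A B (emb x)) = 0" for A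
      using euler_Sg1[of A] X by (simp add: euler_def px_def Sg2_def)
    show "px x (\<lambda>C. Sg3 A B C (emb x)) = - Sg2 A B (emb x)" for A B
      using euler_Sg2[of A B] X by (simp add: euler_def px_def Sg3_def)
    show "px x (\<lambda>D. Sg4 A B C D (emb x)) = - 2 * Sg3 A B C (emb x)" for A B C
      using euler_Sg3[of A B C] X by (simp add: euler_def px_def Sg4_def)
  qed (rule Sg2_sym[OF X] Sg3_sym[OF X] Sg4_sym[OF X] trace_Sgs[OF V])+
qed

definition "kb A B = (\<lambda>X. \<Sum>P\<in>UNIV. eta P * (Sg2 A P X * Sg2 B P X))"
definition "phi = (\<lambda>X. rho X * Sg X)"
definition "kc A B = (\<lambda>X. phi X * Sg2 A B X)"
definition "Nf = (\<lambda>X. \<Sum>P\<in>UNIV. eta P * (Sg1 P X * Sg1 P X))"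
definition "qf = (\<lambda>X. \<Sum>P\<in>UNIV. \<Sum>B\<in>UNIV. eta P * (eta B * (Sg2 P B X * Sg2 P B X)))"
text \<open>The conformal factor m, each of whose terms has degree -2. Its coefficients are those
  that make the quadratic sources match.\<close>

definition "mf = (\<lambda>X. (- 1/2) * (phi X * phi X + (rho X * Nf X + 3/2 * qf X)))"
definition "km A B = (\<lambda>X. (if A = B then eta A else 0) * mf X)"

lemma smc_parts: "smc (kb A B)" "smc phi" "smc (kc A B)" "smc Nf" "smc qf" "smc mf" "smc (km A B)"
  unfolding kb_def phi_def kc_def Nf_def qf_def mf_def km_def
  by (intro smc_intros smc_rho smc_Sg smc_Sgs)+

lemma kb_sym: "kb A B X = kb B A X" by (simp add: kb_def mult.commute)
lemma kc_sym: "X \<in> cone \<Longrightarrow> kc A B X = kc B A X" by (simp add: kc_def Sg2_sym[of X A B])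
lemma km_sym: "km A B X = km B A X" by (simp add: km_def)

lemma euler_phi: "euler (- 1) phi"
  unfolding phi_def using euler_mult[OF smc_rho smc_Sg euler_rho euler_Sg] by simp

lemma euler_kb: "euler (- 2) (kb A B)"
  unfolding kb_def
  by (intro euler_sum euler_cmult smc_intros smc_Sgs)
    (use euler_mult[OF smc_Sgs(2) smc_Sgs(2) euler_Sg2 euler_Sg2] in simp)

lemma euler_kc: "euler (- 2) (kc A B)"
  unfolding kc_def using euler_mult[OF smc_parts(2) smc_Sgs(2) euler_phi euler_Sg2] by simp

lemma euler_Nf: "euler 0 Nf"
  unfolding Nf_def
  by (intro euler_sum euler_cmult smc_intros smc_Sgs)
    (use euler_mult[OF smc_Sgs(1) smc_Sgs(1) euler_Sg1 euler_Sg1] in simp)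

lemma euler_km: "euler (- 2) (km A B)"
proof -
  have "euler (- 2) qf"
    unfolding qf_def
    by (intro euler_sum euler_cmult smc_intros smc_Sgs)
      (use euler_mult[OF smc_Sgs(2) smc_Sgs(2) euler_Sg2 euler_Sg2] in simp)
  moreover have "euler (- 2) (\<lambda>X. phi X * phi X)"
    using euler_mult[OF smc_parts(2) smc_parts(2) euler_phi euler_phi] by simp
  moreover have "euler (- 2) (\<lambda>X. rho X * Nf X)"
    using euler_mult[OF smc_rho smc_parts(4) euler_rho euler_Nf] by simp
  ultimately show ?thesis
    unfolding km_def mf_def by (intro euler_cmult euler_add smc_intros smc_parts smc_rho)
qed

text \<open>The Leibniz rule on actual fields reproduces the arrays of \<open>jet4\<close>, so the
  pointwise algebra applies at every point of the patch.\<close>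

lemma
  assumes x: "x \<in> sbox"
  defines "c0 \<equiv> Sg (emb x)" and "c1 \<equiv> \<lambda>A. Sg1 A (emb x)" and "c2 \<equiv> \<lambda>A B. Sg2 A B (emb x)"
    and "c3 \<equiv> \<lambda>A B C. Sg3 A B C (emb x)" and "c4 \<equiv> \<lambda>A B C D. Sg4 A B C D (emb x)"
  shows D42_kb: "D4 D (D4 C (kb A B)) (emb x) = jet4.kb2 c2 c3 c4 A B C D"
    and D42_kc: "D4 D (D4 C (kc A B)) (emb x) = jet4.kc2 x c0 c1 c2 c3 c4 A B C D"
    and D42_km: "D4 D (D4 C (km A B)) (emb x) = jet4.km2 x c0 c1 c2 c3 c4 A B C D"
proof -
  interpret j: jet4 x c0 c1 c2 c3 c4
    unfolding c0_def c1_def c2_def c3_def c4_def by (rule jet[OF x])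
  note X = emb_cone[of x]
  have S: "D4 C (Sg2 A B) (emb x) = c3 A B C" "D4 D (D4 C (Sg2 A B)) (emb x) = c4 A B C D"
    "D4 C (Sg1 A) (emb x) = c2 A C" "D4 D (D4 C (Sg1 A)) (emb x) = c3 A C D"
    "D4 C Sg (emb x) = c1 C" "D4 D (D4 C Sg) (emb x) = c2 C D"
    "Sg2 A B (emb x) = c2 A B" "Sg1 A (emb x) = c1 A" "Sg (emb x) = c0" for A B C D
    by (simp_all add: c0_def c1_def c2_def c3_def c4_def Sg4_def Sg3_def Sg2_def Sg1_def)
  show "D4 D (D4 C (kb A B)) (emb x) = j.kb2 A B C D"
    unfolding kb_def j.kb2_def
    by (simp add: D42_sum D42_cmult D42_mult smc_intros smc_Sgs X S)
  have r: "D4 A rho (emb x) = j.rr1 A" "D4 B (D4 A rho) (emb x) = j.rr2 A B" for A B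
    unfolding D4_rho[OF X] D42_rho[OF X] rho_emb j.rr1_def j.rr2_def by auto
  have p: "D4 A phi (emb x) = j.f1 A" "D4 B (D4 A phi) (emb x) = j.f2 A B" "phi (emb x) = c0" for A B
    unfolding phi_def j.f1_def j.f2_def
    by (simp_all add: D4_mult D42_mult smc_rho smc_Sg X r S rho_emb)
  show "D4 D (D4 C (kc A B)) (emb x) = j.kc2 A B C D"
    unfolding kc_def j.kc2_def by (simp add: D42_mult smc_parts smc_Sgs X p S)
  have N: "Nf (emb x) = j.Nh" "D4 A Nf (emb x) = 2 * j.N1 A" "D4 B (D4 A Nf) (emb x) = 2 * (j.SQh A B + j.Yh A B)" for A B
  proof -
    show "Nf (emb x) = j.Nh" by (simp add: Nf_def j.Nh_def S)
    show "D4 A Nf (emb x) = 2 * j.N1 A"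
      unfolding Nf_def j.N1_def
      by (simp add: D4_sum D4_cmult D4_mult smc_intros smc_Sgs X S sum_distrib_left algebra_simps)
    have "D4 B (D4 A Nf) (emb x) = (\<Sum>P\<in>UNIV. eta P * ((c3 P A B * c1 P + c2 P A * c2 P B) + (c2 P B * c2 P A + c1 P * c3 P A B)))"
      unfolding Nf_def by (simp add: D42_sum D42_cmult D42_mult smc_intros smc_Sgs X S)
    also have "\<dots> = 2 * (j.SQh A B + j.Yh A B)"
      unfolding j.SQh_def j.Yh_def j.sym2[of _ A] j.sym2[of _ B]
      by (simp add: sum_distrib_left sum.distrib[symmetric] algebra_simps)
    finally show "D4 B (D4 A Nf) (emb x) = 2 * (j.SQh A B + j.Yh A B)" .
  qed
  have q: "D4 B (D4 A qf) (emb x) = 2 * (j.SFh A B + j.Qh A B)" for A B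
  proof -
    have "D4 B (D4 A qf) (emb x) = (\<Sum>P\<in>UNIV. \<Sum>E\<in>UNIV. eta P * (eta E * ((c4 P E A B * c2 P E + c3 P E A * c3 P E B) + (c3 P E B * c3 P E A + c2 P E * c4 P E A B))))"
      unfolding qf_def by (simp add: D42_sum D42_cmult D42_mult smc_intros smc_Sgs X S)
    also have "\<dots> = 2 * (j.SFh A B + (\<Sum>P\<in>UNIV. \<Sum>E\<in>UNIV. eta P * (eta E * (c3 P E A * c3 P E B))))"
      unfolding j.SFh_def by (simp add: sum_distrib_left sum.distrib[symmetric] algebra_simps)
    also have "(\<Sum>P\<in>UNIV. \<Sum>E\<in>UNIV. eta P * (eta E * (c3 P E A * c3 P E B))) = j.Qh A B"
    proof -
      have "c3 P E A = c3 A P E" for P E A by (rule trans[OF j.sym3(2) j.sym3(1)])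
      from this[of _ _ A] this[of _ _ B] show ?thesis by (simp only: j.Qh_def)
    qed
    finally show ?thesis .
  qed
  have "D4 D (D4 C mf) (emb x) = j.m2 C D" for C D
  proof -
    have "D4 D (D4 C mf) (emb x) = (- 1/2) * (((j.f2 C D * c0 + j.f1 C * j.f1 D) + (j.f1 D * j.f1 C + c0 * j.f2 C D))
      + (((j.rr2 C D * j.Nh + j.rr1 C * (2 * j.N1 D)) + (j.rr1 D * (2 * j.N1 C) + 2 * (j.SQh C D + j.Yh C D)))
      + 3/2 * (2 * (j.SFh C D + j.Qh C D))))"
      unfolding mf_def
      by (simp only: D42_cmult D42_add D42_mult smc_intros smc_parts smc_rho X p r N q rho_emb mult_1_left)
    then show ?thesis unfolding j.m2_def by (simp add: algebra_simps)
  qed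
  then show "D4 D (D4 C (km A B)) (emb x) = j.km2 A B C D"
    unfolding km_def j.km2_def by (simp add: D42_cmult smc_parts X)
qed

end

section \<open>The field equations in the coordinates \<open>(\<tau>, \<theta>, \<phi>)\<close>\<close>

lemma pull1_pr: "pull1 T x [a] = pr x (\<lambda>A. T A (emb x)) a"
  by (simp add: pull1_def pr_def)

lemma pull2_pr: "pull2 T x [a, b] = pr2 x (\<lambda>A B. T A B (emb x)) a b"
  by (simp add: pull2_def pr2_def pr_def sum_distrib_left sum_distrib_right mult_ac)

lemma pull3_pr: "pull3 T x [a, b, c] = pr x (\<lambda>A. pr2 x (\<lambda>B C. T A B C (emb x)) b c) a"
  by (simp add: pull3_def pr2_def pr_def sum_distrib_left sum_distrib_right mult_ac)

lemma pull4_pr: "pull4 T x [a, b, c, d] = pr x (\<lambda>A. pr x (\<lambda>B. pr2 x (\<lambda>C D. T A B C D (emb x)) c d) b) a"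
  by (simp add: pull4_def pr2_def pr_def sum_distrib_left sum_distrib_right mult_ac)

lemma length_js: "length js = Suc 0 \<Longrightarrow> \<exists>a. js = [a]" "length js = 2 \<Longrightarrow> \<exists>a b. js = [a, b]"
  "length js = 3 \<Longrightarrow> \<exists>a b c. js = [a, b, c]"
  by (auto simp: length_Suc_conv numeral_2_eq_2 numeral_3_eq_3)

lemma cov_cong1:
  assumes "x \<in> sbox" "\<And>y a. y \<in> sbox \<Longrightarrow> T y [a] = T' y [a]"
  shows "cov g T x [a, b] = cov g T' x [a, b]"
  using cov_cong[OF open_sbox assms(1), of "[a]" 1 T T' g b] assms(2) length_js(1) by fastforce

lemma cov_cong0:
  assumes "x \<in> sbox" "\<And>y. y \<in> sbox \<Longrightarrow> T y [] = T' y []"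
  shows "cov g T x [a] = cov g T' x [a]"
  using cov_cong[OF open_sbox assms(1), of "[]" 0 T T' g a] assms(2) by fastforce

lemma cov_cong2:
  assumes "x \<in> sbox" "\<And>y a b. y \<in> sbox \<Longrightarrow> T y [a, b] = T' y [a, b]"
  shows "cov g T x [a, b, c] = cov g T' x [a, b, c]"
  using cov_cong[OF open_sbox assms(1), of "[a, b]" 2 T T' g c] assms(2) length_js(2) by fastforce

lemma cov_cong3:
  assumes "x \<in> sbox" "\<And>y a b c. y \<in> sbox \<Longrightarrow> T y [a, b, c] = T' y [a, b, c]"
  shows "cov g T x [a, b, c, d] = cov g T' x [a, b, c, d]"
  using cov_cong[OF open_sbox assms(1), of "[a, b, c]" 3 T T' g d] assms(2) length_js(3) by fastforce

lemma cov_pull1_pr: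
  assumes "sin (x $ 2) \<noteq> 0" and T: "\<And>A. has_grad (T A) (\<lambda>C. T' A C (emb x)) (emb x)"
  shows "cov gS (pull1 T) x [a, b] = pr2 x (\<lambda>A B. T' A B (emb x)) a b - gd x a b * px x (\<lambda>A. T A (emb x))"
  using cov_pull1[where T=T and T'=T', OF assms] by (simp add: pull2_pr px_def gd_sym)

lemma cov_pull2_pr:
  assumes "sin (x $ 2) \<noteq> 0" and T: "\<And>A B. has_grad (T A B) (\<lambda>C. T' A B C (emb x)) (emb x)"
  shows "cov gS (pull2 T) x [a, b, c] = pr x (\<lambda>A. pr2 x (\<lambda>B C. T' A B C (emb x)) b c) a
    - gd x c a * px x (\<lambda>A. pr x (\<lambda>B. T A B (emb x)) b) - gd x c b * pr x (\<lambda>A. px x (\<lambda>B. T A B (emb x))) a"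
  unfolding cov_pull2[where T=T and T'=T', OF assms] pull3_pr by (simp add: px_def pr_def sum_distrib_left sum_distrib_right mult_ac)

lemma cov_pull3_pr:
  assumes "sin (x $ 2) \<noteq> 0" and T: "\<And>A B C. has_grad (T A B C) (\<lambda>D. T' A B C D (emb x)) (emb x)"
  shows "cov gS (pull3 T) x [a, b, c, d] = pr x (\<lambda>A. pr x (\<lambda>B. pr2 x (\<lambda>C D. T' A B C D (emb x)) c d) b) a
    - gd x d a * px x (\<lambda>A. pr2 x (\<lambda>B C. T A B C (emb x)) b c)
    - gd x d b * pr x (\<lambda>A. px x (\<lambda>B. pr x (\<lambda>C. T A B C (emb x)) c)) a
    - gd x d c * pr x (\<lambda>A. pr x (\<lambda>B. px x (\<lambda>C. T A B C (emb x))) b) a"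
  unfolding cov_pull3[where T=T and T'=T', OF assms] pull4_pr by (simp add: px_def pr_def pr2_def sum_distrib_left sum_distrib_right mult_ac)

lemma cov_scalar2:
  assumes x: "x \<in> sbox" and f: "smc f"
  shows "(cov gS ^^ 2) (pull0 f) x [a, b] =
    pr2 x (\<lambda>A B. D4 B (D4 A f) (emb x)) a b - gd x a b * px x (\<lambda>A. D4 A f (emb x))"
proof -
  have s: "sin (y $ 2) \<noteq> 0" if "y \<in> sbox" for y using sbox_sin[OF that] by simp
  have "cov gS (cov gS (pull0 f)) x [a, b] = cov gS (pull1 (\<lambda>A. D4 A f)) x [a, b]"
    by (rule cov_cong1[OF x], rule cov_pull0, rule has_grad_D4[OF f emb_cone])
  also have "\<dots> = pr2 x (\<lambda>A B. D4 B (D4 A f) (emb x)) a b - gd x a b * px x (\<lambda>A. D4 A f (emb x))"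
    by (rule cov_pull1_pr[OF s[OF x]], rule has_grad_D4[OF smc_D4[OF f] emb_cone])
  finally show ?thesis by (simp add: numeral_2_eq_2)
qed

context scalar_field begin

text \<open>By the Gauss formula each covariant derivative of \<sigma> is a projected partial
  derivative plus metric terms, and the degrees of homogeneity turn the normal contractions into
  lower derivatives.\<close>

lemma cov_Sg:
  assumes x: "x \<in> sbox"
  defines "c0 \<equiv> Sg (emb x)" and "c1 \<equiv> \<lambda>A. Sg1 A (emb x)" and "c2 \<equiv> \<lambda>A B. Sg2 A B (emb x)"
    and "c3 \<equiv> \<lambda>A B C. Sg3 A B C (emb x)" and "c4 \<equiv> \<lambda>A B C D. Sg4 A B C D (emb x)"
  shows "cov gS (pull0 Sg) x [a] = pr x c1 a"
    and "(cov gS ^^ 2) (pull0 Sg) x [a, b] = mass_aspect_jet.s2 (\<lambda>a. gd x a a) c0 (jet4.S x c2) a b"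
    and "(cov gS ^^ 3) (pull0 Sg) x [a, b, c] = mass_aspect_jet.s3 (\<lambda>a. gd x a a) (pr x c1) (jet4.S3 x c3) a b c"
    and "(cov gS ^^ 4) (pull0 Sg) x [a, b, c, d] =
      mass_aspect_jet.s4 (\<lambda>a. gd x a a) c0 (jet4.S x c2) (jet4.S4 x c4) a b c d"
proof -
  have s: "sin (y $ 2) \<noteq> 0" if "y \<in> sbox" for y using sbox_sin[OF that] by simp
  interpret j: jet4 x c0 c1 c2 c3 c4
    unfolding c0_def c1_def c2_def c3_def c4_def by (rule jet[OF x])
  \<comment> \<open>The metric term is written with the Minkowski metric instead of its pullback.
    The covariant derivative is then again a pullback of a field on the cone, and the rule for the
    next rank applies.\<close>
  define T2 where "T2 A B X = Sg2 A B X - (if A = B then eta A * Sg X else 0)" for A B X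
  define T3 where "T3 A B C X = Sg3 A B C X - (if A = B then eta A * Sg1 C X else 0)" for A B C X
  define T4 where "T4 A B C D X = Sg4 A B C D X - (if A = B then eta A * Sg2 C D X else 0)" for A B C D X
  have gT: "has_grad (T2 A B) (\<lambda>C. T3 A B C (emb y)) (emb y)" "has_grad (T3 A B C) (\<lambda>D. T4 A B C D (emb y)) (emb y)"
    for A B C y
  proof -
    have 1: "has_grad Sg (\<lambda>C. Sg1 C (emb y)) (emb y)" "has_grad (Sg1 A) (\<lambda>C. Sg2 A C (emb y)) (emb y)"
      "has_grad (Sg2 A B) (\<lambda>C. Sg3 A B C (emb y)) (emb y)" "has_grad (Sg3 A B C) (\<lambda>D. Sg4 A B C D (emb y)) (emb y)" for A B C
      unfolding Sg1_def Sg2_def Sg3_def Sg4_def by (intro has_grad_D4 smc_intros smc_Sg emb_cone)+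
    have m: "has_grad (\<lambda>X. if P then e * f X else 0) (\<lambda>C. if P then e * f' C else 0) X"
      if "has_grad f f' X" for P e f f' X
      using has_grad_eq[OF has_grad_mult[OF has_grad_const that], of e] has_grad_const[of 0 X] by (cases P) auto
    show "has_grad (T2 A B) (\<lambda>C. T3 A B C (emb y)) (emb y)" "has_grad (T3 A B C) (\<lambda>D. T4 A B C D (emb y)) (emb y)"
      unfolding T2_def T3_def T4_def by (intro has_grad_diff m 1)+
  qed
  have eta_px: "px y (\<lambda>B. if A = B then eta A * z else 0) = z * (eta A * emb y $ A)"
    "px y (\<lambda>A. if A = B then eta A * z else 0) = z * (eta B * emb y $ B)" for y A B z
    by (simp_all add: px_def if_distrib[of "\<lambda>c. c * _"] cong: if_cong)
  \<comment> \<open>Both normal contractions are multiples of the position covector, which has no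
    tangential components, so no metric term appears at third order.\<close>
  have T2x: "px y (\<lambda>B. T2 A B (emb y)) = - Sg (emb y) * (eta A * emb y $ A)"
     "px y (\<lambda>A. T2 A B (emb y)) = - Sg (emb y) * (eta B * emb y $ B)"
    if y: "y \<in> sbox" for A B y
  proof -
    interpret y: jet4 y "Sg (emb y)" "\<lambda>A. Sg1 A (emb y)" "\<lambda>A B. Sg2 A B (emb y)" "\<lambda>A B C. Sg3 A B C (emb y)"
      "\<lambda>A B C D. Sg4 A B C D (emb y)" by (rule jet[OF y])
    have d: "px y (\<lambda>A. U A - W A) = px y U - px y W" for U W
      using px_add[of y U "\<lambda>A. - W A"] px_minus[of y W] by simp
    show "px y (\<lambda>B. T2 A B (emb y)) = - Sg (emb y) * (eta A * emb y $ A)"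
      "px y (\<lambda>A. T2 A B (emb y)) = - Sg (emb y) * (eta B * emb y $ B)"
      unfolding T2_def d eta_px y.eul2 y.eul2' by simp_all
  qed
  have c1: "cov gS (pull0 Sg) y [a] = pull1 Sg1 y [a]" for y a
    unfolding Sg1_def by (rule cov_pull0, rule has_grad_D4[OF smc_Sg emb_cone])
  have "cov gS (cov gS (pull0 Sg)) y [a, b] = pull2 T2 y [a, b]" if y: "y \<in> sbox" for y a b
  proof -
    have "px y (\<lambda>A. Sg1 A (emb y)) = Sg (emb y)"
      using jet[OF y] by (simp add: jet4_def)
    then have "cov gS (pull1 Sg1) y [a, b] = pr2 y (\<lambda>A B. Sg2 A B (emb y)) a b - gd y a b * Sg (emb y)"
      using cov_pull1_pr[OF s[OF y], of Sg1 Sg2 a b] has_grad_D4[OF smc_Sgs(1) emb_cone]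
      by (simp add: Sg2_def)
    then have "cov gS (cov gS (pull0 Sg)) y [a, b] = pr2 y (\<lambda>A B. Sg2 A B (emb y)) a b - gd y a b * Sg (emb y)"
      using cov_cong1[OF y, of "cov gS (pull0 Sg)" "pull1 Sg1"] c1 by simp
    then show ?thesis unfolding pull2_pr T2_def pr2_diff pr2_metric by simp
  qed
  then have c2: "(cov gS ^^ 2) (pull0 Sg) y [a, b] = pull2 T2 y [a, b]" if "y \<in> sbox" for y a b
    using that by (simp add: numeral_2_eq_2)
  have c3: "(cov gS ^^ 3) (pull0 Sg) y [a, b, c] = pull3 T3 y [a, b, c]" if y: "y \<in> sbox" for y a b c
  proof -
    have "(cov gS ^^ 3) (pull0 Sg) y [a, b, c] = cov gS ((cov gS ^^ 2) (pull0 Sg)) y [a, b, c]"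
      by (simp add: numeral_3_eq_3 numeral_2_eq_2)
    also have "\<dots> = cov gS (pull2 T2) y [a, b, c]"
      by (rule cov_cong2[OF y]) (rule c2)
    also have "\<dots> = pull3 T3 y [a, b, c]"
      unfolding cov_pull2_pr[where T=T2 and T'=T3, OF s[OF y] gT(1)] pull3_pr pr_px_swap[symmetric] T2x[OF y] pr_cmult pr_low by simp
    finally show ?thesis .
  qed
  have c4: "(cov gS ^^ 4) (pull0 Sg) x [a, b, c, d] = cov gS (pull3 T3) x [a, b, c, d]" for a b c d
  proof -
    have "(cov gS ^^ 4) (pull0 Sg) x [a, b, c, d] = cov gS ((cov gS ^^ 3) (pull0 Sg)) x [a, b, c, d]"
      by (simp add: eval_nat_numeral)
    also have "\<dots> = cov gS (pull3 T3) x [a, b, c, d]"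
      by (rule cov_cong3[OF x]) (rule c3)
    finally show ?thesis .
  qed
  show "cov gS (pull0 Sg) x [a] = pr x c1 a"
    unfolding c1 pull1_pr c1_def ..
  show "(cov gS ^^ 2) (pull0 Sg) x [a, b] = j.s2 a b"
    unfolding c2[OF x] pull2_pr T2_def pr2_diff pr2_metric j.s2_def j.S_def j.gm_gd by (simp add: c0_def c2_def)
  have pm: "pr x (\<lambda>A. pr2 x (\<lambda>B C. if A = B then eta A * f C else 0) b c) a = gd x a b * pr x f c" for f a b c
  proof -
    have "pr x (\<lambda>C. if A = B then eta A * f C else 0) c = (if A = B then eta A * pr x f c else 0)" for A B
      by (simp add: pr_cmult pr_zero)
    then show ?thesis
      using pr2_metric[of x "pr x f c" a b] unfolding pr2_def by (simp add: mult.commute)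
  qed
  show "(cov gS ^^ 3) (pull0 Sg) x [a, b, c] = j.s3 a b c"
    unfolding c3[OF x] pull3_pr T3_def pr2_diff pr_diff pm j.s3_def j.S3_def j.gm_gd by (simp add: c1_def c3_def mult.commute)
  have d: "px x (\<lambda>A. U A - W A) = px x U - px x W" for U W
    using px_add[of x U "\<lambda>A. - W A"] px_minus[of x W] by simp
  have T3a: "px x (\<lambda>A. T3 A B C (emb x)) = - c2 B C - c1 C * (eta B * emb x $ B)" for B C
    unfolding T3_def d eta_px using j.eul3'(2)[of B C] by (simp add: c1_def c2_def c3_def)
  have T3b: "px x (\<lambda>B. T3 A B C (emb x)) = - c2 A C - c1 C * (eta A * emb x $ A)" for A C
    unfolding T3_def d eta_px using j.eul3'(1)[of A C] by (simp add: c1_def c2_def c3_def)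
  have T3c: "px x (\<lambda>C. T3 A B C (emb x)) = - c2 A B - (if A = B then eta A * c0 else 0)" for A B
  proof -
    have "px x (\<lambda>C. if A = B then eta A * Sg1 C (emb x) else 0) = (if A = B then eta A * c0 else 0)"
      using j.eul1 by (simp add: px_cmult px_zero c1_def)
    then show ?thesis unfolding T3_def d using j.eul3[of A B] by (simp add: c2_def c3_def)
  qed
  have pm4: "pr x (\<lambda>A. pr x (\<lambda>B. pr2 x (\<lambda>C D. if A = B then eta A * f C D else 0) c d) b) a = gd x a b * pr2 x f c d" for f
  proof -
    have "pr2 x (\<lambda>C D. if A = B then eta A * f C D else 0) c d = (if A = B then eta A * pr2 x f c d else 0)" for A B
      by (simp add: pr2_cmult) (simp add: pr2_def pr_zero)
    then show ?thesis
      using pr2_metric[of x "pr2 x f c d" a b] unfolding pr2_def[of x _ a b] by (simp add: mult.commute)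
  qed
  have 1: "pr x (\<lambda>A. pr x (\<lambda>B. pr2 x (\<lambda>C D. T4 A B C D (emb x)) c d) b) a = j.S4 a b c d - gd x a b * j.S c d"
    unfolding T4_def pr2_diff pr_diff pm4 j.S4_def j.S_def by (simp add: c2_def c4_def)
  have 2: "px x (\<lambda>A. pr2 x (\<lambda>B C. T3 A B C (emb x)) b c) = - j.S b c"
    unfolding pr2_def pr_px_swap[symmetric] T3a pr_diff pr_minus pr_multc pr_cmult pr_low j.S_def by simp
  have 3: "pr x (\<lambda>A. px x (\<lambda>B. pr x (\<lambda>C. T3 A B C (emb x)) c)) a = - j.S a c"
    unfolding pr_px_swap[symmetric] T3b pr_diff pr_minus pr_multc pr_cmult pr_low j.S_def pr2_def by simp
  have 4: "pr x (\<lambda>A. pr x (\<lambda>B. px x (\<lambda>C. T3 A B C (emb x))) b) a = - j.S a b - gd x a b * c0"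
    unfolding T3c pr_diff pr_minus pr2_def[symmetric] j.S_def by (simp add: pr2_metric mult.commute)
  show "(cov gS ^^ 4) (pull0 Sg) x [a, b, c, d] = j.s4 a b c d"
    unfolding c4 cov_pull3_pr[where T=T3 and T'=T4, OF s[OF x] gT(2)] 1 2 3 4 j.s4_def j.gm_gd
    by (simp add: algebra_simps)
qed

text \<open>When \<sigma>_ab is replaced by its trace-free counterpart \<open>S\<close>, the terms
  proportional to \<sigma>^2 h, to \<sigma>_a \<sigma>_b and to \<sigma>_c \<sigma>^c h cancel
  between \<gamma> and \<Delta>; the symmetrizations are automatic because the contractions are
  symmetric.\<close>

lemma current_source:
  assumes x: "x \<in> sbox"
  defines "c0 \<equiv> Sg (emb x)" and "c1 \<equiv> \<lambda>A. Sg1 A (emb x)" and "c2 \<equiv> \<lambda>A B. Sg2 A B (emb x)"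
    and "c3 \<equiv> \<lambda>A B C. Sg3 A B C (emb x)" and "c4 \<equiv> \<lambda>A B C D. Sg4 A B C D (emb x)"
  defines "w \<equiv> wt x" and "g \<equiv> \<lambda>a. gd x a a" and "S \<equiv> jet4.S x c2" and "S3 \<equiv> jet4.S3 x c3" and "S4 \<equiv> jet4.S4 x c4"
  shows "4 * (gamma gS (pull0 Sg) x a b + Delta2 gS (pull0 Sg) x a b) =
    - 6 * c0 * S a b - 14 * mass_aspect_jet.SQ w S a b + 6 * mass_aspect_jet.SS w S * gd x a b
    + 3 * mass_aspect_jet.TT w S3 * gd x a b - 9 * mass_aspect_jet.QQ w S3 a b + 3 * mass_aspect_jet.SF w S S4 a b
    + 2 * mass_aspect_jet.YY w (pr x c1) S3 a b" (is ?K)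
    and "grad_sq gS (pull0 Sg) x = mass_aspect_jet.PP w (pr x c1)" (is ?P)
proof -
  have s: "sin (x $ 2) \<noteq> 0" using sbox_sin[OF x] by simp
  interpret j: jet4 x c0 c1 c2 c3 c4
    unfolding c0_def c1_def c2_def c3_def c4_def by (rule jet[OF x])
  note cs = cov_Sg[OF x, folded c0_def c1_def c2_def c3_def c4_def]
  have up: "up gS k T x is = wt x (is ! k) * T x is" for k T "is" by (rule up_gS[OF s])
  have s0: "pull0 Sg x [] = c0" by (simp add: pull0_def c0_def)
  have P: "grad_sq gS (pull0 Sg) x = j.PP"
    by (simp add: grad_sq_def up cs j.PP_def mult_ac)
  then show ?P by (simp add: w_def)
  have s2s: "j.s2 a b = j.s2 b a" for a b by (simp add: j.s2_def j.S_sym[of a b] j.gm_sym[of a b])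
  have h: "hess_sq gS (pull0 Sg) x = j.SS + 3 * c0\<^sup>2"
    unfolding j.hess_contr[symmetric] by (simp add: hess_sq_def Let_def up cs mult_ac)
  have t: "third_sq gS (pull0 Sg) x = j.TT + 3 * j.PP"
    unfolding j.third_contr[symmetric] by (simp add: third_sq_def Let_def up cs mult_ac)
  have q1: "(\<Sum>c\<in>UNIV. up gS 1 ((cov gS ^^ 2) (pull0 Sg)) x [a, c] * (cov gS ^^ 2) (pull0 Sg) x [c, b])
    = j.SQ a b - 2 * c0 * j.S a b + c0\<^sup>2 * j.gm a b" for a b
    unfolding j.SQ_contr[symmetric] by (simp add: up cs s2s[of _ b] mult_ac)
  have q2: "(\<Sum>p\<in>UNIV. (cov gS ^^ 2) (pull0 Sg) x [a, p] * up gS 1 ((cov gS ^^ 2) (pull0 Sg)) x [b, p])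
    = j.SQ a b - 2 * c0 * j.S a b + c0\<^sup>2 * j.gm a b" for a b
    unfolding j.SQ_contr[symmetric] by (simp add: up cs mult_ac)
  have q3: "(\<Sum>p\<in>UNIV. \<Sum>q\<in>UNIV. (cov gS ^^ 3) (pull0 Sg) x [p, q, a] * up gS 0 (up gS 1 ((cov gS ^^ 3) (pull0 Sg))) x [p, q, b])
    = j.QQ a b + 3 * (pr x c1 a * pr x c1 b)" for a b
    unfolding j.QQ_contr[symmetric] by (simp add: up cs mult_ac)
  have sy: "j.SF a b = j.SF b a" "j.SQ a b = j.SQ b a" "j.QQ a b = j.QQ b a" "j.YY a b = j.YY b a" for a b
    unfolding j.SF_def j.SQ_def j.QQ_def j.YY_def
    by (simp_all only: mult.commute j.S4_sym[of _ _ a b] j.S3_sym(2)[of _ a b])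
  have q4: "(\<Sum>p\<in>UNIV. \<Sum>q\<in>UNIV. up gS 0 (up gS 1 ((cov gS ^^ 2) (pull0 Sg))) x [p, q] *
      symm (\<lambda>a b. (cov gS ^^ 4) (pull0 Sg) x [p, q, a, b]) a b)
    = j.SF a b + 2 * j.SQ a b + j.SS * j.gm a b + 3 * c0 * j.S a b - 3 * c0\<^sup>2 * j.gm a b"
  proof -
    have "(\<Sum>p\<in>UNIV. \<Sum>q\<in>UNIV. up gS 0 (up gS 1 ((cov gS ^^ 2) (pull0 Sg))) x [p, q] *
      symm (\<lambda>a b. (cov gS ^^ 4) (pull0 Sg) x [p, q, a, b]) a b) =
      1/2 * ((\<Sum>p\<in>UNIV. \<Sum>q\<in>UNIV. wt x p * (wt x q * (j.s2 p q * j.s4 p q a b)))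
        + (\<Sum>p\<in>UNIV. \<Sum>q\<in>UNIV. wt x p * (wt x q * (j.s2 p q * j.s4 p q b a))))"
      by (simp add: up cs symm_def sum_distrib_left sum.distrib[symmetric] algebra_simps)
    then show ?thesis
      unfolding j.SF_contr sy(1)[of b a] sy(2)[of b a] j.S_sym[of b a] j.gm_sym[of b a] by simp
  qed
  have q5: "(\<Sum>e\<in>UNIV. up gS 0 (cov gS (pull0 Sg)) x [e] * symm (\<lambda>a b. (cov gS ^^ 3) (pull0 Sg) x [e, a, b]) a b)
    = j.YY a b - pr x c1 a * pr x c1 b"
  proof -
    have "(\<Sum>e\<in>UNIV. up gS 0 (cov gS (pull0 Sg)) x [e] * symm (\<lambda>a b. (cov gS ^^ 3) (pull0 Sg) x [e, a, b]) a b) =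
      1/2 * ((\<Sum>e\<in>UNIV. wt x e * (pr x c1 e * j.s3 e a b)) + (\<Sum>e\<in>UNIV. wt x e * (pr x c1 e * j.s3 e b a)))"
      by (simp add: up cs symm_def sum_distrib_left sum.distrib[symmetric] algebra_simps)
    then show ?thesis
      unfolding j.YY_contr sy(4)[of b a] by simp
  qed
  have g: "gamma gS (pull0 Sg) x a b = 2 * c0 * j.s2 a b + 5/2 * c0\<^sup>2 * gd x a b + (j.SQ a b - 2 * c0 * j.S a b + c0\<^sup>2 * gd x a b)
     - 1/2 * (j.SS + 3 * c0\<^sup>2) * gd x a b"
    unfolding gamma_def Let_def q1 h gS_nth s0 j.gm_gd unfolding cs ..
  have d: "Delta2 gS (pull0 Sg) x a b = - (1/4) * (9 * j.PP * gd x a b - 29 * pr x c1 a * pr x c1 b + 63 * c0 * j.s2 a b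
     + 24 * (j.SQ a b - 2 * c0 * j.S a b + c0\<^sup>2 * gd x a b) - 5 * (j.SS + 3 * c0\<^sup>2) * gd x a b + 45 * c0\<^sup>2 * gd x a b
     - 3 * (j.TT + 3 * j.PP) * gd x a b + 9 * (j.QQ a b + 3 * (pr x c1 a * pr x c1 b))
     - 3 * (j.SF a b + 2 * j.SQ a b + j.SS * gd x a b + 3 * c0 * j.S a b - 3 * c0\<^sup>2 * gd x a b)
     - 2 * (j.YY a b - pr x c1 a * pr x c1 b))"
    unfolding Delta2_def Let_def q2 q4 q5 q3 h t P gS_nth s0 j.gm_gd
    unfolding cs symm_def sy(3)[of b a] by (simp add: field_simps power2_eq_square)
  show ?K
    unfolding g d j.s2_def w_def S_def S3_def S4_def j.gm_gd by (simp add: algebra_simps power2_eq_square)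
qed

end

section \<open>The homogeneous extension of the second-order field\<close>

text \<open>Tangency and degree -2 determine H over the patch from its pullback, so the field
  equations may be stated for the pullback in spherical coordinates.\<close>

locale einstein_field = scalar_field Sg V for Sg V +
  fixes H :: "4 \<Rightarrow> 4 \<Rightarrow> real^4 \<Rightarrow> real"
  assumes smc_H: "smc (H A B)" and H_sym: "X \<in> cone \<Longrightarrow> H A B X = H B A X"
    and euler_H: "euler (- 2) (H A B)"
    and H_tang: "X \<in> cone \<Longrightarrow> (\<Sum>A\<in>UNIV. H A B X * X $ A) = 0"
    and H_trace: "x \<in> sbox \<Longrightarrow> (\<Sum>a\<in>UNIV. up gS 0 (pull2 H) x [a, a]) =
      12 * (pull0 Sg x [])\<^sup>2 + grad_sq gS (pull0 Sg) x"
    and H_div: "x \<in> sbox \<Longrightarrow> (\<Sum>b\<in>UNIV. up gS 2 (cov gS (pull2 H)) x [a, b, b]) =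
      cov gS (\<lambda>y _. grad_sq gS (pull0 Sg) y + 8 * (pull0 Sg y [])\<^sup>2) x [a]"
    and H_box: "x \<in> sbox \<Longrightarrow> box_op gS (pull2 H) x [a, b] - 2 * pull2 H x [a, b] =
      (cov gS ^^ 2) (\<lambda>y _. 5 * (pull0 Sg y [])\<^sup>2 + grad_sq gS (pull0 Sg) y) x [b, a]
      + gS x $ a $ b * (- 18 * (pull0 Sg x [])\<^sup>2 + 4 * grad_sq gS (pull0 Sg) x)
      + 4 * pull0 Sg x [] * (cov gS ^^ 2) (pull0 Sg) x [a, b]"
begin

definition "H1 A B C = D4 C (H A B)"
definition "H2 A B C D = D4 D (H1 A B C)"

lemma smc_Hs: "smc (H1 A B C)" "smc (H2 A B C D)"
  unfolding H1_def H2_def by (intro smc_intros smc_H)+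

lemma H1_sym: assumes X: "X \<in> cone" shows "H1 A B C X = H1 B A C X"
  unfolding H1_def by (rule D4_cong_cone[OF X]) (rule H_sym)

lemma H2_sym: assumes X: "X \<in> cone" shows "H2 A B C D X = H2 A B D C X"
  unfolding H2_def H1_def by (rule D4_commute[OF smc_H X])

text \<open>Differentiate the tangency of H.\<close>

lemma H1_tang:
  assumes X: "X \<in> cone"
  shows "(\<Sum>A\<in>UNIV. H1 A B C X * X $ A) = - H C B X"
proof -
  have "D4 C (\<lambda>X. \<Sum>A\<in>UNIV. H A B X * X $ A) X = D4 C (\<lambda>X. 0) X"
    by (rule D4_cong_cone[OF X]) (rule H_tang)
  moreover have "D4 C (\<lambda>X. \<Sum>A\<in>UNIV. H A B X * X $ A) X = (\<Sum>A\<in>UNIV. H1 A B C X * X $ A) + H C B X"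
  proof -
    have "D4 C (\<lambda>X. \<Sum>A\<in>UNIV. H A B X * X $ A) X = (\<Sum>A\<in>UNIV. D4 C (\<lambda>X. H A B X * X $ A) X)"
      by (intro D4_sum smc_intros smc_H X)
    also have "\<dots> = (\<Sum>A\<in>UNIV. H1 A B C X * X $ A + H A B X * (if C = A then 1 else 0))"
      by (simp only: D4_mult[OF smc_H smc_nth X] D4_nth[OF X] H1_def)
    finally show ?thesis by (simp add: sum.distrib if_distrib[of "\<lambda>c. _ * c"] cong: if_cong)
  qed
  ultimately show ?thesis by (simp add: D4_const)
qed

lemma H_contractions:
  fixes x
  shows "px x (\<lambda>A. H A B (emb x)) = 0" "px x (\<lambda>B. H A B (emb x)) = 0"
    "px x (\<lambda>A. H1 A B C (emb x)) = - H C B (emb x)" "px x (\<lambda>B. H1 A B C (emb x)) = - H A C (emb x)"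
    "px x (\<lambda>C. H1 A B C (emb x)) = - 2 * H A B (emb x)"
    "px x (\<lambda>D. H2 A B C D (emb x)) = - 3 * H1 A B C (emb x)"
    "px x (\<lambda>C. H2 A B C D (emb x)) = - 3 * H1 A B D (emb x)"
proof -
  note X = emb_cone[of x]
  show "px x (\<lambda>A. H A B (emb x)) = 0" for B using H_tang[OF X] by (simp add: px_def)
  then show "px x (\<lambda>B. H A B (emb x)) = 0" for A by (simp add: H_sym[OF X, of A])
  show 1: "px x (\<lambda>A. H1 A B C (emb x)) = - H C B (emb x)" for B C using H1_tang[OF X] by (simp add: px_def)
  show "px x (\<lambda>B. H1 A B C (emb x)) = - H A C (emb x)"
    using 1[of A C] by (simp add: H1_sym[OF X, of A] H_sym[OF X, of A C])
  show "px x (\<lambda>C. H1 A B C (emb x)) = - 2 * H A B (emb x)"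
    using euler_H[of A B] X by (simp add: euler_def px_def H1_def)
  have "euler (- 3) (H1 A B C)" for C
    unfolding H1_def using euler_D4[OF smc_H euler_H, of C A B] by simp
  then show 2: "px x (\<lambda>D. H2 A B C D (emb x)) = - 3 * H1 A B C (emb x)" for C
    using X by (simp add: euler_def px_def H2_def)
  show "px x (\<lambda>C. H2 A B C D (emb x)) = - 3 * H1 A B D (emb x)"
    using 2[of D] H2_sym[OF X, of A B D] by simp
qed

lemma cov_H:
  assumes x: "x \<in> sbox"
  shows "cov gS (pull2 H) x [a, b, c] = pull3 H1 x [a, b, c]"
    and "(cov gS ^^ 2) (pull2 H) x [a, b, c, d] =
      pr x (\<lambda>A. pr x (\<lambda>B. pr2 x (\<lambda>C D. H2 A B C D (emb x)) c d) b) a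
      + gd x d a * pr2 x (\<lambda>A B. H A B (emb x)) c b + gd x d b * pr2 x (\<lambda>A B. H A B (emb x)) a c
      + 2 * gd x d c * pr2 x (\<lambda>A B. H A B (emb x)) a b"
proof -
  have s: "sin (y $ 2) \<noteq> 0" if "y \<in> sbox" for y using sbox_sin[OF that] by simp
  have gH: "has_grad (H A B) (\<lambda>C. H1 A B C (emb y)) (emb y)" "has_grad (H1 A B C) (\<lambda>D. H2 A B C D (emb y)) (emb y)" for A B C y
    unfolding H2_def by (simp_all add: H1_def has_grad_D4[OF smc_H emb_cone] has_grad_D4[OF smc_D4[OF smc_H] emb_cone])
  have 1: "cov gS (pull2 H) y [a, b, c] = pull3 H1 y [a, b, c]" if "y \<in> sbox" for y a b c
    unfolding cov_pull2_pr[where T=H and T'=H1, OF s[OF that] gH(1)] pull3_pr pr_px_swap[symmetric] H_contractions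
    by (simp add: pr_zero)
  show "cov gS (pull2 H) x [a, b, c] = pull3 H1 x [a, b, c]" by (rule 1[OF x])
  have "(cov gS ^^ 2) (pull2 H) x [a, b, c, d] = cov gS (pull3 H1) x [a, b, c, d]"
    using cov_cong3[where T="cov gS (pull2 H)" and T'="pull3 H1" and g=gS, OF x 1, of a b c d] by (simp add: numeral_2_eq_2)
  also have "\<dots> = pr x (\<lambda>A. pr x (\<lambda>B. pr2 x (\<lambda>C D. H2 A B C D (emb x)) c d) b) a
      + gd x d a * pr2 x (\<lambda>A B. H A B (emb x)) c b + gd x d b * pr2 x (\<lambda>A B. H A B (emb x)) a c
      + 2 * gd x d c * pr2 x (\<lambda>A B. H A B (emb x)) a b"
    unfolding cov_pull3_pr[where T=H1 and T'=H2, OF s[OF x] gH(2)] pr2_def pr_px_swap[symmetric] H_contractions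
      pr_minus pr_cmult
    by (simp add: pr_swap[of x "\<lambda>A B. H B A (emb x)"])
  finally show "(cov gS ^^ 2) (pull2 H) x [a, b, c, d] = \<dots>" .
qed

text \<open>Each block of the linearized Einstein tensor is governed by one field equation: the wave
  operator by the equation for \<box>h, the divergences by the divergence equation, the trace
  Hessian by the trace equation. Tangency and the degree turn flat derivatives into covariant
  ones.\<close>

lemma lin_ein_H:
  assumes x: "x \<in> sbox"
  defines "c0 \<equiv> Sg (emb x)" and "c1 \<equiv> \<lambda>A. Sg1 A (emb x)" and "c2 \<equiv> \<lambda>A B. Sg2 A B (emb x)"
  shows "pr2 x (lin_ein (\<lambda>A B C D. H2 A B C D (emb x))) a b = 2 * (pr x c1 a * pr x c1 b) + 6 * c0 * jet4.S x c2 a b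
    - 4 * mass_aspect_jet.PP (wt x) (pr x c1) * gd x a b"
proof -
  have s: "sin (y $ 2) \<noteq> 0" if "y \<in> sbox" for y using sbox_sin[OF that] by simp
  define c3 where "c3 \<equiv> \<lambda>A B C. Sg3 A B C (emb x)"
  define c4 where "c4 \<equiv> \<lambda>A B C D. Sg4 A B C D (emb x)"
  interpret j: jet4 x c0 c1 c2 c3 c4
    unfolding c0_def c1_def c2_def c3_def c4_def by (rule jet[OF x])
  note X = emb_cone[of x]
  define h2 where "h2 A B C D = H2 A B C D (emb x)" for A B C D
  define Hx where "Hx a b = pr2 x (\<lambda>A B. H A B (emb x)) a b" for a b
  define th where "th = tr0 (\<lambda>A B. H A B (emb x))"
  define trH where "trH X = tr0 (\<lambda>A B. H A B X)" for X
  define dvH where "dvH A X = dv (\<lambda>A B C. H1 A B C X) A" for A X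
  have grad: "grad_sq gS (pull0 Sg) y = Nf (emb y) - (Sg (emb y))\<^sup>2" if y: "y \<in> sbox" for y
  proof -
    interpret y: jet4 y "Sg (emb y)" "\<lambda>A. Sg1 A (emb y)" "\<lambda>A B. Sg2 A B (emb y)" "\<lambda>A B C. Sg3 A B C (emb y)"
      "\<lambda>A B C D. Sg4 A B C D (emb y)" by (rule jet[OF y])
    show ?thesis using current_source(2)[OF y] y.Nh by (simp add: Nf_def y.Nh_def)
  qed
  \<comment> \<open>\<open>Nf\<close> restricts to \<sigma>_c \<sigma>^c + \<sigma>^2. Hence the
    expressions \<sigma>_c \<sigma>^c + j \<sigma>^2 with j = 12, 8, 5 of the trace, divergence and
    wave equations are the restrictions of \<open>F c\<close> with c = 11, 7, 4.\<close>
  define F where "F c = (\<lambda>X. Nf X + c * (Sg X * Sg X))" for c :: real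
  have smF: "smc (F c)" for c unfolding F_def by (intro smc_intros smc_parts smc_Sg)
  define DN where "DN a b = pr2 x (\<lambda>A B. D4 B (D4 A Nf) (emb x)) a b" for a b
  define DQ where "DQ a b = 2 * (pr x c1 a * pr x c1 b) + 2 * c0 * j.S a b - 2 * c0\<^sup>2 * gd x a b" for a b
  have hessF: "(cov gS ^^ 2) (pull0 (F c)) x [a, b] = DN a b + c * DQ a b" for c a b
  proof -
    have 1: "D4 A (F c) (emb x) = D4 A Nf (emb x) + c * (2 * (c0 * c1 A))" for A
      unfolding F_def by (simp add: D4_add D4_cmult D4_mult smc_intros smc_parts smc_Sg X c0_def c1_def Sg1_def)
    have 2: "D4 B (D4 A (F c)) (emb x) = D4 B (D4 A Nf) (emb x) + c * (2 * (c1 A * c1 B) + 2 * (c0 * c2 A B))" for A B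
      unfolding F_def by (simp add: D42_add D42_cmult D42_mult smc_intros smc_parts smc_Sg X c0_def c1_def c2_def Sg1_def Sg2_def algebra_simps)
    have 3: "px x (\<lambda>A. D4 A Nf (emb x)) = 0"
      using euler_Nf X by (simp add: euler_def px_def)
    show ?thesis
      unfolding cov_scalar2[OF x smF] 1 2 px_add px_cmult 3 j.eul1 pr2_add pr2_cmult pr2_prod DN_def DQ_def j.S_def
      by (simp add: power2_eq_square algebra_simps)
  qed
  have DNs: "DN a b = DN b a" for a b
    unfolding DN_def pr2_def by (subst pr_swap) (simp add: D4_commute[OF smc_parts(4) X])
  have DQs: "DQ a b = DQ b a" for a b
    by (simp add: DQ_def j.S_sym[of a b] gd_sym[of x a b])
  have DQt: "(\<Sum>a\<in>UNIV. wt x a * DQ a a) = 2 * j.PP - 6 * c0\<^sup>2"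
  proof -
    have "(\<Sum>a\<in>UNIV. wt x a * DQ a a) = 2 * j.PP + 2 * c0 * (\<Sum>a\<in>UNIV. wt x a * j.S a a) - 2 * c0\<^sup>2 * (\<Sum>a\<in>UNIV. wt x a * j.gm a a)"
    proof -
      have e: "DQ a a = 2 * (pr x c1 a * pr x c1 a) + 2 * c0 * j.S a a - 2 * c0\<^sup>2 * j.gm a a" for a
        by (simp only: DQ_def j.gm_gd)
      show ?thesis
        unfolding e j.PP_def by (simp add: algebra_simps sum.distrib sum_subtractf sum_distrib_left)
    qed
    then show ?thesis by (simp add: j.S_tr j.gm_trace)
  qed
  \<comment> \<open>\<open>F c\<close> need not have the degree of the quantity it represents. The
    two agree on the hyperboloid, and that is all the covariant Hessian sees.\<close>
  have hess_scalar: "(cov gS ^^ 2) T x [a, b] = DN a b + c * DQ a b"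
    if "\<And>y. y \<in> sbox \<Longrightarrow> T y [] = F c (emb y)" for T c a b
  proof -
    have "cov gS T y [a'] = cov gS (pull0 (F c)) y [a']" if "y \<in> sbox" for y a'
      by (rule cov_cong0[OF that]) (use \<open>\<And>y. y \<in> sbox \<Longrightarrow> T y [] = F c (emb y)\<close> in \<open>simp add: pull0_def\<close>)
    then have "cov gS (cov gS T) x [a, b] = cov gS (cov gS (pull0 (F c))) x [a, b]"
      by (rule cov_cong1[OF x])
    then show ?thesis using hessF[of c a b] by (simp add: numeral_2_eq_2)
  qed
  have smtr: "smc trH" "smc (dvH A)" for A
    unfolding trH_def[abs_def] dvH_def tr0_def dv_def by (intro smc_intros smc_H smc_Hs)+
  have trF: "trH (emb y) = F 11 (emb y)" if y: "y \<in> sbox" for y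
  proof -
    have "(\<Sum>a\<in>UNIV. up gS 0 (pull2 H) y [a, a]) = trH (emb y)"
      using contr_bil[OF s[OF y], of "\<lambda>A B. H A B (emb y)"]
      by (simp add: trH_def tr0_def up_gS[OF s[OF y]] pull2_pr H_contractions px_zero)
    then show ?thesis using H_trace[OF y] grad[OF y] by (simp add: F_def pull0_def power2_eq_square)
  qed
  have D_tr: "D4 A trH (emb x) = tr1 (\<lambda>A B C. H1 A B C (emb x)) A" "D4 B (D4 A trH) (emb x) = tr2 h2 A B" for A B
    unfolding trH_def[abs_def] tr0_def tr1_def tr2_def h2_def
    by (simp_all add: D4_sum D4_cmult D42_sum D42_cmult smc_intros smc_H X H1_def H2_def)
  have D_dv: "D4 B (dvH A) (emb x) = dv1 h2 A B" for A B
    unfolding dvH_def dv_def dv1_def h2_def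
    by (simp add: D4_sum D4_cmult smc_intros smc_Hs X H2_def)
  have px_tr: "px x (\<lambda>A. tr1 (\<lambda>A B C. H1 A B C (emb x)) A) = - 2 * th"
    unfolding tr1_def th_def tr0_def px_sum px_cmult H_contractions by (simp add: sum_distrib_left mult_ac)
  have px_dv: "px x (\<lambda>A. dvH A (emb x)) = - th"
    unfolding dvH_def dv_def th_def tr0_def px_sum px_cmult H_contractions by (simp add: sum_negf)
  have tr_eq: "pr2 x (tr2 h2) a b + 2 * th * gd x a b = DN a b + 11 * DQ a b" for a b
  proof -
    have "(cov gS ^^ 2) (pull0 trH) x [a, b] = DN a b + 11 * DQ a b"
      by (rule hess_scalar) (simp add: pull0_def trF)
    then show ?thesis unfolding cov_scalar2[OF x smtr(1)] D_tr px_tr by (simp add: mult_ac)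
  qed
  have dv_eq: "pr2 x (dv1 h2) a b + th * gd x a b = DN a b + 7 * DQ a b" for a b
  proof -
    let ?U = "\<lambda>y (_::3 list). grad_sq gS (pull0 Sg) y + 8 * (pull0 Sg y [])\<^sup>2"
    have "pull1 dvH y [a'] = cov gS ?U y [a']" if y: "y \<in> sbox" for y a'
    proof -
      have "(\<Sum>b\<in>UNIV. up gS 2 (cov gS (pull2 H)) y [a', b, b]) = (\<Sum>b\<in>UNIV. wt y b * pr2 y (\<lambda>B C. pr y (\<lambda>A. H1 A B C (emb y)) a') b b)"
      proof -
        have "pr y (\<lambda>A. pr2 y (\<lambda>B C. H1 A B C (emb y)) b b) a' = pr2 y (\<lambda>B C. pr y (\<lambda>A. H1 A B C (emb y)) a') b b" for b
          unfolding pr2_def by (subst pr_swap, subst (2) pr_swap) simp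
        then show ?thesis by (simp add: up_gS[OF s[OF y]] cov_H(1)[OF y] pull3_pr)
      qed
      also have "\<dots> = (\<Sum>B\<in>UNIV. eta B * pr y (\<lambda>A. H1 A B B (emb y)) a')"
      proof -
        have "px y (\<lambda>B. px y (\<lambda>C. pr y (\<lambda>A. H1 A B C (emb y)) a')) = 0"
          unfolding pr_px_swap[symmetric] H_contractions px_cmult by (simp add: pr_cmult px_cmult pr_px_swap[symmetric] H_contractions pr_zero px_minus pr_minus)
        then show ?thesis
          using contr_bil[OF s[OF y], of "\<lambda>B C. pr y (\<lambda>A. H1 A B C (emb y)) a'"] by simp
      qed
      also have "\<dots> = pull1 dvH y [a']"
        unfolding pull1_pr dvH_def dv_def pr_sum pr_cmult ..
      finally show ?thesis using H_div[OF y, of a'] by simp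
    qed
    then have "cov gS (pull1 dvH) x [a, b] = cov gS (cov gS ?U) x [a, b]"
      by (rule cov_cong1[OF x])
    moreover have "(cov gS ^^ 2) ?U x [a, b] = DN a b + 7 * DQ a b"
      by (rule hess_scalar) (simp add: grad F_def pull0_def power2_eq_square)
    moreover have "cov gS (pull1 dvH) x [a, b] = pr2 x (dv1 h2) a b - gd x a b * (- th)"
      using cov_pull1_pr[where T=dvH and T'="\<lambda>A B. D4 B (dvH A)", OF s[OF x] has_grad_D4[OF smtr(2) X], of a b]
      unfolding px_dv D_dv by simp
    ultimately show ?thesis by (simp add: numeral_2_eq_2 mult.commute)
  qed
  have th_val: "th = 12 * c0\<^sup>2 + j.PP"
  proof -
    have "Nf (emb x) = j.Nh" unfolding Nf_def j.Nh_def by (simp add: c1_def)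
    then show ?thesis
      using trF[OF x] j.Nh unfolding F_def c0_def[symmetric] trH_def th_def by (simp add: power2_eq_square)
  qed
  \<comment> \<open>The Gauss terms add 8 times H to the covariant wave operator and the double
    normal contraction subtracts (-3)(-2) = 6 times H. The remaining 2 is exactly what the field
    equation subtracts, so the left side is the projected flat wave operator.\<close>
  have box_eq: "pr2 x (\<lambda>A B. \<Sum>E\<in>UNIV. eta E * h2 A B E E) a b = DN a b + 4 * DQ a b
     + gd x a b * (- 18 * c0\<^sup>2 + 4 * j.PP) + 4 * c0 * (j.S a b - c0 * gd x a b)" for a b
  proof -
    have "box_op gS (pull2 H) x [a, b] = (\<Sum>c\<in>UNIV. wt x c * (cov gS ^^ 2) (pull2 H) x [a, b, c, c])"
      by (simp add: box_op_def ginv_gS[OF s[OF x]] if_distrib[of "\<lambda>c. c * _"] cong: if_cong)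
    also have "\<dots> = (\<Sum>c\<in>UNIV. wt x c * pr2 x (\<lambda>C D. pr2 x (\<lambda>A B. h2 A B C D) a b) c c)
       + (\<Sum>c\<in>UNIV. wt x c * (j.gm c a * Hx c b)) + (\<Sum>c\<in>UNIV. wt x c * (j.gm c b * Hx a c)) + 2 * Hx a b * (\<Sum>c\<in>UNIV. wt x c * j.gm c c)"
    proof -
      have "pr x (\<lambda>A. pr x (\<lambda>B. pr2 x (\<lambda>C D. h2 A B C D) c c) b) a = pr2 x (\<lambda>C D. pr2 x (\<lambda>A B. h2 A B C D) a b) c c" for c
        unfolding pr2_def
        apply (subst (2) pr_swap)
        apply (subst (3) pr_swap)
        apply (subst (1) pr_swap)
        apply (subst (2) pr_swap)
        apply simp
        done
      then show ?thesis
        unfolding cov_H(2)[OF x] h2_def[symmetric] Hx_def[symmetric] j.gm_gd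
        by (simp add: algebra_simps sum.distrib sum_distrib_left)
    qed
    also have "\<dots> = (\<Sum>c\<in>UNIV. wt x c * pr2 x (\<lambda>C D. pr2 x (\<lambda>A B. h2 A B C D) a b) c c) + 8 * Hx a b"
      unfolding j.contract_gm j.gm_trace by simp
    also have "(\<Sum>c\<in>UNIV. wt x c * pr2 x (\<lambda>C D. pr2 x (\<lambda>A B. h2 A B C D) a b) c c) =
      pr2 x (\<lambda>A B. \<Sum>E\<in>UNIV. eta E * h2 A B E E) a b - 6 * Hx a b"
    proof -
      have "px x (\<lambda>C. px x (\<lambda>D. pr2 x (\<lambda>A B. h2 A B C D) a b)) = 6 * Hx a b"
        unfolding pr2_def pr_px_swap[symmetric] h2_def H_contractions px_cmult Hx_def
        by (simp add: pr_cmult pr_minus)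
      moreover have "(\<Sum>E\<in>UNIV. eta E * pr2 x (\<lambda>A B. h2 A B E E) a b) = pr2 x (\<lambda>A B. \<Sum>E\<in>UNIV. eta E * h2 A B E E) a b"
        unfolding pr2_def pr_sum pr_cmult ..
      ultimately show ?thesis
        using contr_bil[OF s[OF x], of "\<lambda>C D. pr2 x (\<lambda>A B. h2 A B C D) a b"] by simp
    qed
    finally have "pr2 x (\<lambda>A B. \<Sum>E\<in>UNIV. eta E * h2 A B E E) a b = box_op gS (pull2 H) x [a, b] - 2 * pull2 H x [a, b]"
      by (simp add: pull2_pr Hx_def)
    moreover have "(cov gS ^^ 2) (\<lambda>y _. 5 * (pull0 Sg y [])\<^sup>2 + grad_sq gS (pull0 Sg) y) x [b, a] = DN b a + 4 * DQ b a"
      by (rule hess_scalar) (simp add: grad F_def pull0_def power2_eq_square)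
    ultimately show ?thesis
      using H_box[OF x, of a b] current_source(2)[OF x] cov_Sg(2)[OF x, of a b]
      unfolding j.s2_def[folded c0_def c2_def] gS_nth
      by (simp add: pull0_def c0_def[symmetric] c1_def[symmetric] c2_def[symmetric] j.s2_def j.gm_gd DNs[of b a] DQs[of b a])
  qed
  have tdv: "(\<Sum>B\<in>UNIV. eta B * dv1 h2 B B) = (\<Sum>a\<in>UNIV. wt x a * pr2 x (dv1 h2) a a) + 3 * th"
  proof -
    have "px x (dv1 h2 A) = - 3 * dvH A (emb x)" for A
      unfolding dv1_def h2_def dvH_def dv_def px_sum px_cmult H_contractions by (simp add: sum_distrib_left mult_ac)
    then have "px x (\<lambda>A. px x (dv1 h2 A)) = 3 * th"
      using px_dv by (simp add: px_cmult px_minus)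
    then show ?thesis unfolding contr_bil[OF s[OF x]] by simp
  qed
  have ttr: "(\<Sum>B\<in>UNIV. eta B * tr2 h2 B B) = (\<Sum>a\<in>UNIV. wt x a * pr2 x (tr2 h2) a a) + 6 * th"
  proof -
    have "px x (tr2 h2 A) = - 3 * tr1 (\<lambda>A B C. H1 A B C (emb x)) A" for A
      unfolding tr2_def h2_def tr1_def px_sum px_cmult H_contractions by (simp add: sum_distrib_left mult_ac)
    then have "px x (\<lambda>A. px x (tr2 h2 A)) = 6 * th"
      using px_tr by (simp add: px_cmult px_minus)
    then show ?thesis unfolding contr_bil[OF s[OF x]] by simp
  qed
  \<comment> \<open>The normal contractions cancel the terms with \<open>th\<close> in each trace,
    the traces of \<open>DN\<close> cancel in the difference, and \<open>DQ\<close> is left with the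
    coefficient 7 - 11 = -4.\<close>
  have diff: "(\<Sum>B\<in>UNIV. eta B * dv1 h2 B B) - (\<Sum>B\<in>UNIV. eta B * tr2 h2 B B) = - 4 * (2 * j.PP - 6 * c0\<^sup>2)"
  proof -
    have "(\<Sum>a\<in>UNIV. wt x a * pr2 x (dv1 h2) a a) = (\<Sum>a\<in>UNIV. wt x a * DN a a) + 7 * (\<Sum>a\<in>UNIV. wt x a * DQ a a)
      - th * (\<Sum>a\<in>UNIV. wt x a * j.gm a a)"
    proof -
      have e: "pr2 x (dv1 h2) a a = DN a a + 7 * DQ a a - th * j.gm a a" for a using dv_eq[of a a] by (simp add: j.gm_gd)
      show ?thesis unfolding e by (simp add: algebra_simps sum.distrib sum_subtractf sum_distrib_left)
    qed
    moreover have "(\<Sum>a\<in>UNIV. wt x a * pr2 x (tr2 h2) a a) = (\<Sum>a\<in>UNIV. wt x a * DN a a) + 11 * (\<Sum>a\<in>UNIV. wt x a * DQ a a)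
      - 2 * th * (\<Sum>a\<in>UNIV. wt x a * j.gm a a)"
    proof -
      have e: "pr2 x (tr2 h2) a a = DN a a + 11 * DQ a a - 2 * th * j.gm a a" for a using tr_eq[of a a] by (simp add: j.gm_gd)
      show ?thesis unfolding e by (simp add: algebra_simps sum.distrib sum_subtractf sum_distrib_left)
    qed
    ultimately show ?thesis unfolding tdv ttr DQt j.gm_trace by simp
  qed
  have "pr2 x (\<lambda>A C. dv1 h2 C A) a b = pr2 x (dv1 h2) b a"
    unfolding pr2_def by (rule pr_swap)
  then have "pr2 x (lin_ein h2) a b = pr2 x (\<lambda>A B. \<Sum>E\<in>UNIV. eta E * h2 A B E E) a b - pr2 x (dv1 h2) a b - pr2 x (dv1 h2) b a
     + pr2 x (tr2 h2) a b + (- 4 * (2 * j.PP - 6 * c0\<^sup>2)) * gd x a b"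
    unfolding lin_ein_def diff pr2_add pr2_diff pr2_metric by simp
  \<comment> \<open>\<open>DN\<close> enters with 1 - 2 + 1 = 0 and \<open>DQ\<close> with 4 - 14 +
    11 = 1; the \<open>th\<close> terms of the divergences and the trace cancel as well.\<close>
  also have "\<dots> = 2 * (pr x c1 a * pr x c1 b) + 6 * c0 * j.S a b - 4 * j.PP * gd x a b"
    using dv_eq[of a b] dv_eq[of b a] tr_eq[of a b]
    unfolding box_eq DNs[of b a] DQs[of b a] gd_sym[of x b a] th_val
    unfolding DQ_def by (simp add: algebra_simps power2_eq_square)
  finally show ?thesis unfolding h2_def .
qed

definition "kk A B = (\<lambda>X. H A B X + (6 * kb A B X + (kc A B X + km A B X)))"

lemma smc_kk: "smc (kk A B)"
  unfolding kk_def by (intro smc_intros smc_H smc_parts)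

lemma kk_sym: "X \<in> cone \<Longrightarrow> kk A B X = kk B A X"
  by (simp add: kk_def H_sym[of X A B] kb_sym[of A B] kc_sym[of X A B] km_sym[of A B])

lemma euler_kk: "euler (- 2) (kk A B)"
  unfolding kk_def by (intro euler_add euler_cmult smc_intros smc_H smc_parts euler_H euler_kb euler_kc euler_km)

lemma current_lin_ein:
  assumes x: "x \<in> sbox"
  shows "4 * (gamma gS (pull0 Sg) x a b + Delta2 gS (pull0 Sg) x a b) =
    - pr2 x (lin_ein (\<lambda>A B C D. D4 D (D4 C (kk A B)) (emb x))) a b"
proof -
  define c0 where "c0 \<equiv> Sg (emb x)"
  define c1 where "c1 \<equiv> \<lambda>A. Sg1 A (emb x)"
  define c2 where "c2 \<equiv> \<lambda>A B. Sg2 A B (emb x)"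
  define c3 where "c3 \<equiv> \<lambda>A B C. Sg3 A B C (emb x)"
  define c4 where "c4 \<equiv> \<lambda>A B C D. Sg4 A B C D (emb x)"
  note cs = c0_def c1_def c2_def c3_def c4_def
  interpret j: jet4 x c0 c1 c2 c3 c4
    unfolding cs by (rule jet[OF x])
  have "D4 D (D4 C (kk A B)) (emb x) = H2 A B C D (emb x) + (6 * j.kb2 A B C D + (j.kc2 A B C D + j.km2 A B C D))" for A B C D
    unfolding kk_def
    using D42_kb[OF x, folded cs] D42_kc[OF x, folded cs] D42_km[OF x, folded cs]
    by (simp add: D42_add D42_cmult smc_intros smc_H smc_parts emb_cone H2_def H1_def)
  moreover have "pr2 x (lin_ein (\<lambda>A B C D. H2 A B C D (emb x))) a b =
      2 * (pr x c1 a * pr x c1 b) + 6 * c0 * j.S a b - 4 * j.PP * j.gm a b" for a b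
    using lin_ein_H[OF x, of a b] unfolding cs[symmetric] j.gm_gd .
  ultimately show ?thesis
    using j.source_identity[of "\<lambda>A B C D. H2 A B C D (emb x)" a b] current_source(1)[OF x, of a b]
    unfolding cs[symmetric] j.gm_gd by simp
qed

end

section \<open>The conserved current of a Killing field and its potential\<close>

text \<open>With lower index, tangential and of degree 1, a Killing field of the hyperboloid becomes
  a Killing field of Minkowski space, an infinitesimal Lorentz transformation.\<close>

locale killing_charge = einstein_field Sg V H for Sg V H +
  fixes Xi :: "4 \<Rightarrow> real^4 \<Rightarrow> real"
  assumes smc_Xi: "smc (Xi A)" and euler_Xi: "euler 1 (Xi A)"
    and Xi_tang: "X \<in> cone \<Longrightarrow> (\<Sum>A\<in>UNIV. Xi A X * X $ A) = 0"
    and Xi_killing: "X \<in> V \<Longrightarrow> D4 B (Xi A) X = - D4 A (Xi B) X"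
begin

definition "k1 A B C = D4 C (kk A B)"
definition "k2 A B C D = D4 D (k1 A B C)"
definition "Om A B = D4 A (Xi B)"
definition "Fp A B = (\<lambda>X. spot (\<lambda>A B. kk A B X) (\<lambda>A B C. k1 A B C X) (\<lambda>A. Xi A X) (\<lambda>A B. Om A B X) A B)"
text \<open>The potential 1-form of the flux. Its components have degree -1, so as a form it is
  invariant under dilations.\<close>

definition "al D = (\<lambda>X. dual1 X (\<lambda>A B. Fp A B X) D)"

lemma smc_ks: "smc (k1 A B C)" "smc (k2 A B C D)" "smc (Om A B)"
  unfolding k2_def k1_def Om_def by (intro smc_intros smc_kk smc_Xi)+

lemma smc_Fp: "smc (Fp A B)"
  unfolding Fp_def spot_def dv_def tr0_def tr1_def
  by (intro smc_intros smc_kk smc_ks smc_Xi)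

lemma smc_al: "smc (al D)"
proof -
  have i: "smc (\<lambda>X. if P then f X else g X)" if "smc f" "smc g" for P f g
    using that by (cases P) simp_all
  show ?thesis unfolding al_def dual1_def by (intro i smc_intros smc_Fp)
qed

text \<open>The array of second derivatives is antisymmetric in A, B and symmetric in A, C;
  permuting the indices around makes it equal to its negative.\<close>

lemma Xi2_zero:
  assumes X: "X \<in> V"
  shows "D4 C (Om A B) X = 0"
proof -
  define T where "T A B C = D4 C (Om A B) X" for A B C
  have Xc: "X \<in> cone" using X V_cone by blast
  have 1: "T A B C = - T B A C" for A B C
  proof -
    have "D4 C (Om A B) X = D4 C (\<lambda>X. - 1 * Om B A X) X"
      by (rule D4_cong[OF open_V X], unfold Om_def mult_minus1) (rule Xi_killing)
    then show ?thesis by (simp only: T_def D4_cmult[OF smc_ks(3) Xc])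
  qed
  have 2: "T A B C = T C B A" for A B C
    unfolding T_def Om_def by (rule D4_commute[OF smc_Xi Xc])
  have "T A B C = - T A B C"
    using 1[of A B C] 2[of B A C] 1[of C A B] 2[of A C B] 1[of B C A] 2[of C B A] by linarith
  then show ?thesis by (simp add: T_def)
qed

lemma D4_Fp:
  assumes X: "X \<in> V"
  shows "D4 E (Fp A B) X = spot1 (\<lambda>A B. kk A B X) (\<lambda>A B C. k1 A B C X) (\<lambda>A B C D. k2 A B C D X)
    (\<lambda>A. Xi A X) (\<lambda>A B. Om A B X) A B E"
proof -
  have Xc: "X \<in> cone" using X V_cone by blast
  have gk: "has_grad (kk A B) (\<lambda>C. k1 A B C X) X" "has_grad (k1 A B C) (\<lambda>D. k2 A B C D X) X" for A B C
    unfolding k2_def by (simp_all add: k1_def has_grad_D4[OF smc_kk Xc] has_grad_D4[OF smc_D4[OF smc_kk] Xc])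
  have gX: "has_grad (Xi A) (\<lambda>E. Om E A X) X" "has_grad (Om A B) (\<lambda>C. 0) X" for A B
    using has_grad_D4[OF smc_Xi Xc] has_grad_D4[OF smc_ks(3) Xc, of A B] by (simp_all add: Om_def[symmetric] Xi2_zero[OF X])
  have c: "has_grad (\<lambda>X. eta C * f X) (\<lambda>E. eta C * f' E) X" if "has_grad f f' X" for C f f'
    using has_grad_eq[OF has_grad_mult[OF has_grad_const that]] by simp
  have gd: "has_grad (\<lambda>X. dv (\<lambda>A B C. k1 A B C X) B) (\<lambda>E. dv1 (\<lambda>A B C D. k2 A B C D X) B E) X" for B
    unfolding dv_def dv1_def by (intro has_grad_sum c gk)
  have gt: "has_grad (\<lambda>X. tr1 (\<lambda>A B C. k1 A B C X) B) (\<lambda>E. tr2 (\<lambda>A B C D. k2 A B C D X) B E) X" for B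
    unfolding tr1_def tr2_def by (intro has_grad_sum c gk)
  have g0: "has_grad (\<lambda>X. tr0 (\<lambda>A B. kk A B X)) (\<lambda>E. tr1 (\<lambda>A B C. k1 A B C X) E) X"
    unfolding tr0_def tr1_def by (intro has_grad_sum c gk)
  have "has_grad (Fp A B) (\<lambda>E.
    (\<Sum>C\<in>UNIV. eta C * (Om E C X * (k1 A C B X - k1 B C A X) + Xi C X * (k2 A C B E X - k2 B C A E X)))
    + ((Om E A X * dv (\<lambda>A B C. k1 A B C X) B + Xi A X * dv1 (\<lambda>A B C D. k2 A B C D X) B E)
       - (Om E B X * dv (\<lambda>A B C. k1 A B C X) A + Xi B X * dv1 (\<lambda>A B C D. k2 A B C D X) A E))
    + ((Om E B X * tr1 (\<lambda>A B C. k1 A B C X) A + Xi B X * tr2 (\<lambda>A B C D. k2 A B C D X) A E)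
       - (Om E A X * tr1 (\<lambda>A B C. k1 A B C X) B + Xi A X * tr2 (\<lambda>A B C D. k2 A B C D X) B E))
    + (\<Sum>C\<in>UNIV. eta C * ((k1 A C E X * Om C B X + kk A C X * 0) - (k1 B C E X * Om C A X + kk B C X * 0)))
    - (tr1 (\<lambda>A B C. k1 A B C X) E * Om A B X + tr0 (\<lambda>A B. kk A B X) * 0)) X"
    unfolding Fp_def spot_def
    by (intro has_grad_add has_grad_diff has_grad_sum c has_grad_mult gk gX gd gt g0)
  from D4_eqI[OF smc_Fp Xc this, of E] show ?thesis by (simp add: spot1_def)
qed

lemma Om_antisym: "X \<in> V \<Longrightarrow> Om A B X = - Om B A X"
  unfolding Om_def by (rule Xi_killing)

lemma Fp_antisym: "X \<in> V \<Longrightarrow> Fp A B X = - Fp B A X"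
  unfolding Fp_def by (rule spot_antisym) (rule Om_antisym)

text \<open>Degree count: 1 - 3 from the Killing field times first derivatives of k, and -2 + 0 from
  k times \<open>Om\<close>. This is the degree that \<open>dual_closed\<close> demands.\<close>

lemma euler_Fp: "euler (- 2) (Fp A B)"
proof -
  have k: "euler (- 3) (k1 A B C)" for A B C
    unfolding k1_def using euler_D4[OF smc_kk euler_kk, of C A B] by simp
  have o: "euler 0 (Om A B)" for A B
    unfolding Om_def using euler_D4[OF smc_Xi euler_Xi, of A B] by simp
  have m1: "euler (- 2) (\<lambda>X. Xi A X * f X)" if "smc f" "euler (- 3) f" for A f
    using euler_mult[OF smc_Xi that(1) euler_Xi that(2), of A] by simp
  have m2: "euler (- 2) (\<lambda>X. f X * Om A B X)" if "smc f" "euler (- 2) f" for A B f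
    using euler_mult[OF that(1) smc_ks(3) that(2) o, of A B] by simp
  show ?thesis
    unfolding Fp_def spot_def dv_def tr0_def tr1_def
    by (intro euler_add euler_diff euler_sum euler_cmult m1 m2 k euler_kk smc_intros smc_kk smc_ks smc_Xi)
qed

text \<open>The exterior derivative of \<open>al\<close> on the cut tangents is minus a determinant
  containing the divergence of \<open>Fp\<close>, which is the Killing contraction of
  \<open>lin_ein\<close>, hence -4 times that of \<gamma> + \<Delta>. The two signs cancel and the
  factor 4 stays.\<close>

lemma flux_exact:
  assumes x: "x \<in> sbox"
  defines "K a b \<equiv> gamma gS (pull0 Sg) x a b + Delta2 gS (pull0 Sg) x a b"
  shows "(\<Sum>D\<in>UNIV. \<Sum>E\<in>UNIV. D4 E (al D) (emb x) *
      ((fr x 2 E + p * fr x 1 E) * (fr x 3 D + q * fr x 1 D) - (fr x 3 E + q * fr x 1 E) * (fr x 2 D + p * fr x 1 D))) =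
    4 * ((cosh (x$1))\<^sup>2 * sin (x$2) *
      (\<Sum>a\<in>UNIV. wt x a * pr x (\<lambda>A. Xi A (emb x)) a * (K a 1 + wt x 2 * p * K a 2 + wt x 3 * q * K a 3)))"
proof -
  note X = emb_cone[of x] and V = emb_V[OF x]
  have s: "sin (x $ 2) \<noteq> 0" using sbox_sin[OF x] by simp
  define f where "f A B = Fp A B (emb x)" for A B
  define f1 where "f1 A B E = D4 E (Fp A B) (emb x)" for A B E
  define kx where "kx A B C D = k2 A B C D (emb x)" for A B C D
  have fa: "f A B = - f B A" for A B unfolding f_def by (rule Fp_antisym[OF V])
  have f1a: "f1 A B E = - f1 B A E" for A B E
  proof -
    have "D4 E (Fp A B) (emb x) = D4 E (\<lambda>X. - 1 * Fp B A X) (emb x)"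
      by (rule D4_cong[OF open_V V], unfold mult_minus1) (rule Fp_antisym)
    then show ?thesis by (simp only: f1_def D4_cmult[OF smc_Fp X])
  qed
  have eul: "(\<Sum>E\<in>UNIV. emb x $ E * f1 A B E) = - 2 * f A B" for A B
    using euler_Fp[of A B] X by (simp add: euler_def f_def f1_def mult.commute)
  have al: "D4 E (al D) (emb x) = dual1 (axis E 1) f D + dual1 (emb x) (\<lambda>A B. f1 A B E) D" for D E
  proof -
    have F: "D4 E (\<lambda>X. X $ A * Fp B C X) (emb x) = axis E 1 $ A * f B C + emb x $ A * f1 B C E" for A B C
      by (simp add: D4_mult[OF smc_nth smc_Fp X] D4_nth[OF X] f_def f1_def axis_def)
    have G: "D4 E (\<lambda>X. - X $ A * Fp B C X) (emb x) = - (axis E 1 $ A) * f B C + - (emb x $ A) * f1 B C E" for A B C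
      using D4_cmult[OF smc_mult[OF smc_nth smc_Fp] X, of E "- 1" A B C] F[of A B C] by simp
    have A: "D4 E (\<lambda>X. g X + h X + k X) (emb x) = D4 E g (emb x) + D4 E h (emb x) + D4 E k (emb x)"
      if "smc g" "smc h" "smc k" for g h k
      using that by (simp add: D4_add smc_add X)
    have M: "smc (\<lambda>X. - X $ A * Fp B C X)" "smc (\<lambda>X. X $ A * Fp B C X)" for A B C
      by (intro smc_intros smc_Fp)+
    have "al 1 = (\<lambda>X. X $ 2 * Fp 3 4 X + - X $ 3 * Fp 2 4 X + X $ 4 * Fp 2 3 X)"
      "al 2 = (\<lambda>X. - X $ 1 * Fp 3 4 X + - X $ 3 * Fp 1 4 X + X $ 4 * Fp 1 3 X)"
      "al 3 = (\<lambda>X. X $ 1 * Fp 2 4 X + X $ 2 * Fp 1 4 X + - X $ 4 * Fp 1 2 X)"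
      "al 4 = (\<lambda>X. - X $ 1 * Fp 2 3 X + - X $ 2 * Fp 1 3 X + X $ 3 * Fp 1 2 X)"
      by (simp_all add: al_def dual1_def fun_eq_iff)
    note A4 = this
    have "\<forall>D. D4 E (al D) (emb x) = dual1 (axis E 1) f D + dual1 (emb x) (\<lambda>A B. f1 A B E) D"
      unfolding forall_4 A4 A[OF M(2) M(1) M(2)] A[OF M(1) M(1) M(2)] A[OF M(2) M(2) M(1)] F G
      by (simp add: dual1_def)
    then show ?thesis by blast
  qed
  have k2s: "kx A B C D = kx B A C D" "kx A B C D = kx A B D C" for A B C D
  proof -
    have 1: "k1 A B C Y = k1 B A C Y" if "Y \<in> cone" for Y
      unfolding k1_def by (rule D4_cong_cone[OF that]) (rule kk_sym)
    show "kx A B C D = kx B A C D"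
      unfolding kx_def k2_def by (rule D4_cong_cone[OF X]) (rule 1)
    show "kx A B C D = kx A B D C"
      unfolding kx_def k2_def k1_def by (rule D4_commute[OF smc_kk X])
  qed
  have k1s: "k1 A B C (emb x) = k1 B A C (emb x)" for A B C
    unfolding k1_def by (rule D4_cong_cone[OF X]) (rule kk_sym)
  define J where "J B = (\<Sum>C\<in>UNIV. eta C * f1 B C C)" for B
  have J: "J A = (\<Sum>C\<in>UNIV. eta C * (Xi C (emb x) * lin_ein kx A C))" for A
  proof -
    have e: "(\<lambda>A B C D. k2 A B C D (emb x)) = kx" by (simp add: kx_def fun_eq_iff)
    show ?thesis
      unfolding J_def f1_def D4_Fp[OF V] e
      by (rule spot_divergence[of "\<lambda>A B. Om A B (emb x)" "\<lambda>A B C. k1 A B C (emb x)" kx, OF Om_antisym[OF V] k1s k2s])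
  qed
  have Jp: "(\<Sum>B\<in>UNIV. J B * fr x b B) = - 4 * (\<Sum>a\<in>UNIV. wt x a * (pr x (\<lambda>A. Xi A (emb x)) a * K a b))" for b
  proof -
    have "(\<Sum>B\<in>UNIV. J B * fr x b B) = (\<Sum>C\<in>UNIV. eta C * (Xi C (emb x) * pr x (\<lambda>A. lin_ein kx A C) b))"
    proof -
      have "(\<Sum>B\<in>UNIV. J B * fr x b B) = pr x (\<lambda>A. \<Sum>C\<in>UNIV. eta C * (Xi C (emb x) * lin_ein kx A C)) b"
        by (simp only: pr_def J)
      then show ?thesis by (simp only: pr_sum pr_cmult)
    qed
    also have "\<dots> = (\<Sum>a\<in>UNIV. wt x a * (pr x (\<lambda>A. Xi A (emb x)) a * pr2 x (lin_ein kx) b a))"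
      using contr_pr[OF s, of "\<lambda>A. Xi A (emb x)" "\<lambda>C. pr x (\<lambda>A. lin_ein kx A C) b"] Xi_tang[OF X]
        pr_swap[of x "\<lambda>C A. lin_ein kx A C"]
      unfolding pr2_def by (simp add: px_def[of x "\<lambda>A. Xi A (emb x)"])
    finally have fin: "(\<Sum>B\<in>UNIV. J B * fr x b B) =
      (\<Sum>a\<in>UNIV. wt x a * (pr x (\<lambda>A. Xi A (emb x)) a * pr2 x (lin_ein kx) b a))" .
    \<comment> \<open>\<open>lin_ein\<close> is symmetric, so the order in which the Killing index
      and the free index are projected is immaterial.\<close>
    have lk: "pr2 x (lin_ein kx) b a = - 4 * K a b" for a
    proof -
      have "dv1 kx A C + dv1 kx C A = dv1 kx C A + dv1 kx A C" "tr2 kx A C = tr2 kx C A" for A C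
        unfolding tr2_def using k2s(2)[of _ _ A C] by simp_all
      then have e: "lin_ein kx A C = lin_ein kx C A" for A C
        unfolding lin_ein_def using k2s(1)[of A C] by auto
      have "pr2 x (lin_ein kx) b a = pr x (\<lambda>C. pr x (\<lambda>A. lin_ein kx A C) b) a"
        unfolding pr2_def by (rule pr_swap)
      then have "pr2 x (lin_ein kx) b a = pr2 x (lin_ein kx) a b"
      proof -
        have "(\<lambda>A. lin_ein kx A C) = lin_ein kx C" for C by (rule ext) (rule e)
        with \<open>pr2 x (lin_ein kx) b a = _\<close> show ?thesis by (simp only: pr2_def)
      qed
      then show ?thesis
        using current_lin_ein[OF x, of a b] unfolding K_def kx_def k2_def k1_def by simp
    qed
    show ?thesis unfolding fin lk by (simp add: sum_distrib_left mult_ac)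
  qed
  have "(\<Sum>D\<in>UNIV. \<Sum>E\<in>UNIV. D4 E (al D) (emb x) *
      ((fr x 2 E + p * fr x 1 E) * (fr x 3 D + q * fr x 1 D) - (fr x 3 E + q * fr x 1 E) * (fr x 2 D + p * fr x 1 D))) =
    - vol4 (\<lambda>A. fr x 2 A + p * fr x 1 A) (\<lambda>A. fr x 3 A + q * fr x 1 A) (\<lambda>A. emb x $ A) (\<lambda>B. eta B * J B)"
    unfolding al J_def
    using dual_closed[of f f1 "emb x" "\<lambda>A. fr x 2 A + p * fr x 1 A" "\<lambda>A. fr x 3 A + q * fr x 1 A", OF fa f1a eul] .
  also have "\<dots> = 4 * ((cosh (x$1))\<^sup>2 * sin (x$2) *
      (\<Sum>a\<in>UNIV. wt x a * pr x (\<lambda>A. Xi A (emb x)) a * (K a 1 + wt x 2 * p * K a 2 + wt x 3 * q * K a 3)))"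
    unfolding flux_form[OF s] Jp by (simp add: sum_3 algebra_simps)
  finally show ?thesis .
qed

end

section \<open>A global chart of de Sitter space\<close>

abbreviation U0 :: "(real^3) set" where "U0 \<equiv> - {0}"

text \<open>One chart covers all of de Sitter space, so fields smooth in every chart extend smoothly to the
  cone, also across the poles of the spherical coordinates.\<close>

definition psi0 :: "real^3 \<Rightarrow> pt" where "psi0 y = (ln (norm y), (1 / norm y) *\<^sub>R y)"

text \<open>The spherical coordinates in the global chart: \<tau> is the logarithm of the
  radius.\<close>

definition yS :: "real^3 \<Rightarrow> real^3" where "yS x = exp (x $ 1) *\<^sub>R sph (x $ 2) (x $ 3)"

lemma open_U0: "open U0" by auto

lemma sph_nth: "sph a b $ 1 = sin a * cos b" "sph a b $ 2 = sin a * sin b" "sph a b $ 3 = cos a"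
  by (simp_all add: sph_def)

lemma norm_sph: "norm (sph a b) = 1"
proof -
  have "sin a * cos b * (sin a * cos b) + sin a * sin b * (sin a * sin b) + cos a * cos a =
    (sin a)\<^sup>2 * ((sin b)\<^sup>2 + (cos b)\<^sup>2) + (cos a)\<^sup>2"
    by (simp only: power2_eq_square algebra_simps)
  then show ?thesis by (simp add: norm_eq_1 inner_vec_def sum_3 sph_nth)
qed

lemma norm_yS: "norm (yS x) = exp (x $ 1)"
  by (simp add: yS_def norm_sph)

lemma yS_U0: "yS x \<in> U0"
  using norm_yS[of x] by (metis Compl_iff empty_iff exp_not_eq_zero insert_iff norm_zero)

lemma psi0_yS: "psi0 (yS x) = sph_chart x"
  by (simp add: psi0_def norm_yS sph_chart_def) (simp add: yS_def)

lemma psi0_dS: "y \<in> U0 \<Longrightarrow> psi0 y \<in> dS"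
  by (simp add: psi0_def dS_def)

lemma smooth_norm: "smooth_on U0 (norm :: real^3 \<Rightarrow> real)"
proof (rule smooth_on_cong[OF open_U0])
  show "sqrt (\<Sum>i\<in>UNIV. y $ i * y $ i) = norm y" for y :: "real^3"
    by (simp add: norm_eq_sqrt_inner inner_vec_def)
  show "smooth_on U0 (\<lambda>y::real^3. sqrt (\<Sum>i\<in>UNIV. y $ i * y $ i))"
  proof (rule smooth_on_sqrt_comp[OF open_U0])
    show "smooth_on U0 (\<lambda>y::real^3. \<Sum>i\<in>UNIV. y $ i * y $ i)"
      by (intro smooth_on_sum smooth_on_mult smooth_on_bounded_linear open_U0 bounded_linear_vec_nth)
    show "(\<Sum>i\<in>UNIV. y $ i * y $ i) > 0" if "y \<in> U0" for y :: "real^3"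
      using that inner_gt_zero_iff[of y] by (simp add: inner_vec_def)
  qed
qed

lemma smooth_psi0: "smooth_on U0 psi0"
  unfolding psi0_def[abs_def]
proof (rule smooth_on_Pair[OF open_U0])
  show "smooth_on U0 (\<lambda>y::real^3. ln (norm y))"
    by (rule smooth_on_ln_comp[OF open_U0 smooth_norm]) simp
  show "smooth_on U0 (\<lambda>y::real^3. (1 / norm y) *\<^sub>R y)"
  proof (rule smooth_on_vec[OF open_U0])
    fix i
    have "smooth_on U0 (\<lambda>y::real^3. 1 / norm y * y $ i)"
      by (intro smooth_on_mult smooth_on_divide smooth_on_const smooth_norm open_U0
          smooth_on_bounded_linear bounded_linear_vec_nth) simp
    then show "smooth_on U0 (\<lambda>y. ((1 / norm y) *\<^sub>R y) $ i)" by simp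
  qed
qed

lemma psi0_has_derivative:
  assumes "y \<in> U0"
  shows "(psi0 has_derivative (\<lambda>v. ((v \<bullet> y) / (norm y)\<^sup>2, (1 / norm y) *\<^sub>R v - ((v \<bullet> y) / (norm y)^3) *\<^sub>R y))) (at y)"
proof -
  have y: "y \<noteq> 0" "norm y > 0" using assms by auto
  have n: "(norm has_derivative (\<lambda>v. (v \<bullet> y) / norm y)) (at y)"
    using has_derivative_norm[OF y(1)] by (rule has_derivative_eq_rhs) (simp add: fun_eq_iff sgn_div_norm inner_commute divide_inverse mult.commute)
  have l: "((\<lambda>y. ln (norm y)) has_derivative (\<lambda>v. (v \<bullet> y) / (norm y)\<^sup>2)) (at y)"
    by (rule has_derivative_eq_rhs, rule has_derivative_ln[OF y(2) n])
      (use y in \<open>auto simp: fun_eq_iff power2_eq_square field_simps\<close>)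
  have i: "((\<lambda>y. 1 / norm y) has_derivative (\<lambda>v. - ((v \<bullet> y) / (norm y)^3))) (at y)"
    by (rule has_derivative_eq_rhs, rule has_derivative_divide[OF has_derivative_const n])
      (use y in \<open>auto simp: fun_eq_iff power3_eq_cube field_simps\<close>)
  have "((\<lambda>y. (1 / norm y) *\<^sub>R y) has_derivative (\<lambda>v. (1 / norm y) *\<^sub>R v - ((v \<bullet> y) / (norm y)^3) *\<^sub>R y)) (at y)"
    by (rule has_derivative_eq_rhs, rule has_derivative_scaleR[OF i has_derivative_ident]) (simp add: fun_eq_iff)
  from has_derivative_Pair[OF l this] show ?thesis unfolding psi0_def[abs_def] .
qed

lemma frechet_psi0:
  "y \<in> U0 \<Longrightarrow> frechet_derivative psi0 (at y) v = ((v \<bullet> y) / (norm y)\<^sup>2, (1 / norm y) *\<^sub>R v - ((v \<bullet> y) / (norm y)^3) *\<^sub>R y)"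
  using fun_cong[OF frechet_derivative_at[OF psi0_has_derivative], of y v] by simp

lemma chart_psi0: "chart U0 psi0"
  unfolding chart_def
proof (intro conjI ballI open_U0 smooth_psi0)
  show "psi0 ` U0 \<subseteq> dS" using psi0_dS by blast
  show "inj_on psi0 U0"
  proof (rule inj_onI)
    fix y z :: "real^3" assume yz: "y \<in> U0" "z \<in> U0" "psi0 y = psi0 z"
    then have n: "norm y = norm z" by (simp add: psi0_def)
    with yz show "y = z" by (simp add: psi0_def)
  qed
  show "inj (frechet_derivative psi0 (at y))" if y: "y \<in> U0" for y
  proof (rule injI)
    fix v w assume e: "frechet_derivative psi0 (at y) v = frechet_derivative psi0 (at y) w"
    have "norm y \<noteq> 0" using y by simp
    with e have "v \<bullet> y = w \<bullet> y" unfolding frechet_psi0[OF y] by simp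
    with e \<open>norm y \<noteq> 0\<close> show "v = w" unfolding frechet_psi0[OF y] by simp
  qed
qed

lemma frame_sum:
  assumes y: "y \<in> U0"
  shows "frechet_derivative psi0 (at y) v = (\<Sum>i\<in>UNIV. v $ i *\<^sub>R frame psi0 y i)"
proof -
  interpret bounded_linear "frechet_derivative psi0 (at y)"
    using smooth_on_has_derivative[OF smooth_psi0 y] by (rule has_derivative_bounded_linear)
  have "v = (\<Sum>i\<in>UNIV. v $ i *\<^sub>R axis i 1)"
    using basis_expansion[of v] by (simp add: scalar_mult_eq_scaleR)
  then have "frechet_derivative psi0 (at y) v = frechet_derivative psi0 (at y) (\<Sum>i\<in>UNIV. v $ i *\<^sub>R axis i 1)"
    by (rule arg_cong)
  then show ?thesis by (simp only: sum scaleR frame_def)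
qed

lemma h0_bilinear: "bilinear (h0 p)"
  unfolding bilinear_def linear_iff h0_def
  by (auto simp: algebra_simps inner_add_left inner_add_right)

lemma bilinear_sum_sum:
  fixes h :: "pt \<Rightarrow> pt \<Rightarrow> real"
  assumes "bilinear h"
  shows "h (\<Sum>i\<in>I. u i *\<^sub>R e i) (\<Sum>j\<in>J. v j *\<^sub>R f j) = (\<Sum>i\<in>I. \<Sum>j\<in>J. u i * v j * h (e i) (f j))"
proof -
  have l: "linear (\<lambda>x. h x z)" "linear (h z)" for z using assms unfolding bilinear_def by blast+
  show ?thesis
    by (simp add: linear_sum[OF l(1)] linear_sum[OF l(2)] linear_scale[OF l(1)] linear_scale[OF l(2)] sum_distrib_left
        mult.left_commute mult.assoc) (rule sum.swap)
qed

text \<open>A null covector argument alone would not suffice in Lorentzian signature; the vector is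
  tested against its own time reflection, which produces a positive definite quadratic form.\<close>

lemma met_psi0_nondegenerate:
  assumes y: "y \<in> U0" and v: "met psi0 y *v v = 0"
  shows "v = 0"
proof -
  let ?D = "frechet_derivative psi0 (at y)"
  have hD: "h0 (psi0 y) (?D w) (?D v) = 0" for w
  proof -
    have "h0 (psi0 y) (?D w) (?D v) = (\<Sum>i\<in>UNIV. w $ i * (met psi0 y *v v) $ i)"
      unfolding frame_sum[OF y] bilinear_sum_sum[OF h0_bilinear]
      by (simp add: matrix_vector_mult_def met_def sum_distrib_left mult_ac)
    then show ?thesis by (simp add: v)
  qed
  have n: "norm y > 0" using y by simp
  have yy: "y \<bullet> y = (norm y)\<^sup>2" by (simp add: power2_norm_eq_inner)
  \<comment> \<open>The reflection of v in the plane orthogonal to y. In this chart the radial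
    direction is time, so the image of w is the time reflection of the image of v.\<close>
  define w where "w = v - (2 * (v \<bullet> y) / (norm y)\<^sup>2) *\<^sub>R y"
  have wy: "w \<bullet> y = - (v \<bullet> y)"
    using n by (simp add: w_def inner_diff_left yy)
  have "?D w = (- fst (?D v), snd (?D v))"
    unfolding frechet_psi0[OF y] wy using n
    by (simp add: w_def vec_eq_iff field_simps power2_eq_square power3_eq_cube)
  then have "(fst (?D v))\<^sup>2 + (cosh (fst (psi0 y)))\<^sup>2 * (snd (?D v) \<bullet> snd (?D v)) = 0"
    using hD[of w] by (simp add: h0_def power2_eq_square)
  moreover have "(fst (?D v))\<^sup>2 \<ge> 0" "(cosh (fst (psi0 y)))\<^sup>2 * (snd (?D v) \<bullet> snd (?D v)) \<ge> 0"
    by auto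
  ultimately have "(fst (?D v))\<^sup>2 = 0" "(cosh (fst (psi0 y)))\<^sup>2 * (snd (?D v) \<bullet> snd (?D v)) = 0"
    by linarith+
  then have "fst (?D v) = 0" "snd (?D v) = 0" using cosh_ne_0 by auto
  then have "?D v = ?D 0"
    unfolding frechet_psi0[OF y] by (auto simp: prod_eq_iff)
  then show "v = 0"
    using chart_psi0 y unfolding chart_def by (blast dest: injD)
qed

lemma met_psi0_inverse:
  assumes y: "y \<in> U0"
  shows "met psi0 y ** matrix_inv (met psi0 y) = mat 1"
proof -
  obtain B where B: "B ** met psi0 y = mat 1"
    using matrix_left_invertible_ker[of "met psi0 y"] met_psi0_nondegenerate[OF y] by blast
  then have "met psi0 y ** B = mat 1" using matrix_left_right_inverse by blast
  with B show ?thesis using matrix_inv_eqI by metis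
qed

lemma smooth_frame: "smooth_on U0 (\<lambda>y. frame psi0 y i)"
  unfolding frame_def by (rule smooth_on_frechet[OF smooth_psi0])

lemma smooth_met: "smooth_on U0 (\<lambda>y. met psi0 y $ i $ j)"
proof -
  have f: "smooth_on U0 (\<lambda>y. fst (frame psi0 y i))" for i
    by (rule smooth_on_linear[OF open_U0 bounded_linear_fst smooth_frame])
  have s: "smooth_on U0 (\<lambda>y. snd (frame psi0 y i) $ k)" for i k
    by (rule smooth_on_linear[OF open_U0 bounded_linear_compose[OF bounded_linear_vec_nth bounded_linear_snd] smooth_frame, simplified o_def])
  have c: "smooth_on U0 (\<lambda>y. cosh (fst (psi0 y)))"
    by (rule smooth_on_cosh_comp[OF open_U0 smooth_on_linear[OF open_U0 bounded_linear_fst smooth_psi0]])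
  have "smooth_on U0 (\<lambda>y. - (fst (frame psi0 y i) * fst (frame psi0 y j)) +
     (cosh (fst (psi0 y)))\<^sup>2 * (\<Sum>k\<in>UNIV. snd (frame psi0 y i) $ k * snd (frame psi0 y j) $ k))"
    by (intro smooth_on_add smooth_on_minus smooth_on_mult smooth_on_sum smooth_on_power f s c open_U0)
  then show ?thesis by (simp add: met_def h0_def inner_vec_def)
qed

text \<open>\<open>smooth_vector_field\<close> speaks of contravariant components; lowering them
  with the smooth metric of the chart recovers the covariant ones.\<close>

lemma smooth_lower:
  assumes V: "smooth_vector_field V"
  shows "smooth_on U0 (\<lambda>y. lower_comp psi0 V y [i])"
proof (rule smooth_on_cong[OF open_U0])
  show "smooth_on U0 (\<lambda>y. \<Sum>a\<in>UNIV. met psi0 y $ i $ a * vec_comp psi0 V y a)"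
    using V chart_psi0 by (intro smooth_on_sum smooth_on_mult smooth_met open_U0) (auto simp: smooth_vector_field_def)
  show "(\<Sum>a\<in>UNIV. met psi0 y $ i $ a * vec_comp psi0 V y a) = lower_comp psi0 V y [i]" if y: "y \<in> U0" for y
  proof -
    have "(\<Sum>a\<in>UNIV. met psi0 y $ i $ a * vec_comp psi0 V y a) =
      (\<Sum>d\<in>UNIV. (met psi0 y ** matrix_inv (met psi0 y)) $ i $ d * lower_comp psi0 V y [d])"
      unfolding vec_comp_def up_def ginv_def matrix_matrix_mult_def
      by (simp add: sum_distrib_left sum_distrib_right mult.assoc) (rule sum.swap)
    also have "\<dots> = lower_comp psi0 V y [i]"
      unfolding met_psi0_inverse[OF y] by (simp add: mat_def if_distrib[of "\<lambda>c. c * _"] cong: if_cong)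
    finally show ?thesis .
  qed
qed

lemma tangent_frame:
  assumes y: "y \<in> U0"
  shows "tangent dS (psi0 y) (frame psi0 y i)"
proof -
  \<comment> \<open>\<open>tangent\<close> asks for a curve that stays in the set for all times,
    while the line may run into the origin; the curve is set constant there, away from time
    0.\<close>
  define c where "c t = (if y + t *\<^sub>R axis i 1 \<in> U0 then psi0 (y + t *\<^sub>R axis i 1) else psi0 y)" for t :: real
  have "\<forall>t. c t \<in> dS" using psi0_dS y by (simp add: c_def)
  moreover have "c 0 = psi0 y" using y by (simp add: c_def)
  moreover have "(c has_vector_derivative frame psi0 y i) (at 0)"
  proof -
    let ?S = "(\<lambda>t. y + t *\<^sub>R axis i 1) -` U0"
    have S: "open ?S" "0 \<in> ?S"
      using y by (auto intro!: open_vimage continuous_intros)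
    have d: "(psi0 has_derivative frechet_derivative psi0 (at y)) (at (y + 0 *\<^sub>R axis i 1))"
      using smooth_on_has_derivative[OF smooth_psi0 y] by simp
    interpret bounded_linear "frechet_derivative psi0 (at y)" using d by (rule has_derivative_bounded_linear)
    have "((\<lambda>t. y + t *\<^sub>R axis i 1) has_derivative (\<lambda>h. h *\<^sub>R axis i 1)) (at 0)"
      by (auto intro!: derivative_eq_intros)
    from has_derivative_compose[OF this d]
    have "((\<lambda>t. psi0 (y + t *\<^sub>R axis i 1)) has_vector_derivative frame psi0 y i) (at 0)"
      by (simp add: has_vector_derivative_def frame_def scaleR)
    then show ?thesis
      unfolding has_vector_derivative_def
      by (rule has_derivative_transform_within_open[OF _ S]) (simp add: c_def)
  qed
  ultimately show ?thesis unfolding tangent_def by blast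
qed

lemma chart_sph: "chart sbox sph_chart"
  unfolding chart_def
proof (intro conjI ballI open_sbox)
  have n: "smooth_on sbox (\<lambda>x::real^3. x $ i)" for i
    by (rule smooth_on_bounded_linear[OF open_sbox bounded_linear_vec_nth])
  show "smooth_on sbox sph_chart"
    unfolding sph_chart_def[abs_def]
  proof (rule smooth_on_Pair[OF open_sbox n], rule smooth_on_vec[OF open_sbox])
    have "\<forall>i. smooth_on sbox (\<lambda>x. sph (x $ 2) (x $ 3) $ i)"
      unfolding forall_3 sph_nth
      by (intro conjI smooth_on_mult smooth_on_sin_comp smooth_on_cos_comp open_sbox n)
    then show "smooth_on sbox (\<lambda>x. sph (x $ 2) (x $ 3) $ i)" for i by blast
  qed
  show "sph_chart ` sbox \<subseteq> dS"
    by (auto simp: sph_chart_def dS_def norm_sph)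
  show "inj_on sph_chart sbox"
  proof (rule inj_onI)
    fix x y assume xy: "x \<in> sbox" "y \<in> sbox" "sph_chart x = sph_chart y"
    have 1: "x $ 1 = y $ 1" and s: "sph (x$2) (x$3) = sph (y$2) (y$3)" using xy(3) by (auto simp: sph_chart_def)
    have c: "cos (x$2) = cos (y$2)" using s by (metis sph_nth(3))
    have 2: "x $ 2 = y $ 2"
      by (rule cos_inj_pi[OF _ _ _ _ c]) (use xy in \<open>auto simp: sbox_def\<close>)
    have "sin (x$2) > 0" by (rule sbox_sin[OF xy(1)])
    then have "cos (x$3) = cos (y$3)" "sin (x$3) = sin (y$3)"
      using s 2 by (metis sph_nth(1) mult_left_cancel less_irrefl) (metis s 2 sph_nth(2) mult_left_cancel less_irrefl \<open>sin (x$2) > 0\<close>)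
    then obtain k :: int where k: "x$3 = y$3 + 2 * pi * k" using sin_cos_eq_iff by metis
    have "\<bar>2 * pi * k\<bar> < 2 * pi" using k xy by (auto simp: sbox_def)
    then have "\<bar>real_of_int k\<bar> < 1" by (simp add: abs_mult)
    then have "k = 0" by linarith
    with k have 3: "x $ 3 = y $ 3" by simp
    show "x = y" using 1 2 3 by (simp add: vec_eq_iff forall_3)
  qed
  show "inj (frechet_derivative sph_chart (at x))" if x: "x \<in> sbox" for x
  proof (rule injI)
    fix v w assume e: "frechet_derivative sph_chart (at x) v = frechet_derivative sph_chart (at x) w"
    have s: "sin (x $ 2) \<noteq> 0" using sbox_sin[OF x] by simp
    let ?c3 = "cos (x$3)" and ?s3 = "sin (x$3)" and ?c2 = "cos (x$2)" and ?s2 = "sin (x$2)"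
    note e' = e[unfolded frechet_derivative_at[OF has_derivative_sph_chart, symmetric]]
    have 1: "v $ 1 = w $ 1" using e' by simp
    have v: "v $ 2 * (?c2 * ?c3) - v $ 3 * (?s2 * ?s3) = w $ 2 * (?c2 * ?c3) - w $ 3 * (?s2 * ?s3)"
      "v $ 2 * (?c2 * ?s3) + v $ 3 * (?s2 * ?c3) = w $ 2 * (?c2 * ?s3) + w $ 3 * (?s2 * ?c3)"
      "- v $ 2 * ?s2 = - w $ 2 * ?s2"
      using arg_cong[OF e', of "\<lambda>p. snd p $ 1"] arg_cong[OF e', of "\<lambda>p. snd p $ 2"] arg_cong[OF e', of "\<lambda>p. snd p $ 3"]
      by simp_all
    have 2: "v $ 2 = w $ 2" using v(3) s by simp
    have "v $ 3 * (?s2 * ?s3) = w $ 3 * (?s2 * ?s3)" "v $ 3 * (?s2 * ?c3) = w $ 3 * (?s2 * ?c3)"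
      using v 2 by simp_all
    moreover have "?s3 \<noteq> 0 \<or> ?c3 \<noteq> 0" using sin_zero_norm_cos_one by fastforce
    ultimately have "v $ 3 = w $ 3" using s by auto
    then show "v = w" using 1 2 by (simp add: vec_eq_iff forall_3)
  qed
qed

section \<open>Homogeneous extensions\<close>

lemma mink_scale: "mink (t *\<^sub>R X) = t\<^sup>2 * mink X"
  by (simp add: mink_def sum_distrib_left power2_eq_square mult_ac)

lemma cone_scale: "t > 0 \<Longrightarrow> X \<in> cone \<Longrightarrow> t *\<^sub>R X \<in> cone"
  by (simp add: cone_def mink_scale)

text \<open>Differentiating the scaling law transports an identity between derivatives from the
  hyperboloid along each ray of the cone.\<close>

lemma D4_scale:
  assumes f: "smc f" and t: "t > 0" and s: "\<And>X. X \<in> cone \<Longrightarrow> f (t *\<^sub>R X) = c * f X" and X: "X \<in> cone"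
  shows "D4 A f (t *\<^sub>R X) = (c / t) * D4 A f X"
proof -
  have g: "has_grad (\<lambda>X. (t *\<^sub>R X) $ j) (\<lambda>i. if i = j then t else 0) X" for j
    using has_grad_eq[OF has_grad_mult[OF has_grad_const[where c=t] has_grad_nth[where j=j and x=X]], of "\<lambda>i. if i = j then t else 0"] by simp
  have "has_grad (\<lambda>X. f (t *\<^sub>R X)) (\<lambda>i. \<Sum>j\<in>UNIV. D4 j f (t *\<^sub>R X) * (if i = j then t else 0)) X"
    by (rule has_grad_chain[OF g]) (rule has_grad_D4[OF f cone_scale[OF t X]])
  then have 1: "has_grad (\<lambda>X. f (t *\<^sub>R X)) (\<lambda>i. D4 i f (t *\<^sub>R X) * t) X"
    by (rule has_grad_eq) (simp add: if_distrib[of "\<lambda>c. _ * c"] cong: if_cong)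
  have "has_grad (\<lambda>X. c * f X) (\<lambda>i. c * D4 i f X) X"
    using has_grad_eq[OF has_grad_mult[OF has_grad_const[where c=c] has_grad_D4[OF f X]], of "\<lambda>i. c * D4 i f X"] by simp
  then have "has_grad (\<lambda>X. f (t *\<^sub>R X)) (\<lambda>i. c * D4 i f X) X"
    by (rule has_grad_transform[OF _ open_cone X]) (simp add: s)
  from has_grad_unique[OF 1 this] show ?thesis using t by (simp add: field_simps)
qed

lemma euler_scale_invariant:
  assumes f: "smc f" and s: "\<And>X t. X \<in> cone \<Longrightarrow> t > 0 \<Longrightarrow> f (t *\<^sub>R X) = f X"
  shows "euler 0 f"
  unfolding euler_def
proof
  fix X assume X: "X \<in> cone"
  have "((\<lambda>t. t *\<^sub>R X) has_derivative (\<lambda>h. h *\<^sub>R X)) (at 1)"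
    by (auto intro!: derivative_eq_intros)
  from has_derivative_compose[OF this, of f "\<lambda>v. \<Sum>A\<in>UNIV. D4 A f X * v $ A"]
  have "((\<lambda>t. f (t *\<^sub>R X)) has_derivative (\<lambda>h. h * (\<Sum>A\<in>UNIV. D4 A f X * X $ A))) (at 1)"
    using has_grad_D4[OF f X] by (simp add: has_grad_def sum_distrib_left mult_ac)
  moreover have "((\<lambda>t. f (t *\<^sub>R X)) has_derivative (\<lambda>h. 0)) (at 1)"
    by (rule has_derivative_transform_within_open[OF has_derivative_const, of "{0<..}" 1 "f X"]) (use s[OF X] in auto)
  ultimately have "(\<lambda>h. h * (\<Sum>A\<in>UNIV. D4 A f X * X $ A)) = (\<lambda>h. 0)" by (rule has_derivative_unique)
  from fun_cong[OF this, of 1] show "(\<Sum>A\<in>UNIV. D4 A f X * X $ A) = 0 * f X" by simp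
qed

definition rad :: "real^4 \<Rightarrow> real" where "rad X = sqrt (mink X)"
definition spn :: "real^4 \<Rightarrow> real" where "spn X = sqrt (X $ 2 * X $ 2 + X $ 3 * X $ 3 + X $ 4 * X $ 4)"
definition si :: "3 \<Rightarrow> 4" where "si i = (if i = 1 then 2 else if i = 2 then 3 else 4)"
text \<open>The coordinates of X / \<open>rad X\<close> in the global chart, extended with degree 0:
  on the hyperboloid X_1 + \<open>spn X\<close> is sinh \<tau> + cosh \<tau> = exp \<tau>, and the
  remaining factor is the direction on the sphere.\<close>

definition qc :: "3 \<Rightarrow> real^4 \<Rightarrow> real" where "qc i X = (X $ 1 + spn X) / (rad X * spn X) * X $ si i"
definition qv :: "real^4 \<Rightarrow> real^3" where "qv X = (\<chi> i. qc i X)"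

lemma mink_eq: "mink X = (X $ 2 * X $ 2 + X $ 3 * X $ 3 + X $ 4 * X $ 4) - X $ 1 * X $ 1"
  by (simp add: mink_def sum_4 eta_def)

lemma cone_pos:
  assumes "X \<in> cone"
  shows "X $ 2 * X $ 2 + X $ 3 * X $ 3 + X $ 4 * X $ 4 > 0" "rad X > 0" "spn X > 0" "X $ 1 + spn X > 0"
proof -
  have m: "mink X > 0" using assms by (simp add: cone_def)
  then show 1: "X $ 2 * X $ 2 + X $ 3 * X $ 3 + X $ 4 * X $ 4 > 0"
    unfolding mink_eq by (smt (verit) zero_le_square)
  show "rad X > 0" using m by (simp add: rad_def)
  show s: "spn X > 0" using 1 by (simp add: spn_def)
  have "(X $ 1)\<^sup>2 < (spn X)\<^sup>2" using m 1 by (simp add: mink_eq spn_def power2_eq_square)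
  then have "\<bar>X $ 1\<bar> < spn X" using s by (simp add: power2_less_imp_less abs_square_less_1 abs_le_square_iff[symmetric] power_mono_iff real_less_rsqrt)
  then show "X $ 1 + spn X > 0" by linarith
qed

lemma smc_qs: "smc rad" "smc spn" "smc (qc i)" "smooth_on cone qv"
proof -
  show r: "smc rad"
    unfolding rad_def[abs_def] by (rule smooth_on_sqrt_comp[OF open_cone smc_mink]) (simp add: cone_def)
  show s: "smc spn"
    unfolding spn_def[abs_def] by (rule smooth_on_sqrt_comp[OF open_cone]) (auto intro!: smc_intros cone_pos)
  show q: "smc (qc i)" for i
    unfolding qc_def[abs_def]
    by (intro smc_mult smooth_on_divide[OF open_cone] smc_add smc_nth r s) (use cone_pos in force)
  show "smooth_on cone qv"
    by (rule smooth_on_vec[OF open_cone]) (simp add: qv_def q)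
qed

lemma scale_qs:
  assumes "t > 0"
  shows "rad (t *\<^sub>R X) = t * rad X" "spn (t *\<^sub>R X) = t * spn X" "qc i (t *\<^sub>R X) = qc i X" "qv (t *\<^sub>R X) = qv X"
proof -
  show r: "rad (t *\<^sub>R X) = t * rad X" using assms by (simp add: rad_def mink_scale real_sqrt_mult)
  have "t * X $ 2 * (t * X $ 2) + t * X $ 3 * (t * X $ 3) + t * X $ 4 * (t * X $ 4)
    = t\<^sup>2 * (X $ 2 * X $ 2 + X $ 3 * X $ 3 + X $ 4 * X $ 4)" by (simp add: algebra_simps power2_eq_square)
  then show s: "spn (t *\<^sub>R X) = t * spn X" using assms by (simp add: spn_def real_sqrt_mult)
  have "(t * X $ 1 + t * spn X) = t * (X $ 1 + spn X)" by (simp add: algebra_simps)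
  then show q: "qc i (t *\<^sub>R X) = qc i X" for i
    using assms by (simp add: qc_def r s)
  show "qv (t *\<^sub>R X) = qv X" by (simp add: qv_def q)
qed

lemma qv_U0: "X \<in> cone \<Longrightarrow> qv X \<in> U0"
proof
  assume X: "X \<in> cone" and "qv X \<in> {0}"
  then have "qc i X = 0" for i by (simp add: qv_def vec_eq_iff)
  then have "X $ si i = 0" for i using cone_pos[OF X] by (simp add: qc_def)
  from this[of 1] this[of 2] this[of 3] have "X $ 2 = 0" "X $ 3 = 0" "X $ 4 = 0" by (simp_all add: si_def)
  then show False using cone_pos(1)[OF X] by simp
qed

lemma qc_emb: "qc i (emb x) = yS x $ i" and rad_emb: "rad (emb x) = 1"
proof -
  show r: "rad (emb x) = 1" using emb_unit[of x] by (simp add: rad_def mink_def mult.assoc)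
  have "(spn (emb x)) = cosh (x $ 1)"
  proof -
    have "emb x $ 2 * emb x $ 2 + emb x $ 3 * emb x $ 3 + emb x $ 4 * emb x $ 4 = (cosh (x $ 1))\<^sup>2"
      using emb_unit[of x] cosh_sq_real[of "x $ 1"] by (simp add: sum_4 eta_def power2_eq_square) (simp add: emb_def)
    then show ?thesis by (simp add: spn_def)
  qed
  moreover have "sinh (x $ 1) + cosh (x $ 1) = exp (x $ 1)" by (rule sinh_plus_cosh)
  ultimately have "qc i (emb x) = exp (x $ 1) / cosh (x $ 1) * emb x $ si i"
    by (simp add: qc_def r) (simp add: emb_def)
  also have "\<dots> = yS x $ i"
    using exhaust_3[of i] by (auto simp: emb_def si_def yS_def sph_nth cosh_ne_0)
  finally show "qc i (emb x) = yS x $ i" .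
qed

lemma qv_emb: "qv (emb x) = yS x"
  by (simp add: qv_def vec_eq_iff qc_emb)

lemma euler_qc: "euler 0 (qc i)"
  by (rule euler_scale_invariant[OF smc_qs(3)]) (rule scale_qs(3))

lemma euler_mink: "euler 2 mink"
  unfolding euler_def by (auto simp: D4_mink mink_def sum_distrib_left mult_ac)

lemma euler_rad: "euler 1 rad"
  unfolding euler_def
proof
  fix X assume X: "X \<in> cone"
  have r: "rad X > 0" by (rule cone_pos[OF X])
  have m: "rad Y * rad Y = mink Y" if "Y \<in> cone" for Y using that by (simp add: rad_def cone_def)
  have "2 * (D4 A rad X * rad X) = D4 A mink X" for A
  proof -
    have "D4 A (\<lambda>X. rad X * rad X) X = D4 A mink X"
      by (rule D4_cong_cone[OF X]) (rule m)
    then show ?thesis by (simp add: D4_mult[OF smc_qs(1) smc_qs(1) X] mult.commute)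
  qed
  then have "(\<Sum>A\<in>UNIV. 2 * (D4 A rad X * rad X) * X $ A) = 2 * mink X"
    using euler_mink X by (simp add: euler_def)
  moreover have "(\<Sum>A\<in>UNIV. 2 * (D4 A rad X * rad X) * X $ A) = 2 * (rad X * (\<Sum>A\<in>UNIV. D4 A rad X * X $ A))"
    by (simp add: sum_distrib_left mult_ac)
  ultimately have "rad X * (\<Sum>A\<in>UNIV. D4 A rad X * X $ A) = rad X * rad X" using m[OF X] by simp
  then show "(\<Sum>A\<in>UNIV. D4 A rad X * X $ A) = 1 * rad X" using r by simp
qed

lemma smc_comp_qv: "smooth_on U0 f \<Longrightarrow> smc (\<lambda>X. f (qv X))"
  by (rule smooth_on_compose[OF open_cone open_U0 _ smc_qs(4)]) (use qv_U0 in auto)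

lemma euler_comp_qv: "smooth_on U0 f \<Longrightarrow> euler 0 (\<lambda>X. f (qv X))"
  by (rule euler_scale_invariant[OF smc_comp_qv]) (simp_all add: scale_qs(4))

lemma euler_D4_qc: "euler (- 1) (D4 A (qc i))"
  using euler_D4[OF smc_qs(3) euler_qc, of A i] by simp

text \<open>The Jacobian of the change from spherical coordinates to the global chart, computed
  through the embedding.\<close>

definition ey :: "real^3 \<Rightarrow> 3 \<Rightarrow> 3 \<Rightarrow> real" where
  "ey x i a = (\<Sum>A\<in>UNIV. D4 A (qc i) (emb x) * fr x a A)"

lemma has_grad_yS: "has_grad (\<lambda>x. yS x $ i) (\<lambda>a. ey x i a) x"
  using has_grad_emb_comp[OF has_grad_D4[OF smc_qs(3) emb_cone]] by (simp add: ey_def qc_emb)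

lemma frame_sph_chart: "frame sph_chart x a = (\<Sum>i\<in>UNIV. ey x i a *\<^sub>R frame psi0 (yS x) i)"
proof -
  have "(yS has_derivative (\<lambda>v. \<chi> i. \<Sum>a\<in>UNIV. ey x i a * v $ a)) (at x)"
    by (subst has_derivative_componentwise_within)
      (use has_grad_yS in \<open>auto simp: Basis_vec_def inner_axis has_grad_def\<close>)
  from has_derivative_compose[OF this smooth_on_has_derivative[OF smooth_psi0 yS_U0]]
  have "(sph_chart has_derivative (\<lambda>v. frechet_derivative psi0 (at (yS x)) (\<chi> i. \<Sum>a\<in>UNIV. ey x i a * v $ a))) (at x)"
    by (simp add: psi0_yS)
  from fun_cong[OF frechet_derivative_at[OF this], of "axis a 1"] show ?thesis
    unfolding frame_def[of sph_chart] frame_sum[OF yS_U0]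
    by (simp add: axis_def if_distrib[of "\<lambda>c. _ * c"] cong: if_cong)
qed

definition Sgf :: "(pt \<Rightarrow> real) \<Rightarrow> real^4 \<Rightarrow> real" where "Sgf \<sigma> = (\<lambda>X. rad X * \<sigma> (psi0 (qv X)))"
text \<open>The pullback of the tensor along the dilation invariant map to the hyperboloid.
  Invariance makes it tangential, and the two gradients of degree -1 give the degree -2.\<close>

definition Hf :: "(pt \<Rightarrow> pt \<Rightarrow> pt \<Rightarrow> real) \<Rightarrow> 4 \<Rightarrow> 4 \<Rightarrow> real^4 \<Rightarrow> real" where
  "Hf h A B = (\<lambda>X. \<Sum>i\<in>UNIV. \<Sum>j\<in>UNIV. comp2 psi0 h (qv X) [i, j] * (D4 A (qc i) X * D4 B (qc j) X))"
text \<open>The same pullback for a covector has degree -1; the factor \<open>mink X\<close>, equal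
  to 1 on the hyperboloid, raises it to 1.\<close>

definition Xif :: "(pt \<Rightarrow> pt) \<Rightarrow> 4 \<Rightarrow> real^4 \<Rightarrow> real" where
  "Xif \<xi> A = (\<lambda>X. mink X * (\<Sum>i\<in>UNIV. lower_comp psi0 \<xi> (qv X) [i] * D4 A (qc i) X))"

lemma comp0_pull0: "comp0 sph_chart \<sigma> = pull0 (Sgf \<sigma>)"
  by (intro ext) (simp add: comp0_def pull0_def Sgf_def rad_emb qv_emb psi0_yS)

text \<open>Bilinearity lets the spherical frame be expanded in the frame of the global chart, where
  the components are smooth.\<close>

lemma comp2_pull2:
  assumes "\<And>p. p \<in> dS \<Longrightarrow> bilinear (h p)"
  shows "comp2 sph_chart h = pull2 (Hf h)"
proof (intro ext)
  fix x "is"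
  have b: "bilinear (h (sph_chart x))"
    using assms psi0_dS[OF yS_U0[of x]] by (simp add: psi0_yS)
  have "comp2 sph_chart h x is = (\<Sum>i\<in>UNIV. \<Sum>j\<in>UNIV. ey x i (is ! 0) * ey x j (is ! 1) * comp2 psi0 h (yS x) [i, j])"
    unfolding comp2_def frame_sph_chart bilinear_sum_sum[OF b] by (simp add: psi0_yS)
  also have "\<dots> = (\<Sum>i\<in>UNIV. \<Sum>j\<in>UNIV. \<Sum>A\<in>UNIV. \<Sum>B\<in>UNIV. comp2 psi0 h (yS x) [i, j] * (D4 A (qc i) (emb x) * D4 B (qc j) (emb x))
      * fr x (is ! 0) A * fr x (is ! 1) B)"
    unfolding ey_def sum_product by (simp add: sum_distrib_left sum_distrib_right mult_ac)
  also have "\<dots> = (\<Sum>A\<in>UNIV. \<Sum>B\<in>UNIV. \<Sum>i\<in>UNIV. \<Sum>j\<in>UNIV. comp2 psi0 h (yS x) [i, j] * (D4 A (qc i) (emb x) * D4 B (qc j) (emb x))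
      * fr x (is ! 0) A * fr x (is ! 1) B)"
    by (subst (2) sum.swap, subst sum.swap, subst (3) sum.swap, subst (2) sum.swap) simp
  also have "\<dots> = pull2 (Hf h) x is"
    by (simp add: pull2_def Hf_def qv_emb sum_distrib_right)
  finally show "comp2 sph_chart h x is = pull2 (Hf h) x is" .
qed

lemma lower_pull1: "lower_comp sph_chart \<xi> = pull1 (Xif \<xi>)"
proof (intro ext)
  fix x "is"
  have l: "linear (h0 p v)" for p v using h0_bilinear unfolding bilinear_def by blast
  have "lower_comp sph_chart \<xi> x is = (\<Sum>i\<in>UNIV. ey x i (is ! 0) * lower_comp psi0 \<xi> (yS x) [i])"
    unfolding lower_comp_def frame_sph_chart
    by (simp add: linear_sum[OF l] linear_scale[OF l] psi0_yS)
  also have "\<dots> = (\<Sum>i\<in>UNIV. \<Sum>A\<in>UNIV. lower_comp psi0 \<xi> (yS x) [i] * D4 A (qc i) (emb x) * fr x (is ! 0) A)"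
    unfolding ey_def by (simp add: sum_distrib_left sum_distrib_right mult_ac)
  also have "\<dots> = pull1 (Xif \<xi>) x is"
    using emb_unit[of x] unfolding pull1_def Xif_def qv_emb
    by (subst sum.swap) (simp add: sum_distrib_right mink_def mult.assoc)
  finally show "lower_comp sph_chart \<xi> x is = pull1 (Xif \<xi>) x is" .
qed

text \<open>The cone over the patch covered by the spherical coordinates.\<close>

definition Vc :: "(real^4) set" where "Vc = cone \<inter> - {X. X $ 3 = 0 \<and> X $ 2 \<ge> 0}"

lemma open_Vc: "open Vc"
proof -
  have "closed {X::real^4. X $ 3 = 0 \<and> X $ 2 \<ge> 0}"
    by (intro closed_Collect_conj closed_Collect_eq closed_Collect_le continuous_intros)
  then show ?thesis unfolding Vc_def by (intro open_Int open_cone) auto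
qed

lemma emb_Vc:
  assumes x: "x \<in> sbox"
  shows "emb x \<in> Vc"
proof -
  have s: "cosh (x $ 1) > 0" "sin (x $ 2) > 0" using sbox_sin[OF x] by (auto simp: cosh_real_pos)
  have "cos (x $ 3) < 0" if "sin (x $ 3) = 0"
  proof -
    have "x $ 3 = pi"
      using that x sin_gt_zero[of "x $ 3"] sin_lt_zero[of "x $ 3"] by (auto simp: sbox_def) (metis less_irrefl linorder_neqE_linordered_idom)
    then show ?thesis by simp
  qed
  then have "emb x $ 2 < 0" if "emb x $ 3 = 0"
    using that s mult_pos_neg[OF s(1) mult_pos_neg[OF s(2)]] by (auto simp: emb_def)
  then have "\<not> (emb x $ 3 = 0 \<and> emb x $ 2 \<ge> 0)" by fastforce
  then show ?thesis using emb_cone by (simp add: Vc_def)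
qed

text \<open>The spherical coordinates are recovered from X: t is the Lorentzian radius, \<tau> comes
  from X_1 by arsinh, \<theta> from the height by arccos, and \<phi> from the horizontal
  direction.\<close>

lemma Vc_param:
  assumes X: "X \<in> Vc"
  obtains t x where "t > 0" "x \<in> sbox" "X = t *\<^sub>R emb x"
proof -
  have Xc: "X \<in> cone" and nz: "\<not> (X $ 3 = 0 \<and> X $ 2 \<ge> 0)" using X by (auto simp: Vc_def)
  note pos = cone_pos[OF Xc]
  define r where "r = rad X"
  define R where "R = spn X / r"
  define \<rho> where "\<rho> = sqrt (X$2 * X$2 + X$3 * X$3)"
  have r: "r > 0" "r * r = mink X" using pos Xc by (auto simp: r_def rad_def cone_def)
  have R: "R > 0" using pos r by (simp add: R_def r_def)
  have \<rho>: "\<rho> > 0" "\<rho> * \<rho> = X$2 * X$2 + X$3 * X$3"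
    using nz by (auto simp: \<rho>_def sum_squares_gt_zero_iff)
  have sp: "spn X * spn X = \<rho> * \<rho> + X$4 * X$4" unfolding \<rho>(2) using pos by (simp add: spn_def)
  define \<tau> where "\<tau> = arsinh (X$1 / r)"
  have ch: "cosh \<tau> = R"
  proof -
    have "(cosh \<tau>)\<^sup>2 = 1 + (X$1 / r)\<^sup>2" unfolding cosh_sq_real \<tau>_def by simp
    also have "\<dots> = R\<^sup>2" using r sp \<rho>(2) by (simp add: R_def power2_eq_square field_simps mink_eq)
    finally show ?thesis using R cosh_real_pos[of \<tau>] by (simp add: power2_eq_iff_nonneg)
  qed
  define c where "c = X$4 / spn X"
  have c1: "c\<^sup>2 + (\<rho> / spn X)\<^sup>2 = 1"
  proof -
    have "c\<^sup>2 + (\<rho> / spn X)\<^sup>2 = (\<rho> * \<rho> + X$4 * X$4) / (spn X * spn X)"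
      by (simp add: c_def power2_eq_square add_divide_distrib)
    then show ?thesis unfolding sp[symmetric] using pos by simp
  qed
  have "(\<rho> / spn X)\<^sup>2 > 0" using \<rho> pos by simp
  with c1 have "c\<^sup>2 < 1" by linarith
  then have c: "-1 < c" "c < 1" using abs_square_less_1[of c] by auto
  define \<theta> where "\<theta> = arccos c"
  have \<theta>: "0 < \<theta>" "\<theta> < pi" "cos \<theta> = c"
    using c arccos_lt_bounded[of c] by (auto simp: \<theta>_def)
  have "(sin \<theta>)\<^sup>2 = (\<rho> / spn X)\<^sup>2" using c1 \<theta>(3) sin_cos_squared_add[of \<theta>] by simp
  then have s\<theta>: "sin \<theta> = \<rho> / spn X"
    using sin_gt_zero[OF \<theta>(1,2)] \<rho> pos by (simp add: power2_eq_iff_nonneg)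
  have "(X$2 / \<rho>)\<^sup>2 + (X$3 / \<rho>)\<^sup>2 = 1"
  proof -
    have "(X$2 / \<rho>)\<^sup>2 + (X$3 / \<rho>)\<^sup>2 = (X$2 * X$2 + X$3 * X$3) / (\<rho> * \<rho>)"
      by (simp add: power2_eq_square add_divide_distrib)
    then show ?thesis unfolding \<rho>(2)[symmetric] using \<rho>(1) by simp
  qed
  then obtain \<phi> where \<phi>: "0 \<le> \<phi>" "\<phi> < 2 * pi" "X$2 / \<rho> = cos \<phi>" "X$3 / \<rho> = sin \<phi>"
    using sincos_total_2pi by metis
  \<comment> \<open>This is where the half hyperplane removed in \<open>Vc\<close> enters: \<phi> =
    0 would put X on it.\<close>
  have "\<phi> \<noteq> 0"
  proof
    assume "\<phi> = 0"
    then have "X$3 = 0" "X$2 = \<rho>" using \<phi> \<rho> by (auto simp: field_simps)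
    then show False using nz \<rho> by simp
  qed
  define x where "x = (vector [\<tau>, \<theta>, \<phi>] :: real^3)"
  have "x \<in> sbox" using \<theta> \<phi> \<open>\<phi> \<noteq> 0\<close> by (simp add: sbox_def x_def)
  moreover have "X = r *\<^sub>R emb x"
  proof -
    have "X$1 = r * sinh \<tau>" using r by (simp add: \<tau>_def)
    moreover have "X$2 = r * (R * (sin \<theta> * cos \<phi>))" "X$3 = r * (R * (sin \<theta> * sin \<phi>))"
      unfolding \<phi>(3,4)[symmetric] s\<theta> R_def using r \<rho> pos by (simp_all add: field_simps)
    moreover have "X$4 = r * (R * cos \<theta>)" unfolding \<theta>(3) c_def R_def using r pos by (simp add: field_simps)
    ultimately have "\<forall>A. X $ A = (r *\<^sub>R emb x) $ A"
      unfolding forall_4 by (simp add: emb_def x_def ch)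
    then show ?thesis by (simp add: vec_eq_iff)
  qed
  ultimately show ?thesis using that r by blast
qed

text \<open>The frame and the unit normal together form a basis, so an array with no tangential and
  no normal components is zero.\<close>

lemma pr2_px_zero:
  assumes s: "sin (x $ 2) \<noteq> 0" and sym: "\<And>A B. M A B = M B A"
    and z: "\<And>a b. pr2 x M a b = 0" and n: "\<And>A. px x (M A) = 0"
  shows "M A B = 0"
proof -
  have expand: "U C = 0" if "\<And>a. pr x U a = 0" "px x U = 0" for U :: "4 \<Rightarrow> real" and C
  proof -
    have "(\<Sum>A\<in>UNIV. eta A * (U A * (if A = C then 1 else 0))) = (\<Sum>A\<in>UNIV. if A = C then eta C * U C else 0)"
      by (intro sum.cong refl) simp
    then have "eta C * U C = 0"
      using contr_pr[OF s, of U "\<lambda>A. if A = C then 1 else 0"] that by simp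
    then show ?thesis by (simp add: eta_def split: if_splits)
  qed
  have "pr x (M A) a = 0" for A a
  proof (rule expand[of "\<lambda>A. pr x (M A) a"])
    show "pr x (\<lambda>A. pr x (M A) a) b = 0" for b using z[of b a] by (simp add: pr2_def)
    have "px x (\<lambda>A. pr x (M A) a) = pr x (\<lambda>B. px x (\<lambda>A. M A B)) a" by (rule pr_px_swap[symmetric])
    also have "\<dots> = 0" using n by (simp add: sym[of _ "_ :: 4"] pr_zero)
    finally show "px x (\<lambda>A. pr x (M A) a) = 0" .
  qed
  then show ?thesis using expand[of "M A" B] n by blast
qed

text \<open>Every differential equation is read off at points of the hyperboloid in the spherical
  chart and carried along rays by homogeneity, because the locale asks for it on an open set of
  Minkowski space.\<close>

lemma killing_charge_fields:
  assumes \<sigma>: "smooth_function \<sigma>" and h: "smooth_symmetric_tensor h2"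
    and e: "asymptotic_einstein \<sigma> h2" and k: "killing \<xi>"
  shows "killing_charge (Sgf \<sigma>) Vc (Hf h2) (Xif \<xi>)"
proof -
  have f0: "smooth_on U0 (\<lambda>y. \<sigma> (psi0 y))"
    using \<sigma> chart_psi0 by (simp add: smooth_function_def)
  have smS: "smc (Sgf \<sigma>)"
    unfolding Sgf_def by (rule smc_mult[OF smc_qs(1) smc_comp_qv[OF f0]])
  have euS: "euler 1 (Sgf \<sigma>)"
    unfolding Sgf_def using euler_mult[OF smc_qs(1) smc_comp_qv[OF f0] euler_rad euler_comp_qv[OF f0]] by simp
  have hb: "bilinear (h2 p)" if "p \<in> dS" for p
    using h that by (simp add: smooth_symmetric_tensor_def)
  have h0s: "smooth_on U0 (\<lambda>y. comp2 psi0 h2 y [i, j])" for i j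
    using h chart_psi0 by (simp add: smooth_symmetric_tensor_def)
  have kv: "smooth_vector_field \<xi>" using k by (simp add: killing_def)
  note l0 = smooth_lower[OF kv]
  note P0 = comp0_pull0[of \<sigma>]
  have P2: "comp2 sph_chart h2 = pull2 (Hf h2)" by (rule comp2_pull2) (rule hb)
  have E: "box_op gS (pull0 (Sgf \<sigma>)) x [] + 3 * pull0 (Sgf \<sigma>) x [] = 0"
    "(\<Sum>a\<in>UNIV. up gS 0 (pull2 (Hf h2)) x [a, a]) = 12 * (pull0 (Sgf \<sigma>) x [])\<^sup>2 + grad_sq gS (pull0 (Sgf \<sigma>)) x"
    "(\<Sum>b\<in>UNIV. up gS 2 (cov gS (pull2 (Hf h2))) x [a, b, b]) =
      cov gS (\<lambda>y _. grad_sq gS (pull0 (Sgf \<sigma>)) y + 8 * (pull0 (Sgf \<sigma>) y [])\<^sup>2) x [a]"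
    "box_op gS (pull2 (Hf h2)) x [a, b] - 2 * pull2 (Hf h2) x [a, b] =
      (cov gS ^^ 2) (\<lambda>y _. 5 * (pull0 (Sgf \<sigma>) y [])\<^sup>2 + grad_sq gS (pull0 (Sgf \<sigma>)) y) x [b, a]
      + gS x $ a $ b * (- 18 * (pull0 (Sgf \<sigma>) x [])\<^sup>2 + 4 * grad_sq gS (pull0 (Sgf \<sigma>)) x)
      + 4 * pull0 (Sgf \<sigma>) x [] * (cov gS ^^ 2) (pull0 (Sgf \<sigma>)) x [a, b]"
    if x: "x \<in> sbox" for x a b
  proof -
    have "box_op gS (pull0 (Sgf \<sigma>)) x [] + 3 * pull0 (Sgf \<sigma>) x [] = 0
      \<and> (\<Sum>a\<in>UNIV. up gS 0 (pull2 (Hf h2)) x [a, a]) = 12 * (pull0 (Sgf \<sigma>) x [])\<^sup>2 + grad_sq gS (pull0 (Sgf \<sigma>)) x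
      \<and> (\<forall>a. (\<Sum>b\<in>UNIV. up gS 2 (cov gS (pull2 (Hf h2))) x [a, b, b]) =
        cov gS (\<lambda>y _. grad_sq gS (pull0 (Sgf \<sigma>)) y + 8 * (pull0 (Sgf \<sigma>) y [])\<^sup>2) x [a])
      \<and> (\<forall>a b. box_op gS (pull2 (Hf h2)) x [a, b] - 2 * pull2 (Hf h2) x [a, b] =
        (cov gS ^^ 2) (\<lambda>y _. 5 * (pull0 (Sgf \<sigma>) y [])\<^sup>2 + grad_sq gS (pull0 (Sgf \<sigma>)) y) x [b, a]
        + gS x $ a $ b * (- 18 * (pull0 (Sgf \<sigma>) x [])\<^sup>2 + 4 * grad_sq gS (pull0 (Sgf \<sigma>)) x)
        + 4 * pull0 (Sgf \<sigma>) x [] * (cov gS ^^ 2) (pull0 (Sgf \<sigma>)) x [a, b])"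
      using e chart_sph x unfolding asymptotic_einstein_def Let_def P0[symmetric] P2[symmetric] by blast
    then show "box_op gS (pull0 (Sgf \<sigma>)) x [] + 3 * pull0 (Sgf \<sigma>) x [] = 0"
      "(\<Sum>a\<in>UNIV. up gS 0 (pull2 (Hf h2)) x [a, a]) = 12 * (pull0 (Sgf \<sigma>) x [])\<^sup>2 + grad_sq gS (pull0 (Sgf \<sigma>)) x"
      "(\<Sum>b\<in>UNIV. up gS 2 (cov gS (pull2 (Hf h2))) x [a, b, b]) =
      cov gS (\<lambda>y _. grad_sq gS (pull0 (Sgf \<sigma>)) y + 8 * (pull0 (Sgf \<sigma>) y [])\<^sup>2) x [a]"
      "box_op gS (pull2 (Hf h2)) x [a, b] - 2 * pull2 (Hf h2) x [a, b] =
      (cov gS ^^ 2) (\<lambda>y _. 5 * (pull0 (Sgf \<sigma>) y [])\<^sup>2 + grad_sq gS (pull0 (Sgf \<sigma>)) y) x [b, a]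
      + gS x $ a $ b * (- 18 * (pull0 (Sgf \<sigma>) x [])\<^sup>2 + 4 * grad_sq gS (pull0 (Sgf \<sigma>)) x)
      + 4 * pull0 (Sgf \<sigma>) x [] * (cov gS ^^ 2) (pull0 (Sgf \<sigma>)) x [a, b]"
      by (elim conjE; simp only:)+
  qed
  \<comment> \<open>For degree 1 the covariant wave operator is the tangential trace of the flat
    Hessian minus 3 \<Sigma>, which the +3 in the field equation compensates. The Hessian has no
    normal part.\<close>
  have tr_emb: "(\<Sum>A\<in>UNIV. eta A * D4 A (D4 A (Sgf \<sigma>)) (emb x)) = 0" if x: "x \<in> sbox" for x
  proof -
    have s: "sin (x $ 2) \<noteq> 0" using sbox_sin[OF x] by simp
    have wg: "wt x a * gd x a a = 1" for a
      using s cosh_ne_0[of "x $ 1"] by (simp add: wt_def gd_def)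
    let ?M = "\<lambda>A B. D4 B (D4 A (Sgf \<sigma>)) (emb x)"
    have 1: "px x (\<lambda>A. D4 A (Sgf \<sigma>) (emb x)) = Sgf \<sigma> (emb x)"
      using euS emb_cone by (simp add: euler_def px_def)
    have "euler 0 (D4 A (Sgf \<sigma>))" for A using euler_D4[OF smS euS] by simp
    then have 2: "px x (?M A) = 0" for A using emb_cone by (simp add: euler_def px_def)
    have "box_op gS (pull0 (Sgf \<sigma>)) x [] = (\<Sum>c\<in>UNIV. wt x c * (cov gS ^^ 2) (pull0 (Sgf \<sigma>)) x [c, c])"
      by (simp add: box_op_def ginv_gS[OF s] if_distrib[of "\<lambda>c. c * _"] cong: if_cong)
    also have "\<dots> = (\<Sum>c\<in>UNIV. wt x c * pr2 x ?M c c) - (\<Sum>c\<in>UNIV. wt x c * gd x c c) * Sgf \<sigma> (emb x)"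
      unfolding cov_scalar2[OF x smS] 1 by (simp add: right_diff_distrib sum_subtractf sum_distrib_right mult.assoc)
    finally have "(\<Sum>c\<in>UNIV. wt x c * pr2 x ?M c c) = 0"
      using E(1)[OF x] by (simp add: wg pull0_def)
    then show ?thesis using contr_bil[OF s, of ?M] by (simp add: 2 px_zero)
  qed
  have scS: "Sgf \<sigma> (t *\<^sub>R X) = t * Sgf \<sigma> X" if "t > 0" for t X
    using that by (simp add: Sgf_def scale_qs)
  have D2sc: "D4 B (D4 A (Sgf \<sigma>)) (t *\<^sub>R X) = (1 / t) * D4 B (D4 A (Sgf \<sigma>)) X" if t: "t > 0" and X: "X \<in> cone" for t X A B
  proof (rule D4_scale[OF smc_D4[OF smS] t _ X])
    show "D4 A (Sgf \<sigma>) (t *\<^sub>R Y) = 1 * D4 A (Sgf \<sigma>) Y" if "Y \<in> cone" for Y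
      using D4_scale[OF smS t scS[OF t] that, of A] t by simp
  qed
  have trV: "(\<Sum>A\<in>UNIV. eta A * D4 A (D4 A (Sgf \<sigma>)) X) = 0" if X: "X \<in> Vc" for X
  proof -
    obtain t x where tx: "t > 0" "x \<in> sbox" "X = t *\<^sub>R emb x" using Vc_param[OF X] .
    have "(\<Sum>A\<in>UNIV. eta A * D4 A (D4 A (Sgf \<sigma>)) X) = (1 / t) * (\<Sum>A\<in>UNIV. eta A * D4 A (D4 A (Sgf \<sigma>)) (emb x))"
      unfolding tx(3) D2sc[OF tx(1) emb_cone] sum_distrib_left by (simp only: mult.left_commute)
    then show ?thesis using tr_emb[OF tx(2)] by simp
  qed
  have smX: "smc (Xif \<xi> A)" for A
    unfolding Xif_def by (intro smc_mult smc_mink smc_sum smc_comp_qv[OF l0] smc_D4 smc_qs)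
  have euX: "euler 1 (Xif \<xi> A)" for A
  proof -
    have "euler (- 1) (\<lambda>X. \<Sum>i\<in>UNIV. lower_comp psi0 \<xi> (qv X) [i] * D4 A (qc i) X)"
    proof (rule euler_sum)
      show "smc (\<lambda>X. lower_comp psi0 \<xi> (qv X) [i] * D4 A (qc i) X)" for i
        by (intro smc_mult smc_comp_qv[OF l0] smc_D4 smc_qs)
      show "euler (- 1) (\<lambda>X. lower_comp psi0 \<xi> (qv X) [i] * D4 A (qc i) X)" for i
        using euler_mult[OF smc_comp_qv[OF l0] smc_D4[OF smc_qs(3)] euler_comp_qv[OF l0] euler_D4_qc] by simp
    qed
    from euler_mult[OF smc_mink _ euler_mink this] show ?thesis
      unfolding Xif_def by (simp add: smc_sum smc_mult smc_comp_qv[OF l0] smc_D4 smc_qs)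
  qed
  have qt: "(\<Sum>A\<in>UNIV. D4 A (qc i) X * X $ A) = 0" if "X \<in> cone" for X i
    using euler_qc[of i] that by (simp add: euler_def)
  have Xt: "(\<Sum>A\<in>UNIV. Xif \<xi> A X * X $ A) = 0" if X: "X \<in> cone" for X
  proof -
    have "(\<Sum>A\<in>UNIV. Xif \<xi> A X * X $ A) = mink X * (\<Sum>i\<in>UNIV. lower_comp psi0 \<xi> (qv X) [i] * (\<Sum>A\<in>UNIV. D4 A (qc i) X * X $ A))"
      unfolding Xif_def by (simp add: sum_distrib_left sum_distrib_right mult.assoc) (rule sum.swap)
    then show ?thesis by (simp add: qt[OF X])
  qed
  \<comment> \<open>The tangential part is the Killing equation. In the normal part the contraction
    with the derivative index gives +Xi by the degree 1, the one with the field index gives -Xi by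
    tangency, so the symmetrized derivative vanishes entirely.\<close>
  have k_emb: "D4 B (Xif \<xi> A) (emb x) + D4 A (Xif \<xi> B) (emb x) = 0" if x: "x \<in> sbox" for x A B
  proof -
    have s: "sin (x $ 2) \<noteq> 0" using sbox_sin[OF x] by simp
    note X = emb_cone[of x]
    let ?N = "\<lambda>A B. D4 B (Xif \<xi> A) (emb x)"
    have x0: "px x (\<lambda>A. Xif \<xi> A (emb x)) = 0" using Xt[OF X] by (simp add: px_def)
    have cv: "cov gS (pull1 (Xif \<xi>)) x [a, b] = pr2 x ?N a b" for a b
      using cov_pull1_pr[where T="Xif \<xi>" and T'="\<lambda>A B. D4 B (Xif \<xi> A)", OF s has_grad_D4[OF smX X], of a b] x0 by simp
    have "cov gS (pull1 (Xif \<xi>)) x [a, b] + cov gS (pull1 (Xif \<xi>)) x [b, a] = 0" for a b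
      using k chart_sph x unfolding killing_def lower_pull1[symmetric] by blast
    then have z: "pr2 x ?N a b + pr2 x ?N b a = 0" for a b unfolding cv .
    have r1: "px x (?N A) = Xif \<xi> A (emb x)" for A
      using euX[of A] X by (simp add: euler_def px_def)
    have r2: "px x (\<lambda>A. ?N A B) = - Xif \<xi> B (emb x)" for B
    proof -
      have "D4 B (\<lambda>X. \<Sum>A\<in>UNIV. Xif \<xi> A X * X $ A) (emb x) = D4 B (\<lambda>X. 0) (emb x)"
        by (rule D4_cong_cone[OF X]) (rule Xt)
      moreover have "D4 B (\<lambda>X. \<Sum>A\<in>UNIV. Xif \<xi> A X * X $ A) (emb x) = px x (\<lambda>A. ?N A B) + Xif \<xi> B (emb x)"
      proof -
        have "D4 B (\<lambda>X. \<Sum>A\<in>UNIV. Xif \<xi> A X * X $ A) (emb x) = (\<Sum>A\<in>UNIV. D4 B (\<lambda>X. Xif \<xi> A X * X $ A) (emb x))"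
          by (intro D4_sum smc_intros smX X)
        also have "\<dots> = (\<Sum>A\<in>UNIV. ?N A B * emb x $ A + Xif \<xi> A (emb x) * (if B = A then 1 else 0))"
          by (simp only: D4_mult[OF smX smc_nth X] D4_nth[OF X])
        finally show ?thesis by (simp add: px_def sum.distrib if_distrib[of "\<lambda>c. _ * c"] cong: if_cong)
      qed
      ultimately show ?thesis by (simp add: D4_const)
    qed
    show ?thesis
    proof (rule pr2_px_zero[OF s, of "\<lambda>A B. ?N A B + ?N B A"])
      show "pr2 x (\<lambda>A B. ?N A B + ?N B A) a b = 0" for a b
      proof -
        have "pr2 x (\<lambda>A B. ?N B A) a b = pr2 x ?N b a" unfolding pr2_def by (rule pr_swap)
        then show ?thesis unfolding pr2_add using z[of a b] by simp
      qed
      show "px x (\<lambda>B. ?N A B + ?N B A) = 0" for A unfolding px_add r1 r2 by simp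
    qed simp
  qed
  have scX: "Xif \<xi> A (t *\<^sub>R X) = t * Xif \<xi> A X" if t: "t > 0" and X: "X \<in> cone" for t X A
  proof -
    have "D4 A (qc i) (t *\<^sub>R X) = (1 / t) * D4 A (qc i) X" for i
      by (rule D4_scale[OF smc_qs(3) t _ X]) (simp add: scale_qs(3)[OF t])
    then show ?thesis
      using t by (simp add: Xif_def scale_qs(4)[OF t] mink_scale power2_eq_square sum_distrib_left mult_ac)
  qed
  have kV: "D4 B (Xif \<xi> A) X = - D4 A (Xif \<xi> B) X" if X: "X \<in> Vc" for X A B
  proof -
    obtain t x where tx: "t > 0" "x \<in> sbox" "X = t *\<^sub>R emb x" using Vc_param[OF X] .
    have "D4 B (Xif \<xi> A) X = D4 B (Xif \<xi> A) (emb x)" for A B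
      unfolding tx(3) using D4_scale[OF smX tx(1) scX[OF tx(1)] emb_cone, of B A] tx(1) by simp
    then show ?thesis using k_emb[OF tx(2), of B A] by simp
  qed
  have cs: "comp2 psi0 h2 y [i, j] = comp2 psi0 h2 y [j, i]" if y: "y \<in> U0" for y i j
  proof -
    have "h2 p u v = h2 p v u" if "p \<in> dS" "tangent dS p u" "tangent dS p v" for p u v
      using h that unfolding smooth_symmetric_tensor_def by blast
    from this[OF psi0_dS[OF y] tangent_frame[OF y] tangent_frame[OF y]]
    show ?thesis by (simp add: comp2_def)
  qed
  show ?thesis
  proof
    show "Vc \<subseteq> cone" by (simp add: Vc_def)
    show "smc (Hf h2 A B)" for A B
      unfolding Hf_def by (intro smc_sum smc_mult smc_comp_qv[OF h0s] smc_D4 smc_qs)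
    show "Hf h2 A B X = Hf h2 B A X" if X: "X \<in> cone" for A B X
      unfolding Hf_def by (subst sum.swap) (simp add: cs[OF qv_U0[OF X]] mult_ac)
    show "euler (- 2) (Hf h2 A B)" for A B
      unfolding Hf_def
    proof (intro euler_sum smc_sum)
      fix i j
      show "smc (\<lambda>X. comp2 psi0 h2 (qv X) [i, j] * (D4 A (qc i) X * D4 B (qc j) X))"
        by (intro smc_mult smc_comp_qv[OF h0s] smc_D4 smc_qs)
      have "euler (- 2) (\<lambda>X. D4 A (qc i) X * D4 B (qc j) X)"
        using euler_mult[OF smc_D4[OF smc_qs(3)] smc_D4[OF smc_qs(3)] euler_D4_qc euler_D4_qc] by simp
      from euler_mult[OF smc_comp_qv[OF h0s] _ euler_comp_qv[OF h0s] this]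
      show "euler (- 2) (\<lambda>X. comp2 psi0 h2 (qv X) [i, j] * (D4 A (qc i) X * D4 B (qc j) X))"
        by (simp add: smc_mult smc_D4 smc_qs)
    qed (intro smc_mult smc_comp_qv[OF h0s] smc_D4 smc_qs)
    show "(\<Sum>A\<in>UNIV. Hf h2 A B X * X $ A) = 0" if X: "X \<in> cone" for B X
    proof -
      have "(\<Sum>A\<in>UNIV. Hf h2 A B X * X $ A) = (\<Sum>i\<in>UNIV. \<Sum>j\<in>UNIV. comp2 psi0 h2 (qv X) [i, j] * D4 B (qc j) X * (\<Sum>A\<in>UNIV. D4 A (qc i) X * X $ A))"
        unfolding Hf_def sum_distrib_left sum_distrib_right
        by (subst sum.swap, rule sum.cong[OF refl], subst sum.swap) (simp only: mult_ac)
      then show ?thesis by (simp add: qt[OF X])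
    qed
  qed (rule smS euS open_Vc smX euX | erule emb_Vc trV Xt kV E(2-4))+
qed

section \<open>Stokes' theorem on the rectangle\<close>

lemma smooth_on_partials:
  fixes f :: "real \<times> real \<Rightarrow> real"
  assumes f: "smooth_on UNIV f"
  shows "((\<lambda>t. f (t, y)) has_real_derivative frechet_derivative f (at (x, y)) (1, 0)) (at x)"
    and "((\<lambda>t. f (x, t)) has_real_derivative frechet_derivative f (at (x, y)) (0, 1)) (at y)"
proof -
  let ?D = "frechet_derivative f (at (x, y))"
  have D: "(f has_derivative ?D) (at (x, y))" by (rule smooth_on_has_derivative[OF f UNIV_I])
  interpret bounded_linear ?D by (rule has_derivative_bounded_linear[OF D])
  have 1: "((\<lambda>t. (t, y)) has_derivative (\<lambda>h. (h, 0))) (at x)"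
    by (rule has_derivative_Pair[OF has_derivative_ident has_derivative_const])
  have 2: "((\<lambda>t. (x, t)) has_derivative (\<lambda>h. (0, h))) (at y)"
    by (rule has_derivative_Pair[OF has_derivative_const has_derivative_ident])
  have "?D (h, 0) = ?D (1, 0) * h" "?D (0, h) = ?D (0, 1) * h" for h :: real
    using scaleR[of h "(1, 0)"] scaleR[of h "(0, 1)"] by (simp_all add: mult.commute)
  then have 3: "(\<lambda>h. ?D (h, 0)) = (*) (?D (1, 0))" "(\<lambda>h. ?D (0, h)) = (*) (?D (0, 1))"
    by (intro ext, blast)+
  show "((\<lambda>t. f (t, y)) has_real_derivative ?D (1, 0)) (at x)" "((\<lambda>t. f (x, t)) has_real_derivative ?D (0, 1)) (at y)"
    using has_derivative_compose[OF 1 D] has_derivative_compose[OF 2 D] unfolding has_field_derivative_def 3 .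
qed

text \<open>Green's theorem for the 1-form b d\<theta> + a d\<phi>. The pole edges see only a, which
  vanishes there, and the edges \<phi> = 0 and \<phi> = 2 pi cancel by periodicity of b.\<close>

lemma stokes_box:
  fixes a b :: "real \<times> real \<Rightarrow> real"
  assumes a: "smooth_on UNIV a" and b: "smooth_on UNIV b"
    and a0: "\<And>\<phi>. a (0, \<phi>) = 0" and api: "\<And>\<phi>. a (pi, \<phi>) = 0" and bper: "\<And>\<theta>. b (\<theta>, 2 * pi) = b (\<theta>, 0)"
  defines "f w \<equiv> frechet_derivative a (at w) (1, 0) - frechet_derivative b (at w) (0, 1)"
  shows "set_integrable lborel ({0<..<pi} \<times> {0<..<2*pi}) f"
    and "(LINT w : {0<..<pi} \<times> {0<..<2*pi} | lborel. f w) = 0"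
proof -
  let ?B = "{0<..<pi} \<times> {0<..<2*pi}" and ?C = "cbox (0, 0) (pi, 2 * pi)"
  let ?fa = "\<lambda>w. frechet_derivative a (at w) (1, 0)" and ?fb = "\<lambda>w. frechet_derivative b (at w) (0, 1)"
  have ca: "continuous_on S ?fa" and cb: "continuous_on S ?fb" for S
    by (rule continuous_on_subset[OF smooth_on_continuous[OF smooth_on_frechet] subset_UNIV], rule a b)+
  have B: "?B = box (0, 0) (pi, 2 * pi)" by (simp add: box_prod)
  have cf: "continuous_on ?C f" unfolding f_def by (intro continuous_on_diff ca cb)
  have "set_integrable lborel ?C f"
    unfolding set_integrable_def by (rule borel_integrable_compact[OF compact_cbox cf])
  then show i: "set_integrable lborel ?B f"
    by (rule set_integrable_subset) (auto simp: B box_subset_cbox)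
  have Ia: "((\<lambda>x. ?fa (x, y)) has_integral a (pi, y) - a (0, y)) {0..pi}" for y
    by (rule fundamental_theorem_of_calculus[where f="\<lambda>x. a (x, y)"])
      (simp, rule has_vector_derivative_at_within, rule iffD1[OF has_real_derivative_iff_has_vector_derivative], rule smooth_on_partials(1)[OF a])
  have Ib: "((\<lambda>y. ?fb (x, y)) has_integral b (x, 2 * pi) - b (x, 0)) {0..2*pi}" for x
    by (rule fundamental_theorem_of_calculus[where f="\<lambda>y. b (x, y)"])
      (simp, rule has_vector_derivative_at_within, rule iffD1[OF has_real_derivative_iff_has_vector_derivative], rule smooth_on_partials(2)[OF b])
  have "integral ?C ?fa = integral (cbox 0 pi) (\<lambda>x. integral (cbox 0 (2*pi)) (\<lambda>y. ?fa (x, y)))"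
    by (rule integral_prod_continuous[OF ca])
  moreover have "\<dots> = integral (cbox 0 (2*pi)) (\<lambda>y. integral (cbox 0 pi) (\<lambda>x. ?fa (x, y)))"
    by (rule integral_swap_continuous) (unfold case_prod_beta prod.collapse, rule ca)
  moreover have "integral (cbox 0 pi) (\<lambda>x. ?fa (x, y)) = 0" for y
    using integral_unique[OF Ia] by (simp add: a0 api)
  ultimately have 1: "integral ?C ?fa = 0" by simp
  have "integral ?C ?fb = integral (cbox 0 pi) (\<lambda>x. integral (cbox 0 (2*pi)) (\<lambda>y. ?fb (x, y)))"
    by (rule integral_prod_continuous[OF cb])
  moreover have "integral (cbox 0 (2*pi)) (\<lambda>y. ?fb (x, y)) = 0" for x
    using integral_unique[OF Ib] by (simp add: bper)
  ultimately have 2: "integral ?C ?fb = 0" by simp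
  have "(LINT w : ?B | lborel. f w) = integral ?C f"
    unfolding set_borel_integral_eq_integral(2)[OF i] unfolding B by (rule integral_open_interval)
  also have "\<dots> = integral ?C ?fa - integral ?C ?fb"
    unfolding f_def by (intro integral_diff integrable_continuous ca cb)
  finally show "(LINT w : ?B | lborel. f w) = 0" unfolding 1 2 by simp
qed

text \<open>No integrability of \<open>f\<close> is needed: the integral of a non-integrable function is 0.\<close>

lemma set_integral_diff_null:
  fixes f g :: "'a \<Rightarrow> real"
  assumes g: "set_integrable M A g" "(LINT x : A | M. g x) = 0"
  shows "(LINT x : A | M. f x - g x) = (LINT x : A | M. f x)"
proof (cases "set_integrable M A f")
  case True
  then show ?thesis using g by (simp add: set_integral_diff(2))
next
  case False
  have "\<not> set_integrable M A (\<lambda>x. f x - g x)"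
  proof
    assume "set_integrable M A (\<lambda>x. f x - g x)"
    from set_integral_add(1)[OF this g(1)] False show False by simp
  qed
  with False show ?thesis
    by (simp add: set_integrable_def set_lebesgue_integral_def not_integrable_integral_eq)
qed

section \<open>Unit normal and area element of the cut\<close>

locale smooth_cut =
  fixes S :: "pt set" and T :: "real^3 \<Rightarrow> real"
  assumes cut: "smooth_Cauchy_cut S T"
begin

definition tau :: "real \<times> real \<Rightarrow> real" where "tau w = T (sph (fst w) (snd w))"
definition dtau :: "real \<times> real \<Rightarrow> real \<times> real \<Rightarrow> real" where "dtau w v = frechet_derivative tau (at w) v"
definition xc :: "real \<times> real \<Rightarrow> real^3" where "xc w = cut_coords T (fst w) (snd w)"

lemma xc_nth: "xc w $ 1 = tau w" "xc w $ 2 = fst w" "xc w $ 3 = snd w"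
  by (simp_all add: xc_def cut_coords_def tau_def)

lemma smooth_fst_snd: "smooth_on UNIV (fst :: real \<times> real \<Rightarrow> real)" "smooth_on UNIV (snd :: real \<times> real \<Rightarrow> real)"
  by (auto intro: smooth_on_bounded_linear bounded_linear_fst bounded_linear_snd)

text \<open>The unit sphere lies inside the domain of the global chart, and there T is smooth along
  it; composing with \<open>sph\<close> gives smoothness for all angles, including those of the
  poles.\<close>

lemma smooth_tau: "smooth_on UNIV tau"
proof -
  have "smooth_function (\<lambda>p. T (snd p))" using cut by (simp add: smooth_Cauchy_cut_def)
  then have t: "smooth_on U0 (\<lambda>y. T (snd (psi0 y)))" using chart_psi0 by (simp add: smooth_function_def)
  have sp: "smooth_on UNIV (\<lambda>w::real \<times> real. sph (fst w) (snd w))"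
  proof (rule smooth_on_vec)
    have "\<forall>i. smooth_on UNIV (\<lambda>w::real \<times> real. sph (fst w) (snd w) $ i)"
      unfolding forall_3 sph_nth
      by (intro conjI smooth_on_mult smooth_on_sin_comp smooth_on_cos_comp open_UNIV smooth_fst_snd)
    then show "smooth_on UNIV (\<lambda>w::real \<times> real. sph (fst w) (snd w) $ i)" for i by blast
  qed simp
  have n0: "sph a b \<noteq> 0" for a b using norm_sph[of a b] by auto
  have "smooth_on UNIV (\<lambda>w::real \<times> real. T (snd (psi0 (sph (fst w) (snd w)))))"
    by (rule smooth_on_compose[OF open_UNIV open_U0 t sp]) (use n0 in auto)
  then show ?thesis by (simp add: psi0_def norm_sph tau_def[abs_def])
qed

lemma tau_derivative: "(tau has_derivative dtau w) (at w)"
  unfolding dtau_def[abs_def] by (rule smooth_on_has_derivative[OF smooth_tau]) simp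

lemma xc_sbox: "w \<in> {0<..<pi} \<times> {0<..<2*pi} \<Longrightarrow> xc w \<in> sbox"
  by (auto simp: sbox_def xc_nth)

lemma sph_chart_xc: "sph_chart (xc w) = cut_point T (fst w) (snd w)"
  by (simp add: sph_chart_def xc_nth cut_point_def tau_def)

lemma dtau_sum: "dtau w (u, v) = u * dtau w (1, 0) + v * dtau w (0, 1)"
proof -
  interpret bounded_linear "dtau w" by (rule has_derivative_bounded_linear[OF tau_derivative])
  have "(u, v) = u *\<^sub>R (1, 0) + v *\<^sub>R (0, 1)" by simp
  then show ?thesis unfolding add scaleR by (simp only: add scaleR real_scaleR_def)
qed

lemma xc_derivative: "(xc has_derivative (\<lambda>v. vector [dtau w v, fst v, snd v])) (at w)"
proof (subst has_derivative_componentwise_within, rule ballI)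
  fix i :: "real^3" assume "i \<in> Basis"
  then obtain k :: 3 where i: "i = axis k 1" by (auto simp: Basis_vec_def)
  have "((\<lambda>x. xc x $ k) has_derivative (\<lambda>v. vector [dtau w v, fst v, snd v] $ k)) (at w)"
    using exhaust_3[of k] tau_derivative[of w] bounded_linear_imp_has_derivative[OF bounded_linear_fst, of "at w"]
      bounded_linear_imp_has_derivative[OF bounded_linear_snd, of "at w"]
    by (elim disjE) (simp_all add: xc_nth)
  then show "((\<lambda>x. xc x \<bullet> i) has_derivative (\<lambda>v. vector [dtau w v, fst v, snd v] \<bullet> i)) (at w)"
    by (simp add: i inner_axis)
qed

lemma cut_point_derivative:
  "((\<lambda>w. cut_point T (fst w) (snd w)) has_derivative
    (\<lambda>v. dtau w v *\<^sub>R frame sph_chart (xc w) 1 + fst v *\<^sub>R frame sph_chart (xc w) 2 + snd v *\<^sub>R frame sph_chart (xc w) 3)) (at w)"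
proof -
  let ?D = "frechet_derivative sph_chart (at (xc w))"
  have d: "(sph_chart has_derivative ?D) (at (xc w))"
    by (rule frechet_derivative_works[THEN iffD1, OF differentiableI[OF has_derivative_sph_chart]])
  interpret bounded_linear ?D by (rule has_derivative_bounded_linear[OF d])
  have "(vector [a, b, c] :: real^3) = a *\<^sub>R axis 1 1 + b *\<^sub>R axis 2 1 + c *\<^sub>R axis 3 1" for a b c :: real
    by (simp add: vec_eq_iff forall_3 axis_def)
  then have "?D (vector [a, b, c]) = a *\<^sub>R frame sph_chart (xc w) 1 + b *\<^sub>R frame sph_chart (xc w) 2 + c *\<^sub>R frame sph_chart (xc w) 3" for a b c
    by (simp only: add scaleR frame_def)
  with has_derivative_compose[OF xc_derivative d] show ?thesis by (simp add: sph_chart_xc)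
qed

lemma has_vector_derivative_theta:
  "((\<lambda>t. cut_point T t (snd w)) has_vector_derivative
    (frame sph_chart (xc w) 2 + dtau w (1, 0) *\<^sub>R frame sph_chart (xc w) 1)) (at (fst w))"
proof -
  have d: "((\<lambda>t. (t, snd w)) has_derivative (\<lambda>h. (h, 0))) (at (fst w))"
    by (rule has_derivative_Pair[OF has_derivative_ident has_derivative_const])
  have e: "dtau w (h, 0) = h * dtau w (1, 0)" for h using dtau_sum[of w h 0] by simp
  have "(\<lambda>h. dtau w (h, 0) *\<^sub>R frame sph_chart (xc w) 1 + fst (h, 0::real) *\<^sub>R frame sph_chart (xc w) 2 + snd (h, 0) *\<^sub>R frame sph_chart (xc w) 3)
    = (\<lambda>h. h *\<^sub>R (frame sph_chart (xc w) 2 + dtau w (1, 0) *\<^sub>R frame sph_chart (xc w) 1))"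
    by (rule ext, subst e) (simp add: scaleR_add_right)
  from has_derivative_compose[OF d, where g="\<lambda>w. cut_point T (fst w) (snd w)", unfolded prod.collapse, OF cut_point_derivative, unfolded this]
  show ?thesis unfolding has_vector_derivative_def fst_conv snd_conv .
qed

lemma has_vector_derivative_phi:
  "((\<lambda>t. cut_point T (fst w) t) has_vector_derivative
    (frame sph_chart (xc w) 3 + dtau w (0, 1) *\<^sub>R frame sph_chart (xc w) 1)) (at (snd w))"
proof -
  have d: "((\<lambda>t. (fst w, t)) has_derivative (\<lambda>h. (0, h))) (at (snd w))"
    by (rule has_derivative_Pair[OF has_derivative_const has_derivative_ident])
  have e: "dtau w (0, h) = h * dtau w (0, 1)" for h using dtau_sum[of w 0 h] by simp
  have "(\<lambda>h. dtau w (0, h) *\<^sub>R frame sph_chart (xc w) 1 + fst (0, h::real) *\<^sub>R frame sph_chart (xc w) 2 + snd (0, h) *\<^sub>R frame sph_chart (xc w) 3)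
    = (\<lambda>h. h *\<^sub>R (frame sph_chart (xc w) 3 + dtau w (0, 1) *\<^sub>R frame sph_chart (xc w) 1))"
    by (rule ext, subst e) (simp add: scaleR_add_right)
  from has_derivative_compose[OF d, where g="\<lambda>w. cut_point T (fst w) (snd w)", unfolded prod.collapse, OF cut_point_derivative, unfolded this]
  show ?thesis unfolding has_vector_derivative_def fst_conv snd_conv .
qed

lemma cut_point_S: "cut_point T \<theta> \<phi> \<in> S"
proof -
  have "S = {(T \<omega>, \<omega>) | \<omega>. \<omega> \<in> sphere 0 1}" using cut unfolding smooth_Cauchy_cut_def by blast
  then show ?thesis by (auto simp: cut_point_def norm_sph)
qed

lemma tangent_S:
  shows "tangent S (sph_chart (xc w)) (frame sph_chart (xc w) 2 + dtau w (1, 0) *\<^sub>R frame sph_chart (xc w) 1)"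
    and "tangent S (sph_chart (xc w)) (frame sph_chart (xc w) 3 + dtau w (0, 1) *\<^sub>R frame sph_chart (xc w) 1)"
proof -
  have d: "((\<lambda>t. a + t) has_derivative (\<lambda>h. h)) (at 0)" for a :: real by (auto intro!: derivative_eq_intros)
  show "tangent S (sph_chart (xc w)) (frame sph_chart (xc w) 2 + dtau w (1, 0) *\<^sub>R frame sph_chart (xc w) 1)"
    unfolding tangent_def
  proof (intro exI[of _ "\<lambda>t. cut_point T (fst w + t) (snd w)"] conjI allI cut_point_S)
    show "cut_point T (fst w + 0) (snd w) = sph_chart (xc w)" by (simp add: sph_chart_xc)
    show "((\<lambda>t. cut_point T (fst w + t) (snd w)) has_vector_derivative
      frame sph_chart (xc w) 2 + dtau w (1, 0) *\<^sub>R frame sph_chart (xc w) 1) (at 0)"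
      using has_vector_derivative_theta[of w] unfolding has_vector_derivative_def
      by (intro has_derivative_compose[OF d]) simp
  qed
  show "tangent S (sph_chart (xc w)) (frame sph_chart (xc w) 3 + dtau w (0, 1) *\<^sub>R frame sph_chart (xc w) 1)"
    unfolding tangent_def
  proof (intro exI[of _ "\<lambda>t. cut_point T (fst w) (snd w + t)"] conjI allI cut_point_S)
    show "cut_point T (fst w) (snd w + 0) = sph_chart (xc w)" by (simp add: sph_chart_xc)
    show "((\<lambda>t. cut_point T (fst w) (snd w + t)) has_vector_derivative
      frame sph_chart (xc w) 3 + dtau w (0, 1) *\<^sub>R frame sph_chart (xc w) 1) (at 0)"
      using has_vector_derivative_phi[of w] unfolding has_vector_derivative_def
      by (intro has_derivative_compose[OF d]) simp
  qed
qed

end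

text \<open>Differentiate the unit length of the spherical part of the curve.\<close>

lemma tangent_dS_orth:
  assumes "tangent dS p v"
  shows "snd v \<bullet> snd p = 0"
proof -
  obtain c where c: "\<And>t. c t \<in> dS" "c 0 = p" "(c has_vector_derivative v) (at 0)"
    using assms unfolding tangent_def by blast
  have s: "((\<lambda>t. snd (c t)) has_derivative (\<lambda>h. h *\<^sub>R snd v)) (at 0)"
    using has_derivative_snd[OF c(3)[unfolded has_vector_derivative_def]] by simp
  have "norm (snd (c t)) = 1" for t using c(1)[of t] by (auto simp: dS_def)
  then have "(\<lambda>t. snd (c t) \<bullet> snd (c t)) = (\<lambda>t. 1)" by (simp add: norm_eq_1)
  with has_derivative_inner[OF s s]
  have "((\<lambda>t::real. 1::real) has_derivative (\<lambda>h. snd (c 0) \<bullet> (h *\<^sub>R snd v) + (h *\<^sub>R snd v) \<bullet> snd (c 0))) (at 0)" by simp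
  from has_derivative_unique[OF this has_derivative_const]
  have "(\<lambda>h. snd (c 0) \<bullet> (h *\<^sub>R snd v) + (h *\<^sub>R snd v) \<bullet> snd (c 0)) = (\<lambda>h. 0)" .
  from fun_cong[OF this, of 1] show ?thesis by (simp add: c(2) inner_commute)
qed

lemma frame_sph_chart_eq:
  "frame sph_chart x 1 = (1, 0)"
  "frame sph_chart x 2 = (0, vector [cos (x $ 2) * cos (x $ 3), cos (x $ 2) * sin (x $ 3), - sin (x $ 2)])"
  "frame sph_chart x 3 = (0, vector [- (sin (x $ 2) * sin (x $ 3)), sin (x $ 2) * cos (x $ 3), 0])"
  unfolding frame_def frechet_derivative_at[OF has_derivative_sph_chart, symmetric]
  by (simp_all add: axis_def vec_eq_iff forall_3)

text \<open>On the tangent plane of the sphere the coordinate vectors are orthogonal with lengths 1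
  and sin \<theta>. The proof rotates by \<phi> in the horizontal plane and then by
  \<theta>.\<close>

lemma inner_sph_frame:
  fixes x :: "real^3" and z :: "real^3"
  assumes z: "z \<bullet> sph (x $ 2) (x $ 3) = 0" and s: "sin (x $ 2) \<noteq> 0"
  shows "z \<bullet> z = (z \<bullet> snd (frame sph_chart x 2))\<^sup>2 + (z \<bullet> snd (frame sph_chart x 3))\<^sup>2 / (sin (x $ 2))\<^sup>2"
proof -
  define a where "a = z $ 1 * cos (x $ 3) + z $ 2 * sin (x $ 3)"
  define b where "b = z $ 2 * cos (x $ 3) - z $ 1 * sin (x $ 3)"
  let ?c = "cos (x $ 2)" and ?s = "sin (x $ 2)"
  have "a\<^sup>2 + b\<^sup>2 = ((z $ 1)\<^sup>2 + (z $ 2)\<^sup>2) * ((sin (x $ 3))\<^sup>2 + (cos (x $ 3))\<^sup>2)"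
    unfolding a_def b_def by algebra
  then have ab: "a\<^sup>2 + b\<^sup>2 = (z $ 1)\<^sup>2 + (z $ 2)\<^sup>2" by simp
  have 1: "?s * a + ?c * z $ 3 = 0"
    using z by (simp add: inner_vec_def sum_3 sph_nth a_def algebra_simps)
  have 2: "z \<bullet> snd (frame sph_chart x 2) = ?c * a - ?s * z $ 3"
    by (simp add: frame_sph_chart_eq inner_vec_def sum_3 a_def algebra_simps)
  have 3: "z \<bullet> snd (frame sph_chart x 3) = ?s * b"
    by (simp add: frame_sph_chart_eq inner_vec_def sum_3 b_def algebra_simps)
  have "(?c * a - ?s * z $ 3)\<^sup>2 + (?s * a + ?c * z $ 3)\<^sup>2 = (a\<^sup>2 + (z $ 3)\<^sup>2) * (?s\<^sup>2 + ?c\<^sup>2)" by algebra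
  then have "(?c * a - ?s * z $ 3)\<^sup>2 = a\<^sup>2 + (z $ 3)\<^sup>2" unfolding 1 by simp
  moreover have "z \<bullet> z = (z $ 1)\<^sup>2 + (z $ 2)\<^sup>2 + (z $ 3)\<^sup>2" by (simp add: inner_vec_def sum_3 power2_eq_square)
  ultimately show ?thesis unfolding 2 3 using ab s by (simp add: power_mult_distrib)
qed

lemma h0_frame: "h0 (sph_chart x) (frame sph_chart x a) (frame sph_chart x b) = gd x a b"
  using gS_nth[of x a b] by (simp add: met_def)

context smooth_cut
begin

text \<open>The normal is proportional to the gradient of T - \<tau> with raised index, that is, to
  (1, \<open>wt x 2\<close> \<partial>_\<theta> T, \<open>wt x 3\<close> \<partial>_\<phi> T).
  Normalization and area density combine so that the square roots cancel, leaving the volume factor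
  of the spherical coordinates.\<close>

lemma normal_components:
  assumes n: "future_unit_normal S n" and w: "w \<in> {0<..<pi} \<times> {0<..<2*pi}"
  defines "x \<equiv> xc w"
  shows "vec_comp sph_chart n x 1 * area_density T (fst w) (snd w) = (cosh (x $ 1))\<^sup>2 * sin (x $ 2)"
    and "vec_comp sph_chart n x 2 * area_density T (fst w) (snd w) =
      (cosh (x $ 1))\<^sup>2 * sin (x $ 2) * (wt x 2 * dtau w (1, 0))"
    and "vec_comp sph_chart n x 3 * area_density T (fst w) (snd w) =
      (cosh (x $ 1))\<^sup>2 * sin (x $ 2) * (wt x 3 * dtau w (0, 1))"
proof -
  define p q C s where "p = dtau w (1, 0)" and "q = dtau w (0, 1)" and "C = (cosh (x $ 1))\<^sup>2" and "s = sin (x $ 2)"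
  let ?P = "sph_chart x" and ?f = "frame sph_chart x"
  define N where "N = n ?P"
  have s: "s > 0" unfolding s_def x_def by (rule sbox_sin[OF xc_sbox[OF w]])
  then have s0: "sin (x $ 2) \<noteq> 0" by (simp add: s_def)
  have C: "C > 0" unfolding C_def by (simp add: cosh_ne_0)
  have P: "?P \<in> S" by (simp add: x_def sph_chart_xc cut_point_S)
  have N: "tangent dS ?P N" "h0 ?P N N = -1" "\<And>v. tangent S ?P v \<Longrightarrow> h0 ?P N v = 0" "fst N > 0"
    using n P unfolding future_unit_normal_def N_def by blast+
  have lin: "h0 ?P u (v + r *\<^sub>R v') = h0 ?P u v + r * h0 ?P u v'" "h0 ?P (v + r *\<^sub>R v') u = h0 ?P v u + r * h0 ?P v' u" for u v v' r
    by (simp_all add: h0_def algebra_simps inner_add_left inner_add_right)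
  have nl1: "h0 ?P N (?f 1) = - fst N" by (simp add: h0_def frame_sph_chart_eq)
  have nl2: "h0 ?P N (?f 2) = p * fst N"
    using N(3)[OF tangent_S(1)[of w, folded x_def]] unfolding lin nl1 by (simp add: p_def)
  have nl3: "h0 ?P N (?f 3) = q * fst N"
    using N(3)[OF tangent_S(2)[of w, folded x_def]] unfolding lin nl1 by (simp add: q_def)
  have vc: "vec_comp sph_chart n x a = wt x a * h0 ?P N (?f a)" for a
    by (simp add: vec_comp_def up_gS[OF s0] lower_comp_def N_def)
  have v1: "vec_comp sph_chart n x 1 = fst N" unfolding vc nl1 by (simp add: wt_def)
  have fP: "fst ?P = x $ 1" by (simp add: sph_chart_def)
  have z: "snd N \<bullet> sph (x $ 2) (x $ 3) = 0"
    using tangent_dS_orth[OF N(1)] by (simp add: sph_chart_def)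
  have e2: "C * (snd N \<bullet> snd (?f 2)) = p * fst N" and e3: "C * (snd N \<bullet> snd (?f 3)) = q * fst N"
    using nl2 nl3 by (simp_all add: h0_def fP C_def) (simp_all add: frame_sph_chart_eq)
  have "(fst N)\<^sup>2 = 1 + C * (snd N \<bullet> snd N)"
    using N(2) by (simp add: h0_def fP C_def power2_eq_square)
  also have "\<dots> = 1 + ((p * fst N)\<^sup>2 / C + (q * fst N)\<^sup>2 / (C * s\<^sup>2))"
    unfolding inner_sph_frame[OF z s0] e2[symmetric] e3[symmetric] using C s
    by (simp add: s_def power2_eq_square field_simps)
  \<comment> \<open>The normalization of n, with its spatial components eliminated through
    orthogonality to the two tangents.\<close>
  finally have nN: "(fst N)\<^sup>2 = 1 + ((p * fst N)\<^sup>2 / C + (q * fst N)\<^sup>2 / (C * s\<^sup>2))" .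
  have area: "area_density T (fst w) (snd w) = sqrt ((C - p\<^sup>2) * (C * s\<^sup>2 - q\<^sup>2) - (p * q)\<^sup>2)"
  proof -
    note u = vector_derivative_at[OF has_vector_derivative_theta[of w], folded x_def p_def]
    note v = vector_derivative_at[OF has_vector_derivative_phi[of w], folded x_def q_def]
    have 1: "cut_point T (fst w) (snd w) = ?P" by (simp add: x_def sph_chart_xc)
    have "h0 ?P (?f 2 + p *\<^sub>R ?f 1) (?f 2 + p *\<^sub>R ?f 1) = C - p\<^sup>2"
      "h0 ?P (?f 3 + q *\<^sub>R ?f 1) (?f 3 + q *\<^sub>R ?f 1) = C * s\<^sup>2 - q\<^sup>2"
      "h0 ?P (?f 2 + p *\<^sub>R ?f 1) (?f 3 + q *\<^sub>R ?f 1) = - (p * q)"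
      unfolding lin h0_frame by (simp_all add: gd_def C_def s_def power2_eq_square)
    then show ?thesis unfolding area_density_def Let_def 1 u v by simp
  qed
  define A where "A = (C - p\<^sup>2) * (C * s\<^sup>2 - q\<^sup>2) - (p * q)\<^sup>2"
  \<comment> \<open>The determinant A of the induced metric is (C s)^2 (1 - p^2 / C - q^2 / (C
    s^2)), and by \<open>nN\<close> the bracket is the reciprocal square of the time component of n.
    In particular A is positive.\<close>
  have nA: "(fst N)\<^sup>2 * A = (C * s)\<^sup>2"
  proof -
    have "(fst N)\<^sup>2 * A = (C * s)\<^sup>2 * ((fst N)\<^sup>2 - ((p * fst N)\<^sup>2 / C + (q * fst N)\<^sup>2 / (C * s\<^sup>2)))"
      using C s by (simp add: A_def divide_simps) (algebra)
    also have "\<dots> = (C * s)\<^sup>2" using nN by simp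
    finally show ?thesis .
  qed
  have "(fst N)\<^sup>2 * A > 0" unfolding nA using C s by simp
  then have "A > 0" by (simp add: zero_less_mult_iff)
  then have "(fst N * sqrt A)\<^sup>2 = (C * s)\<^sup>2" unfolding nA[symmetric] by (simp add: power_mult_distrib)
  moreover have "fst N * sqrt A \<ge> 0" using N(4) \<open>A > 0\<close> by simp
  ultimately have a: "fst N * area_density T (fst w) (snd w) = C * s"
    unfolding area A_def[symmetric] using C s by (simp add: power2_eq_iff_nonneg)
  show "vec_comp sph_chart n x 1 * area_density T (fst w) (snd w) = (cosh (x $ 1))\<^sup>2 * sin (x $ 2)"
    unfolding v1 a C_def s_def ..
  show "vec_comp sph_chart n x 2 * area_density T (fst w) (snd w) = (cosh (x $ 1))\<^sup>2 * sin (x $ 2) * (wt x 2 * dtau w (1, 0))"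
    unfolding vc nl2 C_def[symmetric] s_def[symmetric] a[symmetric] p_def[symmetric] by simp
  show "vec_comp sph_chart n x 3 * area_density T (fst w) (snd w) = (cosh (x $ 1))\<^sup>2 * sin (x $ 2) * (wt x 3 * dtau w (0, 1))"
    unfolding vc nl3 C_def[symmetric] s_def[symmetric] a[symmetric] q_def[symmetric] by simp
qed

section \<open>Pullback of the potential to the angles of the cut\<close>

text \<open>The derivative of the embedded cut along v. Unlike the components in the spherical chart
  it is smooth at the poles as a Minkowski vector.\<close>

definition dP :: "real \<times> real \<Rightarrow> 4 \<Rightarrow> real \<times> real \<Rightarrow> real" where
  "dP v A w = fr (xc w) 1 A * dtau w v + fr (xc w) 2 A * fst v + fr (xc w) 3 A * snd v"

lemma smooth_emb_xc: "smooth_on UNIV (\<lambda>w. emb (xc w) $ A)"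
  using exhaust_4[of A]
  by (auto simp: emb_def xc_nth intro!: smooth_on_mult smooth_on_sin_comp smooth_on_cos_comp
      smooth_on_cosh_comp smooth_on_sinh_comp smooth_tau smooth_fst_snd)

lemma frechet_emb_xc: "frechet_derivative (\<lambda>w. emb (xc w) $ A) (at w) v = dP v A w"
proof -
  have "((\<lambda>w. emb (xc w) $ A) has_derivative (\<lambda>v. \<Sum>i\<in>UNIV. fr (xc w) i A * (vector [dtau w v, fst v, snd v] :: real^3) $ i)) (at w)"
    by (rule has_derivative_compose[OF xc_derivative has_grad_emb[unfolded has_grad_def]])
  from fun_cong[OF frechet_derivative_at[OF this], of v] show ?thesis
    by (simp add: sum_3 dP_def)
qed

lemma smooth_dP: "smooth_on UNIV (dP v A)"
  using smooth_on_frechet[OF smooth_emb_xc[of A], of v] unfolding frechet_emb_xc .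

lemma dP_symmetric: "frechet_derivative (dP u A) (at w) v = frechet_derivative (dP v A) (at w) u"
  using smooth_on_symmetric[OF open_UNIV smooth_emb_xc[of A] UNIV_I, of u w v] unfolding frechet_emb_xc .

lemma emb_xc_derivative: "((\<lambda>w. emb (xc w)) has_derivative (\<lambda>v. \<chi> A. dP v A w)) (at w)"
proof (subst has_derivative_componentwise_within, rule ballI)
  fix i :: "real^4" assume "i \<in> Basis"
  then obtain A where i: "i = axis A 1" by (auto simp: Basis_vec_def)
  have "((\<lambda>w. emb (xc w) $ A) has_derivative (\<lambda>v. dP v A w)) (at w)"
    using smooth_on_has_derivative[OF smooth_emb_xc UNIV_I, of A w] unfolding frechet_emb_xc .
  then show "((\<lambda>w. emb (xc w) \<bullet> i) has_derivative (\<lambda>v. (\<chi> A. dP v A w) \<bullet> i)) (at w)"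
    by (simp add: i inner_axis)
qed

lemma smooth_comp_emb_xc: "smc f \<Longrightarrow> smooth_on UNIV (\<lambda>w. f (emb (xc w)))"
  by (rule smooth_on_compose[OF open_UNIV open_cone _ smooth_on_vec[OF open_UNIV smooth_emb_xc]])
    (auto simp: emb_cone)

lemma frechet_comp_emb_xc:
  assumes "smc f"
  shows "frechet_derivative (\<lambda>w. f (emb (xc w))) (at w) v = (\<Sum>E\<in>UNIV. D4 E f (emb (xc w)) * dP v E w)"
  using fun_cong[OF frechet_derivative_at[OF has_derivative_compose[OF emb_xc_derivative has_grad_D4[OF assms emb_cone, unfolded has_grad_def]]], of w v]
  by simp

lemma emb_xc_poles: "emb (xc (0, \<phi>)) = emb (xc (0, 0))" "emb (xc (pi, \<phi>)) = emb (xc (pi, 0))"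
  by (simp_all add: vec_eq_iff emb_def xc_nth tau_def sph_def)

lemma emb_xc_periodic: "emb (xc (\<theta>, 2 * pi)) = emb (xc (\<theta>, 0))"
  by (simp add: vec_eq_iff emb_def xc_nth tau_def sph_def)

text \<open>At a pole the embedded point does not move with \<phi>.\<close>

lemma dP_poles: "dP (0, 1) A (0, \<phi>) = 0" "dP (0, 1) A (pi, \<phi>) = 0"
proof -
  have "((\<lambda>t. emb (xc (0, t)) $ A) has_real_derivative dP (0, 1) A (0, \<phi>)) (at \<phi>)"
    "((\<lambda>t. emb (xc (pi, t)) $ A) has_real_derivative dP (0, 1) A (pi, \<phi>)) (at \<phi>)"
    using smooth_on_partials(2)[OF smooth_emb_xc[of A], of 0 \<phi>] smooth_on_partials(2)[OF smooth_emb_xc[of A], of pi \<phi>]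
    unfolding frechet_emb_xc .
  moreover have "(\<lambda>t. emb (xc (0, t)) $ A) = (\<lambda>t. emb (xc (0, 0)) $ A)" "(\<lambda>t. emb (xc (pi, t)) $ A) = (\<lambda>t. emb (xc (pi, 0)) $ A)"
    by (rule ext, subst emb_xc_poles, rule refl)+
  ultimately have "((\<lambda>t. emb (xc (0, 0)) $ A) has_real_derivative dP (0, 1) A (0, \<phi>)) (at \<phi>)"
    "((\<lambda>t. emb (xc (pi, 0)) $ A) has_real_derivative dP (0, 1) A (pi, \<phi>)) (at \<phi>)" by (simp_all only:)
  then show "dP (0, 1) A (0, \<phi>) = 0" "dP (0, 1) A (pi, \<phi>) = 0"
    by (auto intro: DERIV_unique DERIV_const)
qed

lemma dP_periodic: "dP (1, 0) A (\<theta>, 2 * pi) = dP (1, 0) A (\<theta>, 0)"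
proof -
  have d: "((\<lambda>t. emb (xc (t, y)) $ A) has_real_derivative dP (1, 0) A (\<theta>, y)) (at \<theta>)" for y
    using smooth_on_partials(1)[OF smooth_emb_xc[of A], of y \<theta>] unfolding frechet_emb_xc .
  show ?thesis by (rule DERIV_unique[OF d[of "2 * pi", unfolded emb_xc_periodic] d[of 0]])
qed

end

text \<open>The function f is smooth on the whole plane of angles, which is what the boundary terms
  need; it agrees with the flux density on the open rectangle, where the latter is given by
  spherical coordinates.\<close>

lemma cut_flux_zero:
  assumes "killing_charge Sg V H Xi" and "smooth_cut S T"
  defines "K \<equiv> \<lambda>x a b. gamma gS (pull0 Sg) x a b + Delta2 gS (pull0 Sg) x a b"
    and "k \<equiv> smooth_cut.xc T" and "d \<equiv> smooth_cut.dtau T"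
  shows "\<exists>f. set_integrable lborel ({0<..<pi} \<times> {0<..<2*pi}) f \<and> (LINT w : {0<..<pi} \<times> {0<..<2*pi} | lborel. f w) = 0 \<and>
    (\<forall>w \<in> {0<..<pi} \<times> {0<..<2*pi}. f w = (cosh (k w $ 1))\<^sup>2 * sin (k w $ 2) *
      (\<Sum>a\<in>UNIV. wt (k w) a * pr (k w) (\<lambda>A. Xi A (emb (k w))) a *
        (K (k w) a 1 + wt (k w) 2 * d w (1, 0) * K (k w) a 2 + wt (k w) 3 * d w (0, 1) * K (k w) a 3)))"
proof -
  interpret killing_charge Sg V H Xi by fact
  interpret smooth_cut S T by fact
  \<comment> \<open>The pulled back potential, evaluated on the direction v of the plane of
    angles.\<close>
  define c where "c v w = (\<Sum>D\<in>UNIV. al D (emb (xc w)) * dP v D w)" for v w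
  have sc: "smooth_on UNIV (c v)" for v
    unfolding c_def[abs_def]
    by (intro smooth_on_sum smooth_on_mult smooth_comp_emb_xc smc_al smooth_dP open_UNIV)
  have dc: "frechet_derivative (c u) (at w) v = (\<Sum>D\<in>UNIV. al D (emb (xc w)) * frechet_derivative (dP u D) (at w) v
      + (\<Sum>E\<in>UNIV. D4 E (al D) (emb (xc w)) * dP v E w) * dP u D w)" for u v w
  proof -
    have "((\<lambda>w. \<Sum>D\<in>UNIV. al D (emb (xc w)) * dP u D w) has_derivative
      (\<lambda>v. \<Sum>D\<in>UNIV. al D (emb (xc w)) * frechet_derivative (dP u D) (at w) v
        + frechet_derivative (\<lambda>w. al D (emb (xc w))) (at w) v * dP u D w)) (at w)"
      by (rule has_derivative_sum, rule has_derivative_mult)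
        (rule smooth_on_has_derivative[OF smooth_comp_emb_xc[OF smc_al] UNIV_I] smooth_on_has_derivative[OF smooth_dP UNIV_I])+
    from fun_cong[OF frechet_derivative_at[OF this], of v] show ?thesis
      unfolding c_def[abs_def] frechet_comp_emb_xc[OF smc_al] by simp
  qed
  define f where "f w = frechet_derivative (c (0, 1)) (at w) (1, 0) - frechet_derivative (c (1, 0)) (at w) (0, 1)" for w
  have z: "c (0, 1) (0, \<phi>) = 0" "c (0, 1) (pi, \<phi>) = 0" "c (1, 0) (\<theta>, 2 * pi) = c (1, 0) (\<theta>, 0)" for \<theta> \<phi>
    by (simp_all add: c_def dP_poles dP_periodic emb_xc_periodic)
  have F: "set_integrable lborel ({0<..<pi} \<times> {0<..<2*pi}) f" "(LINT w : {0<..<pi} \<times> {0<..<2*pi} | lborel. f w) = 0"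
    unfolding f_def by (rule stokes_box[OF sc sc z])+
  have fe: "f w = (\<Sum>D\<in>UNIV. \<Sum>E\<in>UNIV. D4 E (al D) (emb (xc w)) * (dP (1, 0) E w * dP (0, 1) D w - dP (0, 1) E w * dP (1, 0) D w))" for w
    unfolding f_def dc dP_symmetric[of "(0, 1)" _ w "(1, 0)"]
    \<comment> \<open>Second derivatives of the embedding are symmetric and drop out, so the curl of
      the pulled back form is the exterior derivative of \<open>al\<close> on the two
      tangents.\<close>
    by (simp add: sum_subtractf[symmetric] sum_distrib_right right_diff_distrib mult.assoc)
  have dp: "dP (1, 0) E w = fr (xc w) 2 E + dtau w (1, 0) * fr (xc w) 1 E"
    "dP (0, 1) E w = fr (xc w) 3 E + dtau w (0, 1) * fr (xc w) 1 E" for E w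
    by (simp_all add: dP_def mult.commute)
  show ?thesis
  \<comment> \<open>The factor 1/4 undoes the 4 in \<open>flux_exact\<close>.\<close>
  proof (intro exI[of _ "\<lambda>w. 1 / 4 * f w"] conjI ballI)
    show "set_integrable lborel ({0<..<pi} \<times> {0<..<2*pi}) (\<lambda>w. 1 / 4 * f w)"
      using set_integrable_mult_right[of "1/4" lborel "{0<..<pi} \<times> {0<..<2*pi}" f] F(1) by blast
    show "(LINT w : {0<..<pi} \<times> {0<..<2*pi} | lborel. 1 / 4 * f w) = 0"
      unfolding set_integral_mult_right F(2) by simp
    fix w :: "real \<times> real" assume "w \<in> {0<..<pi} \<times> {0<..<2*pi}"
    from flux_exact[OF xc_sbox[OF this], where p="dtau w (1, 0)" and q="dtau w (0, 1)"]
    show "1 / 4 * f w = (cosh (k w $ 1))\<^sup>2 * sin (k w $ 2) *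
      (\<Sum>a\<in>UNIV. wt (k w) a * pr (k w) (\<lambda>A. Xi A (emb (k w))) a *
        (K (k w) a 1 + wt (k w) 2 * d w (1, 0) * K (k w) a 2 + wt (k w) 3 * d w (0, 1) * K (k w) a 3))"
      unfolding fe dp K_def k_def d_def by simp
  qed
qed

theorem mainTheorem5:
  fixes \<sigma> :: "pt \<Rightarrow> real" and h2 :: "pt \<Rightarrow> pt \<Rightarrow> pt \<Rightarrow> real"
    and \<xi> n :: "pt \<Rightarrow> pt" and S :: "pt set" and T :: "real^3 \<Rightarrow> real" and G :: real
  defines "g \<equiv> met sph_chart" and "s \<equiv> comp0 sph_chart \<sigma>" and "h \<equiv> comp2 sph_chart h2"
  assumes "G > 0"
    and "smooth_function \<sigma>"
    and "smooth_symmetric_tensor h2"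
    and "asymptotic_einstein \<sigma> h2"
    and "killing \<xi>"
    and "smooth_Cauchy_cut S T"
    and "future_unit_normal S n"
  shows "1 / (8 * pi * G) * charge T \<xi> n
           (\<lambda>x a b. E2 g s h x a b - s x [] * E1 g s x a b - gamma g s x a b - Delta2 g s x a b)
       = 1 / (8 * pi * G) * charge T \<xi> n
           (\<lambda>x a b. E2 g s h x a b - s x [] * E1 g s x a b)"
proof -
  let ?B = "{0<..<pi} \<times> {0<..<2*pi}"
  have kc: "killing_charge (Sgf \<sigma>) Vc (Hf h2) (Xif \<xi>)"
    by (rule killing_charge_fields) fact+
  interpret smooth_cut S T by unfold_locales fact
  define K where "K x a b = gamma g s x a b + Delta2 g s x a b" for x a b
  have sS: "s = pull0 (Sgf \<sigma>)" unfolding s_def by (rule comp0_pull0)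
  obtain f where f: "set_integrable lborel ?B f" "(LINT w : ?B | lborel. f w) = 0"
    and fe: "\<And>w. w \<in> ?B \<Longrightarrow> f w = (cosh (xc w $ 1))\<^sup>2 * sin (xc w $ 2) *
      (\<Sum>a\<in>UNIV. wt (xc w) a * pr (xc w) (\<lambda>A. Xif \<xi> A (emb (xc w))) a *
        (K (xc w) a 1 + wt (xc w) 2 * dtau w (1, 0) * K (xc w) a 2 + wt (xc w) 3 * dtau w (0, 1) * K (xc w) a 3))"
    using cut_flux_zero[OF kc smooth_cut_axioms] unfolding K_def g_def sS by blast
  \<comment> \<open>The area density is absorbed into the components of n, which turns the charge
    integrand of \<gamma> + \<Delta> into the flux density of the conserved current.\<close>
  have K: "(\<Sum>a\<in>UNIV. \<Sum>b\<in>UNIV. K (xc w) a b * vec_comp sph_chart \<xi> (xc w) a * vec_comp sph_chart n (xc w) b)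
      * area_density T (fst w) (snd w) = f w" if w: "w \<in> ?B" for w
  proof -
    have s0: "sin (xc w $ 2) \<noteq> 0" using sbox_sin[OF xc_sbox[OF w]] by simp
    have v: "vec_comp sph_chart \<xi> (xc w) a = wt (xc w) a * pr (xc w) (\<lambda>A. Xif \<xi> A (emb (xc w))) a" for a
      by (simp add: vec_comp_def up_gS[OF s0] lower_pull1 pull1_def pr_def)
    note nc = normal_components[OF \<open>future_unit_normal S n\<close> w]
    have "(\<Sum>a\<in>UNIV. \<Sum>b\<in>UNIV. K (xc w) a b * vec_comp sph_chart \<xi> (xc w) a * vec_comp sph_chart n (xc w) b)
        * area_density T (fst w) (snd w) =
      (\<Sum>a\<in>UNIV. vec_comp sph_chart \<xi> (xc w) a *
        (K (xc w) a 1 * (vec_comp sph_chart n (xc w) 1 * area_density T (fst w) (snd w))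
        + K (xc w) a 2 * (vec_comp sph_chart n (xc w) 2 * area_density T (fst w) (snd w))
        + K (xc w) a 3 * (vec_comp sph_chart n (xc w) 3 * area_density T (fst w) (snd w))))"
      unfolding sum_distrib_right by (rule sum.cong[OF refl]) (simp add: sum_3 algebra_simps)
    also have "\<dots> = f w"
      unfolding fe[OF w] nc v sum_distrib_left by (rule sum.cong[OF refl]) (simp add: algebra_simps)
    finally show ?thesis .
  qed
  let ?X = "\<lambda>x a b. E2 g s h x a b - s x [] * E1 g s x a b"
  let ?Y = "\<lambda>x a b. E2 g s h x a b - s x [] * E1 g s x a b - gamma g s x a b - Delta2 g s x a b"
  let ?I = "\<lambda>X w. (\<Sum>a\<in>UNIV. \<Sum>b\<in>UNIV. X (xc w) a b * vec_comp sph_chart \<xi> (xc w) a * vec_comp sph_chart n (xc w) b)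
      * area_density T (fst w) (snd w)"
  have ch: "charge T \<xi> n X = (LINT w : ?B | lborel. ?I X w)" for X
    unfolding charge_def Let_def xc_def ..
  have "?I ?Y w = ?I ?X w - f w" if w: "w \<in> ?B" for w
  proof -
    have "?I ?Y w = ?I (\<lambda>x a b. ?X x a b - K x a b) w"
      by (simp only: K_def diff_diff_eq add.assoc)
    also have "\<dots> = ?I ?X w - ?I K w"
      by (simp only: left_diff_distrib sum_subtractf)
    finally show ?thesis unfolding K[OF w] .
  qed
  then have "(LINT w : ?B | lborel. ?I ?Y w) = (LINT w : ?B | lborel. ?I ?X w - f w)"
    by (intro set_lebesgue_integral_cong) (auto simp: borel_open open_Times)
  also have "\<dots> = (LINT w : ?B | lborel. ?I ?X w)"
    by (rule set_integral_diff_null[OF f])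
  finally show ?thesis unfolding ch by simp
qed

end
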